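(* There exist an absolute constant $K\ge 1$ and, for each $T>0$, a real number $A=A(T)\ge 1$ with $(10A)^{-1}<T$ and, for each $a\ge A$, a number $\tau=\tau(a)\in(0,1)$, such that, with $\mathrm{BR}$ denoting the strategy defined in the context using these parameters, the following holds. Fix $q_0\in\mathbb{R}$ with $|q_0|\ge 1$ and $T>0$. Then there exists a constant $C>0$ (depending on $q_0$ and $T$, but not on $a$ or $b$) such that for any $a\in\mathbb{R}$ the strategy $\mathrm{BR}$ for time horizon $T$, starting position $q_0$ and growth parameter $a$ satisfies $$\mathrm{ECost}(\mathrm{BR},b)\le C\cdot \mathrm{ECost}_{\mathrm{opt}}(b)\quad\text{for any } b\in\mathbb{R}.$$
   Context: **Setting.** $W(t)$ is a standard Brownian motion ($W(0)=0$, $\mathrm{Var}[W(t)]=t$) on a probability space $(\Omega,\mathcal{F},\mathrm{Prob})$, and $\mathcal{F}_t$ is the sigma-algebra generated by $(W(s))_{0\le s\le t}$. The controlled dynamics are $$dq(t)=(a q(t)+b u(t))\,dt+dW(t),\qquad q(0)=q_0,$$ where the growth parameter $a$ is known and $b$ is unknown to the controller. **Strategies.** A strategy (for starting position $q_0\neq0$, time horizon $T>0$, growth parameter $a\in\mathbb{R}$) is a collection of random variables $q(t,b),u(t,b)$, $t\in[0,T]$, $b\in\mathbb{R}$, such that: (1) for every $b$, with probability 1, $t\mapsto q(t,b)$ is continuous and $t\mapsto u(t,b)$ is in $L^2$; (2) for every $b$ and $t\in[0,T]$ the maps $(s,\omega)\mapsto q(s,b,\omega)$, $u(s,b,\omega)$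 on $[0,t]\times\Omega$ are measurable as functions on $[0,t]\times(\Omega,\mathcal{F}_t,\mathrm{Prob})$; (3) for every $b$, $\mathrm{E}\big[\int_0^T (q(t,b)^2+u(t,b)^2)\,dt\big]<\infty$; (4) for almost all $\omega$, for all $b,b'\in\mathbb{R}$ and $t\in[0,T]$, if $q(s,b,\omega)=q(s,b',\omega)$ for all $s\in[0,t]$ then $u(s,b,\omega)=u(s,b',\omega)$ for almost all $s\in[0,t]$; (5) for every $b$ and $t\in[0,T]$, $q(t,b)=q_0+W(t)+\int_0^t[a q(s,b)+b u(s,b)]\,ds$ with probability 1. For a strategy $\sigma$ with trajectory $q^\sigma$ and control $u^\sigma$, the expected cost is $$\mathrm{ECost}(\sigma,b)=\mathrm{E}\Big[\int_0^T\big((q^\sigma(t,b))^2+(u^\sigma(t,b))^2\big)\,dt\Big].$$ **Optimal cost for known $b$.** For $\beta\in\mathbb{R}$, let $\sigma_{\mathrm{opt}}(\beta)$ be the strategy with $u(t)=-\beta\,\kappa(T-t,\beta)\,q(t)$, where $\kappa(t,\beta)=t$ if $a=\beta=0$ and otherwise $$\kappa(t,\beta)=\frac{\tanh(t\sqrt{a^2+\beta^2})}{\sqrt{a^2+\beta^2}-a\tanh(t\sqrt{a^2+\beta^2})}.$$ Set $\mathrm{ECost}_{\mathrm{opt}}(b)=\mathrm{ECost}(\sigma_{\mathrm{opt}}(b),b)$. (The strategy $\sigma_{\mathrm{opt}}(b)$ minimizes $\mathrm{ECost}(\sigma,b)$ over all strategies $\sigma$, for the given $a,T,q_0$.) **The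 strategy $\mathrm{BR}$.** It is described for $q_0\ge1$; for $q_0\le-1$ it is defined by symmetry (i.e. apply the description with $(q_0,q,u)$ replaced by $(-q_0,-q,-u)$). Throughout, $q,u$ denote the trajectory and control of $\mathrm{BR}$. The game ends at time $T$. *Case $a\ge A$.* Let $\nu^*=\lfloor aT\rfloor$. The strategy has Epochs $0,1,\dots,\nu^*+1$, starting with Epoch 0 at time 0. Epoch 0: - Subepoch 0.i (from time 0): set $u=-q$. It ends at time $\tau_0$, the first $t\in(0,(10a)^{-1})$ with $q(t)=2q_0$ or $q(t)=\frac12q_0$ if such a time exists, and $\tau_0=(10a)^{-1}$ otherwise. If $\tau_0<(10a)^{-1}$, enter Subepoch 0.ii at time $\tau_0$; if $\tau_0=(10a)^{-1}$, enter Epoch 1 at time $\tau_0$. - Subepoch 0.ii: if $q(\tau_0)=\frac12 q_0$ set $u=-Kq$; if $q(\tau_0)=2q_0$ set $u=Kq$. It lasts until the first $t\in(\tau_0,T)$ with $|q(t)|\ge 2q(\tau_0)$, at which time Epoch 1 is entered; if no such time exists it lasts until the game ends at $T$. Epoch $\nu$, $1\le\nu\le\nu^*$, entered at time $t_\nu<T$: - Subepoch $\nu$.i: set $u=e^\nu q(t_\nu)(a\tau)^{-1/2}$ (constant). It ends at time $\tau_\nu$, the first $t\in(t_\nu,\min\{T,t_\nu+\tau\})$ with $|q(t)-q(t_\nu)|>|q(t_\nu)|(a\tau)^{1/2}$ if such a time exists, and $\tau_\nu=\min\{T,t_\nu+\tau\}$ otherwise. If $\tau_\nu<\min\{T,t_\nu+\tau\}$,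 enter Subepoch $\nu$.ii at time $\tau_\nu$; if $\tau_\nu=t_\nu+\tau<T$, enter Epoch $\nu+1$ at time $\tau_\nu$; if $\tau_\nu=T$ the game ends. - Subepoch $\nu$.ii, entered at time $\tilde t_\nu$: set $u=Ke^\nu q$ until the first $t\in(\tilde t_\nu,T)$ with $|q(t)|\ge2|q(\tilde t_\nu)|$, at which time Subepoch $\nu$.iii is entered; if no such time exists, continue until $T$. - Subepoch $\nu$.iii, entered at time $\hat t_\nu$: set $u=-Ke^\nu q$ until the first $t\in(\hat t_\nu,T)$ with $|q(t)|\ge2|q(\hat t_\nu)|$, at which time Epoch $\nu+1$ is entered; if no such time exists, continue until $T$. Epoch $\nu^*+1$: set $u=0$ until time $T$. *Case $|a|\le A$.* Epoch 0: set $u=-q$ from time 0 until $t_1$, the first $t\in(0,T)$ with $|q(t)|=2q_0$ ($t_1=T$ if none, and then the game ends). Epoch 1 (if $t_1<T$): set $u=q$ from $t_1$ until $t_2$, the first $t\in(t_1,T)$ with $|q(t)|=4q_0$ ($t_2=T$ if none, and then the game ends). Epoch 2 (if $t_2<T$): set $u=0$ until time $T$. *Case $a\le-A$.* Epoch 0: set $u=-q$ from time 0 until $t_1$, the first $t\in(0,(10|a|)^{-1})$ with $q(t)=2q_0$ or $q(t)=\frac12q_0$, and $t_1=(10|a|)^{-1}$ if none. Epoch 1 begins at time $t_1$: if $t_1=(10|a|)^{-1}$, set $u=0$ until time $T$. If $t_1<(10|a|)^{-1}$, set $u=1000\,q$ if $q(t_1)=2q_0$ and $u=-1000\,q$ if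 $q(t_1)=\frac12q_0$, until $t_2$, the first $t\in(t_1,T)$ with $|q(t)|=4q_0$ ($t_2=T$ if none, and then the game ends). Epoch 2 (entered at $t_2$ if $t_2<T$): set $u=0$ until time $T$.
   Formalization: In Subepoch ν.i the "first t with |q(t)-q(t_ν)| > |q(t_ν)|(aτ)^{1/2}" does not exist for a continuous path; it is read as the first t with ≥ (almost surely the same exit time). Where the cases overlap, a≥A takes precedence, then |a|≤A. *)

theory Defs
  imports "HOL-Probability.Probability"
begin

section \<open>Brownian motion and its natural filtration\<close>

text \<open>
  All sample paths are continuous and start at 0, not just almost all of them: the filtration below
  is the raw one (no null sets are added), so hitting times of feedback-controlled paths
  are stopping times only if exceptional paths are excluded from the outset.
\<close>

locale brownian_motion = prob_space M for M :: "'w measure" +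
  fixes W :: "real \<Rightarrow> 'w \<Rightarrow> real"
  assumes start: "\<And>\<omega>. \<omega> \<in> space M \<Longrightarrow> W 0 \<omega> = 0"
    and paths: "\<And>\<omega>. \<omega> \<in> space M \<Longrightarrow> continuous_on {0..} (\<lambda>t. W t \<omega>)"
    and random_variable_W: "\<And>t. 0 \<le> t \<Longrightarrow> random_variable borel (W t)"
    and normal_increments: "\<And>s t. 0 \<le> s \<Longrightarrow> s < t \<Longrightarrow>
      distributed M lborel (\<lambda>\<omega>. W t \<omega> - W s \<omega>) (normal_density 0 (sqrt (t - s)))"
    and indep_increments: "\<And>(n::nat) (ts::nat \<Rightarrow> real).
      0 \<le> ts 0 \<Longrightarrow> (\<And>i. i < n \<Longrightarrow> ts i < ts (Suc i)) \<Longrightarrow>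
      indep_vars (\<lambda>_. borel) (\<lambda>i \<omega>. W (ts (Suc i)) \<omega> - W (ts i) \<omega>) {..<n}"

definition natural_filtration :: "'w measure \<Rightarrow> (real \<Rightarrow> 'w \<Rightarrow> real) \<Rightarrow> real \<Rightarrow> 'w measure" where
  "natural_filtration M W t =
     sigma (space M) (\<Union>s\<in>{0..t}. {W s -` B \<inter> space M | B. B \<in> sets borel})"


section \<open>Strategies and their cost\<close>

text \<open>A strategy is a pair of the trajectory \<open>q t b \<omega>\<close> and the control \<open>u t b \<omega>\<close>;
  only times \<open>t \<in> {0..T}\<close> are relevant.\<close>

type_synonym 'w strat = "(real \<Rightarrow> real \<Rightarrow> 'w \<Rightarrow> real) \<times> (real \<Rightarrow> real \<Rightarrow> 'w \<Rightarrow> real)"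

definition ECost :: "'w measure \<Rightarrow> real \<Rightarrow> 'w strat \<Rightarrow> real \<Rightarrow> ennreal" where
  "ECost M T \<sigma> b = (case \<sigma> of (q, u) \<Rightarrow>
     \<integral>\<^sup>+\<omega>. (\<integral>\<^sup>+t\<in>{0..T}. ennreal ((q t b \<omega>)\<^sup>2 + (u t b \<omega>)\<^sup>2) \<partial>lborel) \<partial>M)"

definition strategy ::
  "'w measure \<Rightarrow> (real \<Rightarrow> 'w \<Rightarrow> real) \<Rightarrow> real \<Rightarrow> real \<Rightarrow> real \<Rightarrow> 'w strat \<Rightarrow> bool" where
  "strategy M W T a q0 \<sigma> \<longleftrightarrow> (case \<sigma> of (q, u) \<Rightarrow>
     (\<forall>b. AE \<omega> in M. continuous_on {0..T} (\<lambda>t. q t b \<omega>) \<and>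
        set_borel_measurable lborel {0..T} (\<lambda>t. u t b \<omega>) \<and>
        set_integrable lborel {0..T} (\<lambda>t. (u t b \<omega>)\<^sup>2)) \<and>
     (\<forall>b. \<forall>t\<in>{0..T}.
        (\<lambda>(s, \<omega>). q s b \<omega>) \<in>
          borel_measurable (restrict_space borel {0..t} \<Otimes>\<^sub>M natural_filtration M W t) \<and>
        (\<lambda>(s, \<omega>). u s b \<omega>) \<in>
          borel_measurable (restrict_space borel {0..t} \<Otimes>\<^sub>M natural_filtration M W t)) \<and>
     (\<forall>b. ECost M T (q, u) b < \<infinity>) \<and>
     (AE \<omega> in M. \<forall>b b'. \<forall>t\<in>{0..T}.
        (\<forall>s\<in>{0..t}. q s b \<omega> = q s b' \<omega>) \<longrightarrow>
        (AE s in lborel. s \<in> {0..t} \<longrightarrow> u s b \<omega> = u s b' \<omega>)) \<and>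
     (\<forall>b. \<forall>t\<in>{0..T}. AE \<omega> in M.
        q t b \<omega> = q0 + W t \<omega> + (LBINT s:{0..t}. a * q s b \<omega> + b * u s b \<omega>)))"


section \<open>The optimal strategy for known \<open>b\<close>\<close>

definition kappa :: "real \<Rightarrow> real \<Rightarrow> real \<Rightarrow> real" where
  "kappa a t \<beta> =
     (if a = 0 \<and> \<beta> = 0 then t
      else tanh (t * sqrt (a\<^sup>2 + \<beta>\<^sup>2)) /
           (sqrt (a\<^sup>2 + \<beta>\<^sup>2) - a * tanh (t * sqrt (a\<^sup>2 + \<beta>\<^sup>2))))"

text \<open>The feedback rule together with the equation of motion determines the strategy up to null sets,
  so its cost does not depend on the choice made by \<open>SOME\<close>.\<close>

definition sigma_opt ::
  "'w measure \<Rightarrow> (real \<Rightarrow> 'w \<Rightarrow> real) \<Rightarrow> real \<Rightarrow> real \<Rightarrow> real \<Rightarrow> real \<Rightarrow> 'w strat" where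
  "sigma_opt M W T a q0 \<beta> = (SOME \<sigma>. strategy M W T a q0 \<sigma> \<and>
     (\<forall>b. AE \<omega> in M. \<forall>t\<in>{0..T}.
        snd \<sigma> t b \<omega> = - \<beta> * kappa a (T - t) \<beta> * fst \<sigma> t b \<omega>))"

definition ECost_opt ::
  "'w measure \<Rightarrow> (real \<Rightarrow> 'w \<Rightarrow> real) \<Rightarrow> real \<Rightarrow> real \<Rightarrow> real \<Rightarrow> real \<Rightarrow> ennreal" where
  "ECost_opt M W T a q0 b = ECost M T (sigma_opt M W T a q0 b) b"


section \<open>The strategy BR\<close>

text \<open>
  \<open>first_time l r P\<close> is the first \<open>t\<close> in the open interval from \<open>l\<close> to \<open>r\<close> with \<open>P t\<close>,
  and \<open>r\<close> if there is none. It is only used with conditions \<open>P\<close> that are closed along a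
  continuous path, so that the infimum is attained (or equals \<open>l\<close>).
\<close>

definition first_time :: "real \<Rightarrow> real \<Rightarrow> (real \<Rightarrow> bool) \<Rightarrow> real" where
  "first_time l r P =
     (if \<exists>t\<in>{l<..<r}. P t then Inf {t\<in>{l<..<r}. P t} else r)"

text \<open>
  In the following, \<open>p\<close> is a single trajectory and \<open>v\<close> a single control path. The switching times
  are functionals of the trajectory. Once the game has ended, all later switching times equal \<open>T\<close>,
  so the rules for later stages range over empty time intervals.
\<close>

subsection \<open>Large \<open>a\<close>\<close>

definition tau0 :: "real \<Rightarrow> real \<Rightarrow> (real \<Rightarrow> real) \<Rightarrow> real" where
  "tau0 a q0 p = first_time 0 (1 / (10 * a)) (\<lambda>t. p t = 2 * q0 \<or> p t = q0 / 2)"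

definition epoch1_start :: "real \<Rightarrow> real \<Rightarrow> real \<Rightarrow> (real \<Rightarrow> real) \<Rightarrow> real" where
  "epoch1_start T a q0 p =
     (if tau0 a q0 p < 1 / (10 * a)
      then first_time (tau0 a q0 p) T (\<lambda>t. \<bar>p t\<bar> \<ge> 2 * p (tau0 a q0 p))
      else tau0 a q0 p)"

text \<open>
  For an epoch \<open>\<nu> \<ge> 1\<close> entered at time \<open>s\<close>, \<open>sub_i_end\<close> is the end of the first subepoch.
  The test phase stops when the displacement exceeds the threshold; since a continuous
  path has no first time at which it strictly exceeds a level, this is the first time at which
  the threshold is reached (almost surely the path then exceeds it immediately afterwards).
\<close>

definition sub_i_end :: "real \<Rightarrow> real \<Rightarrow> real \<Rightarrow> (real \<Rightarrow> real) \<Rightarrow> real \<Rightarrow> real" where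
  "sub_i_end T a \<tau> p s =
     first_time s (min T (s + \<tau>)) (\<lambda>t. \<bar>p t - p s\<bar> \<ge> \<bar>p s\<bar> * sqrt (a * \<tau>))"

definition doubling_time :: "real \<Rightarrow> (real \<Rightarrow> real) \<Rightarrow> real \<Rightarrow> real" where
  "doubling_time T p s = first_time s T (\<lambda>t. \<bar>p t\<bar> \<ge> 2 * \<bar>p s\<bar>)"

definition next_epoch :: "real \<Rightarrow> real \<Rightarrow> real \<Rightarrow> (real \<Rightarrow> real) \<Rightarrow> real \<Rightarrow> real" where
  "next_epoch T a \<tau> p s =
     (let r = sub_i_end T a \<tau> p s
      in if r < min T (s + \<tau>) then doubling_time T p (doubling_time T p r) else r)"

definition epoch_start ::
  "real \<Rightarrow> real \<Rightarrow> real \<Rightarrow> real \<Rightarrow> (real \<Rightarrow> real) \<Rightarrow> nat \<Rightarrow> real" where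
  "epoch_start T a \<tau> q0 p \<nu> = (next_epoch T a \<tau> p ^^ (\<nu> - 1)) (epoch1_start T a q0 p)"

definition BR_large ::
  "real \<Rightarrow> real \<Rightarrow> real \<Rightarrow> real \<Rightarrow> real \<Rightarrow> (real \<Rightarrow> real) \<Rightarrow> (real \<Rightarrow> real) \<Rightarrow> bool" where
  "BR_large K \<tau> T a q0 p v \<longleftrightarrow>
     (let \<tau>0 = tau0 a q0 p;
          t1 = epoch1_start T a q0 p;
          \<nu>max = nat \<lfloor>a * T\<rfloor>
      in (\<forall>t\<in>{0..<\<tau>0}. v t = - p t) \<and>
         (\<tau>0 < 1 / (10 * a) \<longrightarrow>
            (p \<tau>0 = q0 / 2 \<longrightarrow> (\<forall>t\<in>{\<tau>0..<t1}. v t = - K * p t)) \<and>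
            (p \<tau>0 = 2 * q0 \<longrightarrow> (\<forall>t\<in>{\<tau>0..<t1}. v t = K * p t))) \<and>
         (\<forall>\<nu>\<in>{1..\<nu>max}.
            let t\<nu> = epoch_start T a \<tau> q0 p \<nu>;
                \<tau>\<nu> = sub_i_end T a \<tau> p t\<nu>;
                th = doubling_time T p \<tau>\<nu>;
                tn = epoch_start T a \<tau> q0 p (\<nu> + 1)
            in (\<forall>t\<in>{t\<nu>..<\<tau>\<nu>}. v t = exp (real \<nu>) * p t\<nu> / sqrt (a * \<tau>)) \<and>
               (\<tau>\<nu> < min T (t\<nu> + \<tau>) \<longrightarrow>
                  (\<forall>t\<in>{\<tau>\<nu>..<th}. v t = K * exp (real \<nu>) * p t) \<and>
                  (\<forall>t\<in>{th..<tn}. v t = - K * exp (real \<nu>) * p t))) \<and>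
         (\<forall>t\<in>{epoch_start T a \<tau> q0 p (\<nu>max + 1)..<T}. v t = 0))"

subsection \<open>Bounded \<open>a\<close>\<close>

definition BR_bounded ::
  "real \<Rightarrow> real \<Rightarrow> (real \<Rightarrow> real) \<Rightarrow> (real \<Rightarrow> real) \<Rightarrow> bool" where
  "BR_bounded T q0 p v \<longleftrightarrow>
     (let t1 = first_time 0 T (\<lambda>t. \<bar>p t\<bar> = 2 * q0);
          t2 = first_time t1 T (\<lambda>t. \<bar>p t\<bar> = 4 * q0)
      in (\<forall>t\<in>{0..<t1}. v t = - p t) \<and>
         (\<forall>t\<in>{t1..<t2}. v t = p t) \<and>
         (\<forall>t\<in>{t2..<T}. v t = 0))"

subsection \<open>Large negative \<open>a\<close>\<close>

definition BR_negative ::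
  "real \<Rightarrow> real \<Rightarrow> real \<Rightarrow> (real \<Rightarrow> real) \<Rightarrow> (real \<Rightarrow> real) \<Rightarrow> bool" where
  "BR_negative T a q0 p v \<longleftrightarrow>
     (let s = 1 / (10 * \<bar>a\<bar>);
          t1 = first_time 0 s (\<lambda>t. p t = 2 * q0 \<or> p t = q0 / 2);
          t2 = first_time t1 T (\<lambda>t. \<bar>p t\<bar> = 4 * q0)
      in (\<forall>t\<in>{0..<t1}. v t = - p t) \<and>
         (t1 = s \<longrightarrow> (\<forall>t\<in>{t1..<T}. v t = 0)) \<and>
         (t1 < s \<longrightarrow>
            (p t1 = 2 * q0 \<longrightarrow> (\<forall>t\<in>{t1..<t2}. v t = 1000 * p t)) \<and>
            (p t1 = q0 / 2 \<longrightarrow> (\<forall>t\<in>{t1..<t2}. v t = - 1000 * p t)) \<and>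
            (\<forall>t\<in>{t2..<T}. v t = 0)))"

subsection \<open>All cases\<close>

text \<open>The three ranges of \<open>a\<close> overlap at \<open>a = A\<close> and \<open>a = -A\<close>; there, \<open>BR_large\<close> has
  precedence over \<open>BR_bounded\<close>, which has precedence over \<open>BR_negative\<close>.\<close>

definition BR_rule_pos ::
  "real \<Rightarrow> real \<Rightarrow> real \<Rightarrow> real \<Rightarrow> real \<Rightarrow> real \<Rightarrow> (real \<Rightarrow> real) \<Rightarrow> (real \<Rightarrow> real) \<Rightarrow> bool" where
  "BR_rule_pos K A \<tau> T a q0 p v \<longleftrightarrow>
     (if a \<ge> A then BR_large K \<tau> T a q0 p v
      else if \<bar>a\<bar> \<le> A then BR_bounded T q0 p v
      else BR_negative T a q0 p v)"

definition BR_rule ::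
  "real \<Rightarrow> real \<Rightarrow> real \<Rightarrow> real \<Rightarrow> real \<Rightarrow> real \<Rightarrow> (real \<Rightarrow> real) \<Rightarrow> (real \<Rightarrow> real) \<Rightarrow> bool" where
  "BR_rule K A \<tau> T a q0 p v \<longleftrightarrow>
     (if q0 > 0 then BR_rule_pos K A \<tau> T a q0 p v
      else BR_rule_pos K A \<tau> T a (- q0) (\<lambda>t. - p t) (\<lambda>t. - v t))"

definition is_BR ::
  "real \<Rightarrow> real \<Rightarrow> real \<Rightarrow> 'w measure \<Rightarrow> (real \<Rightarrow> 'w \<Rightarrow> real) \<Rightarrow> real \<Rightarrow> real \<Rightarrow> real \<Rightarrow> 'w strat \<Rightarrow> bool" where
  "is_BR K A \<tau> M W T a q0 \<sigma> \<longleftrightarrow> strategy M W T a q0 \<sigma> \<and>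
     (\<forall>b. AE \<omega> in M.
        BR_rule K A \<tau> T a q0 (\<lambda>t. fst \<sigma> t b \<omega>) (\<lambda>t. snd \<sigma> t b \<omega>))"

end

theory Submission
  imports Defs
begin

text \<open>
  \<^bold>\<open>Lower bound.\<close> For every strategy, integrating the expected equation of motion against a deterministic function
  and applying the Cauchy--Schwarz inequality bounds the expected cost from below by a multiple of
  \<open>q0\<^sup>2 / (\<bar>a\<bar> + \<bar>b\<bar> + 1/T)\<close> and, for \<open>a T \<ge> 1\<close>, of \<open>q0\<^sup>2 / (a exp (- 2 a T) + b\<^sup>2 / a)\<close>.

  \<^bold>\<open>Upper bound.\<close> Fix a Brownian path. If its oscillation over time windows of the length of a stage is small, then every
  test of the strategy gives the right answer: an epoch whose gain is too weak is passed without being noticed, and the first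
  epoch \<open>n\<close> with \<open>\<bar>b\<bar> exp n \<ge> a / 2\<close> recognizes the sign of \<open>b\<close>, after which the feedback is stable. The cost is
  then of the order \<open>q0\<^sup>2 exp (2 n) / R\<close>, where \<open>R\<close> is the larger of \<open>\<bar>a\<bar>\<close> and \<open>\<bar>b\<bar>\<close> up to a constant, and this matches the lower bound.
  On all other paths the number of wrong answers is bounded by the logarithm of the oscillation, so the cost exceeds the
  previous bound at most by a factor polynomial in \<open>R\<close> and in the oscillation. Since a window of length \<open>1/R\<close> has oscillation of order
  \<open>R powr (- 1/2)\<close>, with all moments, these paths contribute \<open>O(1/R)\<close> times the same bound.
\<close>


section \<open>Oscillation of Brownian paths\<close>

text \<open>The switching times depend on the path, so the noise after such a time cannot be treated
  as fresh without a strong Markov property. All cost bounds are therefore proved for one fixed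
  path, from bounds on the noise over windows that may start anywhere; expectations enter only at
  the end, through oscillations over the windows of a fixed grid. The constants come from the test.
  With \<tau> = \<delta>^2 / a the threshold factor sqrt (a \<tau>) is \<delta>. In the test of
  Epoch \<nu> the control moves the path by about (b exp \<nu> / a) \<delta> |p|, whereas free
  growth contributes only about \<delta>^2 |p|. Up to a T \<le> a^2 tests may follow each other,
  each changing |p| by a factor between 1 - \<delta> and 1 + \<delta>; hence \<delta> is of order
  a^-2. The bound for noisy paths then loses a factor R^11, which a fortieth moment, of order R^-20,
  outweighs. Finite expected cost is part of being a strategy, so the existence of BR rests on the
  same upper bound, which must not presuppose it.\<close>

text \<open>For continuous paths the supremum over the dyadic times is the supremum over the whole window; the
  countable index set makes it measurable.\<close>

definition osc :: "(real \<Rightarrow> real) \<Rightarrow> real \<Rightarrow> real \<Rightarrow> real" where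
  "osc w s h = (SUP (m, k)\<in>(SIGMA m:UNIV. {..(2::nat) ^ m}). \<bar>w (s + h * (real k / 2 ^ m)) - w s\<bar>)"

text \<open>Chaining: a point of level m + 1 is either a point of level m or one increment of level
  m + 1 away from its left neighbour \<open>k div 2\<close> of level m.\<close>

lemma dyadic_chaining:
  fixes f :: "real \<Rightarrow> real" and r :: "nat \<Rightarrow> real"
  assumes inc: "\<And>n i. i < 2 ^ n \<Longrightarrow> \<bar>f ((real i + 1) / 2 ^ n) - f (real i / 2 ^ n)\<bar> \<le> r n"
    and r0: "\<And>n. 0 \<le> r n"
  shows "k \<le> 2 ^ m \<Longrightarrow> \<bar>f (real k / 2 ^ m) - f 0\<bar> \<le> (\<Sum>n\<le>m. r n)"
proof (induction m arbitrary: k)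
  case 0
  then have "k = 0 \<or> k = 1" by auto
  then show ?case using inc[of 0 0] r0[of 0] by auto
next
  case (Suc m)
  define j where "j = k div 2"
  have j: "j \<le> 2 ^ m" using Suc.prems by (simp add: j_def)
  have IH: "\<bar>f (real j / 2 ^ m) - f 0\<bar> \<le> (\<Sum>n\<le>m. r n)" by (rule Suc.IH[OF j])
  show ?case
  proof (cases "even k")
    case True
    then have "real k / 2 ^ Suc m = real j / 2 ^ m" by (auto simp: j_def elim!: evenE)
    then show ?thesis using IH r0[of "Suc m"] by simp
  next
    case False
    then have k: "k = 2 * j + 1" by (auto simp: j_def elim!: oddE)
    have "2 * j < 2 ^ Suc m" using k Suc.prems by linarith
    from inc[OF this] have "\<bar>f (real k / 2 ^ Suc m) - f (real (2 * j) / 2 ^ Suc m)\<bar> \<le> r (Suc m)"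
      by (simp add: k add.commute)
    moreover have "real (2 * j) / 2 ^ Suc m = real j / 2 ^ m" by simp
    ultimately show ?thesis using IH by simp
  qed
qed

lemma geometric_sum_le:
  fixes m :: nat
  shows "(\<Sum>n\<le>m. (3/4::real) ^ n) \<le> 4"
proof -
  have "(\<Sum>n\<le>m. (3/4::real) ^ n) = 4 * (1 - (3/4) ^ Suc m)"
    by (induction m) auto
  then show ?thesis by simp
qed

lemma osc_le:
  assumes "\<And>m k. k \<le> 2 ^ m \<Longrightarrow> \<bar>w (s + h * (real k / 2 ^ m)) - w s\<bar> \<le> c"
  shows "osc w s h \<le> c"
  unfolding osc_def by (rule cSUP_least) (use assms in auto)

lemma dyadic_approx:
  fixes x :: real
  assumes "0 \<le> x" "x \<le> 1"
  shows "(\<lambda>m. real (nat \<lfloor>x * 2 ^ m\<rfloor>) / 2 ^ m) \<longlonglongrightarrow> x" "nat \<lfloor>x * 2 ^ m\<rfloor> \<le> 2 ^ m"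
proof -
  have lo: "x - (1/2) ^ m \<le> real (nat \<lfloor>x * 2 ^ m\<rfloor>) / 2 ^ m"
    and up: "real (nat \<lfloor>x * 2 ^ m\<rfloor>) / 2 ^ m \<le> x" for m
  proof -
    have e: "real (nat \<lfloor>x * 2 ^ m\<rfloor>) = of_int \<lfloor>x * 2 ^ m\<rfloor>" using assms by simp
    have "(x * 2 ^ m - 1) / 2 ^ m \<le> of_int \<lfloor>x * 2 ^ m\<rfloor> / 2 ^ m"
      by (intro divide_right_mono) (linarith, simp)
    moreover have "(x * 2 ^ m - 1) / 2 ^ m = x - (1/2) ^ m"
      by (simp only: diff_divide_distrib power_one_over) simp
    ultimately show "x - (1/2) ^ m \<le> real (nat \<lfloor>x * 2 ^ m\<rfloor>) / 2 ^ m"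
      unfolding e by (simp only:)
    show "real (nat \<lfloor>x * 2 ^ m\<rfloor>) / 2 ^ m \<le> x"
      unfolding e by (subst pos_divide_le_eq) simp_all
  qed
  have "(\<lambda>m. x - (1/2) ^ m) \<longlonglongrightarrow> x - 0" by (intro tendsto_diff tendsto_const LIMSEQ_power_zero) simp
  then show "(\<lambda>m. real (nat \<lfloor>x * 2 ^ m\<rfloor>) / 2 ^ m) \<longlonglongrightarrow> x"
    by (intro tendsto_sandwich[OF always_eventually[OF allI[OF lo]] always_eventually[OF allI[OF up]]]) simp_all
  have "x * 2 ^ m \<le> 2 ^ m" using assms by simp
  then have "real_of_int \<lfloor>x * 2 ^ m\<rfloor> \<le> 2 ^ m" by (rule order_trans[OF of_int_floor_le])
  then have "real_of_int \<lfloor>x * 2 ^ m\<rfloor> \<le> real_of_int (2 ^ m)" by simp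
  then have "\<lfloor>x * 2 ^ m\<rfloor> \<le> 2 ^ m" by (simp only: of_int_le_iff)
  then show "nat \<lfloor>x * 2 ^ m\<rfloor> \<le> 2 ^ m" by (simp add: nat_le_iff)
qed

lemma osc_bdd:
  fixes w :: "real \<Rightarrow> real"
  assumes c: "continuous_on {0..} w" and s: "0 \<le> s" "0 \<le> h"
  shows "bdd_above ((\<lambda>(m, k). \<bar>w (s + h * (real k / 2 ^ m)) - w s\<bar>) ` (SIGMA m:UNIV. {..(2::nat) ^ m}))"
proof -
  have "continuous_on {s..s+h} w" by (rule continuous_on_subset[OF c]) (use s in auto)
  then have "continuous_on {s..s+h} (\<lambda>t. \<bar>w t - w s\<bar>)" by (intro continuous_intros)
  then have "compact ((\<lambda>t. \<bar>w t - w s\<bar>) ` {s..s+h})" by (rule compact_continuous_image) simp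
  then obtain B where B: "\<And>t. t \<in> {s..s+h} \<Longrightarrow> \<bar>w t - w s\<bar> \<le> B"
    by (force dest!: compact_imp_bounded simp: bounded_iff)
  have "s + h * (real k / 2 ^ m) \<in> {s..s+h}" if "k \<le> 2 ^ m" for k m :: nat
  proof -
    have "real k \<le> real (2 ^ m)" using that by (simp only: of_nat_le_iff)
    then have "real k \<le> 2 ^ m" by simp
    then have "h * (real k / 2 ^ m) \<le> h * 1" using s by (intro mult_left_mono) auto
    then show ?thesis using s by auto
  qed
  then show ?thesis using B by (intro bdd_aboveI[of _ B]) auto
qed

lemma le_osc:
  assumes c: "continuous_on {0..} w" and s: "0 \<le> s" "0 < h" and t: "s \<le> t" "t \<le> s + h"
  shows "\<bar>w t - w s\<bar> \<le> osc w s h"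
proof -
  define x where "x = (t - s) / h"
  have x: "0 \<le> x" "x \<le> 1" "t = s + h * x" using s t by (auto simp: x_def field_simps)
  define d where "d m = real (nat \<lfloor>x * 2 ^ m\<rfloor>) / 2 ^ m" for m
  have d: "d \<longlonglongrightarrow> x" unfolding d_def by (rule dyadic_approx(1)[OF x(1,2)])
  have d0: "0 \<le> d m" for m by (simp add: d_def)
  have "(\<lambda>m. \<bar>w (s + h * d m) - w s\<bar>) \<longlonglongrightarrow> \<bar>w t - w s\<bar>"
    unfolding x(3)
    by (intro tendsto_intros continuous_on_tendsto_compose[OF c] d) (use d0 s x in auto)
  moreover have "\<bar>w (s + h * d m) - w s\<bar> \<le> osc w s h" for m
    unfolding osc_def d_def
    by (rule cSUP_upper2[OF osc_bdd[OF c], of _ _ "(m, nat \<lfloor>x * 2 ^ m\<rfloor>)"])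
       (use s dyadic_approx(2)[OF x(1,2)] in auto)
  ultimately show ?thesis by (intro LIMSEQ_le_const2) auto
qed

lemma osc_nonneg:
  assumes c: "continuous_on {0..} w" and s: "0 \<le> s" "0 < h"
  shows "0 \<le> osc w s h"
  using le_osc[OF c s, of s] s by simp

lemma measurable_osc:
  fixes W :: "real \<Rightarrow> 'w \<Rightarrow> real"
  assumes "\<And>t. 0 \<le> t \<Longrightarrow> W t \<in> borel_measurable M"
    and c: "\<And>\<omega>. \<omega> \<in> space M \<Longrightarrow> continuous_on {0..} (\<lambda>t. W t \<omega>)" and s: "0 \<le> s" "0 \<le> h"
  shows "(\<lambda>\<omega>. osc (\<lambda>t. W t \<omega>) s h) \<in> borel_measurable M"
proof -
  have "(\<lambda>\<omega>. SUP x\<in>(SIGMA m:UNIV. {..(2::nat) ^ m}).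
      \<bar>W (s + h * (real (snd x) / 2 ^ fst x)) \<omega> - W s \<omega>\<bar>) \<in> borel_measurable M"
  proof (rule borel_measurable_cSUP)
    fix \<omega> assume "\<omega> \<in> space M"
    from osc_bdd[OF c[OF this] s]
    show "bdd_above ((\<lambda>x. \<bar>W (s + h * (real (snd x) / 2 ^ fst x)) \<omega> - W s \<omega>\<bar>) ` (SIGMA m:UNIV. {..(2::nat) ^ m}))"
      by (simp add: case_prod_unfold)
  next
    fix x :: "nat \<times> nat"
    show "(\<lambda>\<omega>. \<bar>W (s + h * (real (snd x) / 2 ^ fst x)) \<omega> - W s \<omega>\<bar>) \<in> borel_measurable M"
      by (intro borel_measurable_abs borel_measurable_diff assms) (use s in auto)
  qed auto
  then show ?thesis by (simp add: osc_def case_prod_unfold)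
qed

section \<open>Moments of the oscillation\<close>

lemma (in brownian_motion) increment_moment:
  assumes "0 \<le> s" "s < t"
  shows "(\<integral>\<^sup>+\<omega>. ennreal ((W t \<omega> - W s \<omega>) ^ (2 * k)) \<partial>M) = ennreal (fact (2 * k) / (2 ^ k * fact k) * (t - s) ^ k)"
proof -
  have D: "distributed M lborel (\<lambda>\<omega>. W t \<omega> - W s \<omega>) (normal_density 0 (sqrt (t - s)))"
    by (rule normal_increments[OF assms])
  have p: "0 < sqrt (t - s)" using assms by simp
  have ev: "has_bochner_integral lborel (\<lambda>x. normal_density 0 (sqrt (t - s)) x * x ^ (2 * k))
      (fact (2 * k) / ((2 / (sqrt (t-s))\<^sup>2) ^ k * fact k))"
    using normal_moment_even[OF p, of 0 k] by simp
  have "(\<integral>\<^sup>+\<omega>. ennreal ((W t \<omega> - W s \<omega>) ^ (2 * k)) \<partial>M) =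
     (\<integral>\<^sup>+x. ennreal (normal_density 0 (sqrt (t - s)) x) * ennreal (x ^ (2 * k)) \<partial>lborel)"
    by (rule distributed_nn_integral[OF D, symmetric]) simp
  also have "\<dots> = (\<integral>\<^sup>+x. ennreal (normal_density 0 (sqrt (t - s)) x * x ^ (2 * k)) \<partial>lborel)"
    by (simp add: ennreal_mult)
  also have "\<dots> = ennreal (fact (2 * k) / ((2 / (sqrt (t-s))\<^sup>2) ^ k * fact k))"
    using has_bochner_integral_iff[THEN iffD1, OF ev]
    by (subst nn_integral_eq_integral) (auto simp: zero_le_even_power)
  also have "fact (2 * k) / ((2 / (sqrt (t-s))\<^sup>2) ^ k * fact k) = fact (2 * k) / (2 ^ k * fact k) * (t - s) ^ k"
    using assms by (simp add: power_divide)
  finally show ?thesis .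
qed

text \<open>The Gaussian moment of order 2k at variance 1, times \<open>4 ^ (2 * k)\<close> from the
  chaining sum of (3/4)^n and 2 from the sum of (1/2)^n.\<close>

definition moment_const :: "nat \<Rightarrow> real" where
  "moment_const k = 2 * 4 ^ (2 * k) * (fact (2 * k) / (2 ^ k * fact k))"

lemma moment_const_pos: "0 < moment_const k" by (simp add: moment_const_def)

text \<open>\<open>Z\<close> adds up the 2k-th powers of all dyadic increments, those of level n
  with weight (4/3)^(2kn). If Z = y^(2k), every increment of level n is at most (3/4)^n y, and
  chaining gives an oscillation of at most 4 y. In expectation, level n contributes 2^n increments
  of variance h / 2^n, that is c h^k (2 (8/9)^k)^n since (4/3)^2 / 2 = 8/9. The condition on k makes
  this series geometric with ratio at most 1/2.\<close>

lemma (in brownian_motion) osc_moment: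
  assumes s: "0 \<le> s" "0 < h" and k: "2 * (8/9::real) ^ k \<le> 1/2" "0 < k"
  shows "(\<integral>\<^sup>+\<omega>. ennreal (osc (\<lambda>t. W t \<omega>) s h ^ (2 * k)) \<partial>M) \<le> ennreal (moment_const k * h ^ k)"
proof -
  define c where "c = (fact (2 * k) / (2 ^ k * fact k) :: real)"
  have c0: "c > 0" by (simp add: c_def)
  define pt where "pt n i = s + h * (real i / 2 ^ n)" for n i :: nat
  define \<Delta> where "\<Delta> n i \<omega> = W (pt n (Suc i)) \<omega> - W (pt n i) \<omega>" for n i \<omega>
  define Z where "Z \<omega> = (\<Sum>n. ennreal ((4/3) ^ (2 * k * n)) * (\<Sum>i<2 ^ n. ennreal (\<Delta> n i \<omega> ^ (2 * k))))" for \<omega>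
  have pt0: "0 \<le> pt n i" for n i using s by (simp add: pt_def)
  have m[measurable]: "\<Delta> n i \<in> borel_measurable M" for n i
    unfolding \<Delta>_def by (intro borel_measurable_diff random_variable_W pt0)
  have E\<Delta>: "(\<integral>\<^sup>+\<omega>. ennreal (\<Delta> n i \<omega> ^ (2 * k)) \<partial>M) = ennreal (c * (h / 2 ^ n) ^ k)" for n i
  proof -
    have lt: "pt n i < pt n (Suc i)" using s by (simp add: pt_def divide_strict_right_mono)
    have d: "pt n (Suc i) - pt n i = h / 2 ^ n" by (simp add: pt_def field_simps)
    show ?thesis using increment_moment[OF pt0 lt, of k] by (simp add: \<Delta>_def d c_def)
  qed
  have "(\<integral>\<^sup>+\<omega>. Z \<omega> \<partial>M) = (\<Sum>n. ennreal ((4/3) ^ (2 * k * n)) * (\<Sum>i<(2::nat) ^ n. ennreal (c * (h / 2 ^ n) ^ k)))"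
    unfolding Z_def by (simp add: nn_integral_suminf nn_integral_cmult nn_integral_sum E\<Delta> del: sum_constant sum_ennreal)
  also have "\<dots> = (\<Sum>n. ennreal (c * h ^ k * (2 * (8/9) ^ k) ^ n))"
  proof (intro suminf_cong)
    fix n
    have "ennreal ((4/3) ^ (2 * k * n)) * (\<Sum>i<(2::nat) ^ n. ennreal (c * (h / 2 ^ n) ^ k))
      = ennreal ((4/3) ^ (2 * k * n) * (2 ^ n * (c * (h / 2 ^ n) ^ k)))"
      using s c0 by (subst sum_ennreal) (auto simp: ennreal_mult[symmetric])
    also have "(4/3) ^ (2 * k * n) * (2 ^ n * (c * (h / 2 ^ n) ^ k)) =
       c * h ^ k * (2 ^ n * ((4/3) ^ (2 * (k * n)) / 2 ^ (n * k)))"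
      by (simp add: power_divide power_mult[symmetric] mult.assoc)
    also have "(4/3::real) ^ (2 * (k * n)) / 2 ^ (n * k) = ((8/9) ^ k) ^ n"
    proof -
      have "(4/3::real) ^ (2 * (k * n)) = ((4/3) ^ 2) ^ (k * n)" by (rule power_mult)
      then have "(4/3::real) ^ (2 * (k * n)) / 2 ^ (n * k) = ((4/3) ^ 2) ^ (k * n) / 2 ^ (k * n)"
        by (simp only: mult.commute[of n k])
      also have "\<dots> = ((4/3) ^ 2 / 2) ^ (k * n)" by (simp only: power_divide)
      also have "(4/3::real) ^ 2 / 2 = 8/9" by (simp add: power2_eq_square)
      finally show ?thesis by (simp only: power_mult)
    qed
    finally show "ennreal ((4/3) ^ (2 * k * n)) * (\<Sum>i<(2::nat) ^ n. ennreal (c * (h / 2 ^ n) ^ k)) =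
      ennreal (c * h ^ k * (2 * (8/9) ^ k) ^ n)" by (simp add: power_mult_distrib)
  qed
  also have "\<dots> \<le> (\<Sum>n. ennreal (c * h ^ k * (1/2) ^ n))"
    using k s c0 by (intro suminf_le ennreal_leI mult_left_mono power_mono) auto
  also have "\<dots> = ennreal (c * h ^ k * 2)"
  proof -
    have "(\<lambda>n. c * h ^ k * (1/2) ^ n) sums (c * h ^ k * (1 / (1 - 1/2)))"
      by (intro sums_mult geometric_sums) simp
    then show ?thesis using s c0 by (intro suminf_ennreal_eq) auto
  qed
  finally have EZ: "(\<integral>\<^sup>+\<omega>. Z \<omega> \<partial>M) \<le> ennreal (c * h ^ k * 2)" .
  have path: "ennreal (osc (\<lambda>t. W t \<omega>) s h ^ (2 * k)) \<le> ennreal (4 ^ (2 * k)) * Z \<omega>" if \<omega>: "\<omega> \<in> space M" for \<omega>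
  proof (cases "Z \<omega>")
    case top
    then show ?thesis by (simp add: ennreal_mult_top)
  next
    case (real z)
    define y where "y = root (2 * k) z"
    have y: "y \<ge> 0" "y ^ (2 * k) = z" using real k by (auto simp: y_def)
    have inc: "\<bar>W (s + h * ((real i + 1) / 2 ^ n)) \<omega> - W (s + h * (real i / 2 ^ n)) \<omega>\<bar> \<le> (3/4) ^ n * y"
      if "i < 2 ^ n" for n i
    proof -
      have "ennreal ((4/3) ^ (2 * k * n)) * ennreal (\<Delta> n i \<omega> ^ (2 * k))
         \<le> ennreal ((4/3) ^ (2 * k * n)) * (\<Sum>i<2 ^ n. ennreal (\<Delta> n i \<omega> ^ (2 * k)))"
        using that by (intro mult_left_mono member_le_sum) auto
      also have "\<dots> = (\<Sum>n\<in>{n}. ennreal ((4/3) ^ (2 * k * n)) * (\<Sum>i<2 ^ n. ennreal (\<Delta> n i \<omega> ^ (2 * k))))" by simp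
      also have "\<dots> \<le> Z \<omega>" unfolding Z_def by (rule sum_le_suminf) auto
      finally have "ennreal ((4/3) ^ (2 * k * n) * \<Delta> n i \<omega> ^ (2 * k)) \<le> ennreal z"
        using real by (simp add: ennreal_mult'[symmetric])
      then have "(4/3) ^ (2 * k * n) * \<Delta> n i \<omega> ^ (2 * k) \<le> y ^ (2 * k)"
        using y real by (simp add: ennreal_le_iff)
      moreover have "((4/3::real) ^ n) ^ (2 * k) = (4/3) ^ (2 * k * n)"
        by (simp only: power_mult[symmetric] mult.commute)
      ultimately have "((4/3) ^ n * \<bar>\<Delta> n i \<omega>\<bar>) ^ (2 * k) \<le> y ^ (2 * k)"
        by (simp only: power_mult_distrib power_even_abs even_mult_iff even_numeral simp_thms)
      then have "(4/3) ^ n * \<bar>\<Delta> n i \<omega>\<bar> \<le> y"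
        using y k by (subst (asm) power_mono_iff) auto
      then have "\<bar>\<Delta> n i \<omega>\<bar> \<le> (3/4) ^ n * y"
        by (simp add: power_divide divide_simps mult.commute)
      then show ?thesis by (simp add: \<Delta>_def pt_def add.commute)
    qed
    have "osc (\<lambda>t. W t \<omega>) s h \<le> 4 * y"
    proof (rule osc_le)
      fix m j :: nat assume j: "j \<le> 2 ^ m"
      have "\<bar>W (s + h * (real j / 2 ^ m)) \<omega> - W (s + h * 0) \<omega>\<bar> \<le> (\<Sum>n\<le>m. (3/4) ^ n * y)"
        using dyadic_chaining[of "\<lambda>x. W (s + h * x) \<omega>" "\<lambda>n. (3/4) ^ n * y", OF inc _ j] y by simp
      also have "\<dots> = (\<Sum>n\<le>m. (3/4) ^ n) * y" by (simp add: sum_distrib_right)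
      also have "\<dots> \<le> 4 * y" using y by (intro mult_right_mono geometric_sum_le) auto
      finally show "\<bar>W (s + h * (real j / 2 ^ m)) \<omega> - W s \<omega>\<bar> \<le> 4 * y" by simp
    qed
    then have "osc (\<lambda>t. W t \<omega>) s h ^ (2 * k) \<le> (4 * y) ^ (2 * k)"
      using osc_nonneg[OF paths[OF \<omega>] s] by (intro power_mono) auto
    also have "\<dots> = 4 ^ (2 * k) * z" using y by (simp add: power_mult_distrib)
    finally show ?thesis using real by (simp add: ennreal_mult[symmetric] ennreal_leI)
  qed
  have "(\<integral>\<^sup>+\<omega>. ennreal (osc (\<lambda>t. W t \<omega>) s h ^ (2 * k)) \<partial>M) \<le> (\<integral>\<^sup>+\<omega>. ennreal (4 ^ (2 * k)) * Z \<omega> \<partial>M)"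
    by (intro nn_integral_mono path)
  also have "\<dots> = ennreal (4 ^ (2 * k)) * (\<integral>\<^sup>+\<omega>. Z \<omega> \<partial>M)"
    unfolding Z_def by (rule nn_integral_cmult) measurable
  also have "\<dots> \<le> ennreal (4 ^ (2 * k)) * ennreal (c * h ^ k * 2)" by (intro mult_left_mono EZ) auto
  also have "\<dots> = ennreal (moment_const k * h ^ k)"
    using s c0 by (subst ennreal_mult[symmetric]) (auto simp: moment_const_def c_def)
  finally show ?thesis .
qed

text \<open>\<open>osc_moment\<close> does not cover k = 1, so the second moment is derived from the
  fortieth by y \<le> 1 + y^20, applied to the squared oscillation divided by h, which has the right
  scaling.\<close>

lemma (in brownian_motion) osc_second_moment:
  assumes s: "0 \<le> s" "0 < h"
  shows "(\<integral>\<^sup>+\<omega>. ennreal ((osc (\<lambda>t. W t \<omega>) s h)\<^sup>2) \<partial>M) \<le> ennreal ((1 + moment_const 20) * h)"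
proof -
  define X where "X \<omega> = osc (\<lambda>t. W t \<omega>) s h" for \<omega>
  have X[measurable]: "X \<in> borel_measurable M"
    unfolding X_def by (rule measurable_osc[OF random_variable_W paths]) (use s in auto)
  have X2: "(X \<omega>)\<^sup>2 \<le> h + h * (1 / h ^ 20) * X \<omega> ^ 40" for \<omega>
  proof -
    define y where "y = (X \<omega>)\<^sup>2 / h"
    have y0: "y \<ge> 0" using s by (simp add: y_def)
    have "y \<le> 1 + y ^ 20"
    proof (cases "y \<le> 1")
      case True
      then show ?thesis using y0 by (simp add: add_increasing2)
    next
      case False
      then have "y ^ 1 \<le> y ^ 20" by (intro power_increasing) auto
      then show ?thesis by simp
    qed
    then have "h * y \<le> h * (1 + y ^ 20)" using s by (intro mult_left_mono) auto
    moreover have "h * y = (X \<omega>)\<^sup>2" using s by (simp add: y_def)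
    moreover have "y ^ 20 = 1 / h ^ 20 * X \<omega> ^ 40"
      by (simp add: y_def power_divide power_mult[symmetric])
    ultimately show ?thesis by (metis distrib_left mult.assoc mult.right_neutral)
  qed
  have "(\<integral>\<^sup>+\<omega>. ennreal ((X \<omega>)\<^sup>2) \<partial>M) \<le> (\<integral>\<^sup>+\<omega>. ennreal h + ennreal (h * (1 / h ^ 20)) * ennreal (X \<omega> ^ 40) \<partial>M)"
  proof (intro nn_integral_mono)
    fix \<omega>
    have "ennreal ((X \<omega>)\<^sup>2) \<le> ennreal (h + h * (1 / h ^ 20) * X \<omega> ^ 40)" by (rule ennreal_leI[OF X2])
    also have "\<dots> = ennreal h + ennreal (h * (1 / h ^ 20) * X \<omega> ^ 40)" by (rule ennreal_plus) (use s in auto)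
    also have "ennreal (h * (1 / h ^ 20) * X \<omega> ^ 40) = ennreal (h * (1 / h ^ 20)) * ennreal (X \<omega> ^ 40)"
      by (rule ennreal_mult) (use s in auto)
    finally show "ennreal ((X \<omega>)\<^sup>2) \<le> ennreal h + ennreal (h * (1 / h ^ 20)) * ennreal (X \<omega> ^ 40)" .
  qed
  also have "\<dots> = ennreal h + ennreal (h * (1 / h ^ 20)) * (\<integral>\<^sup>+\<omega>. ennreal (X \<omega> ^ 40) \<partial>M)"
    by (simp add: nn_integral_add nn_integral_cmult emeasure_space_1)
  also have "\<dots> \<le> ennreal h + ennreal (h * (1 / h ^ 20)) * ennreal (moment_const 20 * h ^ 20)"
  proof (intro add_left_mono mult_left_mono)
    have "2 * (8/9::real) ^ 20 \<le> 1/2" by (simp add: power_divide)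
    from osc_moment[OF s this]
    show "(\<integral>\<^sup>+\<omega>. ennreal (X \<omega> ^ 40) \<partial>M) \<le> ennreal (moment_const 20 * h ^ 20)"
      by (simp add: X_def)
  qed auto
  also have "ennreal (h * (1 / h ^ 20)) * ennreal (moment_const 20 * h ^ 20) = ennreal (h * (1 / h ^ 20) * (moment_const 20 * h ^ 20))"
    by (rule ennreal_mult[symmetric]) (use s moment_const_pos[of 20] in auto)
  also have "ennreal h + \<dots> = ennreal (h + h * (1 / h ^ 20) * (moment_const 20 * h ^ 20))"
    by (rule ennreal_plus[symmetric]) (use s moment_const_pos[of 20] in auto)
  also have "h + h * (1 / h ^ 20) * (moment_const 20 * h ^ 20) = (1 + moment_const 20) * h"
    using s by (simp add: distrib_right)
  finally show ?thesis by (simp add: X_def)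
qed


section \<open>Paths in a linear stage\<close>

lemma first_time_bounds:
  assumes "l \<le> r"
  shows "l \<le> first_time l r P" "first_time l r P \<le> r"
proof -
  have bb: "bdd_below {t \<in> {l<..<r}. P t}" by (rule bdd_belowI[of _ l]) auto
  show "l \<le> first_time l r P"
    using assms by (auto simp: first_time_def intro!: cInf_greatest)
  show "first_time l r P \<le> r"
  proof (cases "\<exists>t\<in>{l<..<r}. P t")
    case True
    then obtain t where "t \<in> {l<..<r}" "P t" by blast
    then have "Inf {t \<in> {l<..<r}. P t} \<le> t" by (intro cInf_lower bb) auto
    then show ?thesis using True \<open>t \<in> {l<..<r}\<close> by (auto simp: first_time_def)
  qed (auto simp: first_time_def)
qed

lemma not_before_first_time:
  assumes "l < t" "t < first_time l r P"
  shows "\<not> P t"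
proof
  assume P: "P t"
  have bb: "bdd_below {t \<in> {l<..<r}. P t}" by (rule bdd_belowI[of _ l]) auto
  show False
  proof (cases "\<exists>t\<in>{l<..<r}. P t")
    case True
    then obtain s where "s \<in> {l<..<r}" "P s" by blast
    then have "Inf {t \<in> {l<..<r}. P t} \<le> s" by (intro cInf_lower bb) auto
    then have "t < r" using assms \<open>s \<in> {l<..<r}\<close> True by (auto simp: first_time_def)
    then have "Inf {t \<in> {l<..<r}. P t} \<le> t" using assms P by (intro cInf_lower bb) auto
    then show False using True assms by (simp add: first_time_def)
  next
    case False
    then show False using P assms by (auto simp: first_time_def)
  qed
qed

text \<open>By closedness the infimum satisfies the condition; since \<open>f l\<close> does not lie
  in \<open>S\<close>, the infimum is not the excluded left end point.\<close>

lemma first_time_attained: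
  fixes f :: "real \<Rightarrow> real"
  assumes f: "continuous_on {l..r} f" and S: "closed S" and l: "f l \<notin> S"
    and P: "\<And>t. l < t \<Longrightarrow> t < r \<Longrightarrow> P t \<longleftrightarrow> f t \<in> S" and lt: "first_time l r P < r"
  shows "f (first_time l r P) \<in> S" "l < first_time l r P"
proof -
  define X where "X = {t \<in> {l<..<r}. P t}"
  have ex: "\<exists>t\<in>{l<..<r}. P t" using lt by (auto simp: first_time_def split: if_splits)
  then have ne: "X \<noteq> {}" and ft: "first_time l r P = Inf X" by (auto simp: X_def first_time_def)
  have lr: "l \<le> r" using ex by auto
  have "closed ({l..r} \<inter> f -` S)" by (rule continuous_closed_preimage[OF f _ S]) simp
  moreover have "X \<subseteq> {l..r} \<inter> f -` S" using P by (auto simp: X_def)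
  moreover have "bdd_below X" by (rule bdd_belowI[of _ l]) (auto simp: X_def)
  ultimately have "Inf X \<in> {l..r} \<inter> f -` S"
    using closure_contains_Inf[OF ne] closure_minimal by blast
  then show *: "f (first_time l r P) \<in> S" using ft by simp
  have "first_time l r P \<noteq> l" using * l by auto
  then show "l < first_time l r P" using first_time_bounds(1)[OF lr, of P] by simp
qed

lemma first_time_empty: "r \<le> l \<Longrightarrow> first_time l r P = r"
  by (auto simp: first_time_def)

lemma left_limit_le:
  fixes g :: "real \<Rightarrow> real"
  assumes "continuous_on {l..e} g" "l < e" "\<And>t. l < t \<Longrightarrow> t < e \<Longrightarrow> g t \<le> c" "t \<in> {l..e}"
  shows "g t \<le> c"
  using continuous_le_on_closure[of "{l<..<e}" g t c] assms by (auto simp: closure_greaterThanLessThan)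

lemma sum_squares_le:
  fixes y z B :: real
  assumes "\<bar>y\<bar> \<le> \<alpha> * B" "\<bar>z\<bar> \<le> \<beta> * B" "\<alpha>\<^sup>2 + \<beta>\<^sup>2 \<le> c"
  shows "y\<^sup>2 + z\<^sup>2 \<le> c * B\<^sup>2"
proof -
  have "y\<^sup>2 \<le> (\<alpha> * B)\<^sup>2" "z\<^sup>2 \<le> (\<beta> * B)\<^sup>2"
    using power_mono[OF assms(1) abs_ge_zero, of 2] power_mono[OF assms(2) abs_ge_zero, of 2] by auto
  then have "y\<^sup>2 + z\<^sup>2 \<le> (\<alpha>\<^sup>2 + \<beta>\<^sup>2) * B\<^sup>2" by (simp add: power_mult_distrib distrib_right)
  also have "\<dots> \<le> c * B\<^sup>2" using assms(3) by (intro mult_right_mono) auto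
  finally show ?thesis .
qed

section \<open>Linear equations driven by a continuous path\<close>

text \<open>Although \<open>w\<close> need not be differentiable, y = p - (w - w s) is, with y' =
  \<gamma> (y + w - w s). The integrating factor turns this into z' = exp (- \<gamma> (r - s))
  \<gamma> (w r - w s), whose integral is at most m |1 - exp (- \<gamma> (t - s))|. Multiplying back
  and adding the direct contribution of w gives the bound.\<close>

lemma linear_response:
  fixes p w :: "real \<Rightarrow> real"
  assumes pc: "continuous_on {s..e} p"
    and eq: "\<And>t. t \<in> {s..e} \<Longrightarrow> p t - p s = w t - w s + integral {s..t} (\<lambda>r. \<gamma> * p r)"
    and m: "\<And>t. t \<in> {s..e} \<Longrightarrow> \<bar>w t - w s\<bar> \<le> m"
    and t: "t \<in> {s..e}"
  shows "\<bar>p t - exp (\<gamma> * (t - s)) * p s\<bar> \<le> m * (1 + \<bar>exp (\<gamma> * (t - s)) - 1\<bar>)"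
proof -
  define y where "y r = p s + integral {s..r} (\<lambda>r. \<gamma> * p r)" for r
  have py: "p r = y r + (w r - w s)" if "r \<in> {s..e}" for r using eq[OF that] by (simp add: y_def)
  have se: "s \<le> t" using t by simp
  define z where "z r = exp (- \<gamma> * (r - s)) * y r" for r
  define z' where "z' r = exp (- \<gamma> * (r - s)) * (\<gamma> * (w r - w s))" for r
  have dz: "(z has_vector_derivative z' r) (at r within {s..t})" if r: "r \<in> {s..t}" for r
  proof -
    have r': "r \<in> {s..e}" using r t by auto
    have "((\<lambda>r. integral {s..r} (\<lambda>r. \<gamma> * p r)) has_vector_derivative \<gamma> * p r) (at r within {s..t})"
      by (rule integral_has_vector_derivative)
         (use r t in \<open>auto intro!: continuous_intros continuous_on_subset[OF pc]\<close>)
    then have "(y has_real_derivative \<gamma> * p r) (at r within {s..t})"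
      unfolding y_def has_real_derivative_iff_has_vector_derivative 
      using has_vector_derivative_add[OF has_vector_derivative_const[of "p s"]] by force
    then have "(z has_real_derivative exp (- \<gamma> * (r - s)) * (\<gamma> * p r) + (- \<gamma> * exp (- \<gamma> * (r - s))) * y r) (at r within {s..t})"
      unfolding z_def by (auto intro!: derivative_eq_intros)
    also have "exp (- \<gamma> * (r - s)) * (\<gamma> * p r) + (- \<gamma> * exp (- \<gamma> * (r - s))) * y r = z' r"
      unfolding z'_def py[OF r'] by (simp add: algebra_simps)
    finally show ?thesis by (simp add: has_real_derivative_iff_has_vector_derivative)
  qed
  have I1: "(z' has_integral (z t - z s)) {s..t}" by (rule fundamental_theorem_of_calculus[OF se dz])
  \<comment> \<open>\<open>- sgn \<gamma> * exp (- \<gamma> * (r - s))\<close> is an antiderivative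
    of \<open>\<bar>\<gamma>\<bar> * exp (- \<gamma> * (r - s))\<close> for every sign of \<gamma>,
    including \<gamma> = 0.\<close>
  have "((\<lambda>r. m * (\<bar>\<gamma>\<bar> * exp (- \<gamma> * (r - s)))) has_integral
      (m * (- sgn \<gamma> * exp (- \<gamma> * (t - s))) - m * (- sgn \<gamma> * exp (- \<gamma> * (s - s))))) {s..t}"
    by (rule fundamental_theorem_of_calculus[OF se])
       (auto intro!: derivative_eq_intros simp: has_real_derivative_iff_has_vector_derivative[symmetric] abs_sgn mult_ac)
  moreover have "norm (z' r) \<le> m * (\<bar>\<gamma>\<bar> * exp (- \<gamma> * (r - s)))" if "r \<in> {s..t}" for r
  proof -
    have "exp (- \<gamma> * (r - s)) * (\<bar>\<gamma>\<bar> * \<bar>w r - w s\<bar>) \<le> exp (- \<gamma> * (r - s)) * (\<bar>\<gamma>\<bar> * m)"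
      using that t by (intro mult_left_mono m) auto
    then show ?thesis by (simp add: z'_def abs_mult mult_ac)
  qed
  ultimately have "norm (z t - z s) \<le> m * (- sgn \<gamma> * exp (- \<gamma> * (t - s))) - m * (- sgn \<gamma> * exp (- \<gamma> * (s - s)))"
    using I1 integral_norm_bound_integral[of z' "{s..t}" "\<lambda>r. m * (\<bar>\<gamma>\<bar> * exp (- \<gamma> * (r - s)))"]
    by (metis (no_types, lifting) has_integral_iff)
  also have "\<dots> = m * (sgn \<gamma> * (1 - exp (- \<gamma> * (t - s))))" by (simp add: algebra_simps)
  also have "sgn \<gamma> * (1 - exp (- \<gamma> * (t - s))) = \<bar>1 - exp (- \<gamma> * (t - s))\<bar>"
  proof (cases "\<gamma> \<ge> 0")
    case True
    then have "exp (- \<gamma> * (t - s)) \<le> 1" using se by simp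
    then show ?thesis using True by (auto simp: sgn_if)
  next
    case False
    then have "exp (- \<gamma> * (t - s)) \<ge> 1" using se by (simp add: mult_nonpos_nonneg)
    then show ?thesis using False by (auto simp: sgn_if)
  qed
  finally have zb: "\<bar>z t - z s\<bar> \<le> m * \<bar>1 - exp (- \<gamma> * (t - s))\<bar>" by simp
  define E where "E = exp (\<gamma> * (t - s))"
  have E: "E > 0" "E * exp (- \<gamma> * (t - s)) = 1" by (auto simp: E_def exp_minus_inverse)
  have zs: "z s = p s" by (simp add: z_def y_def)
  have "p t - E * p s = (w t - w s) + E * (z t - z s)"
  proof -
    have "E * z t = y t" unfolding z_def mult.assoc[symmetric] E(2) by simp
    then show ?thesis using py[OF t] by (simp add: zs right_diff_distrib)
  qed
  then have "\<bar>p t - E * p s\<bar> \<le> \<bar>w t - w s\<bar> + E * \<bar>z t - z s\<bar>"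
    using E(1) by (metis abs_mult abs_of_pos abs_triangle_ineq)
  also have "\<dots> \<le> m + E * (m * \<bar>1 - exp (- \<gamma> * (t - s))\<bar>)"
    using E(1) zb m[OF t] by (intro add_mono mult_left_mono) auto
  also have "\<dots> = m * (1 + \<bar>E * (1 - exp (- \<gamma> * (t - s)))\<bar>)"
    unfolding abs_mult abs_of_pos[OF E(1)] by (simp only: distrib_left mult.left_commute mult_1_right)
  also have "E * (1 - exp (- \<gamma> * (t - s))) = E - 1" using E(2) by (simp add: algebra_simps)
  finally show ?thesis by (simp add: E_def)
qed

lemma stable_response:
  fixes p w :: "real \<Rightarrow> real"
  assumes "continuous_on {s..e} p" "c \<ge> 0"
    and "\<And>t. t \<in> {s..e} \<Longrightarrow> p t - p s = w t - w s + integral {s..t} (\<lambda>r. - c * p r)"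
    and "\<And>t. t \<in> {s..e} \<Longrightarrow> \<bar>w t - w s\<bar> \<le> m" and t: "t \<in> {s..e}"
  shows "\<bar>p t - exp (- c * (t - s)) * p s\<bar> \<le> 2 * m"
proof -
  have m: "0 \<le> m" using assms(4)[of s] t by auto
  have "exp (- c * (t - s)) \<le> 1" "0 \<le> exp (- c * (t - s))" using assms t by auto
  then have "1 + \<bar>exp (- c * (t - s)) - 1\<bar> \<le> 2" by linarith
  then have "m * (1 + \<bar>exp (- c * (t - s)) - 1\<bar>) \<le> m * 2" using m by (rule mult_left_mono)
  with linear_response[OF assms(1,3,4) t] show ?thesis by linarith
qed

lemma unstable_response:
  fixes p w :: "real \<Rightarrow> real"
  assumes "continuous_on {s..e} p" "\<gamma> \<ge> 0"
    and "\<And>t. t \<in> {s..e} \<Longrightarrow> p t - p s = w t - w s + integral {s..t} (\<lambda>r. \<gamma> * p r)"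
    and "\<And>t. t \<in> {s..e} \<Longrightarrow> \<bar>w t - w s\<bar> \<le> m" and t: "t \<in> {s..e}"
  shows "\<bar>p t - exp (\<gamma> * (t - s)) * p s\<bar> \<le> exp (\<gamma> * (t - s)) * m"
proof -
  have "exp (\<gamma> * (t - s)) \<ge> 1" using assms t by simp
  then have "m * (1 + \<bar>exp (\<gamma> * (t - s)) - 1\<bar>) = exp (\<gamma> * (t - s)) * m" by simp
  with linear_response[OF assms(1,3,4) t] show ?thesis by linarith
qed

text \<open>Over a window of length h the factor exp (- c h) is at most exp (-1) \<le> 1/2, and the
  noise adds at most \<open>2 * ob k\<close>. At the grid points |p| obeys x' \<le> x/2 + 2 m, so it
  stays below |p s| + 4 m, and inside a window at most 2 m are added.\<close>

lemma stable_stage: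
  fixes p w :: "real \<Rightarrow> real" and ob :: "nat \<Rightarrow> real"
  assumes pc: "continuous_on {s..e} p" and h: "0 < h" "1 \<le> c * h"
    and eq: "\<And>r t. s \<le> r \<Longrightarrow> r \<le> t \<Longrightarrow> t \<le> e \<Longrightarrow> p t - p r = w t - w r + integral {r..t} (\<lambda>r. - c * p r)"
    and ob: "\<And>k t. s + real k * h \<le> t \<Longrightarrow> t \<le> s + real (Suc k) * h \<Longrightarrow> t \<le> e \<Longrightarrow> \<bar>w t - w (s + real k * h)\<bar> \<le> ob k"
    and om: "\<And>k. ob k \<le> m"
  shows "t \<in> {s..e} \<Longrightarrow> \<bar>p t\<bar> \<le> \<bar>p s\<bar> + 6 * m"
    and "(\<And>N. (\<Sum>k<N. (ob k)\<^sup>2) \<le> Q) \<Longrightarrow> s \<le> e \<Longrightarrow> integral {s..e} (\<lambda>t. (p t)\<^sup>2) \<le> h * (4 * (p s)\<^sup>2 + 40 * Q)"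
proof -
  have c: "0 < c" using h by (metis mult_nonpos_nonneg not_le order_less_imp_le zero_less_one order_trans)
  define g where "g k = s + real k * h" for k
  have g0: "g 0 = s" and gS: "g (Suc k) = g k + h" and sg: "s \<le> g k" for k
    using h by (auto simp: g_def algebra_simps)
  have resp: "\<bar>p t - exp (- c * (t - g k)) * p (g k)\<bar> \<le> 2 * ob k" if "g k \<le> t" "t \<le> g (Suc k)" "t \<le> e" for k t
  proof (rule stable_response[where e = t])
    show "continuous_on {g k..t} p" by (rule continuous_on_subset[OF pc]) (use that sg in auto)
    show "\<bar>w r - w (g k)\<bar> \<le> ob k" if "r \<in> {g k..t}" for r
      using ob[of k r] that \<open>t \<le> g (Suc k)\<close> \<open>t \<le> e\<close> by (auto simp: g_def)
    show "p r - p (g k) = w r - w (g k) + integral {g k..r} (\<lambda>r. - c * p r)" if "r \<in> {g k..t}" for r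
      using eq[OF sg] that \<open>t \<le> e\<close> by auto
  qed (use that c in auto)
  have o0: "0 \<le> ob k" if "g k \<le> e" for k
    using ob[of k "g k"] that h by (auto simp: g_def algebra_simps)
  have inside: "\<bar>p t\<bar> \<le> \<bar>p (g k)\<bar> + 2 * ob k" if "g k \<le> t" "t \<le> g (Suc k)" "t \<le> e" for k t
  proof -
    have "\<bar>exp (- c * (t - g k)) * p (g k)\<bar> \<le> 1 * \<bar>p (g k)\<bar>"
      unfolding abs_mult using c that by (intro mult_right_mono) auto
    with resp[OF that] show ?thesis by linarith
  qed
  have step: "\<bar>p (g (Suc k))\<bar> \<le> 1/2 * \<bar>p (g k)\<bar> + 2 * ob k" if "g (Suc k) \<le> e" for k
  proof -
    have "exp (- c * (g (Suc k) - g k)) = exp (- (c * h))" by (simp add: gS)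
    also have "\<dots> \<le> exp (- 1)" using h by simp
    also have "\<dots> \<le> 1/2"
    proof -
      have "1/2 * exp 1 \<ge> (1::real)" using exp_ge_add_one_self[of "1::real"] by simp
      then show ?thesis by (simp add: exp_minus field_simps)
    qed
    finally have "\<bar>exp (- c * (g (Suc k) - g k)) * p (g k)\<bar> \<le> 1/2 * \<bar>p (g k)\<bar>"
      unfolding abs_mult by (intro mult_right_mono) auto
    moreover have "g k \<le> g (Suc k)" using h by (simp add: gS)
    ultimately show ?thesis using resp[of k "g (Suc k)"] that by linarith
  qed
  have grid: "\<bar>p (g k)\<bar> \<le> \<bar>p s\<bar> + 4 * m" if "g k \<le> e" for k
    using that
  proof (induction k)
    case 0
    then show ?case using o0[of 0] om[of 0] by (simp add: g0)
  next
    case (Suc k)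
    have ge: "g k \<le> e" using Suc.prems h by (simp add: gS)
    from Suc.IH[OF ge] step[OF Suc.prems] om[of k] o0[OF ge] show ?case by linarith
  qed
  have loc: "\<exists>k. g k \<le> t \<and> t \<le> g (Suc k)" if "s \<le> t" for t
  proof -
    define x where "x = (t - s) / h"
    have x: "t = s + x * h" "0 \<le> x" using h that by (auto simp: x_def)
    define k where "k = nat \<lfloor>x\<rfloor>"
    have "real k \<le> x" "x \<le> real (Suc k)" using x(2) by (auto simp: k_def) linarith
    then have "real k * h \<le> x * h" "x * h \<le> real (Suc k) * h" using h by (intro mult_right_mono; simp)+
    then show ?thesis using x(1) by (intro exI[of _ k]) (auto simp: g_def)
  qed
  {
    assume t: "t \<in> {s..e}"
    obtain k where k: "g k \<le> t" "t \<le> g (Suc k)" using loc[of t] t by auto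
    from inside[OF k] grid[of k] k t om[of k] show "\<bar>p t\<bar> \<le> \<bar>p s\<bar> + 6 * m" by auto
  }
  {
    assume Q: "\<And>N. (\<Sum>k<N. (ob k)\<^sup>2) \<le> Q" and se: "s \<le> e"
    have ii: "(\<lambda>t. (p t)\<^sup>2) integrable_on {x..y}" if "s \<le> x" "y \<le> e" for x y
      by (intro integrable_continuous_interval continuous_intros continuous_on_subset[OF pc]) (use that in auto)
    have piece: "integral {g k..y} (\<lambda>t. (p t)\<^sup>2) \<le> h * (2 * (p (g k))\<^sup>2 + 8 * (ob k)\<^sup>2)"
      if "g k \<le> y" "y \<le> g (Suc k)" "y \<le> e" for k y
    proof -
      define B where "B = 2 * (p (g k))\<^sup>2 + 8 * (ob k)\<^sup>2"
      have B0: "B \<ge> 0" by (simp add: B_def)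
      have "integral {g k..y} (\<lambda>t. (p t)\<^sup>2) \<le> integral {g k..y} (\<lambda>t. B)"
      proof (rule integral_le)
        fix t assume "t \<in> {g k..y}"
        then have "\<bar>p t\<bar> \<le> \<bar>p (g k)\<bar> + 2 * ob k" using inside[of k t] that by auto
        then have "\<bar>p t\<bar>\<^sup>2 \<le> (\<bar>p (g k)\<bar> + 2 * ob k)\<^sup>2" by (intro power_mono) auto
        also have "\<dots> \<le> B"
          using sum_squares_bound[of "\<bar>p (g k)\<bar>" "2 * ob k"] by (simp add: B_def power2_eq_square algebra_simps)
        finally show "(p t)\<^sup>2 \<le> B" by simp
      qed (use ii sg that in auto)
      also have "\<dots> = (y - g k) * B" using that by simp
      also have "\<dots> \<le> h * B" using that B0 by (intro mult_right_mono) (auto simp: gS)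
      finally show ?thesis by (simp add: B_def)
    qed
    \<comment> \<open>The term \<open>4 * h * (p (g k))\<^sup>2\<close> is a potential. One half of
      it pays for the integral over the next window; the other half covers the next potential
      because (x/2 + 2 o)^2 \<le> x^2/2 + 8 o^2. The noise costs 8 h o^2 in the window and 32 h o^2
      in the potential, together 40 h o^2.\<close>
    have main: "integral {s..g k} (\<lambda>t. (p t)\<^sup>2) + 4 * h * (p (g k))\<^sup>2 \<le> h * (4 * (p s)\<^sup>2 + 40 * (\<Sum>i<k. (ob i)\<^sup>2))"
      if "g k \<le> e" for k
      using that
    proof (induction k)
      case 0
      then show ?case by (simp add: g0)
    next
      case (Suc k)
      have ge: "g k \<le> e" using Suc.prems h by (simp add: gS)
      have gg: "g k \<le> g (Suc k)" using h by (simp add: gS)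
      have "integral {s..g (Suc k)} (\<lambda>t. (p t)\<^sup>2) = integral {s..g k} (\<lambda>t. (p t)\<^sup>2) + integral {g k..g (Suc k)} (\<lambda>t. (p t)\<^sup>2)"
        by (rule Henstock_Kurzweil_Integration.integral_combine[symmetric]) (use ii[of s "g (Suc k)"] Suc.prems sg gg in auto)
      moreover note piece[OF gg order_refl Suc.prems]
      moreover have "(p (g (Suc k)))\<^sup>2 \<le> 1/2 * (p (g k))\<^sup>2 + 8 * (ob k)\<^sup>2"
      proof -
        have "\<bar>p (g (Suc k))\<bar>\<^sup>2 \<le> (1/2 * \<bar>p (g k)\<bar> + 2 * ob k)\<^sup>2" by (intro power_mono step Suc.prems) auto
        also have "\<dots> \<le> 1/2 * \<bar>p (g k)\<bar>\<^sup>2 + 8 * (ob k)\<^sup>2"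
          using sum_squares_bound[of "1/2 * \<bar>p (g k)\<bar>" "2 * ob k"] by (simp add: power2_eq_square algebra_simps)
        finally show ?thesis by simp
      qed
      then have "4 * h * (p (g (Suc k)))\<^sup>2 \<le> 4 * h * (1/2 * (p (g k))\<^sup>2 + 8 * (ob k)\<^sup>2)" using h by (intro mult_left_mono) auto
      ultimately show ?case using Suc.IH[OF ge] by (simp add: algebra_simps)
    qed
    obtain k where k: "g k \<le> e" "e \<le> g (Suc k)" using loc[of e] se by auto
    have "integral {s..e} (\<lambda>t. (p t)\<^sup>2) = integral {s..g k} (\<lambda>t. (p t)\<^sup>2) + integral {g k..e} (\<lambda>t. (p t)\<^sup>2)"
      by (rule Henstock_Kurzweil_Integration.integral_combine[symmetric]) (use ii[of s e] k sg in auto)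
    also have "\<dots> \<le> h * (4 * (p s)\<^sup>2 + 40 * (\<Sum>i<k. (ob i)\<^sup>2)) + h * (8 * (ob k)\<^sup>2)"
    proof -
      have "0 \<le> h * (p (g k))\<^sup>2" using h by simp
      then show ?thesis using main[OF k(1)] piece[OF k(1,2) order_refl] by (simp add: algebra_simps)
    qed
    also have "\<dots> \<le> h * (4 * (p s)\<^sup>2 + 40 * (\<Sum>i<Suc k. (ob i)\<^sup>2))"
      using h by (simp add: algebra_simps)
    also have "\<dots> \<le> h * (4 * (p s)\<^sup>2 + 40 * Q)" using h Q[of "Suc k"] by (intro mult_left_mono) auto
    finally show "integral {s..e} (\<lambda>t. (p t)\<^sup>2) \<le> h * (4 * (p s)\<^sup>2 + 40 * Q)" .
  }
qed

text \<open>The windows start at an arbitrary time \<open>s\<close> because the stages of the strategy begin at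
  path-dependent times; \<open>Q\<close> controls the cost of a stage and \<open>m\<close> its deviation.\<close>

definition noise :: "(real \<Rightarrow> real) \<Rightarrow> real \<Rightarrow> real \<Rightarrow> real \<Rightarrow> real \<Rightarrow> bool" where
  "noise w T h m Q \<longleftrightarrow> (\<forall>s\<in>{0..T}. \<exists>ob :: nat \<Rightarrow> real.
     (\<forall>k t. s + real k * h \<le> t \<longrightarrow> t \<le> s + real (Suc k) * h \<longrightarrow> t \<le> T \<longrightarrow> \<bar>w t - w (s + real k * h)\<bar> \<le> ob k) \<and>
     (\<forall>k. ob k \<le> m) \<and> (\<forall>N. (\<Sum>k<N. (ob k)\<^sup>2) \<le> Q))"

lemma noiseD:
  assumes "noise w T h m Q" "0 \<le> s" "s \<le> t" "t \<le> s + h" "t \<le> T"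
  shows "\<bar>w t - w s\<bar> \<le> m"
proof -
  obtain ob :: "nat \<Rightarrow> real" where "\<And>k t. s + real k * h \<le> t \<Longrightarrow> t \<le> s + real (Suc k) * h \<Longrightarrow> t \<le> T \<Longrightarrow> \<bar>w t - w (s + real k * h)\<bar> \<le> ob k"
    and "\<And>k. ob k \<le> m"
    using bspec[OF assms(1)[unfolded noise_def], of s] assms by auto
  from this(1)[of 0 t] this(2)[of 0] show ?thesis using assms by simp
qed

lemma noise_nonneg:
  assumes "noise w T h m Q" "0 < h" "0 \<le> T"
  shows "0 \<le> m"
  using noiseD[OF assms(1), of 0 0] assms by simp

lemma noise_sup:
  assumes n: "noise w T h m Q" and h: "0 < h" and T: "0 \<le> T" and t: "0 \<le> t" "t \<le> T"
  shows "\<bar>w t - w 0\<bar> \<le> (T / h + 1) * m"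
proof -
  have m: "0 \<le> m" by (rule noise_nonneg[OF n h T])
  have grid: "\<bar>w (real k * h) - w 0\<bar> \<le> real k * m" if "real k * h \<le> T" for k
    using that
  proof (induction k)
    case (Suc k)
    have le: "real k * h \<le> T" using Suc.prems h by (simp add: algebra_simps)
    have "\<bar>w (real (Suc k) * h) - w (real k * h)\<bar> \<le> m"
      by (rule noiseD[OF n]) (use Suc.prems h in \<open>auto simp: algebra_simps\<close>)
    with Suc.IH[OF le] show ?case by (simp add: algebra_simps)
  qed simp
  define k where "k = nat \<lfloor>t / h\<rfloor>"
  have k: "real k \<le> t / h" "t / h \<le> real k + 1" using t h by (auto simp: k_def)
  then have kt: "real k * h \<le> t" "t \<le> real k * h + h" using h by (auto simp: field_simps)
  have "\<bar>w t - w (real k * h)\<bar> \<le> m" by (rule noiseD[OF n]) (use kt t h in auto)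
  with grid[of k] kt t have "\<bar>w t - w 0\<bar> \<le> (real k + 1) * m" by (auto simp: algebra_simps)
  also have "\<dots> \<le> (T / h + 1) * m"
  proof (intro mult_right_mono add_right_mono m)
    have "t / h \<le> T / h" using t h by (intro divide_right_mono) auto
    then show "real k \<le> T / h" using k(1) by linarith
  qed
  finally show ?thesis .
qed

section \<open>Switching times of a single path\<close>

locale continuous_path =
  fixes T q0 :: real and p :: "real \<Rightarrow> real"
  assumes T: "0 < T" and q0: "1 \<le> q0" and p_cont: "continuous_on {0..T} p" and p0: "p 0 = q0"
begin

lemma p_cont_sub: "0 \<le> s \<Longrightarrow> e \<le> T \<Longrightarrow> continuous_on {s..e} p"
  by (rule continuous_on_subset[OF p_cont]) auto

lemma doubling_time_facts:
  assumes s: "0 \<le> s" "s < T" and ps: "p s \<noteq> 0"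
  shows "s < doubling_time T p s" "doubling_time T p s \<le> T"
    and "t \<in> {s..doubling_time T p s} \<Longrightarrow> \<bar>p t\<bar> \<le> 2 * \<bar>p s\<bar>"
    and "doubling_time T p s < T \<Longrightarrow> \<bar>p (doubling_time T p s)\<bar> = 2 * \<bar>p s\<bar>"
proof -
  define d where "d = doubling_time T p s"
  have c: "continuous_on {s..T} (\<lambda>t. \<bar>p t\<bar>)" using s by (intro continuous_intros p_cont_sub) auto
  have att: "\<bar>p d\<bar> \<in> {2 * \<bar>p s\<bar>..} \<and> s < d" if "d < T"
    using first_time_attained[OF c, of "{2 * \<bar>p s\<bar>..}" "\<lambda>t. \<bar>p t\<bar> \<ge> 2 * \<bar>p s\<bar>"] ps that
    by (auto simp: d_def doubling_time_def)
  have dT: "d \<le> T" unfolding d_def doubling_time_def by (rule first_time_bounds) (use s in auto)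
  show sd: "s < doubling_time T p s" using att dT s by (cases "d < T") (auto simp: d_def)
  show "doubling_time T p s \<le> T" using dT by (simp add: d_def)
  have le: "\<bar>p t\<bar> \<le> 2 * \<bar>p s\<bar>" if t: "t \<in> {s..d}" for t
  proof (rule left_limit_le[of s d "\<lambda>t. \<bar>p t\<bar>", OF _ _ _ t])
    show "continuous_on {s..d} (\<lambda>t. \<bar>p t\<bar>)" by (rule continuous_on_subset[OF c]) (use dT in auto)
    show "s < d" using sd by (simp add: d_def)
    show "\<bar>p t\<bar> \<le> 2 * \<bar>p s\<bar>" if "s < t" "t < d" for t
      using not_before_first_time[of s t T "\<lambda>t. \<bar>p t\<bar> \<ge> 2 * \<bar>p s\<bar>"] that by (auto simp: d_def doubling_time_def)
  qed
  then show "t \<in> {s..doubling_time T p s} \<Longrightarrow> \<bar>p t\<bar> \<le> 2 * \<bar>p s\<bar>" by (simp add: d_def)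
  show "doubling_time T p s < T \<Longrightarrow> \<bar>p (doubling_time T p s)\<bar> = 2 * \<bar>p s\<bar>"
    using le[of d] att sd by (force simp: d_def)
qed

lemma doubling_time_end: "T \<le> s \<Longrightarrow> doubling_time T p s = T"
  by (simp add: doubling_time_def first_time_empty)

lemma sub_i_end_facts:
  assumes s: "0 \<le> s" "s < T" and ps: "p s \<noteq> 0" and \<tau>: "0 < \<tau>" "0 < a"
  defines "r \<equiv> sub_i_end T a \<tau> p s"
  shows "s < r" "r \<le> min T (s + \<tau>)"
    and "t \<in> {s..r} \<Longrightarrow> \<bar>p t - p s\<bar> \<le> \<bar>p s\<bar> * sqrt (a * \<tau>)"
    and "r < min T (s + \<tau>) \<Longrightarrow> \<bar>p r - p s\<bar> = \<bar>p s\<bar> * sqrt (a * \<tau>)"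
proof -
  define D where "D = \<bar>p s\<bar> * sqrt (a * \<tau>)"
  have D: "0 < D" using ps \<tau> by (simp add: D_def)
  have c: "continuous_on {s..min T (s + \<tau>)} (\<lambda>t. \<bar>p t - p s\<bar>)"
    using s by (intro continuous_intros p_cont_sub) auto
  have att: "\<bar>p r - p s\<bar> \<in> {D..} \<and> s < r" if "r < min T (s + \<tau>)"
    using first_time_attained[OF c, of "{D..}" "\<lambda>t. \<bar>p t - p s\<bar> \<ge> D"] D that
    by (auto simp: r_def sub_i_end_def D_def)
  show rT: "r \<le> min T (s + \<tau>)" unfolding r_def sub_i_end_def by (rule first_time_bounds) (use s \<tau> in auto)
  show sr: "s < r" using att rT s \<tau> by (cases "r < min T (s + \<tau>)") auto
  have le: "\<bar>p t - p s\<bar> \<le> D" if t: "t \<in> {s..r}" for t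
  proof (rule left_limit_le[of s r "\<lambda>t. \<bar>p t - p s\<bar>", OF _ sr _ t])
    show "continuous_on {s..r} (\<lambda>t. \<bar>p t - p s\<bar>)" by (rule continuous_on_subset[OF c]) (use rT in auto)
    show "\<bar>p t - p s\<bar> \<le> D" if "s < t" "t < r" for t
      using not_before_first_time[of s t "min T (s + \<tau>)" "\<lambda>t. \<bar>p t - p s\<bar> \<ge> D"] that by (auto simp: r_def sub_i_end_def D_def)
  qed
  show "t \<in> {s..r} \<Longrightarrow> \<bar>p t - p s\<bar> \<le> \<bar>p s\<bar> * sqrt (a * \<tau>)" using le by (simp add: D_def)
  show "r < min T (s + \<tau>) \<Longrightarrow> \<bar>p r - p s\<bar> = \<bar>p s\<bar> * sqrt (a * \<tau>)"
    using le[of r] att sr by (force simp: D_def)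
qed

text \<open>The rule mentions only the two edges of the band. By the intermediate value theorem a
  path that starts strictly inside cannot be outside without having met an edge before.
  \<open>level_exit_facts\<close> uses the same argument for one level.\<close>

lemma band_exit_facts:
  fixes s :: real
  assumes s: "0 < s" "s < T"
  defines "r \<equiv> first_time 0 s (\<lambda>t. p t = 2 * q0 \<or> p t = q0 / 2)"
  shows "0 < r" "r \<le> s" "t \<in> {0..r} \<Longrightarrow> q0 / 2 \<le> p t \<and> p t \<le> 2 * q0"
    and "r < s \<Longrightarrow> p r = 2 * q0 \<or> p r = q0 / 2"
proof -
  have c: "continuous_on {0..s} p" using s by (intro p_cont_sub) auto
  have att: "p r \<in> {2 * q0, q0 / 2} \<and> 0 < r" if "r < s"
    using first_time_attained[OF c, of "{2 * q0, q0 / 2}" "\<lambda>t. p t = 2 * q0 \<or> p t = q0 / 2"] that p0 q0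
    by (auto simp: r_def)
  show rs: "r \<le> s" unfolding r_def by (rule first_time_bounds) (use s in auto)
  show r0: "0 < r" using att rs s by (cases "r < s") auto
  show "r < s \<Longrightarrow> p r = 2 * q0 \<or> p r = q0 / 2" using att by auto
  have ne: "p t \<noteq> 2 * q0 \<and> p t \<noteq> q0 / 2" if "0 < t" "t < r" for t
    using not_before_first_time[of 0 t s "\<lambda>t. p t = 2 * q0 \<or> p t = q0 / 2"] that by (auto simp: r_def)
  have in1: "q0 / 2 \<le> p t \<and> p t \<le> 2 * q0" if t: "0 < t" "t < r" for t
  proof (rule ccontr)
    assume "\<not> (q0 / 2 \<le> p t \<and> p t \<le> 2 * q0)"
    then consider "p t < q0 / 2" | "2 * q0 < p t" by linarith
    then have "\<exists>x\<ge>0. x \<le> t \<and> (p x = 2 * q0 \<or> p x = q0 / 2)"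
    proof cases
      case 1
      then show ?thesis using IVT2'[of p t "q0 / 2" 0] p0 q0 t p_cont_sub[of 0 t] s rs by auto
    next
      case 2
      then show ?thesis using IVT'[of p 0 "2 * q0" t] p0 q0 t p_cont_sub[of 0 t] s rs by auto
    qed
    then obtain x where x: "0 \<le> x" "x \<le> t" "p x = 2 * q0 \<or> p x = q0 / 2" by auto
    then have "x \<noteq> 0" using p0 q0 by auto
    then show False using ne[of x] x t by auto
  qed
  have c': "continuous_on {0..r} p" by (rule continuous_on_subset[OF c]) (use rs in auto)
  assume t: "t \<in> {0..r}"
  have "p t \<le> 2 * q0" by (rule left_limit_le[OF c' r0 _ t]) (use in1 in auto)
  moreover have "- p t \<le> - (q0 / 2)"
    by (rule left_limit_le[of 0 r "\<lambda>t. - p t", OF _ r0 _ t]) (use in1 in \<open>auto intro!: continuous_intros c'\<close>)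
  ultimately show "q0 / 2 \<le> p t \<and> p t \<le> 2 * q0" by auto
qed

lemma level_exit_facts:
  assumes s: "0 \<le> s" "s < T" and L: "\<bar>p s\<bar> < L"
  defines "r \<equiv> first_time s T (\<lambda>t. \<bar>p t\<bar> = L)"
  shows "s < r" "r \<le> T" "t \<in> {s..r} \<Longrightarrow> \<bar>p t\<bar> \<le> L" "r < T \<Longrightarrow> \<bar>p r\<bar> = L"
proof -
  have c: "continuous_on {s..T} (\<lambda>t. \<bar>p t\<bar>)" using s by (intro continuous_intros p_cont_sub) auto
  have att: "\<bar>p r\<bar> \<in> {L} \<and> s < r" if "r < T"
    using first_time_attained[OF c, of "{L}" "\<lambda>t. \<bar>p t\<bar> = L"] that L by (auto simp: r_def)
  show rT: "r \<le> T" unfolding r_def by (rule first_time_bounds) (use s in auto)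
  show sr: "s < r" using att rT s by (cases "r < T") auto
  show "r < T \<Longrightarrow> \<bar>p r\<bar> = L" using att by auto
  have ne: "\<bar>p t\<bar> \<noteq> L" if "s < t" "t < r" for t
    using not_before_first_time[of s t T "\<lambda>t. \<bar>p t\<bar> = L"] that by (auto simp: r_def)
  have in1: "\<bar>p t\<bar> \<le> L" if t: "s < t" "t < r" for t
  proof (rule ccontr)
    assume "\<not> \<bar>p t\<bar> \<le> L"
    then obtain x where x: "s \<le> x" "x \<le> t" "\<bar>p x\<bar> = L"
      using IVT'[of "\<lambda>t. \<bar>p t\<bar>" s L t] continuous_on_subset[OF c, of "{s..t}"] L t rT by auto
    then have "x \<noteq> s" using L by auto
    then show False using ne[of x] x t by auto
  qed
  assume t: "t \<in> {s..r}"
  show "\<bar>p t\<bar> \<le> L"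
    by (rule left_limit_le[OF continuous_on_subset[OF c] sr _ t]) (use in1 rT in auto)
qed

end

section \<open>Controlled paths and their cost\<close>

text \<open>For a negative starting position the trajectory, the control and the noise are all
  reflected, so \<open>w\<close> is a path of W or of -W.\<close>

locale controlled_path = continuous_path T q0 p
  for a b T q0 :: real and p v w :: "real \<Rightarrow> real" +
  assumes drift_int: "set_integrable lborel {0..T} (\<lambda>s. a * p s + b * v s)"
    and motion: "\<And>t. 0 \<le> t \<Longrightarrow> t \<le> T \<Longrightarrow> p t = q0 + w t + (LBINT s:{0..t}. a * p s + b * v s)"
    and cost_measurable: "(\<lambda>t. ennreal ((p t)\<^sup>2 + (v t)\<^sup>2) * indicator {0..T} t) \<in> borel_measurable lborel"
begin

definition cost :: "real \<Rightarrow> real \<Rightarrow> ennreal" where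
  "cost s e = (\<integral>\<^sup>+t\<in>{s..e}. ennreal ((p t)\<^sup>2 + (v t)\<^sup>2) \<partial>lborel)"

lemma motion_integral:
  assumes "0 \<le> t" "t \<le> T"
  shows "(\<lambda>s. a * p s + b * v s) integrable_on {0..t}" "p t = q0 + w t + integral {0..t} (\<lambda>s. a * p s + b * v s)"
proof -
  have "set_integrable lborel {0..t} (\<lambda>s. a * p s + b * v s)"
    by (rule set_integrable_subset[OF drift_int]) (use assms in auto)
  from set_borel_integral_eq_integral[OF this] motion[OF assms]
  show "(\<lambda>s. a * p s + b * v s) integrable_on {0..t}" "p t = q0 + w t + integral {0..t} (\<lambda>s. a * p s + b * v s)"
    by auto
qed

lemma increment:
  assumes "0 \<le> s" "s \<le> t" "t \<le> T"
  shows "p t - p s = w t - w s + integral {s..t} (\<lambda>s. a * p s + b * v s)"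
proof -
  have "integral {0..s} (\<lambda>s. a * p s + b * v s) + integral {s..t} (\<lambda>s. a * p s + b * v s) = integral {0..t} (\<lambda>s. a * p s + b * v s)"
    by (rule Henstock_Kurzweil_Integration.integral_combine) (use motion_integral(1)[of t] assms in auto)
  then show ?thesis using motion_integral(2)[of s] motion_integral(2)[of t] assms by simp
qed

lemma increment_feedback:
  assumes "0 \<le> s" "s \<le> t" "t \<le> T" and v: "\<And>r. s \<le> r \<Longrightarrow> r < t \<Longrightarrow> v r = g * p r + \<eta>"
  shows "p t - p s = w t - w s + integral {s..t} (\<lambda>r. (a + b * g) * p r + b * \<eta>)"
proof -
  have "integral {s..t} (\<lambda>s. a * p s + b * v s) = integral {s..t} (\<lambda>r. (a + b * g) * p r + b * \<eta>)"
    by (rule integral_spike[of "{t}"]) (auto simp: v algebra_simps)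
  then show ?thesis using increment[OF assms(1-3)] by simp
qed

text \<open>The rules prescribe \<open>v\<close> on half-open intervals only; the right end point is
  a null set.\<close>

lemma cost_pointwise:
  assumes "s \<le> e" "0 \<le> B" and B: "\<And>t. s \<le> t \<Longrightarrow> t < e \<Longrightarrow> (p t)\<^sup>2 + (v t)\<^sup>2 \<le> B"
  shows "cost s e \<le> ennreal (B * (e - s))"
proof -
  have "cost s e \<le> (\<integral>\<^sup>+t. ennreal B * indicator {s..e} t \<partial>lborel)"
    unfolding cost_def
  proof (rule nn_integral_mono_AE)
    show "AE t in lborel. ennreal ((p t)\<^sup>2 + (v t)\<^sup>2) * indicator {s..e} t \<le> ennreal B * indicator {s..e} t"
      using AE_lborel_singleton[of e]
    proof eventually_elim
      case (elim t)
      then show ?case using B[of t] by (auto simp: indicator_def simp del: ennreal_plus intro: ennreal_leI)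
    qed
  qed
  also have "\<dots> = ennreal B * ennreal (e - s)" using assms by (simp add: nn_integral_cmult)
  finally show ?thesis using assms by (simp add: ennreal_mult)
qed

lemma cost_split:
  assumes "0 \<le> s" "s \<le> r" "r \<le> e" "e \<le> T"
  shows "cost s e \<le> cost s r + cost r e"
proof -
  have m: "(\<lambda>t. ennreal ((p t)\<^sup>2 + (v t)\<^sup>2) * indicator {x..y} t) \<in> borel_measurable lborel"
    if "0 \<le> x" "y \<le> T" for x y
  proof -
    have "(\<lambda>t. (ennreal ((p t)\<^sup>2 + (v t)\<^sup>2) * indicator {0..T} t) * indicator {x..y} t) \<in> borel_measurable lborel"
      by (intro borel_measurable_times_ennreal cost_measurable) simp
    moreover have "(\<lambda>t. (ennreal ((p t)\<^sup>2 + (v t)\<^sup>2) * indicator {0..T} t) * indicator {x..y} t) =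
      (\<lambda>t. ennreal ((p t)\<^sup>2 + (v t)\<^sup>2) * indicator {x..y} t)"
      using that by (auto simp: indicator_def fun_eq_iff)
    ultimately show ?thesis by simp
  qed
  have "cost s e \<le> (\<integral>\<^sup>+t. ennreal ((p t)\<^sup>2 + (v t)\<^sup>2) * indicator {s..r} t + ennreal ((p t)\<^sup>2 + (v t)\<^sup>2) * indicator {r..e} t \<partial>lborel)"
    unfolding cost_def using assms by (intro nn_integral_mono) (auto simp: indicator_def)
  also have "\<dots> = cost s r + cost r e"
    unfolding cost_def using assms by (intro nn_integral_add m) auto
  finally show ?thesis .
qed

lemma cost_split':
  assumes "0 \<le> s" "s \<le> r" "r \<le> e" "e \<le> T" "cost s r \<le> ennreal B" "cost r e \<le> ennreal C" "0 \<le> B" "0 \<le> C" "B + C \<le> D"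
  shows "cost s e \<le> ennreal D"
proof -
  have "cost s e \<le> cost s r + cost r e" by (rule cost_split) fact+
  also have "\<dots> \<le> ennreal B + ennreal C" using assms by (intro add_mono) auto
  also have "\<dots> = ennreal (B + C)" using assms by simp
  also have "\<dots> \<le> ennreal D" using assms by (intro ennreal_leI)
  finally show ?thesis .
qed

lemma cost_feedback:
  assumes "0 \<le> s" "s \<le> e" "e \<le> T" and v: "\<And>r. s \<le> r \<Longrightarrow> r < e \<Longrightarrow> v r = g * p r"
  shows "cost s e \<le> ennreal ((1 + g\<^sup>2) * integral {s..e} (\<lambda>t. (p t)\<^sup>2))"
proof -
  have c: "continuous_on {s..e} (\<lambda>t. (1 + g\<^sup>2) * (p t)\<^sup>2)"
    by (intro continuous_intros p_cont_sub) fact+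
  have si: "set_integrable lborel {s..e} (\<lambda>t. (1 + g\<^sup>2) * (p t)\<^sup>2)"
    unfolding set_integrable_def using borel_integrable_atLeastAtMost'[OF c] by (simp add: set_integrable_def)
  have "cost s e \<le> (\<integral>\<^sup>+t. ennreal (indicator {s..e} t *\<^sub>R ((1 + g\<^sup>2) * (p t)\<^sup>2)) \<partial>lborel)"
    unfolding cost_def
  proof (rule nn_integral_mono_AE)
    show "AE t in lborel. ennreal ((p t)\<^sup>2 + (v t)\<^sup>2) * indicator {s..e} t \<le> ennreal (indicator {s..e} t *\<^sub>R ((1 + g\<^sup>2) * (p t)\<^sup>2))"
      using AE_lborel_singleton[of e]
    proof eventually_elim
      case (elim t)
      then show ?case by (auto simp: indicator_def v power_mult_distrib algebra_simps)
    qed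
  qed
  also have "\<dots> = ennreal (LBINT t:{s..e}. (1 + g\<^sup>2) * (p t)\<^sup>2)"
    unfolding set_lebesgue_integral_def using si
    by (intro nn_integral_eq_integral) (auto simp: set_integrable_def)
  also have "(LBINT t:{s..e}. (1 + g\<^sup>2) * (p t)\<^sup>2) = integral {s..e} (\<lambda>t. (1 + g\<^sup>2) * (p t)\<^sup>2)"
    by (rule set_borel_integral_eq_integral(2)[OF si])
  finally show ?thesis by simp
qed

end

section \<open>Feedback stages under bounded noise\<close>

locale noisy_path = controlled_path +
  fixes h m Q :: real
  assumes h: "0 < h" and noise: "noise w T h m Q"
begin

lemma m0: "0 \<le> m" using noise_nonneg[OF noise h] T by simp

lemma Q0: "0 \<le> Q"
proof -
  obtain ob :: "nat \<Rightarrow> real" where "\<And>N. (\<Sum>k<N. (ob k)\<^sup>2) \<le> Q"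
    using bspec[OF noise[unfolded noise_def], of 0] T by auto
  from this[of 0] show ?thesis by simp
qed

lemma stable:
  assumes s: "0 \<le> s" "s \<le> e" "e \<le> T" and v: "\<And>r. s \<le> r \<Longrightarrow> r < e \<Longrightarrow> v r = g * p r"
    and c: "1 \<le> - (a + b * g) * h"
  shows "t \<in> {s..e} \<Longrightarrow> \<bar>p t\<bar> \<le> \<bar>p s\<bar> + 6 * m"
    and "cost s e \<le> ennreal ((1 + g\<^sup>2) * (h * (4 * (p s)\<^sup>2 + 40 * Q)))"
proof -
  have sT: "s \<in> {0..T}" using s by simp
  then obtain ob :: "nat \<Rightarrow> real" where
    ob: "\<And>k t. s + real k * h \<le> t \<Longrightarrow> t \<le> s + real (Suc k) * h \<Longrightarrow> t \<le> T \<Longrightarrow> \<bar>w t - w (s + real k * h)\<bar> \<le> ob k"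
    "\<And>k. ob k \<le> m" "\<And>N. (\<Sum>k<N. (ob k)\<^sup>2) \<le> Q"
    using bspec[OF noise[unfolded noise_def] sT] by blast
  have eq: "p t - p r = w t - w r + integral {r..t} (\<lambda>r. - (- (a + b * g)) * p r)" if "s \<le> r" "r \<le> t" "t \<le> e" for r t
    using increment_feedback[of r t g 0] v s that by simp
  note st = stable_stage[OF p_cont_sub[OF s(1,3)] h c eq ob(1) ob(2), simplified]
  show "t \<in> {s..e} \<Longrightarrow> \<bar>p t\<bar> \<le> \<bar>p s\<bar> + 6 * m"
    by (rule st(1)) (use s in auto)
  have "integral {s..e} (\<lambda>t. (p t)\<^sup>2) \<le> h * (4 * (p s)\<^sup>2 + 40 * Q)"
    by (rule st(2)[OF _ ob(3) s(2)]) (use s in auto)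
  then have "(1 + g\<^sup>2) * integral {s..e} (\<lambda>t. (p t)\<^sup>2) \<le> (1 + g\<^sup>2) * (h * (4 * (p s)\<^sup>2 + 40 * Q))"
    by (intro mult_left_mono) auto
  then show "cost s e \<le> ennreal ((1 + g\<^sup>2) * (h * (4 * (p s)\<^sup>2 + 40 * Q)))"
    using cost_feedback[OF s v] by (meson ennreal_leI order_trans)
qed

lemma stable_short:
  assumes s: "0 \<le> s" "e \<le> T" "e \<le> s + h" and v: "\<And>r. s \<le> r \<Longrightarrow> r < e \<Longrightarrow> v r = g * p r"
    and c: "a + b * g \<le> 0" and t: "t \<in> {s..e}"
  shows "\<bar>p t - exp ((a + b * g) * (t - s)) * p s\<bar> \<le> 2 * m"
proof -
  have "\<bar>p t - exp (- (- (a + b * g)) * (t - s)) * p s\<bar> \<le> 2 * m"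
  proof (rule stable_response[where w = w])
    show "continuous_on {s..e} p" by (rule p_cont_sub[OF s(1,2)])
    show "p r - p s = w r - w s + integral {s..r} (\<lambda>r. - (- (a + b * g)) * p r)" if "r \<in> {s..e}" for r
      using increment_feedback[of s r g 0] v s that by simp
    show "\<bar>w r - w s\<bar> \<le> m" if "r \<in> {s..e}" for r
      by (rule noiseD[OF noise]) (use that s in auto)
  qed (use c t in auto)
  then show ?thesis by (simp only: minus_minus)
qed

lemma unstable_short:
  assumes s: "0 \<le> s" "e \<le> T" "e \<le> s + h" and v: "\<And>r. s \<le> r \<Longrightarrow> r < e \<Longrightarrow> v r = g * p r"
    and c: "0 \<le> a + b * g" and t: "t \<in> {s..e}"
  shows "\<bar>p t - exp ((a + b * g) * (t - s)) * p s\<bar> \<le> exp ((a + b * g) * (t - s)) * m"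
proof (rule unstable_response[where w = w])
  show "continuous_on {s..e} p" by (rule p_cont_sub[OF s(1,2)])
  show "p r - p s = w r - w s + integral {s..r} (\<lambda>r. (a + b * g) * p r)" if "r \<in> {s..e}" for r
    using increment_feedback[of s r g 0] v s that by simp
  show "\<bar>w r - w s\<bar> \<le> m" if "r \<in> {s..e}" for r
    by (rule noiseD[OF noise]) (use that s in auto)
qed (use c t in auto)

lemma exp2: "5 \<le> exp (2::real)"
  using exp_lower_Taylor_quadratic[of "2::real"] by simp

text \<open>A feedback of the wrong sign is recognized within one window. After time h the solution
  would have grown by a factor of at least exp 2 \<ge> 5 up to noise, so that 5 (|p s| - m) \<le> 2
  |p s|, which contradicts 2 m < |p s|.\<close>

lemma unstable_doubles:
  assumes s: "0 \<le> s" "s \<le> e" "e \<le> T" and v: "\<And>r. s \<le> r \<Longrightarrow> r < e \<Longrightarrow> v r = g * p r"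
    and c: "2 \<le> (a + b * g) * h" and small: "2 * m < \<bar>p s\<bar>"
    and le: "\<And>t. t \<in> {s..e} \<Longrightarrow> \<bar>p t\<bar> \<le> 2 * \<bar>p s\<bar>"
  shows "e \<le> s + h"
proof (rule ccontr)
  assume "\<not> e \<le> s + h"
  then have sh: "s + h \<in> {s..e}" "s + h \<le> T" using h s by auto
  define E where "E = exp ((a + b * g) * h)"
  have "exp 2 \<le> E" using c by (simp add: E_def)
  then have E5: "5 \<le> E" using exp2 by simp
  have c0: "0 \<le> a + b * g" using c h by (metis mult_neg_pos not_le order_trans zero_le_numeral less_imp_le)
  have "\<bar>p (s + h) - exp ((a + b * g) * (s + h - s)) * p s\<bar> \<le> exp ((a + b * g) * (s + h - s)) * m"
    by (rule unstable_short[where e = "s + h"]) (use s sh v c0 h in auto)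
  then have "\<bar>p (s + h) - E * p s\<bar> \<le> E * m" by (simp add: E_def)
  then have "\<bar>E * p s\<bar> \<le> \<bar>p (s + h)\<bar> + E * m" by linarith
  also have "\<bar>E * p s\<bar> = E * \<bar>p s\<bar>" using E5 by (simp add: abs_mult)
  finally have "E * (\<bar>p s\<bar> - m) \<le> 2 * \<bar>p s\<bar>" using le[OF sh(1)] by (simp add: algebra_simps)
  moreover have "5 * (\<bar>p s\<bar> - m) \<le> E * (\<bar>p s\<bar> - m)" using E5 small m0 by (intro mult_right_mono) auto
  ultimately have "5 * (\<bar>p s\<bar> - m) \<le> 2 * \<bar>p s\<bar>" by linarith
  moreover have False if "5 * (x - m) \<le> 2 * x" "2 * m < x" for x using that m0 by (simp add: algebra_simps)
  ultimately show False using small by blast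
qed

end


section \<open>Large growth parameter\<close>

text \<open>\<open>R\<close> is the rate of the feedback stages. The epoch \<open>n\<close> is the first one whose control is strong enough to act
  within the first subepoch, and \<open>G\<close> bounds the noise relative to the threshold \<open>\<delta>\<close> of that test.\<close>

locale large_path = noisy_path a b T q0 p v w "2 / R" m Q
  for a b T q0 :: real and p v w :: "real \<Rightarrow> real" and R m Q :: real +
  fixes \<delta> m' Wst G :: real and n :: nat
  assumes a1: "1 \<le> a" and Ta: "T \<le> a" and aT: "1 \<le> a * T"
    and \<delta>_def: "\<delta> = 1 / (100 * a\<^sup>2)"
    and R_def: "R = (if \<bar>b\<bar> \<le> 40 * a then a else \<bar>b\<bar>)"
    and noise': "\<And>s t. 0 \<le> s \<Longrightarrow> s \<le> t \<Longrightarrow> t \<le> s + \<delta>\<^sup>2 / R \<Longrightarrow> t \<le> T \<Longrightarrow> \<bar>w t - w s\<bar> \<le> m'"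
    and rule: "BR_large 4 (\<delta>\<^sup>2 / a) T a q0 p v"
    and n1: "1 \<le> n" "n \<le> nat \<lfloor>a * T\<rfloor> + 1"
    and weak: "\<And>\<nu>. 1 \<le> \<nu> \<Longrightarrow> \<nu> < n \<Longrightarrow> \<bar>b\<bar> * exp (real \<nu>) < a / 2"
    and strong: "n \<le> nat \<lfloor>a * T\<rfloor> \<Longrightarrow> a / 2 \<le> \<bar>b\<bar> * exp (real n)"
    and Wst: "\<And>t. 0 \<le> t \<Longrightarrow> t \<le> T \<Longrightarrow> \<bar>w t\<bar> \<le> Wst"
    and G: "m \<le> G" "m' / \<delta> \<le> G"
begin

definition \<tau> :: real where "\<tau> = \<delta>\<^sup>2 / a"
definition \<nu>max :: nat where "\<nu>max = nat \<lfloor>a * T\<rfloor>"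
definition ts :: "nat \<Rightarrow> real" where "ts \<nu> = epoch_start T a \<tau> q0 p \<nu>"
definition sub :: "nat \<Rightarrow> real" where "sub \<nu> = sub_i_end T a \<tau> p (ts \<nu>)"
definition th :: "nat \<Rightarrow> real" where "th \<nu> = doubling_time T p (sub \<nu>)"
definition det :: "nat \<Rightarrow> bool" where "det \<nu> \<longleftrightarrow> sub \<nu> < min T (ts \<nu> + \<tau>)"
definition x :: "nat \<Rightarrow> real" where "x \<nu> = \<bar>p (ts \<nu>)\<bar>"
text \<open>A detection is followed by two doublings before the next epoch, so
  \<open>4 ^ d \<nu>\<close> is the scale of \<open>x \<nu>\<close>.\<close>

definition d :: "nat \<Rightarrow> nat" where "d \<nu> = card {i \<in> {1..<\<nu>}. det i}"
definition t0 :: real where "t0 = tau0 a q0 p"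
definition t1 :: real where "t1 = epoch1_start T a q0 p"

lemma a0: "0 < a" using a1 by simp

lemma \<delta>: "0 < \<delta>" "\<delta> \<le> 1/100"
proof -
  have "1 \<le> a\<^sup>2" using a1 by (simp add: one_le_power)
  moreover from this have "0 < a\<^sup>2" by linarith
  ultimately have "1 / a\<^sup>2 \<le> 1" by (simp only: pos_divide_le_eq mult_1)
  then have "1/100 * (1 / a\<^sup>2) \<le> 1/100 * 1" by (intro mult_left_mono) simp_all
  then show "\<delta> \<le> 1/100" unfolding \<delta>_def by simp
  show "0 < \<delta>" unfolding \<delta>_def using a1 by simp
qed

lemma \<tau>: "0 < \<tau>" "sqrt (a * \<tau>) = \<delta>" "a * \<tau> = \<delta>\<^sup>2"
  using a0 \<delta> by (auto simp: \<tau>_def)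

lemma R: "a \<le> R" "0 < R" "\<bar>b\<bar> \<le> 40 * R" using a0 by (auto simp: R_def)

lemma \<nu>max: "real \<nu>max \<le> a * T" "a * T \<le> real \<nu>max + 1" "1 \<le> \<nu>max"
proof -
  show "real \<nu>max \<le> a * T" "a * T \<le> real \<nu>max + 1" using aT unfolding \<nu>max_def by linarith+
  show "1 \<le> \<nu>max" unfolding \<nu>max_def using aT by linarith
qed

text \<open>This is what the size of \<delta> is chosen for: there are at most a T \<le> a^2 tests,
  and a^2 \<delta> = 1/100. Hence all tests together change |p| by a factor between 1/2 and 2
  (\<open>shrink\<close>, \<open>grow\<close>).\<close>

lemma \<delta>\<nu>: "\<nu> \<le> \<nu>max \<Longrightarrow> real \<nu> * \<delta> \<le> 1/100"
proof -
  assume "\<nu> \<le> \<nu>max"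
  then have "real \<nu> \<le> a * T" using \<nu>max(1) by linarith
  also have "\<dots> \<le> a * a" using a0 Ta by (intro mult_left_mono) auto
  finally have "real \<nu> * \<delta> \<le> a\<^sup>2 * \<delta>" using \<delta> by (intro mult_right_mono) (auto simp: power2_eq_square)
  also have "\<dots> = 1/100" using a0 by (simp add: \<delta>_def)
  finally show ?thesis .
qed

lemma shrink: "\<nu> \<le> \<nu>max \<Longrightarrow> 1/2 \<le> (1 - \<delta>) ^ \<nu>"
  using Bernoulli_inequality[of "- \<delta>" \<nu>] \<delta>\<nu>[of \<nu>] \<delta> by (simp add: algebra_simps)

lemma grow: "\<nu> \<le> \<nu>max \<Longrightarrow> (1 + \<delta>) ^ \<nu> \<le> 2"
proof -
  assume \<nu>: "\<nu> \<le> \<nu>max"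
  have "(1 + \<delta>) ^ \<nu> \<le> exp \<delta> ^ \<nu>" using \<delta> by (intro power_mono) auto
  also have "\<dots> = exp (real \<nu> * \<delta>)" by (simp add: exp_of_nat_mult)
  also have "\<dots> \<le> 1 + real \<nu> * \<delta> + (real \<nu> * \<delta>)\<^sup>2"
    using \<delta>\<nu>[OF \<nu>] \<delta> by (intro exp_bound) auto
  also have "\<dots> \<le> 2"
  proof -
    have "(real \<nu> * \<delta>)\<^sup>2 \<le> (1/100)\<^sup>2" using \<delta>\<nu>[OF \<nu>] \<delta> by (intro power_mono) auto
    then show ?thesis using \<delta>\<nu>[OF \<nu>] by (simp add: power2_eq_square)
  qed
  finally show ?thesis .
qed

lemma test_time: "0 < 1 / (10 * a)" "1 / (10 * a) < T"
proof -
  show "0 < 1 / (10 * a)" using a0 by simp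
  have "1 < 10 * a * T" using aT by linarith
  then show "1 / (10 * a) < T" using a0 by (simp add: field_simps)
qed

lemma t0: "0 < t0" "t0 \<le> 1 / (10 * a)" "t \<in> {0..t0} \<Longrightarrow> q0 / 2 \<le> p t \<and> p t \<le> 2 * q0"
  "t0 < 1 / (10 * a) \<Longrightarrow> p t0 = 2 * q0 \<or> p t0 = q0 / 2"
  using band_exit_facts[OF test_time] by (auto simp: t0_def tau0_def)

text \<open>The rule for Epoch 0 compares with \<open>2 * p t0\<close>, \<open>doubling_time\<close>
  with twice the absolute value; they agree because p is positive inside the band.\<close>

lemma t1: "t0 < 1 / (10 * a) \<Longrightarrow> t1 = doubling_time T p t0" "\<not> t0 < 1 / (10 * a) \<Longrightarrow> t1 = t0"
proof -
  have "0 < p t0" using t0(3)[of t0] t0(1) q0 by auto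
  then show "t0 < 1 / (10 * a) \<Longrightarrow> t1 = doubling_time T p t0" "\<not> t0 < 1 / (10 * a) \<Longrightarrow> t1 = t0"
    by (auto simp: t1_def epoch1_start_def t0_def doubling_time_def)
qed

lemma t0_T: "t0 < T" using t0(2) test_time(2) by linarith

lemma start: "0 < t1" "t1 \<le> T" "t0 \<le> t1" "t \<in> {0..t1} \<Longrightarrow> \<bar>p t\<bar> \<le> 4 * q0" "t1 < T \<Longrightarrow> q0 / 2 \<le> \<bar>p t1\<bar>"
proof -
  have pt: "q0 / 2 \<le> p t0" "p t0 \<le> 2 * q0" using t0(3)[of t0] t0(1) by auto
  note D = doubling_time_facts[of t0, OF _ t0_T]
  have "0 < t1 \<and> t1 \<le> T \<and> t0 \<le> t1 \<and> (t \<in> {0..t1} \<longrightarrow> \<bar>p t\<bar> \<le> 4 * q0) \<and> (t1 < T \<longrightarrow> q0 / 2 \<le> \<bar>p t1\<bar>)"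
  proof (cases "t0 < 1 / (10 * a)")
    case True
    have "\<bar>p t\<bar> \<le> 4 * q0" if "t \<in> {0..t1}"
      using t0(3)[of t] D(3)[of t] that pt t0(1) q0 t1(1)[OF True] by (cases "t \<le> t0") auto
    then show ?thesis using D t0(1) pt q0 by (auto simp: t1(1)[OF True])
  next
    case False
    then show ?thesis using t0(1) t0_T t0(3)[of t] pt q0 by (auto simp: t1(2)[OF False])
  qed
  then show "0 < t1" "t1 \<le> T" "t0 \<le> t1" "t \<in> {0..t1} \<Longrightarrow> \<bar>p t\<bar> \<le> 4 * q0" "t1 < T \<Longrightarrow> q0 / 2 \<le> \<bar>p t1\<bar>" by auto
qed

lemma ts1: "ts (Suc 0) = t1" by (simp add: ts_def epoch_start_def t1_def)

lemma ts_Suc: "1 \<le> \<nu> \<Longrightarrow> ts (Suc \<nu>) = (if det \<nu> then doubling_time T p (th \<nu>) else sub \<nu>)"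
  by (cases \<nu>) (auto simp: ts_def epoch_start_def next_epoch_def Let_def det_def sub_def th_def)

lemma controls:
  shows "t \<in> {0..<t0} \<Longrightarrow> v t = - p t"
    and "t0 < 1 / (10 * a) \<Longrightarrow> p t0 = q0 / 2 \<Longrightarrow> t \<in> {t0..<t1} \<Longrightarrow> v t = - 4 * p t"
    and "t0 < 1 / (10 * a) \<Longrightarrow> p t0 = 2 * q0 \<Longrightarrow> t \<in> {t0..<t1} \<Longrightarrow> v t = 4 * p t"
    and "1 \<le> \<nu> \<Longrightarrow> \<nu> \<le> \<nu>max \<Longrightarrow> t \<in> {ts \<nu>..<sub \<nu>} \<Longrightarrow> v t = exp (real \<nu>) * p (ts \<nu>) / \<delta>"
    and "1 \<le> \<nu> \<Longrightarrow> \<nu> \<le> \<nu>max \<Longrightarrow> det \<nu> \<Longrightarrow> t \<in> {sub \<nu>..<th \<nu>} \<Longrightarrow> v t = 4 * exp (real \<nu>) * p t"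
    and "1 \<le> \<nu> \<Longrightarrow> \<nu> \<le> \<nu>max \<Longrightarrow> det \<nu> \<Longrightarrow> t \<in> {th \<nu>..<ts (Suc \<nu>)} \<Longrightarrow> v t = - 4 * exp (real \<nu>) * p t"
    and "t \<in> {ts (Suc \<nu>max)..<T} \<Longrightarrow> v t = 0"
proof -
  note r = rule[unfolded BR_large_def Let_def, folded \<tau>_def \<nu>max_def t0_def t1_def]
  show "t \<in> {0..<t0} \<Longrightarrow> v t = - p t" using r by blast
  show "t0 < 1 / (10 * a) \<Longrightarrow> p t0 = q0 / 2 \<Longrightarrow> t \<in> {t0..<t1} \<Longrightarrow> v t = - 4 * p t" using r by blast
  show "t0 < 1 / (10 * a) \<Longrightarrow> p t0 = 2 * q0 \<Longrightarrow> t \<in> {t0..<t1} \<Longrightarrow> v t = 4 * p t" using r by blast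
  show "t \<in> {ts (Suc \<nu>max)..<T} \<Longrightarrow> v t = 0" using r by (auto simp: ts_def)
  have "\<forall>\<nu>\<in>{1..\<nu>max}. (\<forall>t\<in>{ts \<nu>..<sub \<nu>}. v t = exp (real \<nu>) * p (ts \<nu>) / sqrt (a * \<tau>)) \<and>
     (sub \<nu> < min T (ts \<nu> + \<tau>) \<longrightarrow> (\<forall>t\<in>{sub \<nu>..<th \<nu>}. v t = 4 * exp (real \<nu>) * p t) \<and>
       (\<forall>t\<in>{th \<nu>..<ts (Suc \<nu>)}. v t = - 4 * exp (real \<nu>) * p t))"
    using r by (simp add: ts_def sub_def th_def)
  then have *: "(\<forall>t\<in>{ts \<nu>..<sub \<nu>}. v t = exp (real \<nu>) * p (ts \<nu>) / sqrt (a * \<tau>)) \<and>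
     (det \<nu> \<longrightarrow> (\<forall>t\<in>{sub \<nu>..<th \<nu>}. v t = 4 * exp (real \<nu>) * p t) \<and>
       (\<forall>t\<in>{th \<nu>..<ts (Suc \<nu>)}. v t = - 4 * exp (real \<nu>) * p t))" if "1 \<le> \<nu>" "\<nu> \<le> \<nu>max"
    using that unfolding det_def by (meson atLeastAtMost_iff)
  show "1 \<le> \<nu> \<Longrightarrow> \<nu> \<le> \<nu>max \<Longrightarrow> t \<in> {ts \<nu>..<sub \<nu>} \<Longrightarrow> v t = exp (real \<nu>) * p (ts \<nu>) / \<delta>"
    using * by (simp add: \<tau>(2))
  show "1 \<le> \<nu> \<Longrightarrow> \<nu> \<le> \<nu>max \<Longrightarrow> det \<nu> \<Longrightarrow> t \<in> {sub \<nu>..<th \<nu>} \<Longrightarrow> v t = 4 * exp (real \<nu>) * p t" using * by blast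
  show "1 \<le> \<nu> \<Longrightarrow> \<nu> \<le> \<nu>max \<Longrightarrow> det \<nu> \<Longrightarrow> t \<in> {th \<nu>..<ts (Suc \<nu>)} \<Longrightarrow> v t = - 4 * exp (real \<nu>) * p t" using * by blast
qed

lemma first_subepoch:
  assumes \<nu>: "1 \<le> \<nu>" and t: "0 \<le> ts \<nu>" "ts \<nu> < T" and x: "0 < x \<nu>"
  shows "ts \<nu> < sub \<nu>" "sub \<nu> \<le> T" "sub \<nu> \<le> ts \<nu> + \<tau>"
    and "r \<in> {ts \<nu>..sub \<nu>} \<Longrightarrow> \<bar>p r - p (ts \<nu>)\<bar> \<le> \<delta> * x \<nu>"
    and "r \<in> {ts \<nu>..sub \<nu>} \<Longrightarrow> (1 - \<delta>) * x \<nu> \<le> \<bar>p r\<bar> \<and> \<bar>p r\<bar> \<le> (1 + \<delta>) * x \<nu>"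
    and "det \<nu> \<Longrightarrow> \<bar>p (sub \<nu>) - p (ts \<nu>)\<bar> = \<delta> * x \<nu>"
    and "\<not> det \<nu> \<Longrightarrow> ts (Suc \<nu>) = sub \<nu> \<and> (sub \<nu> < T \<longrightarrow> sub \<nu> = ts \<nu> + \<tau>)"
proof -
  have ne: "p (ts \<nu>) \<noteq> 0" using x by (auto simp: x_def)
  note F = sub_i_end_facts[OF t ne \<tau>(1) a0, folded sub_def, unfolded \<tau>(2) mult.commute[of _ \<delta>], folded x_def]
  show "ts \<nu> < sub \<nu>" "sub \<nu> \<le> T" "sub \<nu> \<le> ts \<nu> + \<tau>" using F(1,2) by auto
  have *: "r \<in> {ts \<nu>..sub \<nu>} \<Longrightarrow> \<bar>p r - p (ts \<nu>)\<bar> \<le> \<delta> * x \<nu>" by (rule F(3))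
  then show "r \<in> {ts \<nu>..sub \<nu>} \<Longrightarrow> \<bar>p r - p (ts \<nu>)\<bar> \<le> \<delta> * x \<nu>" .
  show "r \<in> {ts \<nu>..sub \<nu>} \<Longrightarrow> (1 - \<delta>) * x \<nu> \<le> \<bar>p r\<bar> \<and> \<bar>p r\<bar> \<le> (1 + \<delta>) * x \<nu>"
    using * unfolding x_def left_diff_distrib distrib_right by linarith
  show "det \<nu> \<Longrightarrow> \<bar>p (sub \<nu>) - p (ts \<nu>)\<bar> = \<delta> * x \<nu>" using F(4) by (simp add: det_def)
  show "\<not> det \<nu> \<Longrightarrow> ts (Suc \<nu>) = sub \<nu> \<and> (sub \<nu> < T \<longrightarrow> sub \<nu> = ts \<nu> + \<tau>)"
    using F(2) \<nu> by (auto simp: ts_Suc det_def)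
qed

lemma later_subepochs:
  assumes \<nu>: "1 \<le> \<nu>" and t: "0 \<le> ts \<nu>" "ts \<nu> < T" and x: "0 < x \<nu>" and det: "det \<nu>"
  shows "sub \<nu> < T" "sub \<nu> < th \<nu>" "th \<nu> \<le> ts (Suc \<nu>)" "ts (Suc \<nu>) \<le> T" "0 < \<bar>p (sub \<nu>)\<bar>"
    and "r \<in> {sub \<nu>..th \<nu>} \<Longrightarrow> \<bar>p r\<bar> \<le> 2 * \<bar>p (sub \<nu>)\<bar>"
    and "th \<nu> < T \<Longrightarrow> \<bar>p (th \<nu>)\<bar> = 2 * \<bar>p (sub \<nu>)\<bar>"
    and "r \<in> {th \<nu>..ts (Suc \<nu>)} \<Longrightarrow> \<bar>p r\<bar> \<le> 4 * \<bar>p (sub \<nu>)\<bar>"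
    and "ts (Suc \<nu>) < T \<Longrightarrow> th \<nu> < T \<and> \<bar>p (ts (Suc \<nu>))\<bar> = 4 * \<bar>p (sub \<nu>)\<bar>"
proof -
  note F = first_subepoch[OF \<nu> t x]
  show sT: "sub \<nu> < T" using det by (simp add: det_def)
  have s0: "0 \<le> sub \<nu>" using F(1) t by simp
  have "0 < (1 - \<delta>) * x \<nu>" using \<delta> x by simp
  then show ps: "0 < \<bar>p (sub \<nu>)\<bar>" using F(5)[of "sub \<nu>"] F(1) by auto
  note D = doubling_time_facts[OF s0 sT, folded th_def]
  have ps': "p (sub \<nu>) \<noteq> 0" using ps by auto
  show st: "sub \<nu> < th \<nu>" using D(1) ps' by simp
  show 1: "r \<in> {sub \<nu>..th \<nu>} \<Longrightarrow> \<bar>p r\<bar> \<le> 2 * \<bar>p (sub \<nu>)\<bar>" for r using D(3) ps' by simp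
  show 2: "th \<nu> < T \<Longrightarrow> \<bar>p (th \<nu>)\<bar> = 2 * \<bar>p (sub \<nu>)\<bar>" using D(4) ps' by simp
  have tS: "ts (Suc \<nu>) = doubling_time T p (th \<nu>)" using det \<nu> by (simp add: ts_Suc)
  have "th \<nu> \<le> ts (Suc \<nu>) \<and> ts (Suc \<nu>) \<le> T \<and> (r \<in> {th \<nu>..ts (Suc \<nu>)} \<longrightarrow> \<bar>p r\<bar> \<le> 4 * \<bar>p (sub \<nu>)\<bar>) \<and>
     (ts (Suc \<nu>) < T \<longrightarrow> th \<nu> < T \<and> \<bar>p (ts (Suc \<nu>))\<bar> = 4 * \<bar>p (sub \<nu>)\<bar>)"
  proof (cases "th \<nu> < T")
    case True
    have "0 \<le> th \<nu>" "p (th \<nu>) \<noteq> 0" using s0 st 2[OF True] ps by auto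
    from doubling_time_facts[OF this(1) True this(2), folded tS] 2[OF True] True
    show ?thesis by force
  next
    case False
    then have "th \<nu> = T" using D(2) ps' by simp
    moreover have "ts (Suc \<nu>) = T" using False by (simp add: tS doubling_time_end)
    ultimately show ?thesis using 1[of T] st by auto
  qed
  then show "th \<nu> \<le> ts (Suc \<nu>)" "ts (Suc \<nu>) \<le> T" "r \<in> {th \<nu>..ts (Suc \<nu>)} \<Longrightarrow> \<bar>p r\<bar> \<le> 4 * \<bar>p (sub \<nu>)\<bar>"
    "ts (Suc \<nu>) < T \<Longrightarrow> th \<nu> < T \<and> \<bar>p (ts (Suc \<nu>))\<bar> = 4 * \<bar>p (sub \<nu>)\<bar>" by auto
qed

lemma sub_end: "ts \<nu> = T \<Longrightarrow> sub \<nu> = T \<and> \<not> det \<nu>"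
  using \<tau> by (simp add: sub_def sub_i_end_def first_time_empty det_def)

lemma d_Suc: "1 \<le> \<nu> \<Longrightarrow> d (Suc \<nu>) = d \<nu> + (if det \<nu> then 1 else 0)"
proof -
  assume "1 \<le> \<nu>"
  then have "{i \<in> {1..<Suc \<nu>}. det i} = (if det \<nu> then insert \<nu> {i \<in> {1..<\<nu>}. det i} else {i \<in> {1..<\<nu>}. det i})"
    by (auto simp: less_Suc_eq)
  then show ?thesis by (simp add: d_def)
qed

text \<open>A test keeps |p| within a factor between 1 - \<delta> and 1 + \<delta>, and both
  feedback subepochs end exactly at a doubling. The exponent \<nu> - 1 counts the completed epochs.
  The size is asserted only for \<open>ts \<nu> < T\<close>: once the game is over all later
  switching times are T, and a stage cut off by T need not end at a doubling.\<close>

lemma epoch_invariant: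
  "1 \<le> \<nu> \<Longrightarrow> 0 < ts \<nu> \<and> ts \<nu> \<le> T \<and> ts \<nu> \<le> ts (Suc \<nu>) \<and>
    (ts \<nu> < T \<longrightarrow> 1/2 * (1 - \<delta>) ^ (\<nu> - 1) * 4 ^ d \<nu> \<le> x \<nu> \<and> x \<nu> \<le> 4 * q0 * (1 + \<delta>) ^ (\<nu> - 1) * 4 ^ d \<nu>)"
proof (induction \<nu> rule: nat_induct_at_least)
  case base
  have d1: "d 1 = 0" by (simp add: d_def)
  have le: "ts 1 \<le> ts (Suc 1)"
  proof (cases "ts 1 < T")
    case True
    have "t1 < T" using True ts1 by simp
    then have x1: "0 < x 1" unfolding x_def One_nat_def ts1 using start(5) q0 by linarith
    have t: "0 \<le> ts 1" using start(1) by (simp add: ts1)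
    show ?thesis
      using first_subepoch[OF order_refl t True x1] later_subepochs[OF order_refl t True x1]
      by (cases "det 1") auto
  next
    case False
    then have "ts 1 = T" using start(2) by (simp add: ts1)
    then show ?thesis using sub_end ts_Suc[of 1] by auto
  qed
  then show ?case using start(1,2,5) start(4)[of t1] q0 d1 by (auto simp: x_def ts1)
next
  case (Suc \<nu>)
  note IH = Suc.IH
  have step: "0 < ts (Suc \<nu>) \<and> ts (Suc \<nu>) \<le> T \<and>
    (ts (Suc \<nu>) < T \<longrightarrow> 1/2 * (1 - \<delta>) ^ \<nu> * 4 ^ d (Suc \<nu>) \<le> x (Suc \<nu>) \<and> x (Suc \<nu>) \<le> 4 * q0 * (1 + \<delta>) ^ \<nu> * 4 ^ d (Suc \<nu>))"
  proof (cases "ts \<nu> < T")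
    case True
    have "0 < (1 - \<delta>) ^ (\<nu> - 1)" using \<delta> by simp
    then have lo0: "0 < 1/2 * (1 - \<delta>) ^ (\<nu> - 1) * 4 ^ d \<nu>" by simp
    have lo: "1/2 * (1 - \<delta>) ^ (\<nu> - 1) * 4 ^ d \<nu> \<le> x \<nu>" and up: "x \<nu> \<le> 4 * q0 * (1 + \<delta>) ^ (\<nu> - 1) * 4 ^ d \<nu>"
      using IH True by auto
    then have x0: "0 < x \<nu>" using lo0 by linarith
    have t0: "0 \<le> ts \<nu>" using IH by simp
    note F = first_subepoch[OF Suc.hyps t0 True x0] and L = later_subepochs[OF Suc.hyps t0 True x0]
    have pS: "(1 - \<delta>) ^ \<nu> = (1 - \<delta>) * (1 - \<delta>) ^ (\<nu> - 1)" "(1 + \<delta>) ^ \<nu> = (1 + \<delta>) * (1 + \<delta>) ^ (\<nu> - 1)"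
      using Suc.hyps by (cases \<nu>; simp)+
    have m1: "(1 - \<delta>) * (1/2 * (1 - \<delta>) ^ (\<nu> - 1) * 4 ^ d \<nu>) \<le> (1 - \<delta>) * x \<nu>"
      using \<delta> by (intro mult_left_mono lo) auto
    have m2: "(1 + \<delta>) * x \<nu> \<le> (1 + \<delta>) * (4 * q0 * (1 + \<delta>) ^ (\<nu> - 1) * 4 ^ d \<nu>)"
      using \<delta> by (intro mult_left_mono up) auto
    have b: "(1 - \<delta>) * x \<nu> \<le> \<bar>p (sub \<nu>)\<bar>" "\<bar>p (sub \<nu>)\<bar> \<le> (1 + \<delta>) * x \<nu>"
      using F(5)[of "sub \<nu>"] F(1) by auto
    show ?thesis
    proof (cases "det \<nu>")
      case True
      have dS: "d (Suc \<nu>) = Suc (d \<nu>)" using d_Suc[OF Suc.hyps] True by simp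
      have e1: "1/2 * (1 - \<delta>) ^ \<nu> * 4 ^ d (Suc \<nu>) = 4 * ((1 - \<delta>) * (1/2 * (1 - \<delta>) ^ (\<nu> - 1) * 4 ^ d \<nu>))"
        and e2: "4 * q0 * (1 + \<delta>) ^ \<nu> * 4 ^ d (Suc \<nu>) = 4 * ((1 + \<delta>) * (4 * q0 * (1 + \<delta>) ^ (\<nu> - 1) * 4 ^ d \<nu>))"
        by (simp_all only: pS dS power_Suc mult_ac)
      have "1/2 * (1 - \<delta>) ^ \<nu> * 4 ^ d (Suc \<nu>) \<le> x (Suc \<nu>) \<and> x (Suc \<nu>) \<le> 4 * q0 * (1 + \<delta>) ^ \<nu> * 4 ^ d (Suc \<nu>)"
        if "ts (Suc \<nu>) < T"
      proof -
        have "x (Suc \<nu>) = 4 * \<bar>p (sub \<nu>)\<bar>" using L(9)[OF True that] by (simp add: x_def)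
        then show ?thesis unfolding e1 e2 using b m1 m2 by linarith
      qed
      then show ?thesis using L(1-4)[OF True] F(1) t0 by auto
    next
      case False
      have dS: "d (Suc \<nu>) = d \<nu>" using d_Suc[OF Suc.hyps] False by simp
      have e1: "1/2 * (1 - \<delta>) ^ \<nu> * 4 ^ d (Suc \<nu>) = (1 - \<delta>) * (1/2 * (1 - \<delta>) ^ (\<nu> - 1) * 4 ^ d \<nu>)"
        and e2: "4 * q0 * (1 + \<delta>) ^ \<nu> * 4 ^ d (Suc \<nu>) = (1 + \<delta>) * (4 * q0 * (1 + \<delta>) ^ (\<nu> - 1) * 4 ^ d \<nu>)"
        by (simp_all only: pS dS mult_ac)
      have "x (Suc \<nu>) = \<bar>p (sub \<nu>)\<bar>" using F(7)[OF False] by (simp add: x_def)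
      then have "1/2 * (1 - \<delta>) ^ \<nu> * 4 ^ d (Suc \<nu>) \<le> x (Suc \<nu>) \<and> x (Suc \<nu>) \<le> 4 * q0 * (1 + \<delta>) ^ \<nu> * 4 ^ d (Suc \<nu>)"
        unfolding e1 e2 using b m1 m2 by linarith
      then show ?thesis using F(7)[OF False] F(1,2) t0 by auto
    qed
  next
    case False
    then have "ts \<nu> = T" using IH by simp
    then show ?thesis using sub_end[of \<nu>] ts_Suc[OF Suc.hyps] T by auto
  qed
  have "ts (Suc \<nu>) \<le> ts (Suc (Suc \<nu>))"
  proof (cases "ts (Suc \<nu>) < T")
    case True
    have "0 < (1 - \<delta>) ^ \<nu>" using \<delta> by simp
    then have "0 < 1/2 * (1 - \<delta>) ^ \<nu> * 4 ^ d (Suc \<nu>)" by simp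
    then have x1: "0 < x (Suc \<nu>)" using step True by linarith
    have t: "0 \<le> ts (Suc \<nu>)" and 1: "1 \<le> Suc \<nu>" using step by auto
    show ?thesis
      using first_subepoch[OF 1 t True x1] later_subepochs[OF 1 t True x1]
      by (cases "det (Suc \<nu>)") auto
  next
    case False
    then have "ts (Suc \<nu>) = T" using step by simp
    then show ?thesis using sub_end ts_Suc[of "Suc \<nu>"] by auto
  qed
  then show ?case using step by simp
qed

lemma epoch_bounds:
  assumes "1 \<le> \<nu>"
  shows "0 < ts \<nu>" "ts \<nu> \<le> T" "ts \<nu> \<le> ts (Suc \<nu>)"
    and "ts \<nu> < T \<Longrightarrow> \<nu> \<le> Suc \<nu>max \<Longrightarrow> 1/4 * 4 ^ d \<nu> \<le> x \<nu>"
    and "ts \<nu> < T \<Longrightarrow> \<nu> \<le> Suc \<nu>max \<Longrightarrow> x \<nu> \<le> 8 * q0 * 4 ^ d \<nu>"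
proof -
  note I = epoch_invariant[OF assms]
  show "0 < ts \<nu>" "ts \<nu> \<le> T" "ts \<nu> \<le> ts (Suc \<nu>)" using I by auto
  assume A: "ts \<nu> < T" "\<nu> \<le> Suc \<nu>max"
  then have \<nu>: "\<nu> - 1 \<le> \<nu>max" by simp
  have "1/2 * (1/2) * 4 ^ d \<nu> \<le> 1/2 * (1 - \<delta>) ^ (\<nu> - 1) * 4 ^ d \<nu>"
    using shrink[OF \<nu>] by (intro mult_right_mono mult_left_mono) auto
  moreover have "1/2 * (1 - \<delta>) ^ (\<nu> - 1) * 4 ^ d \<nu> \<le> x \<nu>" using I A by blast
  ultimately show "1/4 * 4 ^ d \<nu> \<le> x \<nu>" by linarith
  have "4 * q0 * (1 + \<delta>) ^ (\<nu> - 1) * 4 ^ d \<nu> \<le> 4 * q0 * 2 * 4 ^ d \<nu>"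
    using grow[OF \<nu>] q0 by (intro mult_right_mono mult_left_mono) auto
  moreover have "x \<nu> \<le> 4 * q0 * (1 + \<delta>) ^ (\<nu> - 1) * 4 ^ d \<nu>" using I A by blast
  ultimately show "x \<nu> \<le> 8 * q0 * 4 ^ d \<nu>" by linarith
qed

lemma x_pos: "1 \<le> \<nu> \<Longrightarrow> ts \<nu> < T \<Longrightarrow> \<nu> \<le> Suc \<nu>max \<Longrightarrow> 1/4 \<le> x \<nu>"
  using epoch_bounds(4)[of \<nu>] one_le_power[of "4::real" "d \<nu>"] by linarith

end

section \<open>Errors of the tests and what they require of the noise\<close>

context large_path
begin

text \<open>Under the constant control the path is linear in time plus noise, up to the free growth
  a \<integral> p. The latter is at most a \<tau> (1 + \<delta>) x = (1 + \<delta>) \<delta>^2 x,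
  well below the threshold \<delta> x.\<close>

lemma test_drift:
  assumes \<nu>: "1 \<le> \<nu>" "\<nu> \<le> \<nu>max" and t: "ts \<nu> < T" and r: "ts \<nu> \<le> r" "r \<le> sub \<nu>"
  shows "\<bar>p r - p (ts \<nu>) - b * (exp (real \<nu>) * p (ts \<nu>) / \<delta>) * (r - ts \<nu>) - (w r - w (ts \<nu>))\<bar> \<le> \<delta> * x \<nu> / 8"
proof -
  have x0: "0 < x \<nu>" using x_pos[OF \<nu>(1) t] \<nu> by auto
  have t0: "0 \<le> ts \<nu>" using epoch_bounds(1)[OF \<nu>(1)] by simp
  note F = first_subepoch[OF \<nu>(1) t0 t x0]
  define \<eta> where "\<eta> = exp (real \<nu>) * p (ts \<nu>) / \<delta>"
  have rT: "r \<le> T" using r F(2) by simp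
  have pi: "p integrable_on {ts \<nu>..r}"
    using t0 rT by (intro integrable_continuous_interval p_cont_sub) auto
  have "p r - p (ts \<nu>) = w r - w (ts \<nu>) + integral {ts \<nu>..r} (\<lambda>r. (a + b * 0) * p r + b * \<eta>)"
    by (rule increment_feedback[OF t0 r(1) rT]) (use controls(4)[OF \<nu>] r in \<open>auto simp: \<eta>_def\<close>)
  also have "integral {ts \<nu>..r} (\<lambda>r. (a + b * 0) * p r + b * \<eta>) = a * integral {ts \<nu>..r} p + b * \<eta> * (r - ts \<nu>)"
    using integrable_on_mult_right[OF pi, of a] r(1)
    by (subst Henstock_Kurzweil_Integration.integral_add) (auto simp: mult.commute)
  finally have "\<bar>p r - p (ts \<nu>) - b * \<eta> * (r - ts \<nu>) - (w r - w (ts \<nu>))\<bar> = a * \<bar>integral {ts \<nu>..r} p\<bar>"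
    using a0 by (simp add: abs_mult)
  also have "\<dots> \<le> a * ((1 + \<delta>) * x \<nu> * (r - ts \<nu>))"
  proof (rule mult_left_mono)
    have "norm (integral {ts \<nu>..r} p) \<le> (1 + \<delta>) * x \<nu> * (r - ts \<nu>)"
      by (rule integral_bound[OF r(1) p_cont_sub[OF t0 rT]]) (use F(5) r in auto)
    then show "\<bar>integral {ts \<nu>..r} p\<bar> \<le> (1 + \<delta>) * x \<nu> * (r - ts \<nu>)" by simp
  qed (use a0 in simp)
  also have "\<dots> \<le> a * ((1 + \<delta>) * x \<nu> * \<tau>)"
    using r F(3) a0 x0 \<delta> by (intro mult_left_mono) auto
  also have "\<dots> = (1 + \<delta>) * \<delta> * (\<delta> * x \<nu>)" using \<tau>(3) by (simp add: power2_eq_square mult_ac)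
  also have "\<dots> \<le> 1/8 * (\<delta> * x \<nu>)"
  proof (rule mult_right_mono)
    have "(1 + \<delta>) * \<delta> \<le> (1 + 1/100) * (1/100)" using \<delta> by (intro mult_mono) auto
    then show "(1 + \<delta>) * \<delta> \<le> 1/8" by simp
  qed (use \<delta> x0 in auto)
  finally show ?thesis by (simp add: \<eta>_def)
qed

text \<open>In a weak epoch the control contributes at most \<delta> x / 2 and the free growth
  \<delta> x / 8, so the noise must supply the remaining 3/8 of the threshold. Weakness also forces
  |b| < a / 2, hence R = a, and the whole test fits into one window of length \<delta>^2 /
  R.\<close>

lemma misfire:
  assumes \<nu>: "1 \<le> \<nu>" "\<nu> \<le> \<nu>max" "\<nu> < n" and t: "ts \<nu> < T" and det: "det \<nu>"
  shows "x \<nu> \<le> 8/3 * (m' / \<delta>)"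
proof -
  have x0: "0 < x \<nu>" using x_pos[OF \<nu>(1) t] \<nu> by auto
  have t0: "0 \<le> ts \<nu>" using epoch_bounds(1)[OF \<nu>(1)] by simp
  note F = first_subepoch[OF \<nu>(1) t0 t x0]
  have wk: "\<bar>b\<bar> * exp (real \<nu>) < a / 2" by (rule weak[OF \<nu>(1,3)])
  have "\<bar>b\<bar> * 1 \<le> \<bar>b\<bar> * exp (real \<nu>)" by (intro mult_left_mono) auto
  then have "R = a" using wk a0 by (simp add: R_def)
  then have w': "\<bar>w (sub \<nu>) - w (ts \<nu>)\<bar> \<le> m'"
    using F(1-3) t0 by (intro noise') (auto simp: \<tau>_def)
  define D where "D = b * (exp (real \<nu>) * p (ts \<nu>) / \<delta>) * (sub \<nu> - ts \<nu>)"
  have "\<bar>D\<bar> = (\<bar>b\<bar> * exp (real \<nu>)) * (x \<nu> / \<delta>) * (sub \<nu> - ts \<nu>)"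
    using F(1) \<delta> by (simp add: D_def abs_mult x_def)
  also have "\<dots> \<le> (a / 2) * (x \<nu> / \<delta>) * \<tau>"
    using F(1,3) wk x0 \<delta> a0 by (intro mult_mono mult_nonneg_nonneg) auto
  also have "\<dots> = \<delta> * x \<nu> / 2" using \<delta> a0 by (simp add: \<tau>_def power2_eq_square)
  finally have D: "\<bar>D\<bar> \<le> \<delta> * x \<nu> / 2" .
  have "\<delta> * x \<nu> \<le> \<bar>D\<bar> + \<bar>w (sub \<nu>) - w (ts \<nu>)\<bar> + \<delta> * x \<nu> / 8"
    using test_drift[OF \<nu>(1,2) t, of "sub \<nu>", folded D_def] F(1) F(6)[OF det] by linarith
  then have "3/8 * (\<delta> * x \<nu>) \<le> m'" using D w' by linarith
  then show ?thesis using \<delta> by (simp add: field_simps)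
qed

text \<open>If R = a this is the definition of \<open>n\<close>; if R = |b| it follows from exp
  \<nu> \<ge> 1.\<close>

lemma strong_gain: "n \<le> \<nu> \<Longrightarrow> \<nu> \<le> \<nu>max \<Longrightarrow> R / 2 \<le> \<bar>b\<bar> * exp (real \<nu>)" "n \<le> \<nu> \<Longrightarrow> \<nu> \<le> \<nu>max \<Longrightarrow> a / 2 \<le> \<bar>b\<bar> * exp (real \<nu>)"
proof -
  assume \<nu>: "n \<le> \<nu>" "\<nu> \<le> \<nu>max"
  have "a / 2 \<le> \<bar>b\<bar> * exp (real n)" using strong \<nu> by (simp add: \<nu>max_def)
  also have "\<dots> \<le> \<bar>b\<bar> * exp (real \<nu>)" using \<nu> by (intro mult_left_mono) auto
  finally show *: "a / 2 \<le> \<bar>b\<bar> * exp (real \<nu>)" .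
  have "\<bar>b\<bar> * 1 \<le> \<bar>b\<bar> * exp (real \<nu>)" by (intro mult_left_mono) auto
  then show "R / 2 \<le> \<bar>b\<bar> * exp (real \<nu>)" using * a0 by (auto simp: R_def)
qed

text \<open>The path is examined at time \<delta>^2 / R after the start of the test, so that
  \<open>m'\<close> applies. With y = |b| exp \<nu> / R the control has moved it there by y \<delta>
  x, although it is still within the threshold \<delta> x. So the noise is at least (y - 9/8)
  \<delta> x, and y - 9/8 \<ge> 7/16 y because y \<ge> 2.\<close>

lemma missed:
  assumes \<nu>: "1 \<le> \<nu>" "\<nu> \<le> \<nu>max" and t: "ts \<nu> < T" and det: "\<not> det \<nu>" and t': "ts (Suc \<nu>) < T"
    and big: "2 \<le> \<bar>b\<bar> * exp (real \<nu>) / R"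
  shows "\<bar>b\<bar> * exp (real \<nu>) / R \<le> 10 * (m' / \<delta>)"
proof -
  have x1: "1/4 \<le> x \<nu>" using x_pos[OF \<nu>(1) t] \<nu> by auto
  then have x0: "0 < x \<nu>" by linarith
  have t0: "0 \<le> ts \<nu>" using epoch_bounds(1)[OF \<nu>(1)] by simp
  note F = first_subepoch[OF \<nu>(1) t0 t x0]
  define r where "r = ts \<nu> + \<delta>\<^sup>2 / R"
  have "\<delta>\<^sup>2 / R \<le> \<tau>" unfolding \<tau>_def using R a0 by (intro divide_left_mono) auto
  then have r: "ts \<nu> \<le> r" "r \<le> sub \<nu>" "r \<le> T" using F(7)[OF det] F(2) t' R by (auto simp: r_def)
  have w': "\<bar>w r - w (ts \<nu>)\<bar> \<le> m'" using r t0 by (intro noise') (auto simp: r_def)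
  define y where "y = \<bar>b\<bar> * exp (real \<nu>) / R"
  define D where "D = b * (exp (real \<nu>) * p (ts \<nu>) / \<delta>) * (r - ts \<nu>)"
  have "\<bar>D\<bar> = y * (\<delta> * x \<nu>)"
    using \<delta> R by (simp add: D_def abs_mult x_def y_def r_def power2_eq_square)
  moreover have "\<bar>D\<bar> \<le> \<delta> * x \<nu> + \<bar>w r - w (ts \<nu>)\<bar> + \<delta> * x \<nu> / 8"
  proof -
    have "\<bar>p r - p (ts \<nu>)\<bar> \<le> \<delta> * x \<nu>" using F(4)[of r] r by auto
    then show ?thesis using test_drift[OF \<nu>(1,2) t r(1,2), folded D_def] by linarith
  qed
  ultimately have "(y - 9/8) * (\<delta> * x \<nu>) \<le> m'" using w' by (simp add: algebra_simps)
  moreover have "7/16 * y * (\<delta> * (1/4)) \<le> (y - 9/8) * (\<delta> * x \<nu>)"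
    using big[folded y_def] x1 \<delta> by (intro mult_mono mult_left_mono) auto
  ultimately have "7/64 * y * \<delta> \<le> m'" by simp
  then have "7/64 * y \<le> m' / \<delta>" using \<delta> by (simp add: pos_le_divide_eq)
  moreover have "0 \<le> y" using R by (simp add: y_def)
  ultimately have "y \<le> 10 * (m' / \<delta>)" by linarith
  then show ?thesis by (simp add: y_def)
qed

text \<open>The choice K = 4: a is at most 2 |b| g, so with the right sign 4 |b| g - a \<ge> 2 |b| g
  \<ge> R, which over a window of length 2 / R gives the contraction that \<open>stable\<close> asks
  for. With the wrong sign the growth rate is at least 4 |b| g \<ge> 2 R.\<close>

lemma stable_rate:
  assumes "R / 2 \<le> \<bar>b\<bar> * g" "a / 2 \<le> \<bar>b\<bar> * g"
  shows "b < 0 \<Longrightarrow> 1 \<le> - (a + b * (4 * g)) * (2 / R)" "b \<ge> 0 \<Longrightarrow> 1 \<le> - (a + b * (- 4 * g)) * (2 / R)"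
    "b \<ge> 0 \<Longrightarrow> 2 \<le> (a + b * (4 * g)) * (2 / R)"
  using assms R a0 by (auto simp: field_simps)

text \<open>In a strong epoch one of the two feedback subepochs is stable, the second if b < 0 and
  the third otherwise. It ends before T only if |p| doubles, but stability allows a growth of at
  most 6 m.\<close>

lemma stable_exit:
  assumes \<nu>: "1 \<le> \<nu>" "\<nu> \<le> \<nu>max" "n \<le> \<nu>" and det: "det \<nu>" and t': "ts (Suc \<nu>) < T"
  shows "x \<nu> \<le> 12 * m"
proof -
  have t: "ts \<nu> < T" using epoch_bounds(3)[OF \<nu>(1)] t' by simp
  have x0: "0 < x \<nu>" using x_pos[OF \<nu>(1) t] \<nu> by auto
  have t0: "0 \<le> ts \<nu>" using epoch_bounds(1)[OF \<nu>(1)] by simp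
  note F = first_subepoch[OF \<nu>(1) t0 t x0] and L = later_subepochs[OF \<nu>(1) t0 t x0 det]
  have s0: "0 \<le> sub \<nu>" using F(1) t0 by simp
  note g = strong_gain[OF \<nu>(3,2)]
  have "\<bar>p (sub \<nu>)\<bar> \<le> 6 * m"
  proof (cases "b < 0")
    case True
    have "\<bar>p (th \<nu>)\<bar> \<le> \<bar>p (sub \<nu>)\<bar> + 6 * m"
      by (rule stable(1)[of "sub \<nu>" "th \<nu>" "4 * exp (real \<nu>)"])
         (use controls(5)[OF \<nu>(1,2) det] L s0 stable_rate(1)[OF g True] t' in auto)
    then show ?thesis using L(7,9) t' by simp
  next
    case False
    then have b: "0 \<le> b" by simp
    have "\<bar>p (ts (Suc \<nu>))\<bar> \<le> \<bar>p (th \<nu>)\<bar> + 6 * m"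
      by (rule stable(1)[of "th \<nu>" "ts (Suc \<nu>)" "- 4 * exp (real \<nu>)"])
         (use controls(6)[OF \<nu>(1,2) det] L s0 stable_rate(2)[OF g b] t' in auto)
    then show ?thesis using L(7,9) t' m0 by simp
  qed
  moreover have "1/2 * x \<nu> \<le> (1 - \<delta>) * x \<nu>" using \<delta> x0 by (intro mult_right_mono) auto
  ultimately show ?thesis using F(5)[of "sub \<nu>"] F(1) by auto
qed

lemma G0: "0 \<le> G" using G m0 by linarith

text \<open>Any detection after which the game still goes on is an error: a misfire in a weak epoch
  or a departure from a stable stage in a strong one. Either forces x \<le> 12 G, while x \<ge> 4^d
  / 4, so the new value of 4^d is at most 192 G. For the second bound, an undetected epoch beyond n
  + 1 has |b| exp \<nu> / R \<ge> 2 and was missed, which gives exp \<nu> \<le> 20 G exp n directly;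
  a detected epoch gains a factor 4 \<ge> exp 1 on the right-hand side.\<close>

lemma counts:
  "1 \<le> \<nu> \<Longrightarrow> ts \<nu> < T \<Longrightarrow> \<nu> \<le> Suc \<nu>max \<Longrightarrow>
   4 ^ d \<nu> \<le> 1 + 192 * G \<and> exp (real \<nu>) \<le> exp (real n + 2) * 4 ^ d \<nu> * (1 + 20 * G)"
proof (induction \<nu> rule: nat_induct_at_least)
  case base
  have "exp (real 1) * 1 * 1 \<le> exp (real n + 2) * 4 ^ d 1 * (1 + 20 * G)"
    using n1 G0 by (intro mult_mono) auto
  then show ?case using G0 by (simp add: d_def)
next
  case (Suc \<nu>)
  have \<nu>: "\<nu> \<le> \<nu>max" using Suc.prems by simp
  have t: "ts \<nu> < T" using epoch_bounds(3)[OF Suc.hyps] Suc.prems by simp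
  from Suc.IH t \<nu> have IH1: "4 ^ d \<nu> \<le> 1 + 192 * G" and IH2: "exp (real \<nu>) \<le> exp (real n + 2) * 4 ^ d \<nu> * (1 + 20 * G)"
    by auto
  have one: "1 \<le> (4::real) ^ k" for k by simp
  have pos: "0 \<le> 4 ^ d \<nu> * (1 + 20 * G)" using G0 by simp
  have e4: "exp (1::real) \<le> 4" using exp_le by simp
  have eS: "exp (real (Suc \<nu>)) = exp 1 * exp (real \<nu>)" by (simp add: exp_add[symmetric])
  have small: "exp (real (Suc \<nu>)) \<le> exp (real n + 2) * 4 ^ d (Suc \<nu>) * (1 + 20 * G)" if "Suc \<nu> \<le> n + 2"
  proof -
    have "exp (real (Suc \<nu>)) * 1 * 1 \<le> exp (real n + 2) * 4 ^ d (Suc \<nu>) * (1 + 20 * G)"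
      using that G0 by (intro mult_mono one) auto
    then show ?thesis by simp
  qed
  show ?case
  proof (cases "det \<nu>")
    case True
    have dS: "d (Suc \<nu>) = Suc (d \<nu>)" using d_Suc[OF Suc.hyps] True by simp
    have "x \<nu> \<le> 12 * G"
    proof (cases "\<nu> < n")
      case True
      then show ?thesis using misfire[OF Suc.hyps \<nu> True t \<open>det \<nu>\<close>] G G0 by linarith
    next
      case False
      then show ?thesis using stable_exit[OF Suc.hyps \<nu> _ True Suc.prems(1)] G by simp
    qed
    then have "4 ^ d (Suc \<nu>) \<le> 1 + 192 * G"
      using epoch_bounds(4)[OF Suc.hyps t] \<nu> by (simp add: dS)
    moreover have "exp 1 * exp (real \<nu>) \<le> 4 * (exp (real n + 2) * 4 ^ d \<nu> * (1 + 20 * G))"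
      using e4 IH2 by (intro mult_mono) auto
    moreover have "4 * (exp (real n + 2) * 4 ^ d \<nu> * (1 + 20 * G)) = exp (real n + 2) * 4 ^ d (Suc \<nu>) * (1 + 20 * G)"
      by (simp add: dS)
    ultimately show ?thesis unfolding eS by simp
  next
    case False
    have dS: "d (Suc \<nu>) = d \<nu>" using d_Suc[OF Suc.hyps] False by simp
    have "exp (real (Suc \<nu>)) \<le> exp (real n + 2) * 4 ^ d (Suc \<nu>) * (1 + 20 * G)"
    proof (cases "\<nu> < n")
      case True
      then show ?thesis by (intro small) simp
    next
      case n: False
      then have n': "n \<le> \<nu>" by simp
      note gn = strong_gain(1)[of n, OF order_refl order_trans[OF n' \<nu>]]
      have en: "exp (real \<nu>) = exp (real n) * exp (real (\<nu> - n))"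
        using n' by (simp add: exp_add[symmetric])
      show ?thesis
      proof (cases "2 \<le> \<bar>b\<bar> * exp (real \<nu>) / R")
        case True
        have "\<bar>b\<bar> * exp (real \<nu>) / R \<le> 10 * G"
          using missed[OF Suc.hyps \<nu> t False Suc.prems(1) True] G by linarith
        then have "\<bar>b\<bar> * exp (real \<nu>) \<le> 10 * G * R" using R by (simp add: pos_divide_le_eq)
        also have "\<dots> \<le> 10 * G * (2 * (\<bar>b\<bar> * exp (real n)))" using gn G0 by (intro mult_left_mono) auto
        finally have "\<bar>b\<bar> * exp (real \<nu>) \<le> \<bar>b\<bar> * (20 * G * exp (real n))" by (simp add: mult_ac)
        moreover have "0 < \<bar>b\<bar>" using gn R by (cases "b = 0") auto
        ultimately have "exp (real \<nu>) \<le> 20 * G * exp (real n)" by simp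
        then have "exp (real (Suc \<nu>)) \<le> exp 1 * (20 * G * exp (real n))" unfolding eS by (intro mult_left_mono) auto
        also have "\<dots> = exp (real n + 1) * 1 * (20 * G)" by (simp add: exp_add)
        also have "\<dots> \<le> exp (real n + 2) * 4 ^ d (Suc \<nu>) * (1 + 20 * G)" using G0 by (intro mult_mono one) auto
        finally show ?thesis .
      next
        case False
        have "\<bar>b\<bar> * exp (real \<nu>) < 2 * R" using False R by (simp add: pos_le_divide_eq)
        also have "\<dots> \<le> 4 * (\<bar>b\<bar> * exp (real n))" using gn by simp
        finally have "(\<bar>b\<bar> * exp (real n)) * exp (real (\<nu> - n)) < (\<bar>b\<bar> * exp (real n)) * 4" unfolding en by (simp add: mult_ac)
        then have lt4: "exp (real (\<nu> - n)) < 4" using gn R by (subst (asm) mult_less_cancel_left_pos) auto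
        have "\<nu> - n < 2"
        proof (rule ccontr)
          assume "\<not> \<nu> - n < 2"
          then have "exp 2 \<le> exp (real (\<nu> - n))" by simp
          then show False using lt4 exp2 by linarith
        qed
        then show ?thesis by (intro small) simp
      qed
    qed
    then show ?thesis using IH1 by (simp add: dS)
  qed
qed

section \<open>Cost of an arbitrary path\<close>

lemma run_cases:
  assumes t: "0 \<le> t" "t < T"
  shows "t < t1 \<or> (\<exists>\<nu>. 1 \<le> \<nu> \<and> \<nu> \<le> \<nu>max \<and> ts \<nu> \<le> t \<and> t < ts (Suc \<nu>)) \<or> ts (Suc \<nu>max) \<le> t"
proof -
  have "t < t1 \<or> (\<exists>\<nu>. 1 \<le> \<nu> \<and> \<nu> \<le> k \<and> ts \<nu> \<le> t \<and> t < ts (Suc \<nu>)) \<or> ts (Suc k) \<le> t" for k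
  proof (induction k)
    case 0
    then show ?case using ts1 by auto
  next
    case (Suc k)
    then show ?case using not_le by (metis le_Suc_eq le_add1 plus_1_eq_Suc)
  qed
  then show ?thesis .
qed

lemma in_epoch:
  assumes \<nu>: "1 \<le> \<nu>" "\<nu> \<le> \<nu>max" and t: "ts \<nu> \<le> t" "t < ts (Suc \<nu>)"
  shows "(p t)\<^sup>2 + (v t)\<^sup>2 \<le> 425 * (exp (real \<nu>) * x \<nu> / \<delta>)\<^sup>2"
proof -
  have tT: "ts \<nu> < T" using t epoch_bounds(2)[of "Suc \<nu>"] by simp
  have x0: "0 < x \<nu>" using x_pos[OF \<nu>(1) tT] \<nu> by auto
  have t0: "0 \<le> ts \<nu>" using epoch_bounds(1)[OF \<nu>(1)] by simp
  note F = first_subepoch[OF \<nu>(1) t0 tT x0]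
  define B where "B = exp (real \<nu>) * x \<nu> / \<delta>"
  have \<delta>1: "(1 + \<delta>) * x \<nu> \<le> 5/4 * x \<nu>" using \<delta> x0 by (intro mult_right_mono) auto
  have "1 * x \<nu> * 1 \<le> exp (real \<nu>) * x \<nu> * (1 / \<delta>)"
    using \<delta> x0 by (intro mult_mono) (auto simp: field_simps)
  then have xB: "x \<nu> \<le> B" by (simp add: B_def)
  have eB: "exp (real \<nu>) * x \<nu> \<le> B"
  proof -
    have "exp (real \<nu>) * x \<nu> * 1 \<le> exp (real \<nu>) * x \<nu> * (1 / \<delta>)"
      using \<delta> x0 by (intro mult_left_mono) (auto simp: field_simps)
    then show ?thesis by (simp add: B_def)
  qed
  have B0: "0 \<le> B" using xB x0 by simp
  \<comment> \<open>5 = 4 * 5/4: at most 1 + \<delta> \<le> 5/4 in the test, then two doublings. The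
    final constant is 425 = 5^2 + 20^2.\<close>
  have "\<bar>p t\<bar> \<le> 5 * x \<nu> \<and> \<bar>v t\<bar> \<le> 20 * B"
  proof (cases "t < sub \<nu>")
    case True
    then have "\<bar>p t\<bar> \<le> (1 + \<delta>) * x \<nu>" using F(5)[of t] t by auto
    then have "\<bar>p t\<bar> \<le> 5 * x \<nu>" using x0 \<delta>1 by linarith
    moreover have "\<bar>v t\<bar> = B" using controls(4)[OF \<nu>, of t] True t \<delta> by (simp add: B_def abs_mult x_def)
    ultimately show ?thesis using B0 by simp
  next
    case False
    then have det: "det \<nu>" using t F(7) by (cases "det \<nu>") auto
    note L = later_subepochs[OF \<nu>(1) t0 tT x0 det]
    have "\<bar>p (sub \<nu>)\<bar> \<le> 5/4 * x \<nu>" using F(5)[of "sub \<nu>"] F(1) \<delta>1 by auto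
    moreover have "\<bar>p t\<bar> \<le> 4 * \<bar>p (sub \<nu>)\<bar>" using L(6)[of t] L(8)[of t] L(5) False t by (cases "t < th \<nu>") auto
    ultimately have p: "\<bar>p t\<bar> \<le> 5 * x \<nu>" by linarith
    have "\<bar>v t\<bar> = 4 * exp (real \<nu>) * \<bar>p t\<bar>"
      using controls(5)[OF \<nu> det, of t] controls(6)[OF \<nu> det, of t] False t by (cases "t < th \<nu>") (auto simp: abs_mult)
    also have "\<dots> \<le> 4 * exp (real \<nu>) * (5 * x \<nu>)" using p by (intro mult_left_mono) auto
    also have "\<dots> \<le> 20 * B" using eB by simp
    finally show ?thesis using p by simp
  qed
  then have "\<bar>p t\<bar> \<le> 5 * B" "\<bar>v t\<bar> \<le> 20 * B" using xB by linarith+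
  then show ?thesis unfolding B_def[symmetric] by (rule sum_squares_le) simp
qed

lemma epoch_weight:
  assumes "1 \<le> \<nu>" "ts \<nu> < T" "\<nu> \<le> Suc \<nu>max"
  shows "exp (real \<nu>) * 4 ^ d \<nu> \<le> exp (real n + 2) * (1 + 192 * G) ^ 3"
proof -
  note c = counts[OF assms]
  have "exp (real \<nu>) * 4 ^ d \<nu> \<le> (exp (real n + 2) * 4 ^ d \<nu> * (1 + 20 * G)) * 4 ^ d \<nu>"
    using c by (intro mult_right_mono) auto
  also have "\<dots> \<le> (exp (real n + 2) * (1 + 192 * G) * (1 + 192 * G)) * (1 + 192 * G)"
    using c G0 by (intro mult_mono) auto
  finally show ?thesis by (simp add: power3_eq_cube mult_ac)
qed

lemma Wst0: "0 \<le> Wst" using Wst[of 0] T by auto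

lemma final_epoch:
  assumes t: "ts (Suc \<nu>max) \<le> t" "t < T"
  shows "\<bar>p t\<bar> \<le> exp (a * (t - ts (Suc \<nu>max))) * (x (Suc \<nu>max) + 2 * Wst)" "v t = 0"
proof -
  define s where "s = ts (Suc \<nu>max)"
  have s0: "0 \<le> s" using epoch_bounds(1)[of "Suc \<nu>max"] by (simp add: s_def)
  have vz: "v r = 0 * p r" if "s \<le> r" "r < T" for r using controls(7)[of r] that by (simp add: s_def)
  then show "v t = 0" using t by (simp add: s_def)
  have "\<bar>p t - exp (a * (t - s)) * p s\<bar> \<le> exp (a * (t - s)) * (2 * Wst)"
  proof (rule unstable_response[where w = w and e = t])
    show "continuous_on {s..t} p" using s0 t by (intro p_cont_sub) auto
    show "p r - p s = w r - w s + integral {s..r} (\<lambda>r. a * p r)" if "r \<in> {s..t}" for r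
      using increment_feedback[of s r 0 0] vz s0 t that by simp
    show "\<bar>w r - w s\<bar> \<le> 2 * Wst" if "r \<in> {s..t}" for r
      using Wst[of r] Wst[of s] s0 t that by auto
  qed (use t a0 in \<open>auto simp: s_def\<close>)
  then have "\<bar>p t\<bar> \<le> \<bar>exp (a * (t - s)) * p s\<bar> + exp (a * (t - s)) * (2 * Wst)" by linarith
  then show "\<bar>p t\<bar> \<le> exp (a * (t - ts (Suc \<nu>max))) * (x (Suc \<nu>max) + 2 * Wst)"
    by (simp add: x_def s_def[symmetric] abs_mult algebra_simps)
qed

text \<open>The sixth power is the square of the cube in \<open>epoch_weight\<close>, and 27200 =
  425 * 8^2. In the final epoch the free growth up to T is at most exp (a T) \<le> exp (\<nu>max +
  1), no worse than the gain of one further epoch; this is why the strategy stops testing after the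
  integer part of a T epochs.\<close>

lemma crude_bound:
  assumes t: "0 \<le> t" "t < T"
  shows "(p t)\<^sup>2 + (v t)\<^sup>2 \<le> 27200 * q0\<^sup>2 / \<delta>\<^sup>2 * (exp (real n + 2))\<^sup>2 * (1 + 192 * G) ^ 6 * (1 + Wst)\<^sup>2"
proof -
  define E where "E = exp (real n + 2) * (1 + 192 * G) ^ 3"
  define B where "B = q0 * E / \<delta> * (1 + Wst)"
  have E1: "1 \<le> E"
  proof -
    have "1 * 1 \<le> exp (real n + 2) * (1 + 192 * G) ^ 3" using G0 by (intro mult_mono one_le_power) auto
    then show ?thesis by (simp add: E_def)
  qed
  have \<delta>1: "1 \<le> 1 / \<delta>" using \<delta> by (simp add: field_simps)
  have qE: "q0 * E \<le> B"
  proof -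
    have "q0 * E * 1 * 1 \<le> q0 * E * (1 / \<delta>) * (1 + Wst)"
      using q0 E1 \<delta>1 Wst0 \<delta> by (intro mult_mono mult_nonneg_nonneg) auto
    then show ?thesis by (simp add: B_def)
  qed
  have q1: "q0 * 1 \<le> q0 * E" using q0 E1 by (intro mult_left_mono) auto
  have "(p t)\<^sup>2 + (v t)\<^sup>2 \<le> 27200 * B\<^sup>2"
  proof -
    consider "t < t1" | \<nu> where "1 \<le> \<nu>" "\<nu> \<le> \<nu>max" "ts \<nu> \<le> t" "t < ts (Suc \<nu>)" | "ts (Suc \<nu>max) \<le> t"
      using run_cases[OF t] by blast
    then show ?thesis
    proof cases
      case 1
      have p: "\<bar>p t\<bar> \<le> 4 * q0" using start(4)[of t] 1 t by auto
      have "\<bar>v t\<bar> \<le> 4 * \<bar>p t\<bar>"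
      proof (cases "t < t0")
        case True
        then show ?thesis using controls(1)[of t] t by auto
      next
        case False
        then have "t0 < 1 / (10 * a)" using 1 t1(2) by auto
        then show ?thesis using controls(2,3)[of t] t0(4) False 1 by auto
      qed
      then have "\<bar>p t\<bar> \<le> 4 * B" "\<bar>v t\<bar> \<le> 16 * B" using p q1 qE by linarith+
      then show ?thesis by (rule sum_squares_le) simp
    next
      case 2
      have tT: "ts \<nu> < T" using 2 t by simp
      have x0: "0 < x \<nu>" using x_pos[OF 2(1) tT] 2 by auto
      have "exp (real \<nu>) * x \<nu> \<le> exp (real \<nu>) * (8 * q0 * 4 ^ d \<nu>)"
        using epoch_bounds(5)[OF 2(1) tT] 2 by (intro mult_left_mono) auto
      also have "\<dots> = 8 * q0 * (exp (real \<nu>) * 4 ^ d \<nu>)" by simp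
      also have "\<dots> \<le> 8 * q0 * E"
        unfolding E_def using epoch_weight[OF 2(1) tT] 2 q0 by (intro mult_left_mono) auto
      finally have "exp (real \<nu>) * x \<nu> / \<delta> \<le> 8 * q0 * E / \<delta>" using \<delta> by (intro divide_right_mono) auto
      also have "\<dots> * 1 \<le> 8 * q0 * E / \<delta> * (1 + Wst)" using q0 E1 \<delta> Wst0 by (intro mult_left_mono) auto
      finally have "exp (real \<nu>) * x \<nu> / \<delta> \<le> 8 * B" by (simp add: B_def)
      then have "(exp (real \<nu>) * x \<nu> / \<delta>)\<^sup>2 \<le> (8 * B)\<^sup>2" using x0 \<delta> by (intro power_mono) auto
      then have "(exp (real \<nu>) * x \<nu> / \<delta>)\<^sup>2 \<le> 64 * B\<^sup>2" by (simp add: power_mult_distrib)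
      with in_epoch[OF 2] show ?thesis by linarith
    next
      case 3
      define \<nu> where "\<nu> = Suc \<nu>max"
      have \<nu>: "1 \<le> \<nu>" "ts \<nu> < T" "\<nu> \<le> Suc \<nu>max" using 3 t by (auto simp: \<nu>_def)
      have s0: "0 < ts \<nu>" by (rule epoch_bounds(1)[OF \<nu>(1)])
      have x0: "0 < x \<nu>" using x_pos[OF \<nu>] by simp
      have "a * (t - ts \<nu>) \<le> a * T" using s0 t a0 by (intro mult_left_mono) auto
      also have "\<dots> \<le> real \<nu>" using \<nu>max(2) by (simp add: \<nu>_def)
      finally have e: "exp (a * (t - ts \<nu>)) \<le> exp (real \<nu>)" by simp
      have "\<bar>p t\<bar> \<le> exp (a * (t - ts \<nu>)) * (x \<nu> + 2 * Wst)" unfolding \<nu>_def by (rule final_epoch(1)[OF 3 t(2)])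
      also have "\<dots> \<le> exp (real \<nu>) * (8 * q0 * 4 ^ d \<nu> * (1 + Wst))"
      proof (intro mult_mono e)
        have "1 * 1 * (2 * Wst) \<le> q0 * 4 ^ d \<nu> * (8 * Wst)" using q0 Wst0 by (intro mult_mono) auto
        then show "x \<nu> + 2 * Wst \<le> 8 * q0 * 4 ^ d \<nu> * (1 + Wst)"
          using epoch_bounds(5)[OF \<nu>] by (simp add: algebra_simps)
      qed (use x0 Wst0 in auto)
      also have "\<dots> = 8 * q0 * (exp (real \<nu>) * 4 ^ d \<nu>) * (1 + Wst)" by simp
      also have "\<dots> \<le> 8 * q0 * E * (1 + Wst)"
        unfolding E_def using epoch_weight[OF \<nu>] q0 Wst0 by (intro mult_left_mono mult_right_mono) auto
      also have "\<dots> \<le> 8 * q0 * E * (1 + Wst) * (1 / \<delta>)" using mult_left_mono[OF \<delta>1, of "8 * q0 * E * (1 + Wst)"] q0 E1 Wst0 by simp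
      also have "\<dots> = 8 * B" by (simp add: B_def)
      finally have "\<bar>p t\<bar> \<le> 8 * B" .
      moreover have "\<bar>v t\<bar> \<le> 0 * B" using final_epoch(2)[OF 3 t(2)] by simp
      ultimately show ?thesis by (rule sum_squares_le) simp
    qed
  qed
  also have "27200 * B\<^sup>2 = 27200 * q0\<^sup>2 / \<delta>\<^sup>2 * (exp (real n + 2))\<^sup>2 * (1 + 192 * G) ^ 6 * (1 + Wst)\<^sup>2"
    by (simp add: B_def E_def power_mult_distrib power_divide power_mult[symmetric])
  finally show ?thesis .
qed

end

section \<open>Cost of a quiet path\<close>

text \<open>With G this small errors are excluded: at the start of an epoch |p| is at least 1/4 by
  \<open>x_pos\<close>, whereas a misfire or a departure from a stable stage would require at most
  12 G.\<close>

locale quiet_large_path = large_path +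
  assumes G_small: "G \<le> 1/1000"
begin

lemma m_small: "m \<le> 1/1000" using G G_small by linarith

definition S :: real where "S = 1 + Q + Wst\<^sup>2"

lemma S: "1 \<le> S" "Q \<le> S" "Wst\<^sup>2 \<le> S" "1 + Wst\<^sup>2 \<le> S"
  using Q0 by (auto simp: S_def)

lemma epoch0_feedback: "0 \<le> r \<Longrightarrow> r < t0 \<Longrightarrow> v r = - 1 * p r"
  using controls(1)[of r] by simp

lemma epoch0_down:
  assumes "r \<in> {0..t0}" "r \<le> 2 / R" "a \<le> b"
  shows "\<bar>p r - exp ((a - b) * r) * q0\<bar> \<le> 2 * m"
  using stable_short[of 0 r "- 1" r] epoch0_feedback assms t0_T p0 by auto

lemma epoch0_up:
  assumes "r \<in> {0..t0}" "r \<le> 2 / R" "b \<le> a"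
  shows "\<bar>p r - exp ((a - b) * r) * q0\<bar> \<le> exp ((a - b) * r) * m"
  using unstable_short[of 0 r "- 1" r] epoch0_feedback assms t0_T p0 by auto

text \<open>For |b| > 40 a the feedback u = -q changes q0 by time 2 / R = 2 / |b| by a factor of at
  most exp (-1) \<le> 2/5 or at least exp 2 \<ge> 5, so the path has left the band, and 2 / |b| < 1
  / (10 a). For |b| \<le> 40 a the length 1 / (10 a) of the test is itself below 2 / R = 2 /
  a.\<close>

lemma t0_short: "t0 \<le> 2 / R" "40 * a < \<bar>b\<bar> \<Longrightarrow> t0 < 1 / (10 * a)"
proof -
  have "t0 \<le> 2 / R \<and> (40 * a < \<bar>b\<bar> \<longrightarrow> t0 < 1 / (10 * a))"
  proof (cases "\<bar>b\<bar> \<le> 40 * a")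
    case True
    then have "R = a" by (simp add: R_def)
    then have "1 / (10 * a) \<le> 2 / R" using a0 by (simp add: field_simps)
    then show ?thesis using t0(2) True by auto
  next
    case False
    then have Rb: "R = \<bar>b\<bar>" by (simp add: R_def)
    have "t0 \<le> 2 / R"
    proof (rule ccontr)
      assume "\<not> t0 \<le> 2 / R"
      then have r: "2 / R \<in> {0..t0}" using R by auto
      have band: "q0 / 2 \<le> p (2 / R)" "p (2 / R) \<le> 2 * q0" using t0(3)[OF r] by auto
      show False
      proof (cases "a \<le> b")
        case True
        then have "R = b" using a0 Rb by simp
        then have "(a - b) * (2 / R) \<le> - 1" using False True a0 by (simp add: field_simps)
        then have "exp ((a - b) * (2 / R)) \<le> exp (- 1)" by simp
        also have "\<dots> \<le> 2/5"
        proof -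
          have "5/2 \<le> exp (1::real)" using exp_lower_Taylor_quadratic[of "1::real"] by simp
          then show ?thesis by (simp add: exp_minus field_simps)
        qed
        finally have "exp ((a - b) * (2 / R)) * q0 \<le> 2/5 * q0" using q0 by (intro mult_right_mono) auto
        then show False using epoch0_down[OF r order_refl True] band m_small q0 by linarith
      next
        case nb: False
        then have "b < 0" using False a0 by linarith
        then have "R = - b" using Rb by simp
        then have "2 \<le> (a - b) * (2 / R)" using \<open>b < 0\<close> a0 by (simp add: field_simps)
        then have "exp 2 \<le> exp ((a - b) * (2 / R))" by simp
        then have E: "5 \<le> exp ((a - b) * (2 / R))" using exp2 by linarith
        have "5 * (q0 - m) \<le> exp ((a - b) * (2 / R)) * (q0 - m)" using E m_small q0 by (intro mult_right_mono) auto
        moreover have "exp ((a - b) * (2 / R)) * (q0 - m) \<le> p (2 / R)"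
          using epoch0_up[OF r order_refl] nb by (simp add: right_diff_distrib abs_le_iff)
        ultimately have "5 * (q0 - m) \<le> p (2 / R)" by (rule order_trans)
        then have "5 * q0 - 5 * m \<le> p (2 / R)" by (simp only: right_diff_distrib)
        then show False using band m_small q0 by linarith
      qed
    qed
    moreover have "2 / R < 1 / (10 * a)" using False Rb a0 by (simp add: field_simps)
    ultimately show ?thesis by simp
  qed
  then show "t0 \<le> 2 / R" "40 * a < \<bar>b\<bar> \<Longrightarrow> t0 < 1 / (10 * a)" by auto
qed

text \<open>The test lasts at most 1 / (10 a). If b < 4 a the exponent (a - b) t0 is at least -3/10,
  and exp (-3/10) \<ge> 7/10 keeps the path away from q0 / 2. If b > -4 a it is at most 1/2, and exp
  (1/2) \<le> 7/4 keeps it away from 2 q0. So an exit shows the sign of b and also |b| \<ge> 4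
  a.\<close>

lemma correct_sign:
  assumes "t0 < 1 / (10 * a)"
  shows "p t0 = q0 / 2 \<and> 4 * a \<le> b \<or> p t0 = 2 * q0 \<and> b \<le> - 4 * a"
proof -
  have r: "t0 \<in> {0..t0}" using t0(1) by simp
  have t10: "t0 * a \<le> 1/10" using t0(2) a0 by (simp add: field_simps)
  have "4 * a \<le> b" if p: "p t0 = q0 / 2"
  proof (rule ccontr)
    assume nb: "\<not> 4 * a \<le> b"
    show False
    proof (cases "a \<le> b")
      case True
      have "(4 * a - b) * t0 \<ge> 0" using nb t0(1) by simp
      then have "- (3/10) \<le> (a - b) * t0" using t10 by (simp add: algebra_simps)
      then have "7/10 \<le> exp ((a - b) * t0)" using exp_ge_add_one_self[of "(a - b) * t0"] by linarith
      then have "7/10 * q0 \<le> exp ((a - b) * t0) * q0" using q0 by (intro mult_right_mono) auto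
      then show False using epoch0_down[OF r t0_short(1) True] p m_small q0 by linarith
    next
      case False
      then have E: "1 \<le> exp ((a - b) * t0)" using t0(1) by simp
      have "1 * (q0 - m) \<le> exp ((a - b) * t0) * (q0 - m)" using E m_small q0 by (intro mult_right_mono) auto
      moreover have "exp ((a - b) * t0) * (q0 - m) \<le> p t0"
        using epoch0_up[OF r t0_short(1)] False by (simp add: right_diff_distrib abs_le_iff)
      ultimately have "1 * (q0 - m) \<le> p t0" by (rule order_trans)
      then have "q0 - m \<le> p t0" by (simp only: mult_1)
      then show False using p m_small q0 by linarith
    qed
  qed
  moreover have "b \<le> - 4 * a" if p: "p t0 = 2 * q0"
  proof (rule ccontr)
    assume nb: "\<not> b \<le> - 4 * a"
    show False
    proof (cases "a \<le> b")
      case True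
      then have "exp ((a - b) * t0) \<le> 1" using t0(1) by (simp add: mult_nonpos_nonneg)
      then have "exp ((a - b) * t0) * q0 \<le> 1 * q0" using q0 by (intro mult_right_mono) auto
      then show False using epoch0_down[OF r t0_short(1) True] p m_small q0 by linarith
    next
      case False
      have "(4 * a + b) * t0 \<ge> 0" using nb t0(1) by simp
      then have y: "(a - b) * t0 \<le> 1/2" using t10 by (simp add: algebra_simps)
      have "exp ((a - b) * t0) \<le> exp (1/2)" using y by simp
      also have "\<dots> \<le> 1 + 1/2 + (1/2)\<^sup>2" by (rule exp_bound) auto
      finally have E: "exp ((a - b) * t0) \<le> 7/4" by (simp add: power2_eq_square)
      have "p t0 \<le> exp ((a - b) * t0) * (q0 + m)"
        using epoch0_up[OF r t0_short(1)] False by (simp add: distrib_left abs_le_iff)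
      also have "\<dots> \<le> 7/4 * (q0 + m)" using E m0 q0 by (intro mult_right_mono) auto
      finally have "p t0 \<le> 7/4 * q0 + 7/4 * m" by (simp only: distrib_left)
      then show False using p m_small q0 by linarith
    qed
  qed
  ultimately show ?thesis using t0(4)[OF assms] by blast
qed

lemma epoch0_cost: "cost 0 t0 \<le> ennreal (16 * q0\<^sup>2 / R)"
proof -
  have "cost 0 t0 \<le> ennreal (8 * q0\<^sup>2 * (t0 - 0))"
  proof (rule cost_pointwise)
    fix t assume t: "0 \<le> t" "t < t0"
    have "\<bar>p t\<bar> \<le> 2 * q0" "v t = - p t" using t0(3)[of t] controls(1)[of t] t q0 by auto
    then have "\<bar>p t\<bar> \<le> 2 * q0" "\<bar>v t\<bar> \<le> 2 * q0" by auto
    then show "(p t)\<^sup>2 + (v t)\<^sup>2 \<le> 8 * q0\<^sup>2" by (rule sum_squares_le) simp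
  qed (use t0 in auto)
  also have "8 * q0\<^sup>2 * (t0 - 0) \<le> 8 * q0\<^sup>2 * (2 / R)" using t0_short(1) by (intro mult_left_mono) auto
  finally show ?thesis by (simp add: ennreal_leI)
qed

text \<open>Since |b| \<ge> 4 a and the sign is right, the feedback of gain 4 is stable at rate 4
  |b| - a \<ge> R / 2. It would end only at a doubling, but |p| grows by at most 6 m; hence it lasts
  until T.\<close>

lemma quiet_epoch0:
  assumes "t0 < 1 / (10 * a)"
  shows "cost 0 T \<le> ennreal (2000 * q0\<^sup>2 / R * S)"
proof -
  define g where "g = (if p t0 = q0 / 2 then - 4 else 4 :: real)"
  have vg: "v r = g * p r" if "t0 \<le> r" "r < t1" for r
    using controls(2,3)[OF assms, of r] t0(4)[OF assms] that by (auto simp: g_def)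
  have "R \<le> 2 * (4 * \<bar>b\<bar> - a) \<and> a + b * g = a - 4 * \<bar>b\<bar>"
    using correct_sign[OF assms] a0 q0 by (auto simp: R_def g_def abs_if)
  then have rate: "1 \<le> - (a + b * g) * (2 / R)" using R by (simp add: field_simps)
  have pt: "q0 / 2 \<le> p t0" "p t0 \<le> 2 * q0" using t0(3)[of t0] t0(1) by auto
  have t0': "0 \<le> t0" using t0(1) by simp
  have "t1 = T"
  proof (rule ccontr)
    assume "t1 \<noteq> T"
    then have lt: "t1 < T" using start(2) by simp
    have "\<bar>p t1\<bar> \<le> \<bar>p t0\<bar> + 6 * m"
      by (rule stable(1)[OF t0' start(3,2) vg rate]) (use start in auto)
    moreover have "\<bar>p t1\<bar> = 2 * \<bar>p t0\<bar>"
      using doubling_time_facts(4)[OF t0' t0_T] lt pt q0 by (auto simp: t1(1)[OF assms])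
    ultimately show False using pt q0 m_small by linarith
  qed
  then have "cost t0 T \<le> ennreal ((1 + g\<^sup>2) * (2 / R * (4 * (p t0)\<^sup>2 + 40 * Q)))"
    using stable(2)[OF t0' start(3,2) vg rate] by simp
  also have "\<dots> \<le> ennreal (17 * (2 / R * (56 * (q0\<^sup>2 * S))))"
  proof (intro ennreal_leI mult_mono mult_left_mono)
    show "1 + g\<^sup>2 \<le> 17" by (simp add: g_def)
    have "\<bar>p t0\<bar> \<le> 2 * q0" using pt q0 by simp
    then have "(p t0)\<^sup>2 \<le> (2 * q0)\<^sup>2" using power_mono[of "\<bar>p t0\<bar>" "2 * q0" 2] by simp
    then have "4 * (p t0)\<^sup>2 \<le> 16 * (q0\<^sup>2 * 1)" by (simp add: power_mult_distrib)
    also have "\<dots> \<le> 16 * (q0\<^sup>2 * S)" using S by (intro mult_left_mono) auto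
    finally have 1: "4 * (p t0)\<^sup>2 \<le> 16 * (q0\<^sup>2 * S)" .
    have "1 * Q \<le> q0\<^sup>2 * S" using q0 S Q0 by (intro mult_mono) auto
    with 1 show "4 * (p t0)\<^sup>2 + 40 * Q \<le> 56 * (q0\<^sup>2 * S)" by linarith
  qed (use R Q0 in auto)
  finally have c2: "cost t0 T \<le> ennreal (17 * (2 / R * (56 * (q0\<^sup>2 * S))))" .
  have "q0\<^sup>2 / R * 1 \<le> q0\<^sup>2 / R * S" using R S by (intro mult_left_mono) auto
  moreover have "0 \<le> q0\<^sup>2 / R * S" using R S by simp
  moreover have "17 * (2 / R * (56 * (q0\<^sup>2 * S))) = 1904 * (q0\<^sup>2 / R * S)" "16 * q0\<^sup>2 / R = 16 * (q0\<^sup>2 / R * 1)"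
    "2000 * q0\<^sup>2 / R * S = 2000 * (q0\<^sup>2 / R * S)" by simp_all
  ultimately have sum: "16 * q0\<^sup>2 / R + 17 * (2 / R * (56 * (q0\<^sup>2 * S))) \<le> 2000 * q0\<^sup>2 / R * S" by linarith
  show ?thesis
    by (rule cost_split'[OF _ _ _ order_refl epoch0_cost c2 _ _ sum]) (use t0' t0_T R S in auto)
qed

lemma quiet_weak:
  assumes "\<not> t0 < 1 / (10 * a)"
  shows "R = a" "\<bar>b\<bar> \<le> 40 * a" "t1 < T"
proof -
  show "\<bar>b\<bar> \<le> 40 * a" using assms t0_short(2) by linarith
  then show "R = a" by (simp add: R_def)
  show "t1 < T" using t1(2)[OF assms] t0_T by simp
qed

text \<open>The control is of size exp \<nu> x / \<delta> and the test lasts at most \<delta>^2 / a,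
  so \<delta> cancels: a small threshold makes the test no more expensive.\<close>

lemma first_subepoch_cost:
  assumes \<nu>: "1 \<le> \<nu>" "\<nu> \<le> \<nu>max" and t: "ts \<nu> < T" and d0: "d \<nu> = 0"
  shows "cost (ts \<nu>) (sub \<nu>) \<le> ennreal (27200 * q0\<^sup>2 / a * (exp (real \<nu>))\<^sup>2)"
proof -
  have x0: "0 < x \<nu>" using x_pos[OF \<nu>(1) t] \<nu> by auto
  have t0: "0 \<le> ts \<nu>" using epoch_bounds(1)[OF \<nu>(1)] by simp
  note F = first_subepoch[OF \<nu>(1) t0 t x0]
  have le: "sub \<nu> \<le> ts (Suc \<nu>)"
    using F(7) later_subepochs(2,3)[OF \<nu>(1) t0 t x0] by (cases "det \<nu>") auto
  have "cost (ts \<nu>) (sub \<nu>) \<le> ennreal (425 * (exp (real \<nu>) * x \<nu> / \<delta>)\<^sup>2 * (sub \<nu> - ts \<nu>))"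
    by (rule cost_pointwise) (use F(1) le in_epoch[OF \<nu>] in auto)
  also have "\<dots> \<le> ennreal (425 * (exp (real \<nu>) * (8 * q0) / \<delta>)\<^sup>2 * \<tau>)"
  proof (intro ennreal_leI mult_mono power_mono divide_right_mono)
    show "x \<nu> \<le> 8 * q0" using epoch_bounds(5)[OF \<nu>(1) t] \<nu> d0 by simp
  qed (use F(1,3) x0 \<delta> in auto)
  also have "425 * (exp (real \<nu>) * (8 * q0) / \<delta>)\<^sup>2 * \<tau> = 27200 * q0\<^sup>2 / a * (exp (real \<nu>))\<^sup>2"
    using \<delta> by (simp add: \<tau>_def power_mult_distrib power_divide)
  finally show ?thesis .
qed

lemma cost_refl: "cost s s \<le> ennreal 0"
  using cost_pointwise[of s s 0] by simp

text \<open>The costs of the tests grow by a factor exp 2 \<ge> 2 from one epoch to the next, so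
  their sum is dominated by the last one.\<close>

lemma undetected_prefix:
  assumes weak: "\<not> t0 < 1 / (10 * a)"
  shows "1 \<le> \<nu> \<Longrightarrow> \<nu> \<le> Suc \<nu>max \<Longrightarrow> (\<And>i. 1 \<le> i \<Longrightarrow> i < \<nu> \<Longrightarrow> \<not> det i) \<Longrightarrow>
    cost 0 (ts \<nu>) \<le> ennreal (27200 * q0\<^sup>2 / a * (exp (real \<nu>))\<^sup>2)"
proof (induction \<nu> rule: nat_induct_at_least)
  case base
  have "cost 0 (ts 1) \<le> ennreal (16 * q0\<^sup>2 / a)"
    using epoch0_cost t1(2)[OF weak] by (simp add: ts1 quiet_weak(1)[OF weak])
  also have "\<dots> \<le> ennreal (27200 * q0\<^sup>2 / a * (exp (real 1))\<^sup>2)"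
  proof (rule ennreal_leI)
    have "16 * (q0\<^sup>2 / a) * 1 \<le> 27200 * (q0\<^sup>2 / a) * (exp (real 1))\<^sup>2"
      using a0 by (intro mult_mono one_le_power) auto
    then show "16 * q0\<^sup>2 / a \<le> 27200 * q0\<^sup>2 / a * (exp (real 1))\<^sup>2" by simp
  qed
  finally show ?case by simp
next
  case (Suc \<nu>)
  have IH: "cost 0 (ts \<nu>) \<le> ennreal (27200 * q0\<^sup>2 / a * (exp (real \<nu>))\<^sup>2)" using Suc by simp
  have nd: "\<not> det \<nu>" using Suc by simp
  have "cost (ts \<nu>) (ts (Suc \<nu>)) \<le> ennreal (27200 * q0\<^sup>2 / a * (exp (real \<nu>))\<^sup>2)"
  proof (cases "ts \<nu> < T")
    case True
    have "d \<nu> = 0" using Suc.prems by (auto simp: d_def)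
    moreover have "ts (Suc \<nu>) = sub \<nu>" using ts_Suc[OF Suc.hyps] nd by simp
    ultimately show ?thesis using first_subepoch_cost[OF Suc.hyps _ True] Suc.prems by simp
  next
    case False
    then have "ts \<nu> = T" "ts (Suc \<nu>) = T"
      using epoch_bounds(2)[OF Suc.hyps] epoch_bounds(2)[of "Suc \<nu>"] epoch_bounds(3)[OF Suc.hyps] by auto
    then show ?thesis using cost_refl[of T] by (auto simp: bot.extremum_unique)
  qed
  moreover have "2 * (exp (real \<nu>))\<^sup>2 \<le> (exp (real (Suc \<nu>)))\<^sup>2"
  proof -
    have "exp (real (Suc \<nu>)) = exp 1 * exp (real \<nu>)" by (simp add: exp_add[symmetric])
    then have "(exp (real (Suc \<nu>)))\<^sup>2 = (exp 1)\<^sup>2 * (exp (real \<nu>))\<^sup>2" by (simp add: power_mult_distrib)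
    moreover have "(exp (1::real))\<^sup>2 = exp 2" by (simp add: power2_eq_square exp_add[symmetric])
    ultimately show ?thesis using exp2 by (simp add: mult_right_mono)
  qed
  then have "27200 * q0\<^sup>2 / a * (2 * (exp (real \<nu>))\<^sup>2) \<le> 27200 * q0\<^sup>2 / a * (exp (real (Suc \<nu>)))\<^sup>2"
    using a0 by (intro mult_left_mono) auto
  ultimately show ?case
    using epoch_bounds(1,2,3)[OF Suc.hyps] epoch_bounds(2)[of "Suc \<nu>"] a0
    by (intro cost_split'[OF _ _ _ _ IH]) auto
qed

text \<open>A misfire being excluded, the epoch is strong. If b < 0, the second subepoch is stable
  and lasts until T. Otherwise it is unstable and ends by doubling within one window of length 2 /
  R, and the third subepoch is stable and lasts until T.\<close>

lemma detected_tail: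
  assumes weak: "\<not> t0 < 1 / (10 * a)" and \<nu>: "1 \<le> \<nu>" "\<nu> \<le> \<nu>max" and t: "ts \<nu> < T" and d0: "d \<nu> = 0" and det: "det \<nu>"
  shows "cost (ts \<nu>) T \<le> ennreal (150000 * q0\<^sup>2 / a * (exp (real \<nu>))\<^sup>2 * S)"
proof -
  have Ra: "R = a" by (rule quiet_weak[OF weak])
  have x1: "1/4 \<le> x \<nu>" using x_pos[OF \<nu>(1) t] \<nu> by auto
  then have x0: "0 < x \<nu>" by simp
  have t0: "0 \<le> ts \<nu>" using epoch_bounds(1)[OF \<nu>(1)] by simp
  note F = first_subepoch[OF \<nu>(1) t0 t x0] and L = later_subepochs[OF \<nu>(1) t0 t x0 det]
  have s0: "0 \<le> sub \<nu>" using F(1) t0 by simp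
  have n\<nu>: "n \<le> \<nu>"
  proof (rule ccontr)
    assume "\<not> n \<le> \<nu>"
    then have "x \<nu> \<le> 8/3 * (m' / \<delta>)" using misfire[OF \<nu> _ t det] by simp
    then show False using G G_small x1 by linarith
  qed
  note g = strong_gain[OF n\<nu> \<nu>(2)]
  have "(1 - \<delta>) * x \<nu> \<le> \<bar>p (sub \<nu>)\<bar>" "\<bar>p (sub \<nu>)\<bar> \<le> (1 + \<delta>) * x \<nu>" using F(5)[of "sub \<nu>"] F(1) by auto
  moreover have "1/2 * x \<nu> \<le> (1 - \<delta>) * x \<nu>" "(1 + \<delta>) * x \<nu> \<le> 5/4 * x \<nu>"
    using \<delta> x0 by (auto intro!: mult_right_mono)
  moreover have "x \<nu> \<le> 8 * q0" using epoch_bounds(5)[OF \<nu>(1) t] \<nu> d0 by simp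
  ultimately have ps: "1/8 \<le> \<bar>p (sub \<nu>)\<bar>" "\<bar>p (sub \<nu>)\<bar> \<le> 10 * q0" using x1 by linarith+
  define U where "U = (exp (real \<nu>))\<^sup>2"
  have U1: "1 \<le> U" unfolding U_def by (intro one_le_power) auto
  have qS: "Q \<le> q0\<^sup>2 * S"
  proof -
    have "1 * Q \<le> q0\<^sup>2 * S" using q0 S Q0 by (intro mult_mono) auto
    then show ?thesis by simp
  qed
  have q1: "q0\<^sup>2 * 1 \<le> q0\<^sup>2 * S" using S by (intro mult_left_mono) auto
  have gain: "1 + g\<^sup>2 \<le> 17 * U" if "g = 4 * exp (real \<nu>) \<or> g = - 4 * exp (real \<nu>)" for g
    using that U1 by (auto simp: U_def power_mult_distrib)
  have stab: "cost s T \<le> ennreal (17 * U * (2 / a * (1640 * (q0\<^sup>2 * S))))"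
    if "cost s T \<le> ennreal ((1 + g\<^sup>2) * (2 / R * (4 * (p s)\<^sup>2 + 40 * Q)))" "\<bar>p s\<bar> \<le> 20 * q0"
      "g = 4 * exp (real \<nu>) \<or> g = - 4 * exp (real \<nu>)" for s g
  proof (rule order_trans[OF that(1)], unfold Ra, intro ennreal_leI mult_mono mult_left_mono gain that)
    have "(p s)\<^sup>2 \<le> (20 * q0)\<^sup>2" using power_mono[OF that(2), of 2] by simp
    then show "4 * (p s)\<^sup>2 + 40 * Q \<le> 1640 * (q0\<^sup>2 * S)" using qS q1 by (simp add: power_mult_distrib)
  qed (use a0 Q0 U1 in auto)
  have later: "cost (sub \<nu>) T \<le> ennreal (120000 * (U * (q0\<^sup>2 / a) * S))"
  proof (cases "b < 0")
    case True
    have thT: "th \<nu> = T"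
    proof (rule ccontr)
      assume "th \<nu> \<noteq> T"
      then have lt: "th \<nu> < T" using L(3,4) by simp
      have "\<bar>p (th \<nu>)\<bar> \<le> \<bar>p (sub \<nu>)\<bar> + 6 * m"
        by (rule stable(1)[of "sub \<nu>" "th \<nu>" "4 * exp (real \<nu>)"])
           (use controls(5)[OF \<nu> det] L s0 stable_rate(1)[OF g True] lt in auto)
      then show False using L(7)[OF lt] ps m_small by linarith
    qed
    have "cost (sub \<nu>) T \<le> ennreal ((1 + (4 * exp (real \<nu>))\<^sup>2) * (2 / R * (4 * (p (sub \<nu>))\<^sup>2 + 40 * Q)))"
      using stable(2)[of "sub \<nu>" T "4 * exp (real \<nu>)"] controls(5)[OF \<nu> det] L s0 stable_rate(1)[OF g True] thT by auto
    then have "cost (sub \<nu>) T \<le> ennreal (17 * U * (2 / a * (1640 * (q0\<^sup>2 * S))))"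
      by (rule stab) (use ps q0 in auto)
    also have "\<dots> \<le> ennreal (120000 * (U * (q0\<^sup>2 / a) * S))"
    proof (rule ennreal_leI)
      have "0 \<le> U * (q0\<^sup>2 / a) * S" using U1 a0 S by simp
      moreover have "17 * U * (2 / a * (1640 * (q0\<^sup>2 * S))) = 55760 * (U * (q0\<^sup>2 / a) * S)" by simp
      ultimately show "17 * U * (2 / a * (1640 * (q0\<^sup>2 * S))) \<le> 120000 * (U * (q0\<^sup>2 / a) * S)" by linarith
    qed
    finally show ?thesis .
  next
    case False
    then have b: "0 \<le> b" by simp
    have sth: "th \<nu> \<le> sub \<nu> + 2 / R"
    proof (rule unstable_doubles[of _ _ "4 * exp (real \<nu>)"])
      show "2 \<le> (a + b * (4 * exp (real \<nu>))) * (2 / R)" by (rule stable_rate(3)[OF g b])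
    qed (use controls(5)[OF \<nu> det] L s0 ps m_small in auto)
    have "cost (sub \<nu>) (th \<nu>) \<le> ennreal (17 * U * (400 * q0\<^sup>2) * (th \<nu> - sub \<nu>))"
    proof (rule cost_pointwise)
      fix t assume t: "sub \<nu> \<le> t" "t < th \<nu>"
      have "\<bar>p t\<bar> \<le> 20 * q0" using L(6)[of t] ps t by auto
      then have "(p t)\<^sup>2 \<le> (20 * q0)\<^sup>2" using power_mono[of "\<bar>p t\<bar>" "20 * q0" 2] by simp
      then have "(1 + (4 * exp (real \<nu>))\<^sup>2) * (p t)\<^sup>2 \<le> 17 * U * (400 * q0\<^sup>2)"
        using U1 by (intro mult_mono gain) (auto simp: power_mult_distrib)
      moreover have "(v t)\<^sup>2 = (4 * exp (real \<nu>))\<^sup>2 * (p t)\<^sup>2"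
        using controls(5)[OF \<nu> det, of t] t by (simp add: power_mult_distrib)
      ultimately show "(p t)\<^sup>2 + (v t)\<^sup>2 \<le> 17 * U * (400 * q0\<^sup>2)" by (simp add: distrib_right)
    qed (use L U1 in auto)
    also have "\<dots> \<le> ennreal (17 * U * (400 * q0\<^sup>2) * (2 / a))"
      using sth Ra U1 by (intro ennreal_leI mult_left_mono) auto
    finally have c1: "cost (sub \<nu>) (th \<nu>) \<le> ennreal (17 * U * (400 * q0\<^sup>2) * (2 / a))" .
    have c2: "cost (th \<nu>) T \<le> ennreal (17 * U * (2 / a * (1640 * (q0\<^sup>2 * S))))"
    proof (cases "th \<nu> < T")
      case True
      have pth: "\<bar>p (th \<nu>)\<bar> = 2 * \<bar>p (sub \<nu>)\<bar>" by (rule L(7)[OF True])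
      have tST: "ts (Suc \<nu>) = T"
      proof (rule ccontr)
        assume "ts (Suc \<nu>) \<noteq> T"
        then have lt: "ts (Suc \<nu>) < T" using L(4) by simp
        have "\<bar>p (ts (Suc \<nu>))\<bar> \<le> \<bar>p (th \<nu>)\<bar> + 6 * m"
          by (rule stable(1)[of "th \<nu>" "ts (Suc \<nu>)" "- 4 * exp (real \<nu>)"])
             (use controls(6)[OF \<nu> det] L s0 stable_rate(2)[OF g b] lt in auto)
        then show False using L(9)[OF lt] pth ps m_small by linarith
      qed
      have "cost (th \<nu>) T \<le> ennreal ((1 + (- 4 * exp (real \<nu>))\<^sup>2) * (2 / R * (4 * (p (th \<nu>))\<^sup>2 + 40 * Q)))"
        using stable(2)[of "th \<nu>" T "- 4 * exp (real \<nu>)"] controls(6)[OF \<nu> det] L s0 stable_rate(2)[OF g b] tST by auto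
      then show ?thesis by (rule stab) (use pth ps q0 in auto)
    next
      case False
      then have "th \<nu> = T" using L(3,4) by simp
      then show ?thesis using cost_refl[of T] by (auto simp: bot.extremum_unique)
    qed
    define V where "V = U * (q0\<^sup>2 / a)"
    have V0: "0 \<le> V" unfolding V_def using a0 U1 by simp
    have "V * 1 \<le> V * S" using V0 S by (intro mult_left_mono) auto
    then have "13600 * V + 55760 * (V * S) \<le> 120000 * (V * S)" using V0 by linarith
    moreover have "17 * U * (400 * q0\<^sup>2) * (2 / a) = 13600 * V"
      "17 * U * (2 / a * (1640 * (q0\<^sup>2 * S))) = 55760 * (V * S)"
      by (simp_all add: V_def)
    ultimately have sum: "17 * U * (400 * q0\<^sup>2) * (2 / a) + 17 * U * (2 / a * (1640 * (q0\<^sup>2 * S))) \<le> 120000 * (U * (q0\<^sup>2 / a) * S)"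
      by (simp add: V_def)
    show ?thesis
      by (rule cost_split'[OF s0 _ _ order_refl c1 c2 _ _ sum]) (use L U1 a0 S(1) in \<open>auto simp del: mult_le_cancel_left1\<close>)
  qed
  show ?thesis
  proof (rule cost_split'[OF t0 _ F(2) order_refl first_subepoch_cost[OF \<nu> t d0] later])
    define V where "V = q0\<^sup>2 / a * U"
    have V0: "0 \<le> V" unfolding V_def using a0 U1 by simp
    have "V * 1 \<le> V * S" using V0 S by (intro mult_left_mono) auto
    then have "27200 * V + 120000 * (V * S) \<le> 150000 * (V * S)" using V0 by linarith
    moreover have "27200 * q0\<^sup>2 / a * (exp (real \<nu>))\<^sup>2 = 27200 * V" "120000 * (U * (q0\<^sup>2 / a) * S) = 120000 * (V * S)"
      "150000 * q0\<^sup>2 / a * (exp (real \<nu>))\<^sup>2 * S = 150000 * (V * S)"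
      by (simp_all add: U_def V_def)
    ultimately show "27200 * q0\<^sup>2 / a * (exp (real \<nu>))\<^sup>2 + 120000 * (U * (q0\<^sup>2 / a) * S) \<le> 150000 * q0\<^sup>2 / a * (exp (real \<nu>))\<^sup>2 * S"
      by simp
  qed (use F(1) a0 U1 S in auto)
qed

text \<open>No control has been detected to be useful, and free growth costs at most X^2 exp (2 a (T
  - s)) / (2 a), which is of order exp (2 (\<nu>max + 1)) / a because a T \<le> \<nu>max +
  1.\<close>

lemma final_tail:
  assumes t: "ts (Suc \<nu>max) < T" and d0: "d (Suc \<nu>max) = 0"
  shows "cost (ts (Suc \<nu>max)) T \<le> ennreal (150000 * q0\<^sup>2 / a * (exp (real (Suc \<nu>max)))\<^sup>2 * S)"
proof -
  define s where "s = ts (Suc \<nu>max)"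
  define X where "X = x (Suc \<nu>max) + 2 * Wst"
  have s0: "0 < s" using epoch_bounds(1)[of "Suc \<nu>max"] by (simp add: s_def)
  have sT: "s < T" using t by (simp add: s_def)
  have x8: "0 \<le> x (Suc \<nu>max)" "x (Suc \<nu>max) \<le> 8 * q0"
    using epoch_bounds(5)[of "Suc \<nu>max"] t d0 by (auto simp: x_def)
  have e2: "((\<lambda>r. X\<^sup>2 * exp (2 * a * (r - s))) has_integral
      X\<^sup>2 * (exp (2 * a * (T - s)) / (2 * a)) - X\<^sup>2 * (exp (2 * a * (s - s)) / (2 * a))) {s..T}"
    using a0 sT by (intro fundamental_theorem_of_calculus)
      (auto intro!: derivative_eq_intros simp: has_real_derivative_iff_has_vector_derivative[symmetric])
  have le: "\<bar>p r\<bar> \<le> exp (a * (r - s)) * X" if r: "r \<in> {s..T}" for r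
  proof -
    have "\<bar>p r\<bar> - exp (a * (r - s)) * X \<le> 0"
  proof (rule left_limit_le[of s T "\<lambda>r. \<bar>p r\<bar> - exp (a * (r - s)) * X" 0, OF _ sT _ r])
    show "continuous_on {s..T} (\<lambda>r. \<bar>p r\<bar> - exp (a * (r - s)) * X)"
      using s0 by (intro continuous_intros p_cont_sub) auto
    show "\<bar>p r\<bar> - exp (a * (r - s)) * X \<le> 0" if "s < r" "r < T" for r
      using final_epoch(1)[of r] that by (simp add: s_def X_def)
  qed
  then show ?thesis by simp
  qed
  have "integral {s..T} (\<lambda>r. (p r)\<^sup>2) \<le> X\<^sup>2 * (exp (2 * a * (T - s)) / (2 * a)) - X\<^sup>2 * (exp (2 * a * (s - s)) / (2 * a))"
  proof (rule has_integral_le[OF _ e2])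
    have "(\<lambda>r. (p r)\<^sup>2) integrable_on {s..T}"
      using s0 by (intro integrable_continuous_interval continuous_intros p_cont_sub) auto
    then show "((\<lambda>r. (p r)\<^sup>2) has_integral integral {s..T} (\<lambda>r. (p r)\<^sup>2)) {s..T}" by (rule integrable_integral)
    fix r assume r: "r \<in> {s..T}"
    have "\<bar>p r\<bar>\<^sup>2 \<le> (exp (a * (r - s)) * X)\<^sup>2" by (rule power_mono[OF le[OF r]]) simp
    also have "\<dots> = X\<^sup>2 * exp (2 * a * (r - s))"
      by (simp add: power_mult_distrib exp_double[symmetric] mult_ac)
    finally show "(p r)\<^sup>2 \<le> X\<^sup>2 * exp (2 * a * (r - s))" by simp
  qed
  also have "\<dots> \<le> X\<^sup>2 * (exp (2 * a * (T - s)) / (2 * a))" using a0 by simp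
  also have "\<dots> \<le> (136 * (q0\<^sup>2 * S)) * ((exp (real (Suc \<nu>max)))\<^sup>2 / a)"
  proof (rule mult_mono)
    have "X\<^sup>2 \<le> 2 * (x (Suc \<nu>max))\<^sup>2 + 8 * Wst\<^sup>2"
      using sum_squares_bound[of "x (Suc \<nu>max)" "2 * Wst"] by (simp add: X_def power2_eq_square algebra_simps)
    also have "(x (Suc \<nu>max))\<^sup>2 \<le> (8 * q0)\<^sup>2" using x8 by (intro power_mono) auto
    finally have 1: "X\<^sup>2 \<le> 128 * (q0\<^sup>2 * 1) + 8 * (1 * Wst\<^sup>2)" by (simp add: power_mult_distrib)
    have "q0\<^sup>2 * 1 \<le> q0\<^sup>2 * S" using S by (intro mult_left_mono) auto
    moreover have "1 * Wst\<^sup>2 \<le> q0\<^sup>2 * S" using S q0 by (intro mult_mono one_le_power) auto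
    moreover note 1
    ultimately show "X\<^sup>2 \<le> 136 * (q0\<^sup>2 * S)" by linarith
    have "a * (T - s) \<le> a * T" using s0 a0 by (intro mult_left_mono) auto
    then have "2 * a * (T - s) \<le> 2 * real (Suc \<nu>max)" using \<nu>max(2) by simp
    then have "exp (2 * a * (T - s)) \<le> exp (2 * real (Suc \<nu>max))" by simp
    also have "\<dots> = (exp (real (Suc \<nu>max)))\<^sup>2" by (simp add: exp_double[symmetric])
    finally have "exp (2 * a * (T - s)) / (2 * a) \<le> (exp (real (Suc \<nu>max)))\<^sup>2 / (2 * a)" using a0 by (intro divide_right_mono) auto
    also have "\<dots> \<le> (exp (real (Suc \<nu>max)))\<^sup>2 / a" using a0 by (intro divide_left_mono) auto
    finally show "exp (2 * a * (T - s)) / (2 * a) \<le> (exp (real (Suc \<nu>max)))\<^sup>2 / a" .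
  qed (use S a0 in auto)
  also have "\<dots> = 136 * (q0\<^sup>2 / a * (exp (real (Suc \<nu>max)))\<^sup>2 * S)" by simp
  also have "\<dots> \<le> 150000 * (q0\<^sup>2 / a * (exp (real (Suc \<nu>max)))\<^sup>2 * S)" using S a0 by (intro mult_right_mono) auto
  finally have I: "integral {s..T} (\<lambda>r. (p r)\<^sup>2) \<le> 150000 * q0\<^sup>2 / a * (exp (real (Suc \<nu>max)))\<^sup>2 * S" by simp
  have "cost s T \<le> ennreal ((1 + 0\<^sup>2) * integral {s..T} (\<lambda>r. (p r)\<^sup>2))"
    by (rule cost_feedback) (use s0 sT final_epoch(2) in \<open>auto simp: s_def\<close>)
  then show ?thesis using I by (auto simp: s_def intro: order_trans ennreal_leI)
qed

text \<open>The run is cut at the first epoch \<open>k\<close> that makes a detection, starts at T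
  or is the final one. Before it only tests are paid for, and what follows has been bounded case by
  case; both parts are of order exp (2 k) / a, and k exceeds n by a bounded amount only.\<close>

lemma quiet_cost: "cost 0 T \<le> ennreal (10 ^ 6 * exp 6 * q0\<^sup>2 * (exp (real n))\<^sup>2 / R * S)"
proof (cases "t0 < 1 / (10 * a)")
  case True
  have "2000 * 1 * q0\<^sup>2 * 1 / R * S \<le> 10 ^ 6 * exp 6 * q0\<^sup>2 * (exp (real n))\<^sup>2 / R * S"
    using R S by (intro mult_right_mono divide_right_mono mult_mono one_le_power) auto
  then show ?thesis using quiet_epoch0[OF True] by (auto intro: order_trans ennreal_leI)
next
  case False
  note qw = quiet_weak[OF False]
  define stop where "stop \<nu> \<longleftrightarrow> 1 \<le> \<nu> \<and> (det \<nu> \<or> ts \<nu> = T \<or> \<nu> = Suc \<nu>max)" for \<nu>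
  define k where "k = (LEAST \<nu>. stop \<nu>)"
  have "stop (Suc \<nu>max)" by (simp add: stop_def)
  then have k: "stop k" "k \<le> Suc \<nu>max" unfolding k_def by (auto intro: LeastI Least_le)
  have before: "\<not> det i \<and> ts i < T \<and> i \<noteq> Suc \<nu>max" if "1 \<le> i" "i < k" for i
    using not_less_Least[of i stop] that epoch_bounds(2)[of i] by (auto simp: k_def stop_def)
  have dk: "d i = 0" if "i \<le> k" for i using before that by (auto simp: d_def)
  have k1: "1 \<le> k" using k(1) by (simp add: stop_def)
  define V where "V \<nu> = q0\<^sup>2 / a * (exp (real \<nu>))\<^sup>2 * S" for \<nu>
  have V0: "0 \<le> V \<nu>" for \<nu> using a0 S by (simp add: V_def)
  have cnt: "exp (real i) \<le> 2 * exp (real n + 2)" if "1 \<le> i" "i \<le> k" "ts i < T" for i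
  proof -
    have "exp (real i) \<le> exp (real n + 2) * 4 ^ d i * (1 + 20 * G)"
      using counts[OF that(1,3)] that k by simp
    also have "\<dots> \<le> exp (real n + 2) * 4 ^ d i * 2" using G_small by (intro mult_left_mono) auto
    finally show ?thesis using dk[OF that(2)] by simp
  qed
  have pre: "cost 0 (ts k) \<le> ennreal (27200 * q0\<^sup>2 / a * (exp (real k))\<^sup>2)"
    by (rule undetected_prefix[OF False k1 k(2)]) (use before in auto)
  have tail: "cost (ts k) T \<le> ennreal (150000 * V k)"
  proof (cases "ts k < T")
    case True
    show ?thesis
    proof (cases "k = Suc \<nu>max")
      case True
      then show ?thesis using final_tail \<open>ts k < T\<close> dk[of k] by (simp add: V_def mult.assoc)
    next
      case nk: False
      then have "det k" "k \<le> \<nu>max" using k True by (auto simp: stop_def)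
      then show ?thesis using detected_tail[OF False k1 _ True] dk[of k] by (simp add: V_def mult.assoc)
    qed
  next
    case False
    then have "ts k = T" using epoch_bounds(2)[OF k1] by simp
    then show ?thesis using cost_refl[of T] by (auto simp: bot.extremum_unique)
  qed
  \<comment> \<open>\<open>counts\<close> speaks only of epochs entered before T. If epoch k starts
    at T, it is applied to epoch k - 1, which costs one more factor exp 1.\<close>
  have ek: "exp (real k) \<le> 2 * exp (real n + 3)"
  proof (cases "ts k < T")
    case True
    have "exp (real k) \<le> 2 * exp (real n + 2)" by (rule cnt[OF k1 order_refl True])
    also have "\<dots> \<le> 2 * exp (real n + 3)" by simp
    finally show ?thesis .
  next
    case nt: False
    have "k \<noteq> 1" using qw(3) nt by (auto simp: ts1)
    then have k2: "1 \<le> k - 1" "k - 1 < k" using k1 by auto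
    have "exp (real k) = exp 1 * exp (real (k - 1))" using k1 by (simp add: exp_add[symmetric])
    also have "\<dots> \<le> exp 1 * (2 * exp (real n + 2))" using cnt[of "k - 1"] before[OF k2] k2 by (intro mult_left_mono) auto
    also have "\<dots> = 2 * exp (real n + 3)" by (simp add: exp_add[symmetric])
    finally show ?thesis .
  qed
  have "V k \<le> q0\<^sup>2 / a * (2 * exp (real n + 3))\<^sup>2 * S"
    unfolding V_def using a0 S ek by (intro mult_right_mono mult_left_mono power_mono) auto
  also have "(2 * exp (real n + 3))\<^sup>2 = 4 * exp 6 * (exp (real n))\<^sup>2"
    by (simp add: power_mult_distrib exp_double[symmetric] exp_add[symmetric])
  finally have Vk: "V k \<le> q0\<^sup>2 / a * (4 * exp 6 * (exp (real n))\<^sup>2) * S" .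
  have "q0\<^sup>2 / a * (exp (real k))\<^sup>2 * 1 \<le> V k" unfolding V_def using S a0 by (intro mult_left_mono) auto
  then have "27200 * q0\<^sup>2 / a * (exp (real k))\<^sup>2 + 150000 * V k \<le> 250000 * V k" using V0[of k] by (simp add: mult.assoc)
  also have "\<dots> \<le> 250000 * (q0\<^sup>2 / a * (4 * exp 6 * (exp (real n))\<^sup>2) * S)" using Vk by simp
  also have "\<dots> = 10 ^ 6 * exp 6 * q0\<^sup>2 * (exp (real n))\<^sup>2 / R * S" by (simp add: qw(1))
  finally show ?thesis
    using epoch_bounds(1,2)[OF k1] a0 V0
    by (intro cost_split'[OF _ _ _ order_refl pre tail]) auto
qed

end


section \<open>Bounded and negative growth parameter\<close>

context controlled_path
begin

lemma uncontrolled: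
  assumes s: "0 \<le> s" "s \<le> t" "t \<le> T" and v: "\<And>r. s \<le> r \<Longrightarrow> r < t \<Longrightarrow> v r = 0"
    and Wst: "\<And>t. 0 \<le> t \<Longrightarrow> t \<le> T \<Longrightarrow> \<bar>w t\<bar> \<le> Wst" and B: "exp (a * (t - s)) \<le> B" "1 \<le> B"
  shows "\<bar>p t\<bar> \<le> B * (\<bar>p s\<bar> + 4 * Wst)"
proof -
  define E where "E = exp (a * (t - s))"
  have "\<bar>p t - E * p s\<bar> \<le> 2 * Wst * (1 + \<bar>E - 1\<bar>)"
    unfolding E_def
  proof (rule linear_response[where w = w and e = t])
    show "continuous_on {s..t} p" using s by (intro p_cont_sub) auto
    show "p r - p s = w r - w s + integral {s..r} (\<lambda>r. a * p r)" if "r \<in> {s..t}" for r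
      using increment_feedback[of s r 0 0] v s that by simp
    show "\<bar>w r - w s\<bar> \<le> 2 * Wst" if "r \<in> {s..t}" for r
      using Wst[of r] Wst[of s] s that by auto
  qed (use s in auto)
  also have "\<dots> \<le> 2 * Wst * (2 * B)"
  proof (rule mult_left_mono)
    have "0 < E" by (simp add: E_def)
    then show "1 + \<bar>E - 1\<bar> \<le> 2 * B" using B by (auto simp: E_def[symmetric] abs_if)
    show "0 \<le> 2 * Wst" using Wst[of 0] T by auto
  qed
  finally have "\<bar>p t\<bar> \<le> \<bar>E * p s\<bar> + 4 * Wst * B" by linarith
  also have "\<bar>E * p s\<bar> \<le> B * \<bar>p s\<bar>" unfolding abs_mult using B by (intro mult_right_mono) (auto simp: E_def)
  finally show ?thesis by (simp add: algebra_simps)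
qed

end

section \<open>Bounded growth parameter\<close>

locale bounded_path = controlled_path +
  fixes Wst :: real
  assumes rule: "BR_bounded T q0 p v"
    and Wst: "\<And>t. 0 \<le> t \<Longrightarrow> t \<le> T \<Longrightarrow> \<bar>w t\<bar> \<le> Wst"
begin

definition s1 :: real where "s1 = first_time 0 T (\<lambda>t. \<bar>p t\<bar> = 2 * q0)"
definition s2 :: real where "s2 = first_time s1 T (\<lambda>t. \<bar>p t\<bar> = 4 * q0)"

lemma bounded_controls:
  "t \<in> {0..<s1} \<Longrightarrow> v t = - 1 * p t" "t \<in> {s1..<s2} \<Longrightarrow> v t = 1 * p t" "t \<in> {s2..<T} \<Longrightarrow> v t = 0"
  using rule by (auto simp: BR_bounded_def Let_def s1_def s2_def)

lemma s1: "0 < s1" "s1 \<le> T" "t \<in> {0..s1} \<Longrightarrow> \<bar>p t\<bar> \<le> 2 * q0" "s1 < T \<Longrightarrow> \<bar>p s1\<bar> = 2 * q0"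
  using level_exit_facts[of 0 "2 * q0"] T p0 q0 by (auto simp: s1_def)

lemma s2: "s1 \<le> s2" "s2 \<le> T" "t \<in> {0..s2} \<Longrightarrow> \<bar>p t\<bar> \<le> 4 * q0" "s2 < T \<Longrightarrow> \<bar>p s2\<bar> = 4 * q0 \<and> s1 < T"
proof -
  have "s1 \<le> s2 \<and> s2 \<le> T \<and> (t \<in> {0..s2} \<longrightarrow> \<bar>p t\<bar> \<le> 4 * q0) \<and> (s2 < T \<longrightarrow> \<bar>p s2\<bar> = 4 * q0 \<and> s1 < T)"
  proof (cases "s1 < T")
    case True
    have "\<bar>p s1\<bar> < 4 * q0" using s1(4)[OF True] q0 by simp
    note F = level_exit_facts[OF less_imp_le[OF s1(1)] True this, folded s2_def]
    have "\<bar>p t\<bar> \<le> 4 * q0" if "t \<in> {0..s2}" using s1(3)[of t] F(3)[of t] that q0 by (cases "t \<le> s1") auto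
    then show ?thesis using F True by auto
  next
    case False
    then have "s1 = T" "s2 = T" using s1(2) by (auto simp: s2_def first_time_empty)
    moreover have "\<bar>p t\<bar> \<le> 4 * q0" if "t \<in> {0..T}" using s1(3)[of t] that q0 \<open>s1 = T\<close> by auto
    ultimately show ?thesis by auto
  qed
  then show "s1 \<le> s2" "s2 \<le> T" "t \<in> {0..s2} \<Longrightarrow> \<bar>p t\<bar> \<le> 4 * q0" "s2 < T \<Longrightarrow> \<bar>p s2\<bar> = 4 * q0 \<and> s1 < T" by auto
qed

lemma bounded_crude:
  assumes t: "0 \<le> t" "t < T" and A: "\<bar>a\<bar> \<le> A"
  shows "(p t)\<^sup>2 + (v t)\<^sup>2 \<le> 32 * (exp (A * T) * q0 * (1 + Wst))\<^sup>2"
proof -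
  define B where "B = exp (A * T) * q0 * (1 + Wst)"
  have W0: "0 \<le> Wst" using Wst[of 0] T by auto
  have E1: "1 \<le> exp (A * T)" using T A by auto
  have "q0 * 1 \<le> (exp (A * T) * q0) * (1 + Wst)"
    using E1 q0 W0 by (intro mult_mono) auto
  then have qB: "q0 \<le> B" by (simp add: B_def)
  have "\<bar>p t\<bar> \<le> 4 * B \<and> \<bar>v t\<bar> \<le> 4 * B"
  proof (cases "t < s2")
    case True
    then have p: "\<bar>p t\<bar> \<le> 4 * q0" using s2(3)[of t] t by auto
    moreover have "\<bar>v t\<bar> = \<bar>p t\<bar>" using bounded_controls(1,2)[of t] True t by (cases "t < s1") auto
    ultimately show ?thesis using qB by auto
  next
    case False
    have ps: "\<bar>p s2\<bar> \<le> 4 * q0" using s2(3)[of s2] s2(1) s1(1) by auto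
    have "a * (t - s2) \<le> A * T"
      using A False t s2(1) s1(1) T by (intro mult_mono) auto
    then have "\<bar>p t\<bar> \<le> exp (A * T) * (\<bar>p s2\<bar> + 4 * Wst)"
      using False t s2(1) s1(1) bounded_controls(3) Wst E1 by (intro uncontrolled) auto
    also have "\<dots> \<le> exp (A * T) * (4 * q0 * (1 + Wst))"
    proof (rule mult_left_mono)
      have "1 * Wst \<le> q0 * Wst" using q0 W0 by (intro mult_right_mono) auto
      then show "\<bar>p s2\<bar> + 4 * Wst \<le> 4 * q0 * (1 + Wst)" using ps by (simp add: algebra_simps)
    qed simp
    also have "\<dots> = 4 * B" by (simp add: B_def)
    finally have "\<bar>p t\<bar> \<le> 4 * B" .
    then show ?thesis using bounded_controls(3)[of t] False t qB q0 by auto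
  qed
  then have "\<bar>p t\<bar> \<le> 4 * B" "\<bar>v t\<bar> \<le> 4 * B" by auto
  then show ?thesis unfolding B_def[symmetric] by (rule sum_squares_le) simp
qed

end

text \<open>With |b| \<ge> 2 |a| a feedback of gain 1 or -1 has a rate of absolute value at least
  |b| / 2. Over windows of length 4 / |b| this is at least 2, enough for both \<open>stable\<close>
  and \<open>unstable_doubles\<close>.\<close>

locale quiet_bounded_path = bounded_path a b T q0 p v w Wst + noisy_path a b T q0 p v w "4 / \<bar>b\<bar>" m Q
  for a b T q0 :: real and p v w :: "real \<Rightarrow> real" and Wst m Q :: real +
  assumes m_small: "m \<le> 1/1000" and b_large: "2 * \<bar>a\<bar> \<le> \<bar>b\<bar>" "0 < \<bar>b\<bar>"
begin

text \<open>If b > 0 Epoch 0 is stable and never ends before T. If b < 0 it reaches 2 q0 within one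
  window, and Epoch 1, being stable, cannot reach 4 q0.\<close>

lemma quiet_bounded_cost: "cost 0 T \<le> ennreal (1000 * q0\<^sup>2 / \<bar>b\<bar> * (1 + Q))"
proof -
  define Y where "Y = q0\<^sup>2 / \<bar>b\<bar> * (1 + Q)"
  have bound: "cost s T \<le> ennreal (2 * (4 / \<bar>b\<bar> * (56 * (q0\<^sup>2 * (1 + Q)))))"
    if c: "cost s T \<le> ennreal ((1 + g\<^sup>2) * (4 / \<bar>b\<bar> * (4 * (p s)\<^sup>2 + 40 * Q)))" and s: "\<bar>p s\<bar> \<le> 2 * q0" "g\<^sup>2 = 1" for s g
  proof (rule order_trans[OF c], intro ennreal_leI mult_mono mult_left_mono)
    have "(p s)\<^sup>2 \<le> 4 * q0\<^sup>2" using power_mono[OF s(1), of 2] by (simp add: power_mult_distrib)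
    moreover have "q0\<^sup>2 * 1 \<le> q0\<^sup>2 * (1 + Q)" using Q0 by (intro mult_left_mono) auto
    moreover have "1 * Q \<le> q0\<^sup>2 * (1 + Q)" using Q0 q0 by (intro mult_mono one_le_power) auto
    ultimately show "4 * (p s)\<^sup>2 + 40 * Q \<le> 56 * (q0\<^sup>2 * (1 + Q))"
        by linarith
  qed (use s Q0 in auto)
  have Y0: "0 \<le> Y" unfolding Y_def using Q0 by simp
  have Y1: "1000 * q0\<^sup>2 / \<bar>b\<bar> * (1 + Q) = 1000 * Y" by (simp add: Y_def)
  have bY: "2 * (4 / \<bar>b\<bar> * (56 * (q0\<^sup>2 * (1 + Q)))) = 448 * Y" by (simp add: Y_def)
  note bound = bound[unfolded bY]
  show ?thesis
  proof (cases "0 < b")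
    case True
    have rate: "1 \<le> - (a + b * (- 1)) * (4 / \<bar>b\<bar>)" using b_large True by (simp add: field_simps)
    have "s1 = T"
    proof (rule ccontr)
      assume "s1 \<noteq> T"
      then have lt: "s1 < T" using s1(2) by simp
      have "\<bar>p s1\<bar> \<le> \<bar>p 0\<bar> + 6 * m"
        by (rule stable(1)[OF order_refl _ s1(2) _ rate]) (use s1 bounded_controls in auto)
      then show False using s1(4)[OF lt] p0 q0 m_small by simp
    qed
    then have "cost 0 T \<le> ennreal ((1 + (- 1)\<^sup>2) * (4 / \<bar>b\<bar> * (4 * (p 0)\<^sup>2 + 40 * Q)))"
      by (intro stable(2)[OF order_refl _ order_refl _ rate]) (use T bounded_controls in auto)
    then have "cost 0 T \<le> ennreal (448 * Y)" by (rule bound) (use p0 q0 in auto)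
    also have "\<dots> \<le> ennreal (1000 * Y)" using Y0 by (intro ennreal_leI) simp
    finally show ?thesis unfolding Y1 .
  next
    case False
    then have b: "b < 0" using b_large by auto
    have up: "2 \<le> (a + b * (- 1)) * (4 / \<bar>b\<bar>)" using b_large b by (simp add: field_simps)
    have rate: "1 \<le> - (a + b * 1) * (4 / \<bar>b\<bar>)" using b_large b by (simp add: field_simps)
    have s1h: "s1 \<le> 0 + 4 / \<bar>b\<bar>"
      by (rule unstable_doubles[OF order_refl _ s1(2) _ up]) (use s1 bounded_controls p0 q0 m_small in auto)
    have "cost 0 s1 \<le> ennreal (8 * q0\<^sup>2 * (s1 - 0))"
    proof (rule cost_pointwise)
      fix t assume t: "0 \<le> t" "t < s1"
      then have "\<bar>p t\<bar> \<le> 2 * q0" "\<bar>v t\<bar> \<le> 2 * q0" using s1(3)[of t] bounded_controls(1)[of t] by auto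
      then show "(p t)\<^sup>2 + (v t)\<^sup>2 \<le> 8 * q0\<^sup>2" by (rule sum_squares_le) simp
    qed (use s1 in auto)
    also have "\<dots> \<le> ennreal (8 * q0\<^sup>2 * (4 / \<bar>b\<bar>))" using s1h by (intro ennreal_leI mult_left_mono) auto
    also have "\<dots> \<le> ennreal (32 * Y)"
    proof (rule ennreal_leI)
      have "q0\<^sup>2 / \<bar>b\<bar> * 1 \<le> Y" unfolding Y_def using Q0 by (intro mult_left_mono) auto
      then show "8 * q0\<^sup>2 * (4 / \<bar>b\<bar>) \<le> 32 * Y" by simp
    qed
    finally have c1: "cost 0 s1 \<le> ennreal (32 * Y)" .
    have ps: "\<bar>p s1\<bar> \<le> 2 * q0" using s1(3)[of s1] s1(1) by simp
    have "s2 = T"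
    proof (rule ccontr)
      assume "s2 \<noteq> T"
      then have lt: "s2 < T" using s2(2) by simp
      have "\<bar>p s2\<bar> \<le> \<bar>p s1\<bar> + 6 * m"
        by (rule stable(1)[OF less_imp_le[OF s1(1)] s2(1,2) _ rate]) (use s2 bounded_controls in auto)
      then show False using s2(4)[OF lt] ps q0 m_small by simp
    qed
    then have "cost s1 T \<le> ennreal ((1 + 1\<^sup>2) * (4 / \<bar>b\<bar> * (4 * (p s1)\<^sup>2 + 40 * Q)))"
      by (intro stable(2)[OF less_imp_le[OF s1(1)] s1(2) order_refl _ rate]) (use bounded_controls in auto)
    then have c2: "cost s1 T \<le> ennreal (448 * Y)" by (rule bound) (use ps in auto)
    have "cost 0 T \<le> ennreal (1000 * Y)"
      by (rule cost_split'[OF order_refl _ s1(2) order_refl c1 c2]) (use s1(1) Y0 in auto)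
    then show ?thesis unfolding Y1 .
  qed
qed

end

section \<open>Large negative growth parameter\<close>

locale negative_path = controlled_path +
  fixes Wst :: real
  assumes a_neg: "a < 0" and test_end: "1 / (10 * \<bar>a\<bar>) < T" and rule: "BR_negative T a q0 p v"
    and Wst: "\<And>t. 0 \<le> t \<Longrightarrow> t \<le> T \<Longrightarrow> \<bar>w t\<bar> \<le> Wst"
begin

definition s0 :: real where "s0 = 1 / (10 * \<bar>a\<bar>)"
definition s1 :: real where "s1 = first_time 0 s0 (\<lambda>t. p t = 2 * q0 \<or> p t = q0 / 2)"
definition s2 :: real where "s2 = first_time s1 T (\<lambda>t. \<bar>p t\<bar> = 4 * q0)"

lemma s0: "0 < s0" "s0 < T" using a_neg test_end by (auto simp: s0_def)

lemma negative_controls: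
  "t \<in> {0..<s1} \<Longrightarrow> v t = - 1 * p t"
  "s1 = s0 \<Longrightarrow> t \<in> {s1..<T} \<Longrightarrow> v t = 0"
  "s1 < s0 \<Longrightarrow> p s1 = 2 * q0 \<Longrightarrow> t \<in> {s1..<s2} \<Longrightarrow> v t = 1000 * p t"
  "s1 < s0 \<Longrightarrow> p s1 = q0 / 2 \<Longrightarrow> t \<in> {s1..<s2} \<Longrightarrow> v t = - 1000 * p t"
  "s1 < s0 \<Longrightarrow> t \<in> {s2..<T} \<Longrightarrow> v t = 0"
  using rule unfolding BR_negative_def Let_def s1_def[symmetric] s2_def[symmetric] s0_def[symmetric] by (simp_all del: atLeastLessThan_iff)

lemma s1: "0 < s1" "s1 \<le> s0" "t \<in> {0..s1} \<Longrightarrow> q0 / 2 \<le> p t \<and> p t \<le> 2 * q0"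
    "s1 < s0 \<Longrightarrow> p s1 = 2 * q0 \<or> p s1 = q0 / 2" "s1 < T"
  using band_exit_facts[OF s0] s0 by (auto simp: s1_def)

lemma s1_abs: "t \<in> {0..s1} \<Longrightarrow> \<bar>p t\<bar> \<le> 2 * q0"
  using s1(3)[of t] q0 by auto

lemma s2: "s1 < s2" "s2 \<le> T" "t \<in> {0..s2} \<Longrightarrow> \<bar>p t\<bar> \<le> 4 * q0" "s2 < T \<Longrightarrow> \<bar>p s2\<bar> = 4 * q0"
proof -
  have "\<bar>p s1\<bar> < 4 * q0" using s1_abs[of s1] s1(1) q0 by auto
  note F = level_exit_facts[OF less_imp_le[OF s1(1)] s1(5) this, folded s2_def]
  show "s1 < s2" "s2 \<le> T" "s2 < T \<Longrightarrow> \<bar>p s2\<bar> = 4 * q0" using F by auto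
  show "t \<in> {0..s2} \<Longrightarrow> \<bar>p t\<bar> \<le> 4 * q0" using s1_abs[of t] F(3)[of t] q0 by (cases "t \<le> s1") auto
qed

lemma negative_crude:
  assumes t: "0 \<le> t" "t < T"
  shows "(p t)\<^sup>2 + (v t)\<^sup>2 \<le> 20000000 * (q0 * (1 + Wst))\<^sup>2"
proof -
  define B where "B = q0 * (1 + Wst)"
  have W0: "0 \<le> Wst" using Wst[of 0] T by auto
  have "q0 * 1 \<le> q0 * (1 + Wst)" using q0 W0 by (intro mult_mono) auto
  then have qB: "q0 \<le> B" by (simp add: B_def)
  have free: "\<bar>p t\<bar> \<le> 4 * B \<and> \<bar>v t\<bar> \<le> 4000 * B"
    if s: "0 \<le> s" "s \<le> t" "\<bar>p s\<bar> \<le> 4 * q0" and v: "\<And>r. r \<in> {s..<T} \<Longrightarrow> v r = 0" for s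
  proof -
    have "\<bar>p t\<bar> \<le> 1 * (\<bar>p s\<bar> + 4 * Wst)"
      using s t v a_neg Wst by (intro uncontrolled) (auto simp: mult_nonpos_nonneg)
    moreover have "1 * Wst \<le> q0 * Wst" using q0 W0 by (intro mult_right_mono) auto
    ultimately have "\<bar>p t\<bar> \<le> 4 * B" using s by (simp add: B_def algebra_simps)
    then show ?thesis using v[of t] s t qB q0 by auto
  qed
  have "\<bar>p t\<bar> \<le> 4 * B \<and> \<bar>v t\<bar> \<le> 4000 * B"
  proof (cases "t < s1")
    case True
    then show ?thesis using s1_abs[of t] negative_controls(1)[of t] t qB q0 by auto
  next
    case t1: False
    show ?thesis
    proof (cases "s1 < s0")
      case True
      show ?thesis
      proof (cases "t < s2")
        case lt: True
        have p: "\<bar>p t\<bar> \<le> 4 * q0" using s2(3)[of t] lt t by auto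
        moreover have "\<bar>v t\<bar> = 1000 * \<bar>p t\<bar>"
          using s1(4)[OF True] negative_controls(3,4)[OF True, of t] t1 lt by auto
        ultimately show ?thesis using qB by auto
      next
        case False
        then show ?thesis using free[of s2] s2(1) s2(3)[of s2] s1(1) negative_controls(5)[OF True] by auto
      qed
    next
      case False
      then have e: "s1 = s0" using s1(2) by simp
      show ?thesis using free[of s1] s1(1) s1_abs[of s1] t1 negative_controls(2)[OF e] q0 by auto
    qed
  qed
  then have "\<bar>p t\<bar> \<le> 4 * B" "\<bar>v t\<bar> \<le> 4000 * B" by auto
  then show ?thesis unfolding B_def[symmetric] by (rule sum_squares_le) simp
qed

end

locale quiet_negative_path = negative_path a b T q0 p v w Wst + noisy_path a b T q0 p v w "2 / R" m Q
  for a b T q0 :: real and p v w :: "real \<Rightarrow> real" and Wst R m Q :: real +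
  assumes m_small: "m \<le> 1/1000" and R_def: "R = (if \<bar>b\<bar> \<le> 40 * \<bar>a\<bar> then \<bar>a\<bar> else \<bar>b\<bar>)"
begin

lemma R: "0 < R" "- a \<le> R" using a_neg by (auto simp: R_def)

lemma test_feedback: "0 \<le> r \<Longrightarrow> r < s1 \<Longrightarrow> v r = - 1 * p r"
  using negative_controls(1)[of r] by simp

lemma test_down:
  assumes "r \<in> {0..s1}" "r \<le> 2 / R" "a \<le> b"
  shows "\<bar>p r - exp ((a - b) * r) * q0\<bar> \<le> 2 * m"
  using stable_short[of 0 r "- 1" r] test_feedback assms s1(5) p0 by auto

lemma test_up:
  assumes "r \<in> {0..s1}" "r \<le> 2 / R" "b \<le> a"
  shows "\<bar>p r - exp ((a - b) * r) * q0\<bar> \<le> exp ((a - b) * r) * m"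
  using unstable_short[of 0 r "- 1" r] test_feedback assms s1(5) p0 by auto

text \<open>As in \<open>t0_short\<close>; since a < 0 now works against an upward exit, the growth
  factor at time 2 / R is bounded below only by exp 1 \<ge> 5/2, which still exceeds 2.\<close>

lemma test_short: "s1 \<le> 2 / R \<and> (40 * \<bar>a\<bar> < \<bar>b\<bar> \<longrightarrow> s1 < s0)"
proof (cases "\<bar>b\<bar> \<le> 40 * \<bar>a\<bar>")
  case True
  then have "R = \<bar>a\<bar>" by (simp add: R_def)
  then have "s0 \<le> 2 / R" using a_neg by (simp add: s0_def field_simps)
  then show ?thesis using s1(2) True by auto
next
  case False
  then have Rb: "R = \<bar>b\<bar>" by (simp add: R_def)
  have e1: "5/2 \<le> exp (1::real)" using exp_lower_Taylor_quadratic[of "1::real"] by simp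
  have "s1 \<le> 2 / R"
  proof (rule ccontr)
    assume "\<not> s1 \<le> 2 / R"
    then have r: "2 / R \<in> {0..s1}" using R by auto
    have band: "q0 / 2 \<le> p (2 / R)" "p (2 / R) \<le> 2 * q0" using s1(3)[OF r] by auto
    show False
    proof (cases "a \<le> b")
      case True
      then have b0: "0 < b" using False a_neg by linarith
      then have "R = b" using Rb by simp
      then have "(a - b) * (2 / R) \<le> - 1" using b0 a_neg by (simp add: field_simps)
      then have "exp ((a - b) * (2 / R)) \<le> exp (- 1)" by simp
      also have "\<dots> \<le> 2/5" using e1 by (simp add: exp_minus field_simps)
      finally have "exp ((a - b) * (2 / R)) * q0 \<le> 2/5 * q0" using q0 by (intro mult_right_mono) auto
      then show False using test_down[OF r order_refl True] band m_small q0 by linarith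
    next
      case nb: False
      then have b0: "b < 0" using a_neg by linarith
      then have "R = - b" using Rb by simp
      then have "1 \<le> (a - b) * (2 / R)" using b0 nb False a_neg by (simp add: field_simps)
      then have "exp 1 \<le> exp ((a - b) * (2 / R))" by simp
      then have E: "5/2 \<le> exp ((a - b) * (2 / R))" using e1 by linarith
      have "5/2 * (q0 - m) \<le> exp ((a - b) * (2 / R)) * (q0 - m)" using E m_small q0 by (intro mult_right_mono) auto
      also have "\<dots> \<le> p (2 / R)"
        using test_up[OF r order_refl] nb by (simp add: right_diff_distrib abs_le_iff)
      finally have "5/2 * q0 - 5/2 * m \<le> p (2 / R)" by (simp only: right_diff_distrib)
      then show False using band m_small q0 by linarith
    qed
  qed
  moreover have "2 / R < s0" using False Rb a_neg by (simp add: s0_def field_simps)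
  ultimately show ?thesis by simp
qed

text \<open>As in \<open>correct_sign\<close>, with the decay at rate |a| shifting the limits. If b
  < 3 |a| the exponent is at least -4/10, so the path stays above q0 / 2; if b > -3 |a| it is at
  most 2/10, so the path stays below 2 q0.\<close>

lemma test_sign:
  assumes "s1 < s0"
  shows "p s1 = q0 / 2 \<and> - 3 * a \<le> b \<or> p s1 = 2 * q0 \<and> b \<le> 3 * a"
proof -
  have r: "s1 \<in> {0..s1}" using s1(1) by simp
  note sh = test_short[THEN conjunct1]
  have t10: "- a * s1 \<le> 1/10" using s1(2) a_neg by (simp add: s0_def field_simps)
  have "- 3 * a \<le> b" if p: "p s1 = q0 / 2"
  proof (rule ccontr)
    assume nb: "\<not> - 3 * a \<le> b"
    show False
    proof (cases "a \<le> b")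
      case True
      have "(- 3 * a - b) * s1 \<ge> 0" using nb s1(1) by simp
      then have "- (4/10) \<le> (a - b) * s1" using t10 by (simp add: algebra_simps)
      then have "6/10 \<le> exp ((a - b) * s1)" using exp_ge_add_one_self[of "(a - b) * s1"] by linarith
      then have "6/10 * q0 \<le> exp ((a - b) * s1) * q0" using q0 by (intro mult_right_mono) auto
      then show False using test_down[OF r sh True] p m_small q0 by linarith
    next
      case False
      then have E: "1 \<le> exp ((a - b) * s1)" using s1(1) by simp
      have "1 * (q0 - m) \<le> exp ((a - b) * s1) * (q0 - m)" using E m_small q0 by (intro mult_right_mono) auto
      also have "\<dots> \<le> p s1"
        using test_up[OF r sh] False by (simp add: right_diff_distrib abs_le_iff)
      finally have "q0 - m \<le> p s1" by (simp only: mult_1)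
      then show False using p m_small q0 by linarith
    qed
  qed
  moreover have "b \<le> 3 * a" if p: "p s1 = 2 * q0"
  proof (rule ccontr)
    assume nb: "\<not> b \<le> 3 * a"
    show False
    proof (cases "a \<le> b")
      case True
      then have "exp ((a - b) * s1) \<le> 1" using s1(1) by (simp add: mult_nonpos_nonneg)
      then have "exp ((a - b) * s1) * q0 \<le> 1 * q0" using q0 by (intro mult_right_mono) auto
      then show False using test_down[OF r sh True] p m_small q0 by linarith
    next
      case False
      have "(b - 3 * a) * s1 \<ge> 0" using nb s1(1) by simp
      then have y: "(a - b) * s1 \<le> 1/2" using t10 by (simp add: algebra_simps)
      have "exp ((a - b) * s1) \<le> exp (1/2)" using y by simp
      also have "\<dots> \<le> 1 + 1/2 + (1/2)\<^sup>2" by (rule exp_bound) auto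
      finally have E: "exp ((a - b) * s1) \<le> 7/4" by (simp add: power2_eq_square)
      have "p s1 \<le> exp ((a - b) * s1) * (q0 + m)"
        using test_up[OF r sh] False by (simp add: distrib_left abs_le_iff)
      also have "\<dots> \<le> 7/4 * (q0 + m)" using E m0 q0 by (intro mult_right_mono) auto
      finally have "p s1 \<le> 7/4 * q0 + 7/4 * m" by (simp only: distrib_left)
      then show False using p m_small q0 by linarith
    qed
  qed
  ultimately show ?thesis using s1(4)[OF assms] by blast
qed

text \<open>If the test ends without an exit, then |b| \<le> 40 |a| and R = |a|, so doing nothing is
  already stable at rate R. After an exit the gain 1000 has the right sign and keeps the path below
  4 q0.\<close>

lemma quiet_negative_cost: "cost 0 T \<le> ennreal (10 ^ 9 * q0\<^sup>2 / R * (1 + Q))"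
proof -
  define Y where "Y = q0\<^sup>2 / R * (1 + Q)"
  have Y0: "0 \<le> Y" unfolding Y_def using Q0 R by simp
  have ps: "\<bar>p s1\<bar> \<le> 2 * q0" using s1_abs[of s1] s1(1) by simp
  have tail: "cost s1 T \<le> ennreal (200000000 * Y)"
    if c: "cost s1 T \<le> ennreal ((1 + g\<^sup>2) * (2 / R * (4 * (p s1)\<^sup>2 + 40 * Q)))" and g: "g\<^sup>2 \<le> 1000000" for g
  proof -
    have "cost s1 T \<le> ennreal (1000001 * (2 / R * (56 * (q0\<^sup>2 * (1 + Q)))))"
    proof (rule order_trans[OF c], intro ennreal_leI mult_mono mult_left_mono)
      have "(p s1)\<^sup>2 \<le> 4 * q0\<^sup>2" using power_mono[OF ps, of 2] by (simp add: power_mult_distrib)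
      moreover have "q0\<^sup>2 * 1 \<le> q0\<^sup>2 * (1 + Q)" using Q0 by (intro mult_left_mono) auto
      moreover have "1 * Q \<le> q0\<^sup>2 * (1 + Q)" using Q0 q0 by (intro mult_mono one_le_power) auto
      ultimately show "4 * (p s1)\<^sup>2 + 40 * Q \<le> 56 * (q0\<^sup>2 * (1 + Q))"
        by linarith
    qed (use g Q0 R in auto)
    also have "1000001 * (2 / R * (56 * (q0\<^sup>2 * (1 + Q)))) = 112000112 * Y" by (simp add: Y_def)
    also have "ennreal (112000112 * Y) \<le> ennreal (200000000 * Y)" using Y0 by (intro ennreal_leI) simp
    finally show ?thesis .
  qed
  have c2: "cost s1 T \<le> ennreal (200000000 * Y)"
  proof (cases "s1 < s0")
    case True
    define g where "g = (if p s1 = q0 / 2 then - 1000 else 1000 :: real)"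
    have vg: "v r = g * p r" if "s1 \<le> r" "r < s2" for r
      using negative_controls(3,4)[OF True, of r] s1(4)[OF True] that by (auto simp: g_def)
    have "R \<le> 2 * (1000 * \<bar>b\<bar> - a) \<and> a + b * g = a - 1000 * \<bar>b\<bar>"
      using test_sign[OF True] a_neg q0 by (auto simp: R_def g_def abs_if)
    then have rate: "1 \<le> - (a + b * g) * (2 / R)" using R by (simp add: field_simps)
    have "s2 = T"
    proof (rule ccontr)
      assume "s2 \<noteq> T"
      then have lt: "s2 < T" using s2(2) by simp
      have "\<bar>p s2\<bar> \<le> \<bar>p s1\<bar> + 6 * m"
        by (rule stable(1)[OF less_imp_le[OF s1(1)] less_imp_le[OF s2(1)] s2(2) vg rate]) (use s2 in auto)
      then show False using s2(4)[OF lt] ps q0 m_small by simp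
    qed
    then have "cost s1 T \<le> ennreal ((1 + g\<^sup>2) * (2 / R * (4 * (p s1)\<^sup>2 + 40 * Q)))"
      by (intro stable(2)[OF less_imp_le[OF s1(1)] less_imp_le[OF s1(5)] order_refl _ rate]) (use vg in auto)
    then show ?thesis by (rule tail) (auto simp: g_def)
  next
    case False
    then have e: "s1 = s0" using s1(2) by simp
    have "R = - a" using test_short False a_neg by (auto simp: R_def)
    then have rate: "1 \<le> - (a + b * 0) * (2 / R)" using a_neg by (simp add: field_simps)
    have "cost s1 T \<le> ennreal ((1 + 0\<^sup>2) * (2 / R * (4 * (p s1)\<^sup>2 + 40 * Q)))"
      by (intro stable(2)[OF less_imp_le[OF s1(1)] less_imp_le[OF s1(5)] order_refl _ rate]) (use negative_controls(2)[OF e] in auto)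
    then show ?thesis by (rule tail) simp
  qed
  have "cost 0 s1 \<le> ennreal (8 * q0\<^sup>2 * (s1 - 0))"
  proof (rule cost_pointwise)
    fix t assume t: "0 \<le> t" "t < s1"
    then have "\<bar>p t\<bar> \<le> 2 * q0" "\<bar>v t\<bar> \<le> 2 * q0" using s1_abs[of t] negative_controls(1)[of t] by auto
    then show "(p t)\<^sup>2 + (v t)\<^sup>2 \<le> 8 * q0\<^sup>2" by (rule sum_squares_le) simp
  qed (use s1 in auto)
  also have "\<dots> \<le> ennreal (8 * q0\<^sup>2 * (2 / R))" using test_short by (intro ennreal_leI mult_left_mono) auto
  also have "\<dots> \<le> ennreal (16 * Y)"
  proof (rule ennreal_leI)
    have "q0\<^sup>2 / R * 1 \<le> Y" unfolding Y_def using Q0 R by (intro mult_left_mono) auto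
    then show "8 * q0\<^sup>2 * (2 / R) \<le> 16 * Y" by simp
  qed
  finally have c1: "cost 0 s1 \<le> ennreal (16 * Y)" .
  have "cost 0 T \<le> ennreal (10 ^ 9 * Y)"
    by (rule cost_split'[OF order_refl _ less_imp_le[OF s1(5)] order_refl c1 c2]) (use s1(1) Y0 in auto)
  moreover have "10 ^ 9 * Y = 10 ^ 9 * q0\<^sup>2 / R * (1 + Q)" by (simp add: Y_def)
  ultimately show ?thesis by (simp only:)
qed

end


section \<open>Lower bounds by duality\<close>

abbreviation time_measure :: "real \<Rightarrow> real measure" where
  "time_measure T \<equiv> restrict_space lborel {0..T}"

lemma space_time_measure: "space (time_measure T) = {0..T}"
  by (simp add: space_restrict_space)

lemma sets_time_measure: "sets (time_measure T) = sets (restrict_space borel {0..T})"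
  by (rule sets_restrict_space_cong) simp

lemma finite_time_measure: "finite_measure (time_measure T)"
proof
  have "emeasure (time_measure T) {0..T} = emeasure lborel {0..T}"
    by (rule emeasure_restrict_space) auto
  then show "emeasure (time_measure T) (space (time_measure T)) \<noteq> \<infinity>"
    by (simp add: space_time_measure emeasure_lborel_Icc_eq)
qed

lemma continuous_bounded_Icc:
  fixes f :: "real \<Rightarrow> real"
  assumes "continuous_on {l..r} f"
  obtains B where "\<And>s. s \<in> {l..r} \<Longrightarrow> \<bar>f s\<bar> \<le> B"
proof -
  have "bounded (f ` {l..r})" by (intro compact_imp_bounded compact_continuous_image assms compact_Icc)
  then obtain B where "\<forall>s\<in>{l..r}. \<bar>f s\<bar> \<le> B" by (auto simp: bounded_iff)
  then show thesis using that by blast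
qed

lemma time_measure_measurable:
  fixes f :: "real \<Rightarrow> real"
  assumes "continuous_on {0..T} f"
  shows "f \<in> borel_measurable (time_measure T)"
  using borel_measurable_continuous_on_restrict[OF assms]
  by (simp add: measurable_cong_sets[OF sets_time_measure refl])

lemma time_measure_integral:
  fixes f :: "real \<Rightarrow> real"
  assumes f: "continuous_on {0..T} f" and s: "0 \<le> s"
  shows "integrable (time_measure T) (\<lambda>t. indicator {s..T} t * f t)"
    and "(LINT t|time_measure T. indicator {s..T} t * f t) = integral {s..T} f"
proof -
  have c: "continuous_on {s..T} f" by (rule continuous_on_subset[OF f]) (use s in auto)
  have si: "set_integrable lborel {s..T} f"
    using borel_integrable_atLeastAtMost'[OF c] .
  have eq: "(\<lambda>t. indicator {0..T} t * (indicator {s..T} t * f t)) = (\<lambda>t. indicator {s..T} t * f t)"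
    using s by (auto simp: indicator_def fun_eq_iff)
  show "integrable (time_measure T) (\<lambda>t. indicator {s..T} t * f t)"
    using si by (subst integrable_restrict_space) (auto simp: eq set_integrable_def)
  have "(LINT t|time_measure T. indicator {s..T} t * f t) = (LBINT t:{s..T}. f t)"
    by (subst integral_restrict_space) (auto simp: eq set_lebesgue_integral_def)
  also have "\<dots> = integral {s..T} f" by (rule set_borel_integral_eq_integral(2)[OF si])
  finally show "(LINT t|time_measure T. indicator {s..T} t * f t) = integral {s..T} f" .
qed

lemma abs_le_one_plus_square: "\<bar>x\<bar> \<le> 1 + x\<^sup>2" for x :: real
  using sum_squares_bound[of 1 "\<bar>x\<bar>"] by simp

lemma exp_minus_one_le: "exp (- 1) \<le> (2/5 :: real)"
proof -
  have "5/2 \<le> exp (1::real)" using exp_lower_Taylor_quadratic[of "1::real"] by simp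
  then show ?thesis by (simp add: exp_minus field_simps)
qed

context brownian_motion
begin

lemma W_integrable:
  assumes "0 \<le> t"
  shows "integrable M (W t)" "expectation (W t) = 0"
proof -
  have "integrable M (W t) \<and> expectation (W t) = 0"
  proof (cases "t = 0")
    case True
    have "expectation (W 0) = expectation (\<lambda>_. 0)" by (intro Bochner_Integration.integral_cong) (auto simp: start)
    moreover have "integrable M (W 0) \<longleftrightarrow> integrable M (\<lambda>_. 0::real)" by (intro Bochner_Integration.integrable_cong) (auto simp: start)
    ultimately show ?thesis using True by simp
  next
    case False
    then have t: "0 < t" using assms by simp
    have D: "distributed M lborel (\<lambda>\<omega>. W t \<omega> - W 0 \<omega>) (normal_density 0 (sqrt t))"
      using normal_increments[OF order_refl t] by simp
    have i: "integrable M (\<lambda>\<omega>. W t \<omega> - W 0 \<omega>)"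
      using distributed_integrable[OF D, of "\<lambda>x. x"] integrable_normal_moment_nz_1[of "sqrt t" 0] t by simp
    have e: "expectation (\<lambda>\<omega>. W t \<omega> - W 0 \<omega>) = 0"
      by (rule normal_distributed_expectation[OF _ D]) (use t in simp)
    have "integrable M (W t) \<longleftrightarrow> integrable M (\<lambda>\<omega>. W t \<omega> - W 0 \<omega>)"
      by (intro Bochner_Integration.integrable_cong) (auto simp: start)
    moreover have "expectation (W t) = expectation (\<lambda>\<omega>. W t \<omega> - W 0 \<omega>)"
      by (intro Bochner_Integration.integral_cong) (auto simp: start)
    ultimately show ?thesis using i e by simp
  qed
  then show "integrable M (W t)" "expectation (W t) = 0" by auto
qed

lemma natural_filtration_sub:
  assumes "0 \<le> t"
  shows "space (natural_filtration M W t) = space M" "sets (natural_filtration M W t) \<subseteq> sets M"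
    "(\<lambda>\<omega>. \<omega>) \<in> measurable M (natural_filtration M W t)"
proof -
  have sub: "(\<Union>s\<in>{0..t}. {W s -` B \<inter> space M | B. B \<in> sets borel}) \<subseteq> sets M"
    by (auto intro!: measurable_sets random_variable_W)
  then have pow: "(\<Union>s\<in>{0..t}. {W s -` B \<inter> space M | B. B \<in> sets borel}) \<subseteq> Pow (space M)"
    using sets.sets_into_space by blast
  show sp: "space (natural_filtration M W t) = space M"
    using pow by (simp add: natural_filtration_def space_measure_of_conv)
  show st: "sets (natural_filtration M W t) \<subseteq> sets M"
    using sets.sigma_sets_subset[OF sub] pow by (simp add: natural_filtration_def sets_measure_of)
  show "(\<lambda>\<omega>. \<omega>) \<in> measurable M (natural_filtration M W t)"
    using sp st by (auto simp: measurable_def)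
qed

abbreviation past :: "real \<Rightarrow> (real \<times> 'w) measure" where
  "past t \<equiv> restrict_space borel {0..t} \<Otimes>\<^sub>M natural_filtration M W t"

lemma product_measurable:
  assumes t: "0 \<le> T"
    and f: "(\<lambda>(s, \<omega>). f s \<omega>) \<in> borel_measurable (past T)"
  shows "(\<lambda>(s, \<omega>). f s \<omega>) \<in> borel_measurable (time_measure T \<Otimes>\<^sub>M M)"
proof -
  have 1: "fst \<in> measurable (time_measure T \<Otimes>\<^sub>M M) (restrict_space borel {0..T})"
    using measurable_fst[of "time_measure T" M] by (simp add: measurable_cong_sets[OF refl sets_time_measure])
  have 2: "snd \<in> measurable (time_measure T \<Otimes>\<^sub>M M) (natural_filtration M W T)"
    using measurable_comp[OF measurable_snd natural_filtration_sub(3)[OF t], of "time_measure T"] by (simp add: comp_def)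
  have "(\<lambda>z. (fst z, snd z)) \<in> measurable (time_measure T \<Otimes>\<^sub>M M) (past T)"
    by (intro measurable_Pair 1 2)
  from measurable_compose[OF this f] show ?thesis by (simp add: case_prod_unfold)
qed

text \<open>Testing the expected equation of motion against a deterministic \<open>\<psi>\<close> eliminates the noise; Young's
  inequality then separates the cost from the dual function.\<close>

lemma dual_bound_aux:
  fixes \<psi> \<Psi> :: "real \<Rightarrow> real"
  assumes T: "0 < T" and st: "strategy M W T a q0 (q, u)"
    and J: "ECost M T (q, u) b = ennreal J" "0 \<le> J"
    and \<psi>: "continuous_on {0..T} \<psi>"
    and d\<Psi>: "\<And>s. s \<in> {0..T} \<Longrightarrow> (\<Psi> has_vector_derivative - \<psi> s) (at s within {0..T})" and \<Psi>T: "\<Psi> T = 0"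
    and \<rho>: "0 < \<rho>"
  shows "q0 * \<Psi> 0 \<le> \<rho> / 2 * J + integral {0..T} (\<lambda>s. (\<psi> s - a * \<Psi> s)\<^sup>2 + (b * \<Psi> s)\<^sup>2) / (2 * \<rho>)"
proof -
  define L where "L = time_measure T"
  define P where "P = L \<Otimes>\<^sub>M M"
  interpret L: finite_measure L unfolding L_def by (rule finite_time_measure)
  interpret LM: pair_sigma_finite L M ..
  interpret P: finite_measure P unfolding P_def by (intro finite_measure_pair_measure) unfold_locales
  interpret LP: pair_sigma_finite L P ..
  have T0: "0 \<le> T" using T by simp
  have spL: "space L = {0..T}" by (simp add: L_def space_time_measure)
  define X where "X z = q (fst z) b (snd z)" for z
  define U where "U z = u (fst z) b (snd z)" for z
  define g where "g z = a * X z + b * U z" for z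
  have meas: "(\<lambda>(s, \<omega>). q s b \<omega>) \<in> borel_measurable (past T)"
    "(\<lambda>(s, \<omega>). u s b \<omega>) \<in> borel_measurable (past T)"
    using st T0 unfolding strategy_def by auto
  have Xm[measurable]: "X \<in> borel_measurable P" and Um[measurable]: "U \<in> borel_measurable P"
    using product_measurable[OF T0 meas(1)] product_measurable[OF T0 meas(2)]
    unfolding X_def[abs_def] U_def[abs_def] P_def L_def by (simp_all add: case_prod_unfold)
  have eqn: "AE \<omega> in M. q t b \<omega> = q0 + W t \<omega> + (LBINT s:{0..t}. a * q s b \<omega> + b * u s b \<omega>)" if "t \<in> {0..T}" for t
    using st that unfolding strategy_def by auto
  have c\<Psi>: "continuous_on {0..T} \<Psi>"
    unfolding continuous_on_eq_continuous_within by (intro ballI has_vector_derivative_continuous[OF d\<Psi>])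
  have \<Psi>int: "integral {s..T} \<psi> = \<Psi> s" if s: "s \<in> {0..T}" for s
  proof -
    have "((\<lambda>s. - \<psi> s) has_integral (\<Psi> T - \<Psi> s)) {s..T}"
    proof (rule fundamental_theorem_of_calculus)
      fix r assume "r \<in> {s..T}"
      then show "(\<Psi> has_vector_derivative - \<psi> r) (at r within {s..T})"
        using s by (intro has_vector_derivative_within_subset[OF d\<Psi>]) auto
    qed (use s in simp)
    then have "(\<psi> has_integral \<Psi> s) {s..T}" using has_integral_neg[of "\<lambda>s. - \<psi> s"] by (force simp: \<Psi>T)
    then show ?thesis by (rule integral_unique)
  qed
  have \<psi>m[measurable]: "\<psi> \<in> borel_measurable L"
    unfolding L_def by (rule time_measure_measurable[OF \<psi>])
  obtain B where B: "\<And>s. s \<in> {0..T} \<Longrightarrow> \<bar>\<psi> s\<bar> \<le> B"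
    using continuous_bounded_Icc[OF \<psi>] by blast
  have sq: "(\<integral>\<^sup>+z. ennreal ((X z)\<^sup>2 + (U z)\<^sup>2) \<partial>P) = ennreal J"
  proof -
    have "(\<integral>\<^sup>+z. ennreal ((X z)\<^sup>2 + (U z)\<^sup>2) \<partial>P) = (\<integral>\<^sup>+\<omega>. \<integral>\<^sup>+s. ennreal ((X (s, \<omega>))\<^sup>2 + (U (s, \<omega>))\<^sup>2) \<partial>L \<partial>M)"
      unfolding P_def by (rule LM.nn_integral_snd[symmetric]) (simp add: P_def[symmetric])
    also have "\<dots> = ECost M T (q, u) b"
      unfolding ECost_def prod.case
      by (intro nn_integral_cong) (simp add: L_def nn_integral_restrict_space X_def U_def)
    finally show ?thesis using J by simp
  qed
  have sqi: "integrable P (\<lambda>z. (X z)\<^sup>2 + (U z)\<^sup>2)" "(LINT z|P. (X z)\<^sup>2 + (U z)\<^sup>2) = J"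
    using sq J(2) by (auto intro!: integrableI_nn_integral_finite integral_eq_nn_integral[THEN trans] simp: nn_integral_eq_integral)
  have one: "integrable P (\<lambda>z. 1 + ((X z)\<^sup>2 + (U z)\<^sup>2))" using sqi(1) by auto
  have absX: "\<bar>X z\<bar> \<le> 1 + ((X z)\<^sup>2 + (U z)\<^sup>2)" "\<bar>U z\<bar> \<le> 1 + ((X z)\<^sup>2 + (U z)\<^sup>2)" for z
    using abs_le_one_plus_square[of "X z"] abs_le_one_plus_square[of "U z"] zero_le_power2[of "X z"] zero_le_power2[of "U z"] by linarith+
  have Xi: "integrable P X"
    by (rule Bochner_Integration.integrable_bound[OF one]) (use absX in auto)
  have Ui: "integrable P U"
    by (rule Bochner_Integration.integrable_bound[OF one]) (use absX in auto)
  have gi: "integrable P g" unfolding g_def[abs_def] using Xi Ui by auto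
  have gm[measurable]: "g \<in> borel_measurable P" using gi by auto
  have idL[measurable]: "(\<lambda>s. s) \<in> borel_measurable L" unfolding L_def by (intro time_measure_measurable continuous_intros)
  have fstP[measurable]: "fst \<in> measurable P L" unfolding P_def by simp
  have fstb[measurable]: "fst \<in> borel_measurable P" using measurable_comp[OF fstP idL] by (simp add: comp_def)
  \<comment> \<open>\<open>K t\<close> is the drift restricted to times up to t, so
    \<open>H t\<close> is the expected drift integral up to t. Exchanging the integrals over t and
    over (s, \<omega>) turns the pairing of \<open>\<psi>\<close> with \<open>H\<close> into the
    pairing of the drift with \<open>\<Psi>\<close>.\<close>
  define K where "K t z = (if fst z \<le> t then g z else 0)" for t :: real and z
  have Ki: "integrable P (K t)" for t
    by (rule Bochner_Integration.integrable_bound[OF gi]) (auto simp: K_def[abs_def])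
  define H where "H t = (LINT z|P. K t z)" for t
  define e where "e t = (LINT \<omega>|M. X (t, \<omega>))" for t
  \<comment> \<open>Only almost every t is covered, because the integrability of
    \<open>X (t, -)\<close> over the probability space comes from Fubini's theorem. This suffices,
    as the identity is integrated over t.\<close>
  have e: "AE t in L. \<psi> t * e t = \<psi> t * (q0 + H t)"
    using LM.AE_integrable_fst'[OF Xi[unfolded P_def]] AE_space
  proof eventually_elim
    case (elim t)
    then have t: "t \<in> {0..T}" and t0: "0 \<le> t" by (auto simp: spL)
    define I where "I \<omega> = (LINT s|L. K t (s, \<omega>))" for \<omega>
    have Kp: "integrable (L \<Otimes>\<^sub>M M) (case_prod (\<lambda>s \<omega>. K t (s, \<omega>)))" using Ki[of t] by (simp add: P_def)
    have Ii: "integrable M I" unfolding I_def by (rule LM.integrable_snd[OF Kp])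
    have IH: "(LINT \<omega>|M. I \<omega>) = H t"
      unfolding I_def H_def P_def using LM.integral_snd[OF Kp] by simp
    have LI: "(LBINT s:{0..t}. a * q s b \<omega> + b * u s b \<omega>) = I \<omega>" for \<omega>
    proof -
      have "I \<omega> = (\<integral>s. indicator {0..T} s *\<^sub>R K t (s, \<omega>) \<partial>lborel)"
        unfolding I_def L_def by (rule integral_restrict_space) simp
      also have "\<dots> = (LBINT s:{0..t}. a * q s b \<omega> + b * u s b \<omega>)"
        unfolding set_lebesgue_integral_def
        by (rule Bochner_Integration.integral_cong) (use t in \<open>auto simp: indicator_def K_def g_def X_def U_def\<close>)
      finally show ?thesis by simp
    qed
    have "e t = (LINT \<omega>|M. q0 + W t \<omega> + I \<omega>)"
      unfolding e_def
    proof (rule integral_cong_AE)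
      show "(\<lambda>\<omega>. X (t, \<omega>)) \<in> borel_measurable M" using elim by auto
      show "(\<lambda>\<omega>. q0 + W t \<omega> + I \<omega>) \<in> borel_measurable M"
        using Ii W_integrable(1)[OF t0] by (intro borel_measurable_add borel_measurable_const borel_measurable_integrable)
      show "AE \<omega> in M. X (t, \<omega>) = q0 + W t \<omega> + I \<omega>"
        using eqn[OF t] by eventually_elim (simp add: X_def LI)
    qed
    also have "\<dots> = q0 + H t"
      using Ii W_integrable[OF t0] IH by (simp add: prob_space)
    finally show ?case by simp
  qed
  have fP: "integrable P (\<lambda>z. f (fst z) * Y z)" if f: "continuous_on {0..T} f" and Y: "integrable P Y" for f Y :: "_ \<Rightarrow> real"
  proof -
    obtain B where B: "\<And>s. s \<in> {0..T} \<Longrightarrow> \<bar>f s\<bar> \<le> B" using continuous_bounded_Icc[OF f] by blast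
    have fm: "f \<in> borel_measurable L" unfolding L_def by (rule time_measure_measurable[OF f])
    show ?thesis
    proof (rule Bochner_Integration.integrable_bound)
      show "integrable P (\<lambda>z. B * Y z)" using Y by simp
      show "(\<lambda>z. f (fst z) * Y z) \<in> borel_measurable P"
        using Y by (intro borel_measurable_times measurable_compose[OF fstP fm] borel_measurable_integrable)
      show "AE z in P. norm (f (fst z) * Y z) \<le> norm (B * Y z)"
      proof (rule AE_I2)
        fix z assume "z \<in> space P"
        then have "fst z \<in> {0..T}" by (auto simp: P_def space_pair_measure spL)
        then have "\<bar>f (fst z)\<bar> \<le> \<bar>B\<bar>" using B by force
        then show "norm (f (fst z) * Y z) \<le> norm (B * Y z)" by (simp add: abs_mult mult_right_mono)
      qed
    qed
  qed
  note \<psi>P = fP[OF \<psi> Xi] and \<Psi>P = fP[OF c\<Psi> gi]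
  have F: "integrable (L \<Otimes>\<^sub>M P) (\<lambda>(t, z). \<psi> t * K t z)"
  proof (rule Bochner_Integration.integrable_bound)
    have "integrable (L \<Otimes>\<^sub>M P) (\<lambda>x. g (snd x))"
      by (rule LP.Fubini_integrable) (use gi in auto)
    then show "integrable (L \<Otimes>\<^sub>M P) (\<lambda>x. B * g (snd x))" by simp
    show "(\<lambda>(t, z). \<psi> t * K t z) \<in> borel_measurable (L \<Otimes>\<^sub>M P)" unfolding K_def by measurable
    show "AE x in L \<Otimes>\<^sub>M P. norm (case x of (t, z) \<Rightarrow> \<psi> t * K t z) \<le> norm (B * g (snd x))"
    proof (rule AE_I2)
      fix x assume "x \<in> space (L \<Otimes>\<^sub>M P)"
      then have "fst x \<in> {0..T}" by (auto simp: space_pair_measure spL)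
      then have "\<bar>\<psi> (fst x)\<bar> \<le> \<bar>B\<bar>" using B by force
      then show "norm (case x of (t, z) \<Rightarrow> \<psi> t * K t z) \<le> norm (B * g (snd x))"
        by (auto simp: abs_mult K_def case_prod_unfold intro!: mult_right_mono)
    qed
  qed
  have "(LINT z|P. \<psi> (fst z) * X z) = (LINT t|L. \<psi> t * e t)"
    using LM.integral_fst'[OF \<psi>P[unfolded P_def]] by (simp add: P_def e_def)
  also have "\<dots> = (LINT t|L. \<psi> t * (q0 + H t))"
  proof (rule integral_cong_AE[OF _ _ e])
    have "e \<in> borel_measurable L" unfolding e_def[abs_def]
      using LM.integrable_fst'[OF Xi[unfolded P_def]] by auto
    then show "(\<lambda>t. \<psi> t * e t) \<in> borel_measurable L" by simp
    have "(\<lambda>t. \<psi> t * H t) \<in> borel_measurable L"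
      using LP.integrable_fst'[OF F] by (auto simp: H_def)
    then show "(\<lambda>t. \<psi> t * (q0 + H t)) \<in> borel_measurable L" by (simp add: distrib_left)
  qed
  also have "\<dots> = q0 * (LINT t|L. \<psi> t) + (LINT t|L. \<psi> t * H t)"
  proof -
    have 1: "integrable L (\<lambda>t. \<psi> t * H t)" using LP.integrable_fst'[OF F] by (simp add: H_def)
    have 2: "integrable L (\<lambda>t. \<psi> t * q0)"
      by (rule integrable_mult_left, rule L.integrable_const_bound[where B = B]) (use B in \<open>auto intro!: AE_I2 simp: spL\<close>)
    show ?thesis unfolding distrib_left using 1 2 by (simp add: mult.commute)
  qed
  also have "(LINT t|L. \<psi> t) = \<Psi> 0"
  proof -
    have "(LINT t|L. \<psi> t) = (LINT t|L. indicator {0..T} t * \<psi> t)"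
      by (rule Bochner_Integration.integral_cong) (auto simp: spL)
    then show ?thesis using time_measure_integral(2)[OF \<psi>, of 0] \<Psi>int[of 0] T by (simp add: L_def)
  qed
  also have "(LINT t|L. \<psi> t * H t) = (LINT z|P. \<Psi> (fst z) * g z)"
  proof -
    have "(LINT t|L. \<psi> t * H t) = (LINT t|L. LINT z|P. \<psi> t * K t z)" by (simp add: H_def)
    also have "\<dots> = (LINT z|P. LINT t|L. \<psi> t * K t z)"
      by (rule LP.Fubini_integral[symmetric]) (use F in simp)
    also have "\<dots> = (LINT z|P. \<Psi> (fst z) * g z)"
    proof (rule Bochner_Integration.integral_cong[OF refl])
      fix z assume "z \<in> space P"
      then have z: "fst z \<in> {0..T}" by (auto simp: P_def space_pair_measure spL)
      have "(LINT t|L. \<psi> t * K t z) = (LINT t|L. (indicator {fst z..T} t * \<psi> t) * g z)"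
        by (rule Bochner_Integration.integral_cong) (auto simp: spL K_def indicator_def)
      also have "\<dots> = \<Psi> (fst z) * g z"
        using time_measure_integral(2)[OF \<psi>, of "fst z"] \<Psi>int[OF z] z by (simp add: L_def)
      finally show "(LINT t|L. \<psi> t * K t z) = \<Psi> (fst z) * g z" .
    qed
    finally show ?thesis .
  qed
  finally have "q0 * \<Psi> 0 = (LINT z|P. \<psi> (fst z) * X z) - (LINT z|P. \<Psi> (fst z) * g z)" by simp
  also have "\<dots> = (LINT z|P. \<psi> (fst z) * X z - \<Psi> (fst z) * g z)" using \<psi>P \<Psi>P by simp
  finally have eq: "q0 * \<Psi> 0 = (LINT z|P. \<psi> (fst z) * X z - \<Psi> (fst z) * g z)" .
  define N where "N s = (\<psi> s - a * \<Psi> s)\<^sup>2 + (b * \<Psi> s)\<^sup>2" for s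
  have Nc: "continuous_on {0..T} N" unfolding N_def by (intro continuous_intros \<psi> c\<Psi>)
  have Ni: "integrable P (\<lambda>z. N (fst z))" using fP[OF Nc, of "\<lambda>_. 1"] by simp
  have young: "\<alpha> * x - \<beta> * y \<le> \<rho> / 2 * (x\<^sup>2 + y\<^sup>2) + (\<alpha>\<^sup>2 + \<beta>\<^sup>2) / (2 * \<rho>)" for \<alpha> \<beta> x y :: real
  proof -
    have "0 \<le> (\<rho> * x - \<alpha>)\<^sup>2 + (\<rho> * y + \<beta>)\<^sup>2" by simp
    then have "2 * \<rho> * (\<alpha> * x - \<beta> * y) \<le> \<rho>\<^sup>2 * (x\<^sup>2 + y\<^sup>2) + (\<alpha>\<^sup>2 + \<beta>\<^sup>2)"
      by (simp add: power2_eq_square algebra_simps)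
    then have "\<alpha> * x - \<beta> * y \<le> (\<rho>\<^sup>2 * (x\<^sup>2 + y\<^sup>2) + (\<alpha>\<^sup>2 + \<beta>\<^sup>2)) / (2 * \<rho>)"
      using \<rho> by (simp add: pos_le_divide_eq mult.commute)
    also have "\<dots> = \<rho> / 2 * (x\<^sup>2 + y\<^sup>2) + (\<alpha>\<^sup>2 + \<beta>\<^sup>2) / (2 * \<rho>)"
      using \<rho> by (simp add: add_divide_distrib power2_eq_square)
    finally show ?thesis .
  qed
  have "(LINT z|P. N (fst z)) = (LINT s|L. N s)"
    using LM.integral_fst'[OF Ni[unfolded P_def]] by (simp add: P_def prob_space)
  also have "\<dots> = (LINT s|L. indicator {0..T} s * N s)"
    by (rule Bochner_Integration.integral_cong) (auto simp: spL)
  also have "\<dots> = integral {0..T} N"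
    using time_measure_integral(2)[OF Nc, of 0] by (simp add: L_def)
  finally have N: "(LINT z|P. N (fst z)) = integral {0..T} N" .
  note Qi = integrable_mult_right[OF sqi(1), of "\<rho> / 2"] integrable_divide[OF Ni, of "2 * \<rho>"]
  have "q0 * \<Psi> 0 \<le> (LINT z|P. \<rho> / 2 * ((X z)\<^sup>2 + (U z)\<^sup>2) + N (fst z) / (2 * \<rho>))"
    unfolding eq
  proof (rule integral_mono)
    show "integrable P (\<lambda>z. \<psi> (fst z) * X z - \<Psi> (fst z) * g z)" using \<psi>P \<Psi>P by simp
    show "integrable P (\<lambda>z. \<rho> / 2 * ((X z)\<^sup>2 + (U z)\<^sup>2) + N (fst z) / (2 * \<rho>))"
      by (rule Bochner_Integration.integrable_add[OF Qi])
    fix z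
    have "\<psi> (fst z) * X z - \<Psi> (fst z) * g z = (\<psi> (fst z) - a * \<Psi> (fst z)) * X z - (b * \<Psi> (fst z)) * U z"
      by (simp add: g_def algebra_simps)
    then show "\<psi> (fst z) * X z - \<Psi> (fst z) * g z \<le> \<rho> / 2 * ((X z)\<^sup>2 + (U z)\<^sup>2) + N (fst z) / (2 * \<rho>)"
      using young by (simp add: N_def)
  qed
  also have "\<dots> = \<rho> / 2 * J + integral {0..T} N / (2 * \<rho>)"
    by (simp only: Bochner_Integration.integral_add[OF Qi] integral_mult_right_zero integral_divide_zero sqi(2) N)
  finally show ?thesis unfolding N_def[abs_def] .
qed

text \<open>The optimal weight \<rho> = N / c, with c = |q0 \<Psi> 0|, turns c \<le> \<rho> J / 2 +
  N / (2 \<rho>) into c^2 \<le> J N. The auxiliary bound is used for both signs of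
  \<open>\<psi>\<close> in order to reach the absolute value.\<close>

lemma dual_bound:
  fixes \<psi> \<Psi> :: "real \<Rightarrow> real"
  assumes T: "0 < T" and st: "strategy M W T a q0 \<sigma>"
    and \<psi>: "continuous_on {0..T} \<psi>"
    and d\<Psi>: "\<And>s. s \<in> {0..T} \<Longrightarrow> (\<Psi> has_vector_derivative - \<psi> s) (at s within {0..T})" and \<Psi>T: "\<Psi> T = 0"
    and N: "integral {0..T} (\<lambda>s. (\<psi> s - a * \<Psi> s)\<^sup>2 + (b * \<Psi> s)\<^sup>2) \<le> N" "0 < N"
  shows "ennreal ((q0 * \<Psi> 0)\<^sup>2 / N) \<le> ECost M T \<sigma> b"
proof -
  obtain q u where \<sigma>: "\<sigma> = (q, u)" by (cases \<sigma>)
  have "ECost M T (q, u) b < \<infinity>" using st by (simp add: strategy_def \<sigma>)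
  then obtain J where J: "ECost M T (q, u) b = ennreal J" "0 \<le> J" by (cases "ECost M T (q, u) b") auto
  define c where "c = \<bar>q0 * \<Psi> 0\<bar>"
  have key: "c \<le> \<rho> / 2 * J + N / (2 * \<rho>)" if \<rho>: "0 < \<rho>" for \<rho>
  proof -
    have le: "integral {0..T} (\<lambda>s. (\<psi> s - a * \<Psi> s)\<^sup>2 + (b * \<Psi> s)\<^sup>2) / (2 * \<rho>) \<le> N / (2 * \<rho>)"
      using N \<rho> by (intro divide_right_mono) auto
    have "q0 * \<Psi> 0 \<le> \<rho> / 2 * J + integral {0..T} (\<lambda>s. (\<psi> s - a * \<Psi> s)\<^sup>2 + (b * \<Psi> s)\<^sup>2) / (2 * \<rho>)"
      by (rule dual_bound_aux[OF T st[unfolded \<sigma>] J \<psi> d\<Psi> \<Psi>T \<rho>])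
    moreover have "q0 * - \<Psi> 0 \<le> \<rho> / 2 * J + integral {0..T} (\<lambda>s. (- \<psi> s - a * - \<Psi> s)\<^sup>2 + (b * - \<Psi> s)\<^sup>2) / (2 * \<rho>)"
    proof (rule dual_bound_aux[OF T st[unfolded \<sigma>] J _ _ _ \<rho>])
      show "continuous_on {0..T} (\<lambda>s. - \<psi> s)" by (intro continuous_intros \<psi>)
      show "((\<lambda>s. - \<Psi> s) has_vector_derivative - (- \<psi> s)) (at s within {0..T})" if "s \<in> {0..T}" for s
        by (rule has_vector_derivative_minus[OF d\<Psi>[OF that]])
    qed (simp add: \<Psi>T)
    moreover have "(\<lambda>s. (- \<psi> s - a * - \<Psi> s)\<^sup>2 + (b * - \<Psi> s)\<^sup>2) = (\<lambda>s. (\<psi> s - a * \<Psi> s)\<^sup>2 + (b * \<Psi> s)\<^sup>2)"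
      by (auto simp: power2_eq_square algebra_simps)
    ultimately show ?thesis using le by (simp add: c_def abs_le_iff)
  qed
  have "c\<^sup>2 \<le> J * N"
  proof (cases "c = 0")
    case True
    then show ?thesis using J N by simp
  next
    case False
    then have c: "0 < c" by (simp add: c_def)
    have "c \<le> N / c / 2 * J + N / (2 * (N / c))" using key[of "N / c"] c N by simp
    also have "N / (2 * (N / c)) = c / 2" using c N by simp
    finally have "c / 2 \<le> N * J / (2 * c)" by (simp add: mult.commute)
    then show ?thesis using c by (simp add: field_simps power2_eq_square)
  qed
  then have "(q0 * \<Psi> 0)\<^sup>2 / N \<le> J" using N by (simp add: c_def pos_divide_le_eq)
  then show ?thesis by (simp add: \<sigma> J ennreal_leI)
qed

text \<open>The test function decays at the rate c = |a| + |b| + 1/T, faster than anything the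
  dynamics can do. The dual integrand is at most 4 c^2 exp (-2 c s), with integral at most 2 c, and
  \<open>\<Psi> 0\<close> is at least 1/2 because c T \<ge> 1.\<close>

lemma cost_lower_bound:
  assumes T: "0 < T" and st: "strategy M W T a q0 \<sigma>"
  shows "ennreal (q0\<^sup>2 / (8 * (\<bar>a\<bar> + \<bar>b\<bar> + 1 / T))) \<le> ECost M T \<sigma> b"
proof -
  define c where "c = \<bar>a\<bar> + \<bar>b\<bar> + 1 / T"
  define \<Psi> where "\<Psi> s = exp (- c * s) - exp (- c * T)" for s
  define \<psi> where "\<psi> s = c * exp (- c * s)" for s
  have "1 / T \<le> c" by (simp add: c_def)
  then have cT: "1 \<le> c * T" using T by (simp add: pos_divide_le_eq)
  have c0: "0 < c" using T by (simp add: c_def add_nonneg_pos)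
  have "ennreal ((q0 * \<Psi> 0)\<^sup>2 / (2 * c)) \<le> ECost M T \<sigma> b"
  proof (rule dual_bound[OF T st])
    show "continuous_on {0..T} \<psi>" unfolding \<psi>_def by (intro continuous_intros)
    show "(\<Psi> has_vector_derivative - \<psi> s) (at s within {0..T})" for s
      unfolding \<Psi>_def \<psi>_def has_real_derivative_iff_has_vector_derivative[symmetric]
      by (auto intro!: derivative_eq_intros)
    have I: "((\<lambda>s. 4 * c\<^sup>2 * exp (- (2 * c) * s)) has_integral (- (2 * c) * exp (- (2 * c) * T) - - (2 * c) * exp (- (2 * c) * 0))) {0..T}"
      using T by (intro fundamental_theorem_of_calculus)
        (auto intro!: derivative_eq_intros simp: has_real_derivative_iff_has_vector_derivative[symmetric] power2_eq_square)
    have "integral {0..T} (\<lambda>s. (\<psi> s - a * \<Psi> s)\<^sup>2 + (b * \<Psi> s)\<^sup>2) \<le> - (2 * c) * exp (- (2 * c) * T) - - (2 * c) * exp (- (2 * c) * 0)"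
    proof (rule has_integral_le[OF integrable_integral I])
      show "(\<lambda>s. (\<psi> s - a * \<Psi> s)\<^sup>2 + (b * \<Psi> s)\<^sup>2) integrable_on {0..T}"
        unfolding \<psi>_def \<Psi>_def by (intro integrable_continuous_interval continuous_intros)
      fix s assume s: "s \<in> {0..T}"
      define E where "E = exp (- c * s)"
      have \<Psi>: "0 \<le> \<Psi> s" "\<Psi> s \<le> E" using s c0 by (auto simp: \<Psi>_def E_def)
      have "\<bar>a\<bar> * \<Psi> s \<le> \<bar>a\<bar> * E" "\<bar>b\<bar> * \<Psi> s \<le> \<bar>b\<bar> * E" using \<Psi> by (auto intro!: mult_left_mono)
      moreover have "\<psi> s = c * E" "0 \<le> c * E" using c0 by (auto simp: \<psi>_def E_def)
      moreover have "\<bar>a * \<Psi> s\<bar> = \<bar>a\<bar> * \<Psi> s" "\<bar>b * \<Psi> s\<bar> = \<bar>b\<bar> * \<Psi> s" using \<Psi>(1) by (auto simp: abs_mult)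
      ultimately have 1: "\<bar>\<psi> s - a * \<Psi> s\<bar> \<le> (c + \<bar>a\<bar>) * E" and 2: "\<bar>b * \<Psi> s\<bar> \<le> \<bar>b\<bar> * E"
        unfolding distrib_right by linarith+
      have "(\<psi> s - a * \<Psi> s)\<^sup>2 + (b * \<Psi> s)\<^sup>2 \<le> ((c + \<bar>a\<bar>) * E)\<^sup>2 + (\<bar>b\<bar> * E)\<^sup>2"
        using power_mono[OF 1, of 2] power_mono[OF 2, of 2] by simp
      also have "\<dots> = ((c + \<bar>a\<bar>)\<^sup>2 + \<bar>b\<bar>\<^sup>2) * E\<^sup>2"
        unfolding power_mult_distrib by (rule distrib_right[symmetric])
      also have "\<dots> \<le> (4 * c\<^sup>2) * E\<^sup>2"
      proof (rule mult_right_mono)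
        have "(c + \<bar>a\<bar>)\<^sup>2 + \<bar>b\<bar>\<^sup>2 \<le> (c + \<bar>a\<bar> + \<bar>b\<bar>)\<^sup>2" using c0 by (simp add: power2_eq_square algebra_simps)
        also have "\<dots> \<le> (2 * c)\<^sup>2"
        proof (rule power_mono)
          have "0 \<le> 1 / T" using T by simp
          then show "c + \<bar>a\<bar> + \<bar>b\<bar> \<le> 2 * c" unfolding c_def distrib_left by linarith
        qed (use c0 in simp)
        finally show "(c + \<bar>a\<bar>)\<^sup>2 + \<bar>b\<bar>\<^sup>2 \<le> 4 * c\<^sup>2" by (simp add: power_mult_distrib)
      qed simp
      also have "E\<^sup>2 = exp (- (2 * c) * s)" by (simp add: E_def exp_double[symmetric] mult.assoc)
      finally show "(\<psi> s - a * \<Psi> s)\<^sup>2 + (b * \<Psi> s)\<^sup>2 \<le> 4 * c\<^sup>2 * exp (- (2 * c) * s)" .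
    qed
    also have "\<dots> \<le> 2 * c" using c0 by simp
    finally show "integral {0..T} (\<lambda>s. (\<psi> s - a * \<Psi> s)\<^sup>2 + (b * \<Psi> s)\<^sup>2) \<le> 2 * c" .
  qed (use c0 in \<open>auto simp: \<Psi>_def\<close>)
  moreover have "q0\<^sup>2 / (8 * c) \<le> (q0 * \<Psi> 0)\<^sup>2 / (2 * c)"
  proof -
    have "exp (- c * T) \<le> exp (- 1)" using cT by simp
    moreover have "\<Psi> 0 = 1 - exp (- c * T)" by (simp add: \<Psi>_def)
    ultimately have "1/2 \<le> \<Psi> 0" using exp_minus_one_le by linarith
    then have "(1/2)\<^sup>2 \<le> (\<Psi> 0)\<^sup>2" by (intro power_mono) auto
    then have "q0\<^sup>2 * (1/4) \<le> q0\<^sup>2 * (\<Psi> 0)\<^sup>2" by (intro mult_left_mono) (auto simp: power2_eq_square)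
    then have "q0\<^sup>2 * (1/4) / (2 * c) \<le> q0\<^sup>2 * (\<Psi> 0)\<^sup>2 / (2 * c)" using c0 by (intro divide_right_mono) auto
    then show ?thesis by (simp add: power_mult_distrib)
  qed
  ultimately show ?thesis unfolding c_def[symmetric] by (meson ennreal_leI order_trans)
qed

text \<open>For exp (- a s) the term \<psi> - a \<Psi> vanishes, so only b is paid for, with b^2 /
  (2 a). The reflected exponential exp (a s - 2 a T) is subtracted to achieve
  \<open>\<Psi> T = 0\<close>; it leaves \<psi> - a \<Psi> = 2 a exp (a s - 2 a T), whose square has
  integral at most 2 a exp (-2 a T).\<close>

lemma cost_lower_bound_unstable:
  assumes T: "0 < T" and st: "strategy M W T a q0 \<sigma>" and a: "0 < a" "1 \<le> a * T"
  shows "ennreal (q0\<^sup>2 / (4 * (2 * a * exp (- (2 * a * T)) + b\<^sup>2 / (2 * a)))) \<le> ECost M T \<sigma> b"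
proof -
  define N where "N = 2 * a * exp (- (2 * a * T)) + b\<^sup>2 / (2 * a)"
  define \<Psi> where "\<Psi> s = exp (- a * s) - exp (a * s - 2 * a * T)" for s
  define \<psi> where "\<psi> s = a * exp (- a * s) + a * exp (a * s - 2 * a * T)" for s
  have N0: "0 < N" using a by (auto simp: N_def intro!: add_pos_nonneg)
  have "ennreal ((q0 * \<Psi> 0)\<^sup>2 / N) \<le> ECost M T \<sigma> b"
  proof (rule dual_bound[OF T st])
    show "continuous_on {0..T} \<psi>" unfolding \<psi>_def by (intro continuous_intros)
    show "(\<Psi> has_vector_derivative - \<psi> s) (at s within {0..T})" for s
      unfolding \<Psi>_def \<psi>_def has_real_derivative_iff_has_vector_derivative[symmetric]
      by (auto intro!: derivative_eq_intros)
    define G where "G s = 2 * a * exp (2 * a * s - 4 * a * T) - b\<^sup>2 / (2 * a) * exp (- (2 * a) * s)" for s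
    have I: "((\<lambda>s. 4 * a\<^sup>2 * exp (2 * a * s - 4 * a * T) + b\<^sup>2 * exp (- (2 * a) * s)) has_integral (G T - G 0)) {0..T}"
      unfolding G_def using T a by (intro fundamental_theorem_of_calculus)
        (auto intro!: derivative_eq_intros simp: has_real_derivative_iff_has_vector_derivative[symmetric] power2_eq_square)
    have "integral {0..T} (\<lambda>s. (\<psi> s - a * \<Psi> s)\<^sup>2 + (b * \<Psi> s)\<^sup>2) \<le> G T - G 0"
    proof (rule has_integral_le[OF integrable_integral I])
      show "(\<lambda>s. (\<psi> s - a * \<Psi> s)\<^sup>2 + (b * \<Psi> s)\<^sup>2) integrable_on {0..T}"
        unfolding \<psi>_def \<Psi>_def by (intro integrable_continuous_interval continuous_intros)
      fix s assume s: "s \<in> {0..T}"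
      have "(\<psi> s - a * \<Psi> s)\<^sup>2 = (2 * a * exp (a * s - 2 * a * T))\<^sup>2" by (simp add: \<psi>_def \<Psi>_def algebra_simps)
      also have "\<dots> = 4 * a\<^sup>2 * exp (2 * a * s - 4 * a * T)"
        by (simp add: power_mult_distrib exp_double[symmetric] right_diff_distrib mult.assoc[symmetric])
      finally have 1: "(\<psi> s - a * \<Psi> s)\<^sup>2 = 4 * a\<^sup>2 * exp (2 * a * s - 4 * a * T)" .
      have "a * s \<le> a * T" using s a by (intro mult_left_mono) auto
      then have "0 \<le> \<Psi> s" "\<Psi> s \<le> exp (- a * s)" by (auto simp: \<Psi>_def)
      then have "(\<Psi> s)\<^sup>2 \<le> (exp (- a * s))\<^sup>2" by (intro power_mono) auto
      then have "b\<^sup>2 * (\<Psi> s)\<^sup>2 \<le> b\<^sup>2 * (exp (- a * s))\<^sup>2" by (intro mult_left_mono) auto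
      also have "(exp (- a * s))\<^sup>2 = exp (- (2 * a) * s)" by (simp add: exp_double[symmetric] mult.assoc)
      finally show "(\<psi> s - a * \<Psi> s)\<^sup>2 + (b * \<Psi> s)\<^sup>2 \<le> 4 * a\<^sup>2 * exp (2 * a * s - 4 * a * T) + b\<^sup>2 * exp (- (2 * a) * s)"
        using 1 by (simp add: power_mult_distrib)
    qed
    also have "\<dots> \<le> N"
    proof -
      have e: "2 * a * T - 4 * a * T = - (2 * a * T)" by simp
      have "0 \<le> b\<^sup>2 / (2 * a) * exp (- (2 * a) * T)" using a by simp
      then have "G T \<le> 2 * a * exp (- (2 * a * T))" unfolding G_def e by linarith
      moreover have "- G 0 \<le> b\<^sup>2 / (2 * a)" using a by (simp add: G_def)
      ultimately show ?thesis by (simp add: N_def)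
    qed
    finally show "integral {0..T} (\<lambda>s. (\<psi> s - a * \<Psi> s)\<^sup>2 + (b * \<Psi> s)\<^sup>2) \<le> N" .
  qed (use N0 in \<open>auto simp: \<Psi>_def\<close>)
  moreover have "q0\<^sup>2 / (4 * N) \<le> (q0 * \<Psi> 0)\<^sup>2 / N"
  proof -
    have "exp (- (2 * a * T)) \<le> exp (- 1)" using a by simp
    moreover have "\<Psi> 0 = 1 - exp (- (2 * a * T))" by (simp add: \<Psi>_def)
    ultimately have "1/2 \<le> \<Psi> 0" using exp_minus_one_le by linarith
    then have "(1/2)\<^sup>2 \<le> (\<Psi> 0)\<^sup>2" by (intro power_mono) auto
    then have "q0\<^sup>2 * (1/4) \<le> q0\<^sup>2 * (\<Psi> 0)\<^sup>2" by (intro mult_left_mono) (auto simp: power2_eq_square)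
    then have "q0\<^sup>2 * (1/4) / N \<le> q0\<^sup>2 * (\<Psi> 0)\<^sup>2 / N" using N0 by (intro divide_right_mono) auto
    then show ?thesis by (simp add: power_mult_distrib)
  qed
  ultimately show ?thesis unfolding N_def[symmetric] by (meson ennreal_leI order_trans)
qed

end


section \<open>Existence of strategies\<close>

definition start_paths :: "real \<Rightarrow> real \<Rightarrow> (real \<Rightarrow> real) set" where
  "start_paths T q0 = {p. continuous_on {0..T} p \<and> p 0 = q0}"

definition continuous_process :: "real \<Rightarrow> 'c measure \<Rightarrow> (real \<Rightarrow> 'c \<Rightarrow> real) \<Rightarrow> bool" where
  "continuous_process T N X \<longleftrightarrow> (\<forall>t\<in>{0..T}. X t \<in> borel_measurable N) \<and>
     (\<forall>\<omega>\<in>space N. continuous_on {0..T} (\<lambda>t. X t \<omega>))"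

section \<open>Continuous processes at random times\<close>

text \<open>The random time is approximated from below by dyadic multiples of T. At those the value
  is a finite sum of measurable terms, and path continuity yields the limit.\<close>

lemma process_at_time:
  fixes X :: "real \<Rightarrow> 'c \<Rightarrow> real"
  assumes T: "0 < T" and X: "continuous_process T N X"
    and \<tau>[measurable]: "\<tau> \<in> borel_measurable N" and r: "\<And>\<omega>. \<omega> \<in> space N \<Longrightarrow> 0 \<le> \<tau> \<omega> \<and> \<tau> \<omega> \<le> T"
  shows "(\<lambda>\<omega>. X (\<tau> \<omega>) \<omega>) \<in> borel_measurable N"
proof -
  define ix where "ix m \<omega> = nat \<lfloor>\<tau> \<omega> / T * 2 ^ m\<rfloor>" for m :: nat and \<omega>
  define Y where "Y m \<omega> = (\<Sum>k\<le>2 ^ m. if ix m \<omega> = k then X (T * (real k / 2 ^ m)) \<omega> else 0)" for m \<omega>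
  have range: "0 \<le> \<tau> \<omega> / T \<and> \<tau> \<omega> / T \<le> 1" if "\<omega> \<in> space N" for \<omega>
    using r[OF that] T by (simp add: divide_le_eq)
  have ixm[measurable]: "ix m \<in> measurable N (count_space UNIV)" for m unfolding ix_def by measurable
  show ?thesis
  proof (rule borel_measurable_LIMSEQ_real)
    fix m
    have "X (T * (real k / 2 ^ m)) \<in> borel_measurable N" if "k \<le> 2 ^ m" for k :: nat
    proof -
      have "real k \<le> real (2 ^ m)" using that by (simp only: of_nat_le_iff)
      then have "real k / 2 ^ m \<le> 1" by (simp add: divide_le_eq)
      then have "T * (real k / 2 ^ m) \<le> T * 1" using T by (intro mult_left_mono) auto
      then show ?thesis using X T by (auto simp: continuous_process_def)
    qed
    then show "Y m \<in> borel_measurable N" unfolding Y_def[abs_def] by (intro borel_measurable_sum measurable_If) auto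
  next
    fix \<omega> assume \<omega>: "\<omega> \<in> space N"
    have ixle: "ix m \<omega> \<le> 2 ^ m" for m unfolding ix_def by (rule dyadic_approx(2)) (use range[OF \<omega>] in auto)
    have Y: "Y m \<omega> = X (T * (real (ix m \<omega>) / 2 ^ m)) \<omega>" for m
      using ixle[of m] by (simp add: Y_def)
    have lim: "(\<lambda>m. T * (real (ix m \<omega>) / 2 ^ m)) \<longlonglongrightarrow> T * (\<tau> \<omega> / T)"
      unfolding ix_def by (intro tendsto_mult tendsto_const dyadic_approx(1)) (use range[OF \<omega>] in auto)
    have mem: "T * (real (ix m \<omega>) / 2 ^ m) \<in> {0..T}" for m
    proof -
      have "real (ix m \<omega>) \<le> real (2 ^ m)" using ixle by (simp only: of_nat_le_iff)
      then have "real (ix m \<omega>) / 2 ^ m \<le> 1" by (simp add: divide_le_eq)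
      then have "T * (real (ix m \<omega>) / 2 ^ m) \<le> T * 1" using T by (intro mult_left_mono) auto
      then show ?thesis using T by auto
    qed
    have "(\<lambda>m. X (T * (real (ix m \<omega>) / 2 ^ m)) \<omega>) \<longlonglongrightarrow> X (T * (\<tau> \<omega> / T)) \<omega>"
      by (rule continuous_on_tendsto_compose[OF _ lim])
         (use X \<omega> mem r[OF \<omega>] T in \<open>auto simp: continuous_process_def\<close>)
    then show "(\<lambda>m. Y m \<omega>) \<longlonglongrightarrow> X (\<tau> \<omega>) \<omega>" using T by (simp add: Y)
  qed
qed

lemma process_comp:
  assumes X: "continuous_process T N X" and f: "f \<in> measurable N' N"
  shows "continuous_process T N' (\<lambda>t \<omega>. X t (f \<omega>))"
  using X measurable_space[OF f] measurable_compose[OF f] by (auto simp: continuous_process_def)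

text \<open>An instance of \<open>process_at_time\<close> on the product space, where the time
  coordinate is itself the random time.\<close>

lemma process_jointly_measurable:
  assumes T: "0 < T" and X: "continuous_process T N X" and t: "0 \<le> t" "t \<le> T"
  shows "(\<lambda>(s, \<omega>). X s \<omega>) \<in> borel_measurable (restrict_space borel {0..t} \<Otimes>\<^sub>M N)"
proof -
  have "(\<lambda>z. X (fst z) (snd z)) \<in> borel_measurable (restrict_space borel {0..t} \<Otimes>\<^sub>M N)"
  proof (rule process_at_time[OF T process_comp[OF X measurable_snd]])
    show "fst \<in> borel_measurable (restrict_space borel {0..t} \<Otimes>\<^sub>M N)"
      by (rule measurable_compose[OF measurable_fst]) (rule measurable_restrict_space1, simp)
  qed (use t in \<open>auto simp: space_pair_measure space_restrict_space\<close>)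
  then show ?thesis by (simp add: case_prod_unfold)
qed

section \<open>Stopping rules as functionals of the path\<close>

lemma first_time_eqI:
  assumes "l \<le> x" "x \<le> r" and Q: "x < r \<Longrightarrow> l < x \<and> Q x" and nQ: "\<And>t. l < t \<Longrightarrow> t < x \<Longrightarrow> \<not> Q t"
  shows "first_time l r Q = x"
proof (cases "x < r")
  case True
  then have x: "x \<in> {l<..<r}" "Q x" using Q by auto
  have "Inf {t \<in> {l<..<r}. Q t} = x"
  proof (rule cInf_eq_minimum)
    show "x \<in> {t \<in> {l<..<r}. Q t}" using x by auto
    show "x \<le> t" if "t \<in> {t \<in> {l<..<r}. Q t}" for t using that nQ[of t] by force
  qed
  then show ?thesis using x by (auto simp: first_time_def)
next
  case False
  then have "x = r" using assms by simp
  then show ?thesis using nQ by (auto simp: first_time_def)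
qed

text \<open>The argument \<open>ty\<close> only carries the type of the probability space, over which a definition
  cannot quantify.\<close>

definition known :: "'c measure itself \<Rightarrow> real \<Rightarrow> real \<Rightarrow> ((real \<Rightarrow> real) \<Rightarrow> real) \<Rightarrow> ((real \<Rightarrow> real) \<Rightarrow> real) \<Rightarrow> bool" where
  "known ty T q0 S g \<longleftrightarrow>
     (\<forall>p\<in>start_paths T q0. \<forall>p'\<in>start_paths T q0. (\<forall>t\<in>{0..S p}. p t = p' t) \<longrightarrow> g p' = g p) \<and>
     (\<forall>(N :: 'c measure) X. continuous_process T N X \<longrightarrow> (\<forall>\<omega>\<in>space N. X 0 \<omega> = q0) \<longrightarrow>
        (\<lambda>\<omega>. g (\<lambda>t. X t \<omega>)) \<in> borel_measurable N)"

text \<open>A stopping time in the form of Galmarino's test: its value is determined by the path up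
  to that value. No filtration appears, so the switching times can be evaluated along the auxiliary
  paths of the construction below and along processes over different sigma-algebras.\<close>

definition stopping :: "'c measure itself \<Rightarrow> real \<Rightarrow> real \<Rightarrow> ((real \<Rightarrow> real) \<Rightarrow> real) \<Rightarrow> bool" where
  "stopping ty T q0 S \<longleftrightarrow> (\<forall>p\<in>start_paths T q0. 0 \<le> S p \<and> S p \<le> T) \<and> known ty T q0 S S"

lemma process_paths:
  assumes "continuous_process T N X" "\<forall>\<omega>\<in>space N. X 0 \<omega> = q0" "\<omega> \<in> space N"
  shows "(\<lambda>t. X t \<omega>) \<in> start_paths T q0"
  using assms by (auto simp: continuous_process_def start_paths_def)

context
  fixes T q0 :: real and ty :: "'c measure itself"
  assumes T: "0 < T"
begin

lemma stopping_range: "stopping ty T q0 S \<Longrightarrow> p \<in> start_paths T q0 \<Longrightarrow> 0 \<le> S p \<and> S p \<le> T"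
  by (auto simp: stopping_def)

lemma known_agree:
  "known ty T q0 S g \<Longrightarrow> p \<in> start_paths T q0 \<Longrightarrow> p' \<in> start_paths T q0 \<Longrightarrow>
    (\<And>t. 0 \<le> t \<Longrightarrow> t \<le> S p \<Longrightarrow> p t = p' t) \<Longrightarrow> g p' = g p"
  unfolding known_def by (meson atLeastAtMost_iff)

lemma known_measurable:
  fixes N :: "'c measure"
  shows "known ty T q0 S g \<Longrightarrow> continuous_process T N X \<Longrightarrow> (\<And>\<omega>. \<omega> \<in> space N \<Longrightarrow> X 0 \<omega> = q0) \<Longrightarrow>
    (\<lambda>\<omega>. g (\<lambda>t. X t \<omega>)) \<in> borel_measurable N"
  by (auto simp: known_def)

lemma stopping_known: "stopping ty T q0 S \<Longrightarrow> known ty T q0 S S"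
  by (auto simp: stopping_def)

lemma known_const: "known ty T q0 S (\<lambda>_. c)"
  by (auto simp: known_def)

lemma stopping_const: "0 \<le> c \<Longrightarrow> c \<le> T \<Longrightarrow> stopping ty T q0 (\<lambda>_. c)"
  by (auto simp: stopping_def known_const)

lemma known_mono:
  assumes "known ty T q0 S g" "\<And>p. p \<in> start_paths T q0 \<Longrightarrow> S p \<le> S' p"
  shows "known ty T q0 S' g"
  using assms unfolding known_def by (meson atLeastAtMost_iff order_trans)

lemma known_pair:
  assumes g: "known ty T q0 S g" and g': "known ty T q0 S g'"
    and G: "(\<lambda>(x, y). G x y) \<in> borel_measurable (borel \<Otimes>\<^sub>M borel)"
  shows "known ty T q0 S (\<lambda>p. G (g p) (g' p))"
  unfolding known_def
proof (intro conjI allI impI ballI)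
  fix p p' assume "p \<in> start_paths T q0" "p' \<in> start_paths T q0" "\<forall>t\<in>{0..S p}. p t = p' t"
  then have "g p' = g p" "g' p' = g' p" using g g' unfolding known_def by blast+
  then show "G (g p') (g' p') = G (g p) (g' p)" by simp
next
  fix N :: "'c measure" and X assume X: "continuous_process T N X" "\<forall>\<omega>\<in>space N. X 0 \<omega> = q0"
  have "(\<lambda>\<omega>. (g (\<lambda>t. X t \<omega>), g' (\<lambda>t. X t \<omega>))) \<in> measurable N (borel \<Otimes>\<^sub>M borel)"
    using g g' X by (intro measurable_Pair) (auto simp: known_def)
  from measurable_compose[OF this G] show "(\<lambda>\<omega>. G (g (\<lambda>t. X t \<omega>)) (g' (\<lambda>t. X t \<omega>))) \<in> borel_measurable N" by simp
qed

lemma known_at: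
  assumes S: "stopping ty T q0 S"
  shows "known ty T q0 S (\<lambda>p. p (S p))"
  unfolding known_def
proof (intro conjI allI impI ballI)
  fix p p' assume p: "p \<in> start_paths T q0" "p' \<in> start_paths T q0" and eq: "\<forall>t\<in>{0..S p}. p t = p' t"
  then have "S p' = S p" using S unfolding stopping_def known_def by blast
  then show "p' (S p') = p (S p)" using eq stopping_range[OF S p(1)] by auto
next
  fix N :: "'c measure" and X assume X: "continuous_process T N X" "\<forall>\<omega>\<in>space N. X 0 \<omega> = q0"
  show "(\<lambda>\<omega>. X (S (\<lambda>t. X t \<omega>)) \<omega>) \<in> borel_measurable N"
    by (rule process_at_time[OF T X(1)])
       (use S X stopping_range[OF S process_paths[OF X]] known_measurable[OF stopping_known[OF S] X(1)] in auto)
qed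

lemma known_cond:
  assumes g: "known ty T q0 S g" "known ty T q0 S g'" and h: "known ty T q0 S' h" "known ty T q0 S' h'"
    and le: "\<And>p. p \<in> start_paths T q0 \<Longrightarrow> S p \<le> S' p"
  shows "known ty T q0 S' (\<lambda>p. if g p < g' p then h p else h' p)"
  unfolding known_def
proof (intro conjI allI impI ballI)
  fix p p' assume p: "p \<in> start_paths T q0" "p' \<in> start_paths T q0" and eq: "\<forall>t\<in>{0..S' p}. p t = p' t"
  then have "\<forall>t\<in>{0..S p}. p t = p' t" using le[OF p(1)] by (meson atLeastAtMost_iff order_trans)
  then have "g p' = g p" "g' p' = g' p" "h p' = h p" "h' p' = h' p" using eq g h p unfolding known_def by blast+
  then show "(if g p' < g' p' then h p' else h' p') = (if g p < g' p then h p else h' p)" by simp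
next
  fix N :: "'c measure" and X assume X: "continuous_process T N X" "\<forall>\<omega>\<in>space N. X 0 \<omega> = q0"
  have X0: "\<And>\<omega>. \<omega> \<in> space N \<Longrightarrow> X 0 \<omega> = q0" using X(2) by blast
  note m = known_measurable[OF _ X(1) X0]
  show "(\<lambda>\<omega>. if g (\<lambda>t. X t \<omega>) < g' (\<lambda>t. X t \<omega>) then h (\<lambda>t. X t \<omega>) else h' (\<lambda>t. X t \<omega>)) \<in> borel_measurable N"
    by (intro measurable_If borel_measurable_less m[OF g(1)] m[OF g(2)] m[OF h(1)] m[OF h(2)])
qed

text \<open>The decision is known at \<open>S\<close>, before either branch ends, so paths that
  agree up to the chosen end take the same branch.\<close>

lemma stopping_cond:
  assumes g: "known ty T q0 S g" "known ty T q0 S g'" and S1: "stopping ty T q0 S1" "\<And>p. p \<in> start_paths T q0 \<Longrightarrow> S p \<le> S1 p"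
    and S2: "stopping ty T q0 S2" "\<And>p. p \<in> start_paths T q0 \<Longrightarrow> S p \<le> S2 p"
  shows "stopping ty T q0 (\<lambda>p. if g p < g' p then S1 p else S2 p)" (is "stopping _ _ _ ?R")
proof -
  have "known ty T q0 ?R ?R"
    unfolding known_def
  proof (intro conjI allI impI ballI)
    fix p p' assume p: "p \<in> start_paths T q0" "p' \<in> start_paths T q0" and eq: "\<forall>t\<in>{0..?R p}. p t = p' t"
    have "S p \<le> ?R p" using S1(2) S2(2) p by auto
    then have "\<forall>t\<in>{0..S p}. p t = p' t" using eq by (meson atLeastAtMost_iff order_trans)
    then have gg: "g p' = g p" "g' p' = g' p" using g p unfolding known_def by blast+
    show "?R p' = ?R p"
    proof (cases "g p < g' p")
      case True
      then have "\<forall>t\<in>{0..S1 p}. p t = p' t" using eq by (simp only: True if_True)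
      then have "S1 p' = S1 p" using p stopping_known[OF S1(1)] unfolding known_def by blast
      then show ?thesis using gg True by simp
    next
      case False
      then have "\<forall>t\<in>{0..S2 p}. p t = p' t" using eq by (simp only: False if_False)
      then have "S2 p' = S2 p" using p stopping_known[OF S2(1)] unfolding known_def by blast
      then show ?thesis using gg False by simp
    qed
  next
    fix N :: "'c measure" and X assume X: "continuous_process T N X" "\<forall>\<omega>\<in>space N. X 0 \<omega> = q0"
    have X0: "\<And>\<omega>. \<omega> \<in> space N \<Longrightarrow> X 0 \<omega> = q0" using X(2) by blast
    note m = known_measurable[OF _ X(1) X0]
    show "(\<lambda>\<omega>. if g (\<lambda>t. X t \<omega>) < g' (\<lambda>t. X t \<omega>) then S1 (\<lambda>t. X t \<omega>) else S2 (\<lambda>t. X t \<omega>)) \<in> borel_measurable N"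
      by (intro measurable_If borel_measurable_less m[OF g(1)] m[OF g(2)] m[OF stopping_known[OF S1(1)]] m[OF stopping_known[OF S2(1)]])
  qed
  then show ?thesis using stopping_range[OF S1(1)] stopping_range[OF S2(1)] by (auto simp: stopping_def)
qed

text \<open>In general the first time after S at which a condition holds may be decided by the
  immediate future of S. \<open>init\<close> prevents this: at S the condition either fails
  strictly, hence also shortly afterwards, or it holds for every value, and then the first time is
  S. The second case occurs for thresholds proportional to |p (S p)| when this is 0.\<close>

lemma stopping_first_time:
  fixes F :: "real \<Rightarrow> real \<Rightarrow> real"
  assumes S: "stopping ty T q0 S" and r: "known ty T q0 S r" "\<And>p. p \<in> start_paths T q0 \<Longrightarrow> S p \<le> r p \<and> r p \<le> T"
    and F: "continuous_on UNIV (\<lambda>(x, y). F x y)"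
    and init: "\<And>p. p \<in> start_paths T q0 \<Longrightarrow> S p < r p \<Longrightarrow> F (p (S p)) (p (S p)) < 0 \<or> (\<forall>y. 0 \<le> F (p (S p)) y)"
  shows "stopping ty T q0 (\<lambda>p. first_time (S p) (r p) (\<lambda>t. 0 \<le> F (p (S p)) (p t)))" (is "stopping _ _ _ ?R")
proof -
  have Fx: "continuous_on UNIV (F x)" for x
    using continuous_on_compose2[OF F, of UNIV "\<lambda>y. (x, y)"] by (simp add: continuous_intros)
  have Fm: "(\<lambda>z. F (fst z) (snd z)) \<in> borel_measurable (borel \<Otimes>\<^sub>M borel)"
    using borel_measurable_continuous_onI[OF F] by (simp add: borel_prod case_prod_unfold)
  have range: "S p \<le> ?R p \<and> ?R p \<le> r p" if "p \<in> start_paths T q0" for p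
    using first_time_bounds[of "S p" "r p"] r(2)[OF that] by auto
  have cont: "continuous_on {S p..r p} (\<lambda>t. F (p (S p)) (p t))" if "p \<in> start_paths T q0" for p
  proof -
    have "continuous_on {0..T} p" using that by (simp add: start_paths_def)
    then have "continuous_on {S p..r p} p"
      using r(2)[OF that] stopping_range[OF S that] by (auto elim: continuous_on_subset)
    then show ?thesis by (rule continuous_on_compose2[OF Fx]) auto
  qed
  have att: "S p < ?R p \<and> 0 \<le> F (p (S p)) (p (?R p))"
    if p: "p \<in> start_paths T q0" and neg: "F (p (S p)) (p (S p)) < 0" and lt: "?R p < r p" for p
    using first_time_attained[OF cont[OF p], of "{0..}" "\<lambda>t. 0 \<le> F (p (S p)) (p t)"] neg lt by auto
  have deg: "?R p = S p" if p: "p \<in> start_paths T q0" and "S p < r p" "\<forall>y. 0 \<le> F (p (S p)) y" for p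
  proof -
    have "{t \<in> {S p<..<r p}. 0 \<le> F (p (S p)) (p t)} = {S p<..<r p}" using that by auto
    then show ?thesis using that dense[of "S p" "r p"] cInf_greaterThanLessThan[of "S p" "r p"]
      by (auto simp: first_time_def)
  qed
  have "known ty T q0 ?R ?R"
    unfolding known_def
  proof (intro conjI allI impI ballI)
    fix p p' assume p: "p \<in> start_paths T q0" and p': "p' \<in> start_paths T q0" and eq: "\<forall>t\<in>{0..?R p}. p t = p' t"
    have eqS: "p t = p' t" if "0 \<le> t" "t \<le> S p" for t
      by (rule bspec[OF eq]) (use that range[OF p] in auto)
    have SS: "S p' = S p" by (rule known_agree[OF stopping_known[OF S] p p' eqS])
    have rr: "r p' = r p" by (rule known_agree[OF r(1) p p' eqS])
    have xx: "p' (S p) = p (S p)" using eqS[of "S p"] stopping_range[OF S p] by simp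
    show "?R p' = ?R p"
    proof (cases "S p < r p \<and> (\<forall>y. 0 \<le> F (p (S p)) y)")
      case True
      then have "?R p = S p" using deg[OF p] by blast
      moreover from True have "first_time (S p) (r p) (\<lambda>t. 0 \<le> F (p (S p)) (p' t)) = S p"
        using deg[OF p'] unfolding SS rr xx by blast
      ultimately show ?thesis unfolding SS rr xx by (simp only:)
    next
      case False
      have "first_time (S p) (r p) (\<lambda>t. 0 \<le> F (p (S p)) (p' t)) = ?R p"
      proof (rule first_time_eqI)
        show "S p \<le> ?R p" "?R p \<le> r p" using range[OF p] by auto
        show "S p < ?R p \<and> 0 \<le> F (p (S p)) (p' (?R p))" if "?R p < r p"
        proof -
          have "S p < r p" using that range[OF p] by linarith
          then have "F (p (S p)) (p (S p)) < 0" using init[OF p] False by blast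
          then have "S p < ?R p \<and> 0 \<le> F (p (S p)) (p (?R p))" using att[OF p _ that] by blast
          moreover have "p (?R p) = p' (?R p)"
            by (rule bspec[OF eq]) (use range[OF p] stopping_range[OF S p] in auto)
          ultimately show ?thesis by (simp only:)
        qed
        show "\<not> 0 \<le> F (p (S p)) (p' t)" if "S p < t" "t < ?R p" for t
        proof -
          have "p t = p' t" by (rule bspec[OF eq]) (use that stopping_range[OF S p] in auto)
          then show ?thesis using not_before_first_time[OF that] by simp
        qed
      qed
      then show ?thesis unfolding SS rr xx .
    qed
  next
    fix N :: "'c measure" and X assume X: "continuous_process T N X" "\<forall>\<omega>\<in>space N. X 0 \<omega> = q0"
    define Sx where "Sx \<omega> = S (\<lambda>t. X t \<omega>)" for \<omega>
    define rx where "rx \<omega> = r (\<lambda>t. X t \<omega>)" for \<omega>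
    define x where "x \<omega> = X (Sx \<omega>) \<omega>" for \<omega>
    define R where "R \<omega> = first_time (Sx \<omega>) (rx \<omega>) (\<lambda>t. 0 \<le> F (x \<omega>) (X t \<omega>))" for \<omega>
    have path: "\<omega> \<in> space N \<Longrightarrow> (\<lambda>t. X t \<omega>) \<in> start_paths T q0" for \<omega> by (rule process_paths[OF X])
    have [measurable]: "Sx \<in> borel_measurable N" "rx \<in> borel_measurable N" "x \<in> borel_measurable N"
      unfolding Sx_def rx_def x_def
      using known_measurable[OF stopping_known[OF S] X(1)] known_measurable[OF r(1) X(1)] known_measurable[OF known_at[OF S] X(1)] X(2) by auto
    have Fm': "(\<lambda>\<omega>. F (f \<omega>) (g \<omega>)) \<in> borel_measurable N" if "f \<in> borel_measurable N" "g \<in> borel_measurable N" for f g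
      using measurable_compose[OF measurable_Pair[OF that] Fm] by simp
    have "R \<in> borel_measurable N"
    proof (rule borel_measurableI_greater)
      fix c :: real
      \<comment> \<open>The random interval from S to c is rescaled to {0..1}, so that the rational
        test points are the same for all \<omega>; \<open>min\<close> and \<open>max\<close> keep
        the time in {0..T}.\<close>
      define Y where "Y y \<omega> = F (x \<omega>) (X (min T (max 0 (Sx \<omega> + (c - Sx \<omega>) * y))) \<omega>)" for y \<omega>
      have Ym[measurable]: "Y y \<in> borel_measurable N" for y
        unfolding Y_def
        by (intro Fm' process_at_time[OF T X(1)]) (use T in auto)
      \<comment> \<open>For c \<ge> S the event means that F is negative on the compact interval
        from S to c, hence at most some -1/(n+1) there, which the rational points detect. This makes
        it a countable combination of measurable events.\<close>
      have "R \<omega> > c \<longleftrightarrow> c < Sx \<omega> \<or> (c < rx \<omega> \<and> (\<exists>n::nat. \<forall>y\<in>{0..1} \<inter> \<rat>. Y y \<omega> \<le> - (1 / real (Suc n))))"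
        if \<omega>: "\<omega> \<in> space N" for \<omega>
      proof (cases "c < Sx \<omega>")
        case True
        then show ?thesis using range[OF path[OF \<omega>]] by (auto simp: R_def Sx_def x_def rx_def)
      next
        case False
        define s where "s = Sx \<omega>"
        have sc: "s \<le> c" using False by (simp add: s_def)
        have Rr: "s \<le> R \<omega>" "R \<omega> \<le> rx \<omega>" using range[OF path[OF \<omega>]] by (auto simp: R_def Sx_def x_def rx_def s_def)
        have s0: "0 \<le> s" "rx \<omega> \<le> T" using stopping_range[OF S path[OF \<omega>]] r(2)[OF path[OF \<omega>]] by (auto simp: s_def Sx_def rx_def)
        show ?thesis
        proof (cases "c < rx \<omega>")
          case c_rx: True
          have YX: "Y y \<omega> = F (x \<omega>) (X (s + (c - s) * y) \<omega>)" if "y \<in> {0..1}" for y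
          proof -
            have "0 \<le> (c - s) * y" "(c - s) * y \<le> (c - s) * 1" using mult_left_mono[of y 1 "c - s"] that sc by auto
            then show ?thesis using s0 c_rx by (simp add: Y_def s_def[symmetric])
          qed
          have Xc: "continuous_on {0..T} (\<lambda>t. X t \<omega>)" using X(1) \<omega> by (simp add: continuous_process_def)
          have Yc: "continuous_on {0..1} (\<lambda>y. Y y \<omega>)"
          proof -
            have "continuous_on {0..1} (\<lambda>y. X (min T (max 0 (s + (c - s) * y))) \<omega>)"
              using T by (intro continuous_on_compose2[OF Xc] continuous_intros) auto
            then show ?thesis unfolding Y_def s_def[symmetric] by (rule continuous_on_compose2[OF Fx]) auto
          qed
          have "c < R \<omega> \<longleftrightarrow> (\<exists>n::nat. \<forall>y\<in>{0..1} \<inter> \<rat>. Y y \<omega> \<le> - (1 / real (Suc n)))"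
          proof
            assume cR: "c < R \<omega>"
            then have s_rx: "s < rx \<omega>" using sc Rr by linarith
            have "\<not> (\<forall>y. 0 \<le> F (x \<omega>) y)"
            proof
              assume "\<forall>y. 0 \<le> F (x \<omega>) y"
              then have "R \<omega> = s" using deg[OF path[OF \<omega>]] s_rx by (simp add: R_def Sx_def x_def rx_def s_def)
              then show False using cR sc by simp
            qed
            then have neg: "F (x \<omega>) (X s \<omega>) < 0"
              using init[OF path[OF \<omega>]] s_rx by (auto simp: Sx_def x_def rx_def s_def)
            have negY: "Y y \<omega> < 0" if y: "y \<in> {0..1}" for y
            proof (cases "s + (c - s) * y = s")
              case True
              then show ?thesis using neg by (simp only: YX[OF y])
            next
              case False
              have "0 \<le> (c - s) * y" "(c - s) * y \<le> c - s" using mult_left_mono[of y 1 "c - s"] y sc by auto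
              then have "s < s + (c - s) * y" "s + (c - s) * y < R \<omega>" using False cR by linarith+
              then show ?thesis
                using not_before_first_time[of s "s + (c - s) * y" "rx \<omega>" "\<lambda>t. 0 \<le> F (x \<omega>) (X t \<omega>)"] YX[OF y] by (simp add: R_def s_def)
            qed
            obtain y0 where y0: "y0 \<in> {0..1}" "\<forall>y\<in>{0..1}. Y y \<omega> \<le> Y y0 \<omega>"
              using continuous_attains_sup[OF compact_Icc _ Yc] by auto
            have "0 < - Y y0 \<omega>" using negY[OF y0(1)] by simp
            then obtain n where "inverse (real (Suc n)) < - Y y0 \<omega>" using reals_Archimedean by blast
            then have "\<forall>y\<in>{0..1} \<inter> \<rat>. Y y \<omega> \<le> - (1 / real (Suc n))"
              using y0(2) by (force simp: inverse_eq_divide)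
            then show "\<exists>n::nat. \<forall>y\<in>{0..1} \<inter> \<rat>. Y y \<omega> \<le> - (1 / real (Suc n))" by blast
          next
            assume "\<exists>n::nat. \<forall>y\<in>{0..1} \<inter> \<rat>. Y y \<omega> \<le> - (1 / real (Suc n))"
            then obtain n :: nat where n: "\<And>y. y \<in> {0..1} \<inter> \<rat> \<Longrightarrow> Y y \<omega> \<le> - (1 / real (Suc n))" by blast
            have all: "Y y \<omega> \<le> - (1 / real (Suc n))" if y: "y \<in> {0..1}" for y
            proof (rule continuous_le_on_closure[of "{0<..<1} \<inter> \<rat>" "\<lambda>y. Y y \<omega>" y])
              have cl: "closure ({0<..<1::real} \<inter> \<rat>) = {0..1}"
              proof -
                have "{0<..<1::real} \<subseteq> closure ({0<..<1} \<inter> \<rat>)"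
                  using open_Int_closure_subset[of "{0<..<1::real}" \<rat>] by (simp add: Rats_closure_real)
                then have "closure {0<..<1::real} \<subseteq> closure ({0<..<1} \<inter> \<rat>)"
                  by (rule closure_minimal) simp
                moreover have "closure ({0<..<1::real} \<inter> \<rat>) \<subseteq> closure {0<..<1}" by (rule closure_mono) simp
                ultimately show ?thesis by (simp add: closure_greaterThanLessThan)
              qed
              show "continuous_on (closure ({0<..<1} \<inter> \<rat>)) (\<lambda>y. Y y \<omega>)" unfolding cl by (rule Yc)
              show "y \<in> closure ({0<..<1} \<inter> \<rat>)" unfolding cl by (rule y)
            qed (use n in auto)
            have neg: "F (x \<omega>) (X (s + (c - s) * y) \<omega>) < 0" if "y \<in> {0..1}" for y
            proof -
              have "0 < 1 / real (Suc n)" by simp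
              then show ?thesis using all[OF that] YX[OF that] by linarith
            qed
            have init': "F (x \<omega>) (X s \<omega>) < 0" using neg[of 0] by simp
            show "c < R \<omega>"
            proof (rule ccontr)
              assume "\<not> c < R \<omega>"
              then have Rc: "R \<omega> \<le> c" by simp
              then have "R \<omega> < rx \<omega>" using c_rx by simp
              then have R: "s < R \<omega>" "0 \<le> F (x \<omega>) (X (R \<omega>) \<omega>)"
                using att[OF path[OF \<omega>]] init' by (auto simp: R_def Sx_def x_def rx_def s_def)
              define y where "y = (R \<omega> - s) / (c - s)"
              have cs: "0 < c - s" using R Rc by linarith
              have "y \<in> {0..1}" using R Rc cs by (auto simp: y_def divide_le_eq)
              moreover have "s + (c - s) * y = R \<omega>" using cs by (simp add: y_def)
              ultimately show False using neg[of y] R by simp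
            qed
          qed
          then show ?thesis using False c_rx by simp
        next
          case c_rx: False
          then show ?thesis using Rr False by auto
        qed
      qed
      then have "{\<omega> \<in> space N. c < R \<omega>} = {\<omega> \<in> space N. c < Sx \<omega> \<or> (c < rx \<omega> \<and> (\<exists>n::nat. \<forall>y\<in>{0..1} \<inter> \<rat>. Y y \<omega> \<le> - (1 / real (Suc n))))}"
        by auto
      moreover have "countable ({0..1::real} \<inter> \<rat>)" by (simp add: countable_rat)
      then have "{\<omega> \<in> space N. c < Sx \<omega> \<or> (c < rx \<omega> \<and> (\<exists>n::nat. \<forall>y\<in>{0..1} \<inter> \<rat>. Y y \<omega> \<le> - (1 / real (Suc n))))} \<in> sets N"
        by measurable
      ultimately show "{\<omega> \<in> space N. c < R \<omega>} \<in> sets N" by simp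
    qed
    then show "(\<lambda>\<omega>. ?R (\<lambda>t. X t \<omega>)) \<in> borel_measurable N" by (simp add: R_def[abs_def] Sx_def rx_def x_def)
  qed
  then show ?thesis using range r(2) stopping_range[OF S] by (force simp: stopping_def)
qed

end

section \<open>Variation of constants\<close>

text \<open>The solution with value x at time s of dp = (\<alpha> p + \<eta>) dt + dw, where
  \<alpha> is the derivative of A. Only the differentiable part p - (w - w s) is solved for, so no
  integral against w occurs.\<close>

definition lin :: "(real \<Rightarrow> real) \<Rightarrow> (real \<Rightarrow> real) \<Rightarrow> real \<Rightarrow> (real \<Rightarrow> real) \<Rightarrow> real \<Rightarrow> real \<Rightarrow> real \<Rightarrow> real" where
  "lin A \<alpha> \<eta> w s x t = w t - w s +
     exp (A t - A s) * (x + (LBINT r:{s..t}. exp (A s - A r) * (\<alpha> r * (w r - w s) + \<eta>)))"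

lemma lin_start: "lin A \<alpha> \<eta> w s x s = x"
proof -
  have "(LBINT r:{s..s}. exp (A s - A r) * (\<alpha> r * (w r - w s) + \<eta>)) = 0"
    unfolding set_lebesgue_integral_def
    by (rule integral_eq_zero_AE) (use AE_lborel_singleton[of s] in eventually_elim, simp)
  then show ?thesis by (simp add: lin_def)
qed

lemma lin_cong:
  assumes "s \<le> t" "\<And>r. s \<le> r \<Longrightarrow> r \<le> t \<Longrightarrow> w r = w' r"
  shows "lin A \<alpha> \<eta> w s x t = lin A \<alpha> \<eta> w' s x t"
proof -
  have "(LBINT r:{s..t}. exp (A s - A r) * (\<alpha> r * (w r - w s) + \<eta>)) = (LBINT r:{s..t}. exp (A s - A r) * (\<alpha> r * (w' r - w' s) + \<eta>))"
    using assms by (intro set_lebesgue_integral_cong) auto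
  then show ?thesis using assms by (simp add: lin_def)
qed

lemma lin_solution:
  assumes w: "continuous_on {s..T} w" and \<alpha>: "continuous_on {s..T} \<alpha>"
    and A: "\<And>r. r \<in> {s..T} \<Longrightarrow> (A has_real_derivative \<alpha> r) (at r within {s..T})"
  shows "continuous_on {s..T} (lin A \<alpha> \<eta> w s x)"
    and "t \<in> {s..T} \<Longrightarrow> lin A \<alpha> \<eta> w s x t = x + (w t - w s) + integral {s..t} (\<lambda>r. \<alpha> r * lin A \<alpha> \<eta> w s x r + \<eta>)"
proof -
  have Ac: "continuous_on {s..T} A" unfolding continuous_on_eq_continuous_within by (intro ballI DERIV_continuous[OF A])
  define \<phi> where "\<phi> r = exp (A s - A r) * (\<alpha> r * (w r - w s) + \<eta>)" for r
  have \<phi>c: "continuous_on {s..T} \<phi>" unfolding \<phi>_def by (intro continuous_intros w \<alpha> Ac)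
  have I: "(LBINT r:{s..t}. \<phi> r) = integral {s..t} \<phi>" if "t \<in> {s..T}" for t
    by (rule set_borel_integral_eq_integral(2), rule borel_integrable_atLeastAtMost')
       (rule continuous_on_subset[OF \<phi>c], use that in auto)
  define y where "y t = exp (A t - A s) * (x + integral {s..t} \<phi>)" for t
  have lin: "lin A \<alpha> \<eta> w s x t = w t - w s + y t" if "t \<in> {s..T}" for t
    using I[OF that] by (simp add: lin_def y_def \<phi>_def)
  have dy: "(y has_real_derivative \<alpha> r * lin A \<alpha> \<eta> w s x r + \<eta>) (at r within {s..T})" if r: "r \<in> {s..T}" for r
  proof -
    have d: "((\<lambda>t. integral {s..t} \<phi>) has_real_derivative \<phi> r) (at r within {s..T})"
      unfolding has_real_derivative_iff_has_vector_derivative by (rule integral_has_vector_derivative[OF \<phi>c r])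
    have "(y has_real_derivative (exp (A r - A s) * \<alpha> r) * (x + integral {s..r} \<phi>) + \<phi> r * exp (A r - A s)) (at r within {s..T})"
      unfolding y_def by (auto intro!: derivative_eq_intros A[OF r] d)
    moreover have "\<phi> r * exp (A r - A s) = \<alpha> r * (w r - w s) + \<eta>"
      unfolding \<phi>_def by (simp add: mult.commute[of _ "exp (A r - A s)"] mult.assoc[symmetric] exp_add[symmetric])
    moreover have "(exp (A r - A s) * \<alpha> r) * (x + integral {s..r} \<phi>) = \<alpha> r * y r" by (simp add: y_def)
    moreover have "\<alpha> r * y r + (\<alpha> r * (w r - w s) + \<eta>) = \<alpha> r * lin A \<alpha> \<eta> w s x r + \<eta>"
      using lin[OF r] by (simp add: distrib_left)
    ultimately show ?thesis by (simp only:)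
  qed
  have yc: "continuous_on {s..T} y" unfolding continuous_on_eq_continuous_within by (intro ballI DERIV_continuous[OF dy])
  have "continuous_on {s..T} (\<lambda>t. w t - w s + y t)" by (intro continuous_intros w yc)
  then show "continuous_on {s..T} (lin A \<alpha> \<eta> w s x)" by (rule continuous_on_eq) (use lin in simp)
  assume t: "t \<in> {s..T}"
  have "((\<lambda>r. \<alpha> r * lin A \<alpha> \<eta> w s x r + \<eta>) has_integral (y t - y s)) {s..t}"
  proof (rule fundamental_theorem_of_calculus)
    fix r assume "r \<in> {s..t}"
    then show "(y has_vector_derivative \<alpha> r * lin A \<alpha> \<eta> w s x r + \<eta>) (at r within {s..t})"
      unfolding has_real_derivative_iff_has_vector_derivative[symmetric]
      using t by (intro DERIV_subset[OF dy]) auto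
  qed (use t in simp)
  then have "integral {s..t} (\<lambda>r. \<alpha> r * lin A \<alpha> \<eta> w s x r + \<eta>) = y t - y s" by (rule integral_unique)
  then show "lin A \<alpha> \<eta> w s x t = x + (w t - w s) + integral {s..t} (\<lambda>r. \<alpha> r * lin A \<alpha> \<eta> w s x r + \<eta>)"
    using lin[OF t] by (simp add: y_def)
qed

lemma lin_measurable:
  fixes N :: "'c measure" and A \<alpha> :: "'c \<Rightarrow> real \<Rightarrow> real"
  assumes T: "0 < T" and X: "continuous_process T N X" and t: "0 \<le> t" "t \<le> T"
    and [measurable]: "\<eta> \<in> borel_measurable N" "S \<in> borel_measurable N" "x \<in> borel_measurable N"
    and Ss: "\<And>\<omega>. \<omega> \<in> space N \<Longrightarrow> 0 \<le> S \<omega> \<and> S \<omega> \<le> T"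
    and A[measurable]: "(\<lambda>(\<omega>, r). A \<omega> r) \<in> borel_measurable (N \<Otimes>\<^sub>M borel)"
    and \<alpha>[measurable]: "(\<lambda>(\<omega>, r). \<alpha> \<omega> r) \<in> borel_measurable (N \<Otimes>\<^sub>M borel)"
  shows "(\<lambda>\<omega>. lin (A \<omega>) (\<alpha> \<omega>) (\<eta> \<omega>) (\<lambda>r. X r \<omega>) (S \<omega>) (x \<omega>) t) \<in> borel_measurable N"
proof -
  define Y where "Y = (\<lambda>(\<omega>, r). X (min T (max 0 r)) \<omega>)"
  have Ym[measurable]: "Y \<in> borel_measurable (N \<Otimes>\<^sub>M lborel)"
  proof -
    have "(\<lambda>z. X (min T (max 0 (snd z))) (fst z)) \<in> borel_measurable (N \<Otimes>\<^sub>M lborel)"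
      by (rule process_at_time[OF T process_comp[OF X measurable_fst]]) (use T in auto)
    then show ?thesis by (simp add: Y_def case_prod_unfold)
  qed
  have [measurable]: "X t \<in> borel_measurable N" using X t by (auto simp: continuous_process_def)
  have [measurable]: "(\<lambda>\<omega>. X (S \<omega>) \<omega>) \<in> borel_measurable N" by (rule process_at_time[OF T X]) (use Ss in auto)
  have A': "(\<lambda>(\<omega>, r). A \<omega> r) \<in> borel_measurable (N \<Otimes>\<^sub>M lborel)" and \<alpha>': "(\<lambda>(\<omega>, r). \<alpha> \<omega> r) \<in> borel_measurable (N \<Otimes>\<^sub>M lborel)"
    using A \<alpha> by (simp_all cong: measurable_cong_sets)
  have AS[measurable]: "(\<lambda>\<omega>. A \<omega> (S \<omega>)) \<in> borel_measurable N" "(\<lambda>\<omega>. A \<omega> t) \<in> borel_measurable N"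
    using measurable_compose[OF measurable_Pair[OF measurable_ident, of S N borel] A] measurable_compose[OF measurable_Pair[OF measurable_ident measurable_const, of t borel N] A]
    by (simp_all add: id_def)
  define Fn where "Fn = (\<lambda>(\<omega>, r). if S \<omega> \<le> r \<and> r \<le> t then exp (A \<omega> (S \<omega>) - A \<omega> r) * (\<alpha> \<omega> r * (Y (\<omega>, r) - X (S \<omega>) \<omega>) + \<eta> \<omega>) else 0)"
  have "Fn \<in> borel_measurable (N \<Otimes>\<^sub>M lborel)"
    unfolding Fn_def using A' \<alpha>' by (simp add: case_prod_unfold)
  then have "(\<lambda>\<omega>. LINT r|lborel. Fn (\<omega>, r)) \<in> borel_measurable N"
    using sigma_finite_measure.borel_measurable_lebesgue_integral[OF sigma_finite_lborel, of "\<lambda>\<omega> r. Fn (\<omega>, r)" N] by simp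
  moreover have "(LINT r|lborel. Fn (\<omega>, r)) = (LBINT r:{S \<omega>..t}. exp (A \<omega> (S \<omega>) - A \<omega> r) * (\<alpha> \<omega> r * (X r \<omega> - X (S \<omega>) \<omega>) + \<eta> \<omega>))"
    if "\<omega> \<in> space N" for \<omega>
    unfolding set_lebesgue_integral_def
    by (intro Bochner_Integration.integral_cong) (use Ss[OF that] t in \<open>auto simp: Fn_def Y_def indicator_def\<close>)
  ultimately have [measurable]: "(\<lambda>\<omega>. LBINT r:{S \<omega>..t}. exp (A \<omega> (S \<omega>) - A \<omega> r) * (\<alpha> \<omega> r * (X r \<omega> - X (S \<omega>) \<omega>) + \<eta> \<omega>)) \<in> borel_measurable N"
    by (simp cong: measurable_cong)
  show ?thesis unfolding lin_def by measurable
qed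

section \<open>Feedback laws with finitely many switching times\<close>

locale switching =
  fixes ty :: "'w measure itself" and T q0 :: real and N :: nat and Sw gn hh :: "nat \<Rightarrow> (real \<Rightarrow> real) \<Rightarrow> real"
  assumes T: "0 < T" and Sw0: "\<And>p. Sw 0 p = 0"
    and stop: "\<And>k. k \<le> N \<Longrightarrow> stopping ty T q0 (Sw k)"
    and Sw_mono: "\<And>k p. k < N \<Longrightarrow> p \<in> start_paths T q0 \<Longrightarrow> Sw k p \<le> Sw (Suc k) p"
    and gn: "\<And>k. k \<le> N \<Longrightarrow> known ty T q0 (Sw k) (gn k)" and hh: "\<And>k. k \<le> N \<Longrightarrow> known ty T q0 (Sw k) (hh k)"
begin

definition stage :: "real \<Rightarrow> real \<Rightarrow> nat \<Rightarrow> (real \<Rightarrow> real) \<Rightarrow> (real \<Rightarrow> real) \<Rightarrow> real \<Rightarrow> real" where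
  "stage a b k w p t = lin (\<lambda>r. (a + b * gn k p) * r) (\<lambda>_. a + b * gn k p) (b * hh k p) w (Sw k p) (p (Sw k p)) t"

text \<open>The feedback equation is solved stage by stage. \<open>P a b k w\<close> is right up to
  its own switching time \<open>Sw k\<close> and arbitrary afterwards; since \<open>Sw k\<close>
  depends only on the path up to that time, it is already the true one. The next step keeps this
  part and continues with the linear equation of stage k up to T. The constant path is right at time
  0 = Sw 0.\<close>

primrec P :: "real \<Rightarrow> real \<Rightarrow> nat \<Rightarrow> (real \<Rightarrow> real) \<Rightarrow> real \<Rightarrow> real" where
  "P a b 0 w = (\<lambda>_. q0)"
| "P a b (Suc k) w = (\<lambda>t. if t \<le> Sw k (P a b k w) then P a b k w t else stage a b k w (P a b k w) t)"

definition nxt :: "nat \<Rightarrow> (real \<Rightarrow> real) \<Rightarrow> real" where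
  "nxt k p = (if k < N then Sw (Suc k) p else T)"

text \<open>A functional of the trajectory alone, without reference to b: equal trajectories for
  different b yield equal controls, as required of a strategy. At most one summand is nonzero
  because the stages are disjoint half-open intervals.\<close>

definition U :: "(real \<Rightarrow> real) \<Rightarrow> real \<Rightarrow> real" where
  "U p t = (\<Sum>k\<le>N. if Sw k p \<le> t \<and> t < nxt k p then gn k p * p t + hh k p else 0)"

definition sol :: "real \<Rightarrow> real \<Rightarrow> (real \<Rightarrow> real) \<Rightarrow> real \<Rightarrow> real" where
  "sol a b w = P a b (Suc N) w"

lemma Sw_range: "k \<le> N \<Longrightarrow> p \<in> start_paths T q0 \<Longrightarrow> 0 \<le> Sw k p \<and> Sw k p \<le> T"
  using stopping_range[OF T stop] by blast

lemma Sw_le: "j \<le> k \<Longrightarrow> k \<le> N \<Longrightarrow> p \<in> start_paths T q0 \<Longrightarrow> Sw j p \<le> Sw k p"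
proof (induction k rule: dec_induct)
  case (step k)
  then show ?case using Sw_mono[of k p] by simp
qed simp

lemma nxt_range: "k \<le> N \<Longrightarrow> p \<in> start_paths T q0 \<Longrightarrow> Sw k p \<le> nxt k p \<and> nxt k p \<le> T"
  using Sw_mono[of k p] Sw_range[of k p] Sw_range[of "Suc k" p] by (auto simp: nxt_def)

lemma nxt_le: "j < k \<Longrightarrow> k \<le> N \<Longrightarrow> p \<in> start_paths T q0 \<Longrightarrow> nxt j p \<le> Sw k p"
  using Sw_le[of "Suc j" k p] by (simp add: nxt_def)

lemma U_stage:
  assumes p: "p \<in> start_paths T q0" and k: "k \<le> N" and t: "Sw k p \<le> t" "t < nxt k p"
  shows "U p t = gn k p * p t + hh k p"
proof -
  have "(if Sw j p \<le> t \<and> t < nxt j p then gn j p * p t + hh j p else 0) = (if j = k then gn k p * p t + hh k p else 0)"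
    if "j \<le> N" for j
    using t nxt_le[OF _ k p, of j] nxt_le[OF _ that p, of k] by (cases j k rule: linorder_cases) auto
  then have "U p t = (\<Sum>j\<le>N. if j = k then gn k p * p t + hh k p else 0)"
    unfolding U_def by (intro sum.cong) auto
  then show ?thesis using k by simp
qed

lemma stage_exists:
  assumes p: "p \<in> start_paths T q0" and t: "0 \<le> t" "t < T"
  shows "\<exists>k\<le>N. Sw k p \<le> t \<and> t < nxt k p"
proof -
  have "t < Sw k p \<Longrightarrow> \<exists>j<k. Sw j p \<le> t \<and> t < Sw (Suc j) p" for k
  proof (induction k)
    case 0
    then show ?case using t Sw0 by simp
  next
    case (Suc k)
    then show ?case by (cases "t < Sw k p") (auto simp: less_Suc_eq)
  qed
  note before = this[of N]
  show ?thesis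
  proof (cases "t < Sw N p")
    case True
    then obtain j where "j < N" "Sw j p \<le> t" "t < Sw (Suc j) p" using before by blast
    then show ?thesis by (intro exI[of _ j]) (simp add: nxt_def)
  next
    case False
    then show ?thesis using t by (intro exI[of _ N]) (simp add: nxt_def)
  qed
qed

lemma stage_props:
  assumes w: "continuous_on {0..T} w" and p: "p \<in> start_paths T q0" and k: "k \<le> N"
  shows "continuous_on {Sw k p..T} (stage a b k w p)" "stage a b k w p (Sw k p) = p (Sw k p)"
    and "t \<in> {Sw k p..T} \<Longrightarrow> stage a b k w p t = p (Sw k p) + (w t - w (Sw k p)) +
      integral {Sw k p..t} (\<lambda>r. (a + b * gn k p) * stage a b k w p r + b * hh k p)"
proof -
  have w': "continuous_on {Sw k p..T} w" by (rule continuous_on_subset[OF w]) (use Sw_range[OF k p] in auto)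
  note L = lin_solution[OF w', where \<alpha> = "\<lambda>_. a + b * gn k p" and A = "\<lambda>r. (a + b * gn k p) * r" and \<eta> = "b * hh k p" and x = "p (Sw k p)"]
  have e: "stage a b k w p = lin (\<lambda>r. (a + b * gn k p) * r) (\<lambda>_. a + b * gn k p) (b * hh k p) w (Sw k p) (p (Sw k p))"
    by (simp add: stage_def[abs_def])
  have D: "((\<lambda>r. (a + b * gn k p) * r) has_real_derivative a + b * gn k p) (at r within {Sw k p..T})" for r
    by (auto intro!: derivative_eq_intros)
  show "continuous_on {Sw k p..T} (stage a b k w p)" unfolding e by (rule L(1)) (auto intro!: D)
  show "stage a b k w p (Sw k p) = p (Sw k p)" unfolding e by (rule lin_start)
  show "t \<in> {Sw k p..T} \<Longrightarrow> stage a b k w p t = p (Sw k p) + (w t - w (Sw k p)) +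
      integral {Sw k p..t} (\<lambda>r. (a + b * gn k p) * stage a b k w p r + b * hh k p)"
    unfolding e by (rule L(2)) (auto intro!: D)
qed

lemma P_path:
  assumes w: "continuous_on {0..T} w"
  shows "k \<le> Suc N \<Longrightarrow> P a b k w \<in> start_paths T q0"
proof (induction k)
  case 0
  then show ?case by (simp add: start_paths_def)
next
  case (Suc k)
  define p where "p = P a b k w"
  have k: "k \<le> N" and p: "p \<in> start_paths T q0" using Suc by (auto simp: p_def)
  note r = Sw_range[OF k p] and st = stage_props[OF w p k]
  have pc: "continuous_on {0..T} p" using p by (simp add: start_paths_def)
  have "continuous_on {0..T} (\<lambda>t. if t \<le> Sw k p then p t else stage a b k w p t)"
    by (rule continuous_on_cases_le[OF continuous_on_subset[OF pc] continuous_on_subset[OF st(1)] continuous_on_id])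
       (use r st(2) in auto)
  then show ?case using r p unfolding p_def by (simp add: start_paths_def)
qed

lemma P_step: "t \<le> Sw k (P a b k w) \<Longrightarrow> P a b (Suc k) w t = P a b k w t"
  by simp

text \<open>The path of step k + 1 differs from that of step k only after \<open>Sw k\<close>, hence
  only after every earlier switching time, and a stopping time does not notice later
  changes.\<close>

lemma P_agree:
  assumes w: "continuous_on {0..T} w" and jk: "j \<le> k" and k: "k \<le> Suc N" and j: "j \<le> N"
  shows "(\<forall>t\<in>{0..Sw j (P a b j w)}. P a b j w t = P a b k w t) \<and> Sw j (P a b k w) = Sw j (P a b j w)"
  using jk k
proof (induction k rule: dec_induct)
  case base
  then show ?case by simp
next
  case (step k)
  have kN: "k \<le> N" using step.prems by simp
  have path: "i \<le> Suc N \<Longrightarrow> P a b i w \<in> start_paths T q0" for i by (rule P_path[OF w])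
  have IH: "\<forall>t\<in>{0..Sw j (P a b j w)}. P a b j w t = P a b k w t" "Sw j (P a b k w) = Sw j (P a b j w)"
    using step by auto
  have le: "Sw j (P a b j w) \<le> Sw k (P a b k w)"
    using Sw_le[OF \<open>j \<le> k\<close> kN path[of k]] kN IH(2) by simp
  have 1: "\<forall>t\<in>{0..Sw j (P a b j w)}. P a b j w t = P a b (Suc k) w t"
  proof
    fix t assume t: "t \<in> {0..Sw j (P a b j w)}"
    then have "P a b (Suc k) w t = P a b k w t" by (intro P_step) (use le in auto)
    then show "P a b j w t = P a b (Suc k) w t" using bspec[OF IH(1) t] by (simp only:)
  qed
  have "Sw j (P a b (Suc k) w) = Sw j (P a b j w)"
    using stopping_known[OF T stop[OF j]] path[of j] path[of "Suc k"] j step.prems 1 unfolding known_def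
    by (meson le_SucI)
  with 1 show ?case by (intro conjI)
qed

lemma sol_path: "continuous_on {0..T} w \<Longrightarrow> sol a b w \<in> start_paths T q0"
  unfolding sol_def by (rule P_path) auto

lemma sol_stage:
  fixes a b :: real
  assumes w: "continuous_on {0..T} w" and k: "k \<le> N"
  defines "p \<equiv> sol a b w"
  assumes t: "Sw k p \<le> t" "t \<le> nxt k p"
  shows "p t = p (Sw k p) + (w t - w (Sw k p)) + integral {Sw k p..t} (\<lambda>r. (a + b * gn k p) * p r + b * hh k p)"
proof -
  define pk where "pk = P a b k w"
  have pp: "p \<in> start_paths T q0" unfolding p_def by (rule sol_path[OF w])
  have pkp: "pk \<in> start_paths T q0" unfolding pk_def by (rule P_path[OF w]) (use k in simp)
  have A: "(\<forall>t\<in>{0..Sw k pk}. pk t = p t) \<and> Sw k p = Sw k pk"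
    unfolding p_def pk_def sol_def by (rule P_agree[OF w]) (use k in \<open>auto simp del: P.simps\<close>)
  then have Sk: "Sw k p = Sw k pk" and eqk: "\<forall>t\<in>{0..Sw k pk}. pk t = p t" by blast+
  have gk: "gn k p = gn k pk" "hh k p = hh k pk"
    using gn[OF k] hh[OF k] pp pkp eqk unfolding known_def by blast+
  have "pk (Sw k pk) = p (Sw k pk)" by (rule bspec[OF eqk]) (use Sw_range[OF k pkp] in auto)
  then have xk: "p (Sw k pk) = pk (Sw k pk)" by (rule sym)
  have seg: "p r = stage a b k w pk r" if r: "Sw k pk \<le> r" "r \<le> nxt k p" for r
  proof -
    have r0: "0 \<le> r" using r Sw_range[OF k pkp] by simp
    have "p r = P a b (Suc k) w r"
    proof (cases "k < N")
      case True
      have B: "(\<forall>t\<in>{0..Sw (Suc k) (P a b (Suc k) w)}. P a b (Suc k) w t = p t) \<and> Sw (Suc k) p = Sw (Suc k) (P a b (Suc k) w)"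
        unfolding p_def sol_def by (rule P_agree[OF w]) (use True in \<open>auto simp del: P.simps\<close>)
      have "nxt k p = Sw (Suc k) (P a b (Suc k) w)" using conjunct2[OF B] True by (simp only: nxt_def if_True)
      then have "r \<in> {0..Sw (Suc k) (P a b (Suc k) w)}" using r r0 by (simp del: P.simps)
      then show ?thesis using bspec[OF conjunct1[OF B]] by (simp del: P.simps)
    next
      case False
      then show ?thesis using k by (simp add: p_def sol_def)
    qed
    also have "\<dots> = stage a b k w pk r"
      using r stage_props(2)[OF w pkp k, of a b] by (cases "r = Sw k pk") (auto simp: pk_def[symmetric])
    finally show ?thesis .
  qed
  have tT: "t \<in> {Sw k pk..T}" using t Sk nxt_range[OF k pp] by auto
  have "p t = pk (Sw k pk) + (w t - w (Sw k pk)) + integral {Sw k pk..t} (\<lambda>r. (a + b * gn k pk) * stage a b k w pk r + b * hh k pk)"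
    using seg[of t] stage_props(3)[OF w pkp k tT, of a b] t Sk by simp
  also have "integral {Sw k pk..t} (\<lambda>r. (a + b * gn k pk) * stage a b k w pk r + b * hh k pk) =
      integral {Sw k pk..t} (\<lambda>r. (a + b * gn k pk) * p r + b * hh k pk)"
    using seg t by (intro Henstock_Kurzweil_Integration.integral_cong) auto
  finally show ?thesis by (simp only: gk Sk xk)
qed

lemma sol_integral:
  fixes a b :: real
  assumes w: "continuous_on {0..T} w" and w0: "w 0 = 0"
  defines "p \<equiv> sol a b w"
  assumes t: "0 \<le> t" "t \<le> T"
  shows "(\<lambda>s. a * p s + b * U p s) integrable_on {0..t} \<and> p t = q0 + w t + integral {0..t} (\<lambda>s. a * p s + b * U p s)"
proof -
  define f where "f s = a * p s + b * U p s" for s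
  have pp: "p \<in> start_paths T q0" unfolding p_def by (rule sol_path[OF w])
  have pc: "continuous_on {0..T} p" using pp by (simp add: start_paths_def)
  have piece: "f integrable_on {Sw k p..t} \<and> p t = p (Sw k p) + (w t - w (Sw k p)) + integral {Sw k p..t} f"
    if k: "k \<le> N" and t: "Sw k p \<le> t" "t \<le> nxt k p" for k t
  proof -
    have ci: "(\<lambda>r. (a + b * gn k p) * p r + b * hh k p) integrable_on {Sw k p..t}"
      using t nxt_range[OF k pp] Sw_range[OF k pp]
      by (intro integrable_continuous_interval continuous_intros continuous_on_subset[OF pc]) auto
    have sp: "f r = (a + b * gn k p) * p r + b * hh k p" if "r \<in> {Sw k p..t} - {t}" for r
      using U_stage[OF pp k, of r] that t by (auto simp: f_def algebra_simps)
    have "f integrable_on {Sw k p..t}" by (rule integrable_spike[OF ci, of "{t}"]) (use sp in auto)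
    moreover have "integral {Sw k p..t} f = integral {Sw k p..t} (\<lambda>r. (a + b * gn k p) * p r + b * hh k p)"
      by (rule integral_spike[of "{t}"]) (use sp in auto)
    ultimately show ?thesis using sol_stage[OF w k, of a b t] t unfolding p_def[symmetric] by simp
  qed
  have join: "f integrable_on {0..t} \<and> p t = q0 + w t + integral {0..t} f"
    if k: "k \<le> N" and I: "f integrable_on {0..Sw k p} \<and> p (Sw k p) = q0 + w (Sw k p) + integral {0..Sw k p} f"
      and t: "Sw k p \<le> t" "t \<le> nxt k p" for k t
  proof -
    have 0: "0 \<le> Sw k p" using Sw_range[OF k pp] by simp
    note pc = piece[OF k t]
    have int: "f integrable_on {0..t}"
      by (rule Henstock_Kurzweil_Integration.integrable_combine[OF 0 t(1)]) (use I pc in auto)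
    have "integral {0..Sw k p} f + integral {Sw k p..t} f = integral {0..t} f"
      by (rule Henstock_Kurzweil_Integration.integral_combine[OF 0 t(1) int])
    then show ?thesis using int I pc by simp
  qed
  have grid: "f integrable_on {0..Sw k p} \<and> p (Sw k p) = q0 + w (Sw k p) + integral {0..Sw k p} f" if "k \<le> N" for k
    using that
  proof (induction k)
    case 0
    then show ?case using pp w0 integrable_on_refl[of f "0::real"] by (simp add: Sw0 start_paths_def)
  next
    case (Suc k)
    then show ?case using join[of k "Sw (Suc k) p"] Sw_mono[OF _ pp, of k] by (auto simp: nxt_def)
  qed
  have "f integrable_on {0..t} \<and> p t = q0 + w t + integral {0..t} f"
  proof (cases "t < T")
    case True
    then obtain k where "k \<le> N" "Sw k p \<le> t" "t < nxt k p" using stage_exists[OF pp t(1)] by auto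
    then show ?thesis using join[of k t] grid[of k] by simp
  next
    case False
    then have "t = nxt N p" using t by (simp add: nxt_def)
    then show ?thesis using join[of N t] grid[of N] nxt_range[OF _ pp, of N] by simp
  qed
  then show ?thesis unfolding f_def[abs_def] .
qed

lemma U_measurable:
  assumes p: "p \<in> start_paths T q0"
  shows "(\<lambda>t. indicator {0..T} t * U p t) \<in> borel_measurable borel"
proof -
  have pm[measurable]: "(\<lambda>t. indicator {0..T} t * p t) \<in> borel_measurable borel"
    using borel_measurable_continuous_on_indicator[of "{0..T}" p] p by (simp add: start_paths_def)
  have e: "(\<lambda>t. indicator {0..T} t * U p t) = (\<lambda>t. \<Sum>k\<le>N. if Sw k p \<le> t \<and> t < nxt k p
      then gn k p * (indicator {0..T} t * p t) + hh k p * indicator {0..T} t else 0)"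
    unfolding U_def sum_distrib_left by (intro ext sum.cong refl) (auto simp: distrib_left)
  show ?thesis unfolding e by measurable
qed

lemma U_bounded:
  assumes p: "p \<in> start_paths T q0"
  obtains B where "\<And>t. t \<in> {0..T} \<Longrightarrow> \<bar>U p t\<bar> \<le> B" "\<And>t. t \<in> {0..T} \<Longrightarrow> \<bar>p t\<bar> \<le> B"
proof -
  obtain B where B: "\<And>t. t \<in> {0..T} \<Longrightarrow> \<bar>p t\<bar> \<le> B"
    using continuous_bounded_Icc[of 0 T p] p by (auto simp: start_paths_def)
  have "\<bar>U p t\<bar> \<le> (\<Sum>k\<le>N. \<bar>gn k p\<bar> * B + \<bar>hh k p\<bar>)" if t: "t \<in> {0..T}" for t
    unfolding U_def
  proof (rule order_trans[OF sum_abs sum_mono])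
    fix k
    have B0: "0 \<le> B" using B[OF t] by linarith
    have "\<bar>gn k p * p t\<bar> \<le> \<bar>gn k p\<bar> * B" unfolding abs_mult using B[OF t] by (intro mult_left_mono) auto
    then show "\<bar>if Sw k p \<le> t \<and> t < nxt k p then gn k p * p t + hh k p else 0\<bar> \<le> \<bar>gn k p\<bar> * B + \<bar>hh k p\<bar>"
      using B0 by auto
  qed
  then show thesis using that[of "max B (\<Sum>k\<le>N. \<bar>gn k p\<bar> * B + \<bar>hh k p\<bar>)"] B by (meson max.coboundedI1 max.coboundedI2)
qed

text \<open>A switching time at or before t is determined, with its coefficients, by the common part
  of the two paths. One after t for one path is so for the other too, and its stage has not begun at
  time s.\<close>

lemma U_agree:
  assumes p: "p \<in> start_paths T q0" "p' \<in> start_paths T q0" and eq: "\<forall>s\<in>{0..t}. p s = p' s" and s: "0 \<le> s" "s \<le> t"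
  shows "U p s = U p' s"
proof -
  have both: "Sw k p = Sw k p' \<and> gn k p = gn k p' \<and> hh k p = hh k p' \<or> s < Sw k p \<and> s < Sw k p'" if k: "k \<le> N" for k
  proof -
    have *: "Sw k p' = Sw k p \<and> gn k p' = gn k p \<and> hh k p' = hh k p"
      if "p \<in> start_paths T q0" "p' \<in> start_paths T q0" "\<forall>s\<in>{0..t}. p s = p' s" "Sw k p \<le> t" for p p'
    proof -
      have "\<forall>s\<in>{0..Sw k p}. p s = p' s" using that by (meson atLeastAtMost_iff order_trans)
      then show ?thesis using stopping_known[OF T stop[OF k]] gn[OF k] hh[OF k] that(1,2) unfolding known_def by blast
    qed
    have eq': "\<forall>s\<in>{0..t}. p' s = p s" using eq by (metis (no_types))
    show ?thesis using *[OF p eq] *[OF p(2,1) eq'] s by linarith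
  qed
  have nx: "s < nxt k p \<longleftrightarrow> s < nxt k p'" if "k \<le> N" for k
    using both[of "Suc k"] by (auto simp: nxt_def)
  have ps: "p s = p' s" using eq s by simp
  show ?thesis unfolding U_def
  proof (rule sum.cong[OF refl])
    fix k assume "k \<in> {..N}"
    then have k: "k \<le> N" by simp
    show "(if Sw k p \<le> s \<and> s < nxt k p then gn k p * p s + hh k p else 0) =
        (if Sw k p' \<le> s \<and> s < nxt k p' then gn k p' * p' s + hh k p' else 0)"
      using both[OF k] nx[OF k] ps by (metis not_le)
  qed
qed

text \<open>Needed for adaptedness: up to t the solution does not change if the noise is stopped at
  t.\<close>

lemma P_nonanticipating:
  assumes w: "continuous_on {0..T} w" "continuous_on {0..T} w'" and eq: "\<And>s. 0 \<le> s \<Longrightarrow> s \<le> t \<Longrightarrow> w s = w' s"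
  shows "k \<le> Suc N \<Longrightarrow> \<forall>s\<in>{0..t}. P a b k w s = P a b k w' s"
proof (induction k)
  case 0
  then show ?case by simp
next
  case (Suc k)
  define p where "p = P a b k w"
  define p' where "p' = P a b k w'"
  have k: "k \<le> N" and IH: "\<forall>s\<in>{0..t}. p s = p' s" using Suc by (auto simp: p_def p'_def)
  have pp: "p \<in> start_paths T q0" "p' \<in> start_paths T q0"
    unfolding p_def p'_def using P_path[OF w(1)] P_path[OF w(2)] Suc.prems by auto
  have *: "Sw k p' = Sw k p \<and> gn k p' = gn k p \<and> hh k p' = hh k p"
    if "p \<in> start_paths T q0" "p' \<in> start_paths T q0" "\<forall>s\<in>{0..t}. p s = p' s" "Sw k p \<le> t" for p p'
  proof -
    have "\<forall>s\<in>{0..Sw k p}. p s = p' s" using that by (meson atLeastAtMost_iff order_trans)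
    then show ?thesis using stopping_known[OF T stop[OF k]] gn[OF k] hh[OF k] that(1,2) unfolding known_def by blast
  qed
  have IH': "\<forall>s\<in>{0..t}. p' s = p s" using IH by (metis (no_types))
  show ?case
  proof
    fix s assume s: "s \<in> {0..t}"
    have ps: "p s = p' s" by (rule bspec[OF IH s])
    show "P a b (Suc k) w s = P a b (Suc k) w' s"
    proof (cases "Sw k p \<le> t \<or> Sw k p' \<le> t")
      case True
      then have e: "Sw k p' = Sw k p" "gn k p' = gn k p" "hh k p' = hh k p"
        using *[OF pp IH] *[OF pp(2,1) IH'] by auto
      have Sr: "0 \<le> Sw k p" using Sw_range[OF k pp(1)] by simp
      have St: "Sw k p \<le> t" using True e by auto
      have "p (Sw k p) = p' (Sw k p)" by (rule bspec[OF IH]) (use Sr St in auto)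
      moreover have "stage a b k w p s = stage a b k w' p s" if "Sw k p \<le> s"
        unfolding stage_def using that Sr s by (intro lin_cong eq) auto
      ultimately have "\<not> s \<le> Sw k p \<Longrightarrow> stage a b k w p s = stage a b k w' p' s"
        unfolding stage_def e by simp
      then show ?thesis using ps by (simp add: p_def[symmetric] p'_def[symmetric] e)
    next
      case False
      then show ?thesis using s ps by (simp add: p_def[symmetric] p'_def[symmetric])
    qed
  qed
qed

lemma P_process:
  fixes M :: "'w measure"
  assumes X: "continuous_process T M X"
  shows "k \<le> Suc N \<Longrightarrow> continuous_process T M (\<lambda>t \<omega>. P a b k (\<lambda>r. X r \<omega>) t)"
proof (induction k)
  case 0
  then show ?case by (simp add: continuous_process_def)
next
  case (Suc k)
  define Y where "Y t \<omega> = P a b k (\<lambda>r. X r \<omega>) t" for t \<omega>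
  have k: "k \<le> N" and Y: "continuous_process T M Y" using Suc by (auto simp: Y_def[abs_def])
  have Xc: "continuous_on {0..T} (\<lambda>r. X r \<omega>)" if "\<omega> \<in> space M" for \<omega> using X that by (simp add: continuous_process_def)
  have Yp: "(\<lambda>t. Y t \<omega>) \<in> start_paths T q0" if "\<omega> \<in> space M" for \<omega>
    using P_path[OF Xc[OF that], of k a b] k by (simp add: Y_def)
  then have Y0: "Y 0 \<omega> = q0" if "\<omega> \<in> space M" for \<omega> using that by (auto simp: start_paths_def)
  note km = known_measurable[OF T _ Y Y0]
  define S where "S \<omega> = Sw k (\<lambda>t. Y t \<omega>)" for \<omega>
  define g where "g \<omega> = gn k (\<lambda>t. Y t \<omega>)" for \<omega>
  define f where "f \<omega> = hh k (\<lambda>t. Y t \<omega>)" for \<omega>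
  define x where "x \<omega> = Y (S \<omega>) \<omega>" for \<omega>
  have [measurable]: "S \<in> borel_measurable M" "g \<in> borel_measurable M" "f \<in> borel_measurable M" "x \<in> borel_measurable M"
    unfolding S_def g_def f_def x_def
    using km[OF stopping_known[OF T stop[OF k]]] km[OF gn[OF k]] km[OF hh[OF k]] km[OF known_at[OF T stop[OF k]]] by auto
  have S_range: "\<omega> \<in> space M \<Longrightarrow> 0 \<le> S \<omega> \<and> S \<omega> \<le> T" for \<omega> unfolding S_def by (rule Sw_range[OF k Yp])
  have SY: "P a b (Suc k) (\<lambda>r. X r \<omega>) t = (if t \<le> S \<omega> then Y t \<omega> else
      lin (\<lambda>r. (a + b * g \<omega>) * r) (\<lambda>_. a + b * g \<omega>) (b * f \<omega>) (\<lambda>r. X r \<omega>) (S \<omega>) (x \<omega>) t)" for t \<omega>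
    by (simp add: Y_def S_def g_def f_def x_def stage_def)
  show ?case
    unfolding continuous_process_def
  proof (intro conjI ballI)
    fix t assume t: "t \<in> {0..T}"
    have [measurable]: "Y t \<in> borel_measurable M" using Y t by (simp add: continuous_process_def)
    have [measurable]: "(\<lambda>\<omega>. lin (\<lambda>r. (a + b * g \<omega>) * r) (\<lambda>_. a + b * g \<omega>) (b * f \<omega>) (\<lambda>r. X r \<omega>) (S \<omega>) (x \<omega>) t) \<in> borel_measurable M"
      by (rule lin_measurable[OF T X]) (use t S_range in auto)
    show "(\<lambda>\<omega>. P a b (Suc k) (\<lambda>r. X r \<omega>) t) \<in> borel_measurable M" unfolding SY by measurable
  next
    fix \<omega> assume "\<omega> \<in> space M"
    then show "continuous_on {0..T} (\<lambda>t. P a b (Suc k) (\<lambda>r. X r \<omega>) t)"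
      using P_path[OF Xc, of \<omega> "Suc k" a b] Suc.prems by (simp add: start_paths_def)
  qed
qed

lemma sol_process:
  fixes M :: "'w measure"
  assumes X: "continuous_process T M X"
  shows "continuous_process T M (\<lambda>t \<omega>. sol a b (\<lambda>r. X r \<omega>) t)"
  unfolding sol_def by (rule P_process[OF X order_refl])

lemma U_process:
  fixes M :: "'w measure"
  assumes X: "continuous_process T M X" and t: "0 \<le> t" "t \<le> T"
  shows "(\<lambda>(s, \<omega>). U (sol a b (\<lambda>r. X r \<omega>)) s) \<in> borel_measurable (restrict_space borel {0..t} \<Otimes>\<^sub>M M)"
proof -
  define Y where "Y t \<omega> = sol a b (\<lambda>r. X r \<omega>) t" for t \<omega>
  have Y: "continuous_process T M Y" unfolding Y_def[abs_def] by (rule sol_process[OF X])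
  have Yp: "(\<lambda>t. Y t \<omega>) \<in> start_paths T q0" if "\<omega> \<in> space M" for \<omega>
    using sol_path[of "\<lambda>r. X r \<omega>" a b] X that by (simp add: Y_def continuous_process_def)
  then have Y0: "Y 0 \<omega> = q0" if "\<omega> \<in> space M" for \<omega> using that by (auto simp: start_paths_def)
  note km = known_measurable[OF T _ Y Y0]
  have Sm: "(\<lambda>\<omega>. Sw k (\<lambda>t. Y t \<omega>)) \<in> borel_measurable M" "(\<lambda>\<omega>. gn k (\<lambda>t. Y t \<omega>)) \<in> borel_measurable M" "(\<lambda>\<omega>. hh k (\<lambda>t. Y t \<omega>)) \<in> borel_measurable M"
    if "k \<le> N" for k
    using km[OF stopping_known[OF T stop[OF that]]] km[OF gn[OF that]] km[OF hh[OF that]] by auto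
  have nm: "(\<lambda>\<omega>. nxt k (\<lambda>t. Y t \<omega>)) \<in> borel_measurable M" if "k \<le> N" for k
    using Sm(1)[of "Suc k"] by (cases "k < N") (auto simp: nxt_def)
  have Ym[measurable]: "(\<lambda>z. Y (fst z) (snd z)) \<in> borel_measurable (restrict_space borel {0..t} \<Otimes>\<^sub>M M)"
    using process_jointly_measurable[OF T Y t] by (simp add: case_prod_unfold)
  have fm[measurable]: "fst \<in> borel_measurable (restrict_space borel {0..t} \<Otimes>\<^sub>M M)"
    by (rule measurable_compose[OF measurable_fst]) (rule measurable_restrict_space1, simp)
  have "(\<lambda>z. U (\<lambda>t. Y t (snd z)) (fst z)) \<in> borel_measurable (restrict_space borel {0..t} \<Otimes>\<^sub>M M)"
    unfolding U_def
  proof (rule borel_measurable_sum)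
    fix k assume "k \<in> {..N}"
    then have k: "k \<le> N" by simp
    note [measurable] = measurable_compose[OF measurable_snd Sm(1)[OF k]] measurable_compose[OF measurable_snd Sm(2)[OF k]]
      measurable_compose[OF measurable_snd Sm(3)[OF k]] measurable_compose[OF measurable_snd nm[OF k]]
    show "(\<lambda>z. if Sw k (\<lambda>t. Y t (snd z)) \<le> fst z \<and> fst z < nxt k (\<lambda>t. Y t (snd z))
        then gn k (\<lambda>t. Y t (snd z)) * Y (fst z) (snd z) + hh k (\<lambda>t. Y t (snd z)) else 0) \<in> borel_measurable (restrict_space borel {0..t} \<Otimes>\<^sub>M M)"
      by measurable
  qed
  then show ?thesis by (simp add: Y_def case_prod_unfold)
qed

end

section \<open>From solutions on paths to strategies\<close>

text \<open>The equation of motion for all times at once on a single path, whereas a strategy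
  satisfies it at each fixed time almost surely.\<close>

definition solution_path :: "real \<Rightarrow> real \<Rightarrow> real \<Rightarrow> real \<Rightarrow> (real \<Rightarrow> real) \<Rightarrow> (real \<Rightarrow> real) \<Rightarrow> (real \<Rightarrow> real) \<Rightarrow> bool" where
  "solution_path T a b q0 p v w \<longleftrightarrow> continuous_on {0..T} p \<and>
     set_borel_measurable lborel {0..T} v \<and> set_integrable lborel {0..T} (\<lambda>t. (v t)\<^sup>2) \<and>
     (\<forall>t\<in>{0..T}. p t = q0 + w t + (LBINT s:{0..t}. a * p s + b * v s))"

lemma square_integrable_imp_integrable:
  fixes v :: "real \<Rightarrow> real"
  assumes m: "set_borel_measurable lborel {0..T} v" and i: "set_integrable lborel {0..T} (\<lambda>t. (v t)\<^sup>2)"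
  shows "set_integrable lborel {0..T} v"
proof -
  have one: "set_integrable lborel {0..T} (\<lambda>_. 1 :: real)"
    by (rule borel_integrable_atLeastAtMost') simp
  have "set_integrable lborel {0..T} (\<lambda>t. 1 + (v t)\<^sup>2)" by (rule set_integral_add(1)[OF one i])
  then show ?thesis
  proof (rule set_integrable_bound[OF _ m])
    show "AE x in lborel. x \<in> {0..T} \<longrightarrow> norm (v x) \<le> norm (1 + (v x)\<^sup>2)"
    proof (rule AE_I2, rule impI)
      fix x
      show "norm (v x) \<le> norm (1 + (v x)\<^sup>2)" using abs_le_one_plus_square[of "v x"] by simp
    qed
  qed
qed

lemma drift_integrable:
  fixes p v :: "real \<Rightarrow> real"
  assumes p: "continuous_on {0..T} p"
    and m: "set_borel_measurable lborel {0..T} v" and i: "set_integrable lborel {0..T} (\<lambda>t. (v t)\<^sup>2)"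
  shows "set_integrable lborel {0..T} (\<lambda>s. a * p s + b * v s)"
  by (intro set_integral_add(1) set_integrable_mult_right borel_integrable_atLeastAtMost'[OF p] square_integrable_imp_integrable[OF m i])

lemma solution_path_controlled:
  assumes s: "solution_path T a b q0 p v w" and T: "0 < T" and q0: "1 \<le> q0" and w0: "w 0 = 0"
  shows "controlled_path a b T q0 p v w"
proof
  have pc: "continuous_on {0..T} p" and m: "set_borel_measurable lborel {0..T} v"
    and i: "set_integrable lborel {0..T} (\<lambda>t. (v t)\<^sup>2)"
    and eq: "\<And>t. t \<in> {0..T} \<Longrightarrow> p t = q0 + w t + (LBINT s:{0..t}. a * p s + b * v s)"
    using s by (auto simp: solution_path_def)
  show "0 < T" "1 \<le> q0" "continuous_on {0..T} p" by fact+
  show di: "set_integrable lborel {0..T} (\<lambda>s. a * p s + b * v s)" by (rule drift_integrable[OF pc m i])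
  show "p t = q0 + w t + (LBINT s:{0..t}. a * p s + b * v s)" if "0 \<le> t" "t \<le> T" for t
    by (rule eq) (use that in auto)
  have "(LBINT s:{0..0}. a * p s + b * v s) = 0"
    unfolding set_lebesgue_integral_def
    by (rule integral_eq_zero_AE) (use AE_lborel_singleton[of 0] in eventually_elim, simp)
  then show "p 0 = q0" using eq[of 0] T w0 by simp
  have pm: "(\<lambda>t. indicator {0..T} t * p t) \<in> borel_measurable lborel"
    using borel_measurable_continuous_on_indicator[of "{0..T}" p] pc by simp
  have vm: "(\<lambda>t. indicator {0..T} t * v t) \<in> borel_measurable lborel"
    using m by (simp add: set_borel_measurable_def)
  have "(\<lambda>t. ennreal ((p t)\<^sup>2 + (v t)\<^sup>2) * indicator {0..T} t) =
      (\<lambda>t. ennreal ((indicator {0..T} t * p t)\<^sup>2 + (indicator {0..T} t * v t)\<^sup>2))"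
    by (auto simp: indicator_def fun_eq_iff)
  then show "(\<lambda>t. ennreal ((p t)\<^sup>2 + (v t)\<^sup>2) * indicator {0..T} t) \<in> borel_measurable lborel"
    using pm vm by simp
qed

lemma solution_path_uminus:
  assumes s: "solution_path T a b q0 p v w"
  shows "solution_path T a b (- q0) (\<lambda>t. - p t) (\<lambda>t. - v t) (\<lambda>t. - w t)"
proof -
  have e: "(LBINT s:{0..t}. a * - p s + b * - v s) = - (LBINT s:{0..t}. a * p s + b * v s)" for t
    unfolding set_lebesgue_integral_def by (subst integral_minus[symmetric]) (simp add: algebra_simps)
  have "set_borel_measurable lborel {0..T} (\<lambda>t. - v t)"
    using s by (simp add: solution_path_def set_borel_measurable_def)
  then show ?thesis using s unfolding solution_path_def e by (auto intro!: continuous_intros)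
qed

context brownian_motion
begin

lemma W_cont: "\<omega> \<in> space M \<Longrightarrow> continuous_on {0..T} (\<lambda>t. W t \<omega>)"
  by (rule continuous_on_subset[OF paths]) auto

text \<open>The exceptional set may depend on t. Countably many rational times give one null set,
  and both sides are continuous in t.\<close>

lemma strategy_solution_path:
  assumes T: "0 < T" and st: "strategy M W T a q0 (q, u)"
  shows "AE \<omega> in M. solution_path T a b q0 (\<lambda>t. q t b \<omega>) (\<lambda>t. u t b \<omega>) (\<lambda>t. W t \<omega>)"
proof -
  have 1: "AE \<omega> in M. continuous_on {0..T} (\<lambda>t. q t b \<omega>) \<and> set_borel_measurable lborel {0..T} (\<lambda>t. u t b \<omega>) \<and>
      set_integrable lborel {0..T} (\<lambda>t. (u t b \<omega>)\<^sup>2)"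
    using st unfolding strategy_def by auto
  have eq: "AE \<omega> in M. q t b \<omega> = q0 + W t \<omega> + (LBINT s:{0..t}. a * q s b \<omega> + b * u s b \<omega>)" if "t \<in> {0..T}" for t
    using st that unfolding strategy_def by auto
  have 2: "AE \<omega> in M. \<forall>t\<in>{0<..<T} \<inter> \<rat>. q t b \<omega> = q0 + W t \<omega> + (LBINT s:{0..t}. a * q s b \<omega> + b * u s b \<omega>)"
    by (rule AE_ball_countable'[OF eq]) (auto simp: countable_rat)
  show ?thesis
    using 1 2 AE_space
  proof eventually_elim
    case (elim \<omega>)
    define f where "f s = a * q s b \<omega> + b * u s b \<omega>" for s
    have di: "set_integrable lborel {0..T} f" unfolding f_def by (rule drift_integrable) (use elim in auto)
    have I: "(LBINT s:{0..t}. f s) = integral {0..t} f" if "t \<in> {0..T}" for t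
      by (rule set_borel_integral_eq_integral(2), rule set_integrable_subset[OF di]) (use that in auto)
    have fi: "f integrable_on {0..T}" by (rule set_borel_integral_eq_integral(1)[OF di])
    have ic: "continuous_on {0..T} (\<lambda>t. integral {0..t} f)" by (rule indefinite_integral_continuous_1[OF fi])
    define g where "g t = q t b \<omega> - (q0 + W t \<omega> + integral {0..t} f)" for t
    have gc: "continuous_on {0..T} g"
      unfolding g_def by (intro continuous_intros W_cont ic) (use elim in auto)
    have cl: "closure ({0<..<T} \<inter> \<rat>) = {0..T}"
    proof -
      have "{0<..<T} \<subseteq> closure ({0<..<T} \<inter> \<rat>)"
        using open_Int_closure_subset[of "{0<..<T}" \<rat>] by (simp add: Rats_closure_real)
      then have "closure {0<..<T} \<subseteq> closure ({0<..<T} \<inter> \<rat>)" by (rule closure_minimal) simp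
      moreover have "closure ({0<..<T} \<inter> \<rat>) \<subseteq> closure {0<..<T}" by (rule closure_mono) simp
      ultimately show ?thesis using T by (simp add: closure_greaterThanLessThan)
    qed
    have "g t = 0" if "t \<in> {0..T}" for t
    proof (rule continuous_constant_on_closure[of "{0<..<T} \<inter> \<rat>" g])
      show "continuous_on (closure ({0<..<T} \<inter> \<rat>)) g" unfolding cl by (rule gc)
      show "t \<in> closure ({0<..<T} \<inter> \<rat>)" unfolding cl by (rule that)
      show "g t = 0" if "t \<in> {0<..<T} \<inter> \<rat>" for t
        using bspec[OF elim(2) that] I[of t] that by (simp add: g_def f_def)
    qed
    then show ?case using elim I by (auto simp: solution_path_def g_def f_def)
  qed
qed

lemma W_adapted:
  assumes "0 \<le> s" "s \<le> t"
  shows "W s \<in> borel_measurable (natural_filtration M W t)"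
proof (rule measurableI)
  fix B :: "real set" assume B: "B \<in> sets borel"
  have sp: "space (natural_filtration M W t) = space M" by (rule natural_filtration_sub) (use assms in simp)
  have sub: "(\<Union>s\<in>{0..t}. {W s -` B \<inter> space M | B. B \<in> sets borel}) \<subseteq> Pow (space M)" by auto
  show "W s -` B \<inter> space (natural_filtration M W t) \<in> sets (natural_filtration M W t)"
    unfolding sp unfolding natural_filtration_def sets_measure_of[OF sub]
    by (intro sigma_sets.Basic UN_I[of s]) (use assms B in auto)
qed simp

text \<open>Every value of the path stopped at t is measurable at time t, so functionals of the
  whole stopped path are adapted.\<close>

lemma stopped_process:
  assumes t: "0 \<le> t"
  shows "continuous_process T (natural_filtration M W t) (\<lambda>r \<omega>. c * W (min r t) \<omega>)"
proof -
  have sp: "space (natural_filtration M W t) = space M" by (rule natural_filtration_sub[OF t])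
  have "continuous_on {0..T} (\<lambda>r. W (min r t) \<omega>)" if "\<omega> \<in> space M" for \<omega>
    by (rule continuous_on_compose2[OF paths[OF that]]) (use t in \<open>auto intro!: continuous_intros\<close>)
  then show ?thesis
    unfolding continuous_process_def sp
    using t by (auto intro!: borel_measurable_times W_adapted continuous_intros)
qed

lemma adapted_cong:
  assumes t: "0 \<le> t" and f: "(\<lambda>(s, \<omega>). f s \<omega>) \<in> borel_measurable (past t)"
    and eq: "\<And>s \<omega>. \<omega> \<in> space M \<Longrightarrow> 0 \<le> s \<Longrightarrow> s \<le> t \<Longrightarrow> g s \<omega> = f s \<omega>"
  shows "(\<lambda>(s, \<omega>). g s \<omega>) \<in> borel_measurable (past t)"
proof -
  have sp: "space (natural_filtration M W t) = space M" by (rule natural_filtration_sub[OF t])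
  show ?thesis
    by (rule measurable_cong[THEN iffD1, OF _ f])
       (use eq in \<open>auto simp: space_pair_measure space_restrict_space sp\<close>)
qed

lemma strategyI:
  fixes q u :: "real \<Rightarrow> real \<Rightarrow> 'w \<Rightarrow> real"
  assumes sol: "\<And>b \<omega>. \<omega> \<in> space M \<Longrightarrow> solution_path T a b q0 (\<lambda>t. q t b \<omega>) (\<lambda>t. u t b \<omega>) (\<lambda>t. W t \<omega>)"
    and adapted: "\<And>b t. 0 \<le> t \<Longrightarrow> t \<le> T \<Longrightarrow>
      (\<lambda>(s, \<omega>). q s b \<omega>) \<in> borel_measurable (past t)"
      "\<And>b t. 0 \<le> t \<Longrightarrow> t \<le> T \<Longrightarrow>
      (\<lambda>(s, \<omega>). u s b \<omega>) \<in> borel_measurable (past t)"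
    and fin: "\<And>b. ECost M T (q, u) b < \<infinity>"
    and na: "\<And>\<omega> b b' t s. \<omega> \<in> space M \<Longrightarrow> t \<le> T \<Longrightarrow> (\<forall>s\<in>{0..t}. q s b \<omega> = q s b' \<omega>) \<Longrightarrow> 0 \<le> s \<Longrightarrow> s \<le> t \<Longrightarrow> u s b \<omega> = u s b' \<omega>"
  shows "strategy M W T a q0 (q, u)"
  unfolding strategy_def prod.case
proof (intro conjI allI ballI)
  show "AE \<omega> in M. continuous_on {0..T} (\<lambda>t. q t b \<omega>) \<and> set_borel_measurable lborel {0..T} (\<lambda>t. u t b \<omega>) \<and>
        set_integrable lborel {0..T} (\<lambda>t. (u t b \<omega>)\<^sup>2)" for b
    using sol by (intro AE_I2) (auto simp: solution_path_def)
  show "AE \<omega> in M. \<forall>b b'. \<forall>t\<in>{0..T}. (\<forall>s\<in>{0..t}. q s b \<omega> = q s b' \<omega>) \<longrightarrow> (AE s in lborel. s \<in> {0..t} \<longrightarrow> u s b \<omega> = u s b' \<omega>)"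
  proof (intro AE_I2 allI ballI impI)
    fix \<omega> b b' t s
    assume "\<omega> \<in> space M" "t \<in> {0..T}" "\<forall>s\<in>{0..t}. q s b \<omega> = q s b' \<omega>" "s \<in> {0..t}"
    then show "u s b \<omega> = u s b' \<omega>" using na[of \<omega> t b b' s] by simp
  qed
  show "AE \<omega> in M. q t b \<omega> = q0 + W t \<omega> + (LBINT s:{0..t}. a * q s b \<omega> + b * u s b \<omega>)" if "t \<in> {0..T}" for b t
    by (intro AE_I2, drule sol[of _ b]) (use that in \<open>auto simp: solution_path_def\<close>)
qed (use adapted fin in auto)

end

context switching
begin

text \<open>c is 1 or -1. For a negative starting position the law is run from the reflected
  position with the reflected noise, and the result is reflected back.\<close>

definition signed :: "real \<Rightarrow> real \<Rightarrow> (real \<Rightarrow> 'w \<Rightarrow> real) \<Rightarrow> 'w strat" where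
  "signed c a W = (\<lambda>t b \<omega>. c * sol a b (\<lambda>r. c * W r \<omega>) t, \<lambda>t b \<omega>. c * U (sol a b (\<lambda>r. c * W r \<omega>)) t)"

lemma sol_solution_path:
  assumes w: "continuous_on {0..T} w" and w0: "w 0 = 0"
  shows "solution_path T a b q0 (sol a b w) (U (sol a b w)) w"
proof -
  define p where "p = sol a b w"
  have pp: "p \<in> start_paths T q0" unfolding p_def by (rule sol_path[OF w])
  then have pc: "continuous_on {0..T} p" by (simp add: start_paths_def)
  have um: "set_borel_measurable lborel {0..T} (U p)"
    using U_measurable[OF pp] by (simp add: set_borel_measurable_def)
  obtain B where B: "\<And>t. t \<in> {0..T} \<Longrightarrow> \<bar>U p t\<bar> \<le> B" using U_bounded[OF pp] by blast
  have "(\<lambda>t. (indicator {0..T} t * U p t)\<^sup>2) \<in> borel_measurable borel"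
    using U_measurable[OF pp] by simp
  moreover have "(\<lambda>t. (indicator {0..T} t * U p t)\<^sup>2) = (\<lambda>t. indicator {0..T} t * (U p t)\<^sup>2)"
    by (auto simp: indicator_def fun_eq_iff)
  ultimately have um2: "set_borel_measurable lborel {0..T} (\<lambda>t. (U p t)\<^sup>2)"
    by (simp add: set_borel_measurable_def)
  have "set_integrable lborel {0..T} (\<lambda>_. B\<^sup>2)" by (rule borel_integrable_atLeastAtMost') simp
  then have ui: "set_integrable lborel {0..T} (\<lambda>t. (U p t)\<^sup>2)"
  proof (rule set_integrable_bound[OF _ um2])
    show "AE t in lborel. t \<in> {0..T} \<longrightarrow> norm ((U p t)\<^sup>2) \<le> norm (B\<^sup>2)"
      using B by (intro AE_I2) (auto simp: power2_le_iff_abs_le abs_le_square_iff[symmetric] intro: order_trans[OF _ abs_ge_self])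
  qed
  have di: "set_integrable lborel {0..T} (\<lambda>s. a * p s + b * U p s)" by (rule drift_integrable[OF pc um ui])
  have "p t = q0 + w t + (LBINT s:{0..t}. a * p s + b * U p s)" if t: "t \<in> {0..T}" for t
  proof -
    have "(LBINT s:{0..t}. a * p s + b * U p s) = integral {0..t} (\<lambda>s. a * p s + b * U p s)"
      by (rule set_borel_integral_eq_integral(2), rule set_integrable_subset[OF di]) (use t in auto)
    then show ?thesis using sol_integral[OF w w0, of t a b] t by (simp add: p_def)
  qed
  then show ?thesis using pc um ui by (simp add: solution_path_def p_def)
qed

lemma signed_solution_path:
  assumes bm: "brownian_motion M W" and c: "c = 1 \<or> c = - 1" and \<omega>: "\<omega> \<in> space M"
  shows "solution_path T a b (c * q0) (\<lambda>t. fst (signed c a W) t b \<omega>) (\<lambda>t. snd (signed c a W) t b \<omega>) (\<lambda>t. W t \<omega>)"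
proof -
  interpret brownian_motion M W by fact
  have w: "continuous_on {0..T} (\<lambda>r. c * W r \<omega>)" by (intro continuous_intros W_cont \<omega>)
  have "solution_path T a b q0 (sol a b (\<lambda>r. c * W r \<omega>)) (U (sol a b (\<lambda>r. c * W r \<omega>))) (\<lambda>r. c * W r \<omega>)"
    by (rule sol_solution_path[OF w]) (simp add: start[OF \<omega>])
  from this solution_path_uminus[OF this] c show ?thesis by (auto simp: signed_def)
qed

text \<open>Finite cost stays a hypothesis here; for BR it is supplied by the upper bound, which is
  derived from the path equations alone. Adaptedness is obtained by stopping the noise at t, which
  changes neither the trajectory nor the control up to t.\<close>

lemma signed_strategy:
  fixes M :: "'w measure"
  assumes bm: "brownian_motion M W" and c: "c = 1 \<or> c = - 1" and fin: "\<And>b. ECost M T (signed c a W) b < \<infinity>"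
  shows "strategy M W T a (c * q0) (signed c a W)"
proof -
  interpret brownian_motion M W by fact
  define q where "q = fst (signed c a W)"
  define u where "u = snd (signed c a W)"
  have qu: "signed c a W = (q, u)" by (simp add: q_def u_def)
  have w: "continuous_on {0..T} (\<lambda>r. c * W r \<omega>)" if "\<omega> \<in> space M" for \<omega> by (intro continuous_intros W_cont that)
  have pp: "sol a b (\<lambda>r. c * W r \<omega>) \<in> start_paths T q0" if "\<omega> \<in> space M" for \<omega> b by (rule sol_path[OF w[OF that]])
  have "strategy M W T a (c * q0) (q, u)"
  proof (rule strategyI)
    show "solution_path T a b (c * q0) (\<lambda>t. q t b \<omega>) (\<lambda>t. u t b \<omega>) (\<lambda>t. W t \<omega>)" if "\<omega> \<in> space M" for b \<omega>
      using signed_solution_path[OF bm c that] by (simp add: q_def u_def)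
    fix b t assume t: "0 \<le> t" "t \<le> T"
    note X = stopped_process[OF t(1), of T c]
    have ws: "continuous_on {0..T} (\<lambda>r. c * W (min r t) \<omega>)" if "\<omega> \<in> space M" for \<omega>
      using X that natural_filtration_sub(1)[OF t(1)] by (simp add: continuous_process_def)
    have eqP: "\<forall>s\<in>{0..t}. sol a b (\<lambda>r. c * W r \<omega>) s = sol a b (\<lambda>r. c * W (min r t) \<omega>) s" if "\<omega> \<in> space M" for \<omega>
      unfolding sol_def by (rule P_nonanticipating[OF w[OF that] ws[OF that] _ order_refl]) simp
    have m1: "(\<lambda>(s, \<omega>). sol a b (\<lambda>r. c * W (min r t) \<omega>) s) \<in> borel_measurable (past t)"
      by (rule process_jointly_measurable[OF T sol_process[OF X] t])
    have m2: "(\<lambda>(s, \<omega>). U (sol a b (\<lambda>r. c * W (min r t) \<omega>)) s) \<in> borel_measurable (past t)"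
      by (rule U_process[OF X t])
    show "(\<lambda>(s, \<omega>). q s b \<omega>) \<in> borel_measurable (past t)"
    proof (rule adapted_cong[OF t(1)])
      show "(\<lambda>(s, \<omega>). c * sol a b (\<lambda>r. c * W (min r t) \<omega>) s) \<in> borel_measurable (past t)"
        using borel_measurable_times[OF borel_measurable_const m1] by (simp add: case_prod_unfold)
    qed (use eqP in \<open>auto simp: q_def signed_def\<close>)
    show "(\<lambda>(s, \<omega>). u s b \<omega>) \<in> borel_measurable (past t)"
    proof (rule adapted_cong[OF t(1)])
      show "(\<lambda>(s, \<omega>). c * U (sol a b (\<lambda>r. c * W (min r t) \<omega>)) s) \<in> borel_measurable (past t)"
        using borel_measurable_times[OF borel_measurable_const m2] by (simp add: case_prod_unfold)
      show "u s b \<omega> = c * U (sol a b (\<lambda>r. c * W (min r t) \<omega>)) s" if "\<omega> \<in> space M" "0 \<le> s" "s \<le> t" for s \<omega>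
        using U_agree[OF pp[OF that(1)] sol_path[OF ws[OF that(1)]] eqP[OF that(1)] that(2,3)] by (simp add: u_def signed_def)
    qed
  next
    show "ECost M T (q, u) b < \<infinity>" for b using fin[of b] by (simp add: qu)
    fix \<omega> b b' t s
    assume \<omega>: "\<omega> \<in> space M" and eq: "\<forall>s\<in>{0..t}. q s b \<omega> = q s b' \<omega>" and s: "0 \<le> s" "s \<le> t"
    have "\<forall>s\<in>{0..t}. sol a b (\<lambda>r. c * W r \<omega>) s = sol a b' (\<lambda>r. c * W r \<omega>) s"
      using eq c by (auto simp: q_def signed_def)
    then show "u s b \<omega> = u s b' \<omega>"
      using U_agree[OF pp[OF \<omega>] pp[OF \<omega>] _ s] by (simp add: u_def signed_def)
  qed
  then show ?thesis by (simp add: qu)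
qed

end

section \<open>BR as a switching law\<close>

lemma start_paths_continuous_path: "0 < T \<Longrightarrow> 1 \<le> q0 \<Longrightarrow> p \<in> start_paths T q0 \<Longrightarrow> continuous_path T q0 p"
  by unfold_locales (auto simp: start_paths_def)

context
  fixes T q0 :: real and ty :: "'w measure itself"
  assumes T: "0 < T" and q0: "1 \<le> q0"
begin

text \<open>The closed condition |y| = L is written as 0 \<le> -||y| - L| to fit
  \<open>stopping_first_time\<close>; \<open>stopping_band\<close> encodes its two levels by a
  product in the same way.\<close>

lemma stopping_level:
  assumes S: "stopping ty T q0 S" and L: "\<And>p. p \<in> start_paths T q0 \<Longrightarrow> S p < T \<Longrightarrow> \<bar>p (S p)\<bar> \<noteq> L"
  shows "stopping ty T q0 (\<lambda>p. first_time (S p) T (\<lambda>t. \<bar>p t\<bar> = L))"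
proof -
  have "stopping ty T q0 (\<lambda>p. first_time (S p) T (\<lambda>t. 0 \<le> - \<bar>\<bar>p t\<bar> - L\<bar>))"
    by (rule stopping_first_time[OF T S known_const, where F = "\<lambda>x y. - \<bar>\<bar>y\<bar> - L\<bar>"])
       (use T stopping_range[OF T S] L in \<open>auto simp: case_prod_unfold intro!: continuous_intros\<close>)
  then show ?thesis by simp
qed

lemma stopping_band:
  assumes s: "0 < s" "s < T"
  shows "stopping ty T q0 (\<lambda>p. first_time 0 s (\<lambda>t. p t = 2 * q0 \<or> p t = q0 / 2))"
proof -
  have "stopping ty T q0 (\<lambda>p. first_time 0 s (\<lambda>t. 0 \<le> - (\<bar>p t - 2 * q0\<bar> * \<bar>p t - q0 / 2\<bar>)))"
  proof (rule stopping_first_time[OF T stopping_const known_const, where F = "\<lambda>x y. - (\<bar>y - 2 * q0\<bar> * \<bar>y - q0 / 2\<bar>)"])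
    show "continuous_on UNIV (\<lambda>(x, y). - (\<bar>y - 2 * q0\<bar> * \<bar>y - q0 / 2\<bar>))"
      by (auto simp: case_prod_unfold intro!: continuous_intros)
    fix p assume "p \<in> start_paths T q0"
    then have "p 0 = q0" by (simp add: start_paths_def)
    then show "- (\<bar>p 0 - 2 * q0\<bar> * \<bar>p 0 - q0 / 2\<bar>) < 0 \<or> (\<forall>y. 0 \<le> - (\<bar>y - 2 * q0\<bar> * \<bar>y - q0 / 2\<bar>))"
      using q0 by auto
  qed (use s in auto)
  moreover have "0 \<le> - (\<bar>y - 2 * q0\<bar> * \<bar>y - q0 / 2\<bar>) \<longleftrightarrow> y = 2 * q0 \<or> y = q0 / 2" for y
    using mult_nonneg_nonneg[of "\<bar>y - 2 * q0\<bar>" "\<bar>y - q0 / 2\<bar>"] by (auto simp: abs_mult[symmetric])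
  ultimately show ?thesis by simp
qed

lemma stopping_doubling:
  assumes S: "stopping ty T q0 S"
  shows "stopping ty T q0 (\<lambda>p. doubling_time T p (S p))"
proof -
  have "stopping ty T q0 (\<lambda>p. first_time (S p) T (\<lambda>t. 0 \<le> \<bar>p t\<bar> - 2 * \<bar>p (S p)\<bar>))"
    by (rule stopping_first_time[OF T S known_const, where F = "\<lambda>x y. \<bar>y\<bar> - 2 * \<bar>x\<bar>"])
       (use T stopping_range[OF T S] in \<open>auto simp: case_prod_unfold intro!: continuous_intros\<close>)
  then show ?thesis by (simp add: doubling_time_def)
qed

lemma doubling_mono:
  assumes S: "stopping ty T q0 S" and p: "p \<in> start_paths T q0"
  shows "S p \<le> doubling_time T p (S p)"
  unfolding doubling_time_def by (rule first_time_bounds) (use stopping_range[OF T S p] in simp)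

lemma test_end_known:
  assumes S: "stopping ty T q0 S"
  shows "known ty T q0 S (\<lambda>p. min T (S p + \<tau>))"
  by (rule known_pair[OF T stopping_known[OF T S] stopping_known[OF T S], where G = "\<lambda>x y. min T (x + \<tau>)"]) measurable

lemma stopping_sub_i_end:
  assumes S: "stopping ty T q0 S" and \<tau>: "0 < \<tau>" "0 < a"
  shows "stopping ty T q0 (\<lambda>p. sub_i_end T a \<tau> p (S p))"
proof -
  have "0 < sqrt (a * \<tau>)" using \<tau> by simp
  then have "stopping ty T q0 (\<lambda>p. first_time (S p) (min T (S p + \<tau>)) (\<lambda>t. 0 \<le> \<bar>p t - p (S p)\<bar> - \<bar>p (S p)\<bar> * sqrt (a * \<tau>)))"
    by (intro stopping_first_time[OF T S test_end_known[OF S], where F = "\<lambda>x y. \<bar>y - x\<bar> - \<bar>x\<bar> * sqrt (a * \<tau>)"])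
       (use stopping_range[OF T S] \<tau> in \<open>auto simp: case_prod_unfold less_imp_le intro!: continuous_intros\<close>)
  then show ?thesis by (simp add: sub_i_end_def)
qed

lemma sub_i_end_mono:
  assumes S: "stopping ty T q0 S" and p: "p \<in> start_paths T q0" and \<tau>: "0 < \<tau>"
  shows "S p \<le> sub_i_end T a \<tau> p (S p)"
  unfolding sub_i_end_def by (rule first_time_bounds) (use stopping_range[OF T S p] \<tau> in auto)

lemma stopping_after_test:
  assumes S: "stopping ty T q0 S" and \<tau>: "0 < \<tau>" "0 < a"
    and S': "stopping ty T q0 S'" "\<And>p. p \<in> start_paths T q0 \<Longrightarrow> sub_i_end T a \<tau> p (S p) \<le> S' p"
  shows "stopping ty T q0 (\<lambda>p. if sub_i_end T a \<tau> p (S p) < min T (S p + \<tau>) then S' p else sub_i_end T a \<tau> p (S p))"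
proof -
  note sub = stopping_sub_i_end[OF S \<tau>]
  have "known ty T q0 (\<lambda>p. sub_i_end T a \<tau> p (S p)) (\<lambda>p. min T (S p + \<tau>))"
    by (rule known_mono[OF T test_end_known[OF S]]) (rule sub_i_end_mono[OF S _ \<tau>(1)])
  from stopping_cond[OF T stopping_known[OF T sub] this S' sub order_refl] show ?thesis .
qed

lemma stopping_next_epoch:
  assumes S: "stopping ty T q0 S" and \<tau>: "0 < \<tau>" "0 < a"
  shows "stopping ty T q0 (\<lambda>p. next_epoch T a \<tau> p (S p))"
  unfolding next_epoch_def Let_def
proof (rule stopping_after_test[OF S \<tau>])
  note sub = stopping_sub_i_end[OF S \<tau>]
  show "stopping ty T q0 (\<lambda>p. doubling_time T p (doubling_time T p (sub_i_end T a \<tau> p (S p))))"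
    by (intro stopping_doubling sub)
  show "sub_i_end T a \<tau> p (S p) \<le> doubling_time T p (doubling_time T p (sub_i_end T a \<tau> p (S p)))" if "p \<in> start_paths T q0" for p
    by (rule order_trans[OF doubling_mono[OF sub that] doubling_mono[OF stopping_doubling[OF sub] that]])
qed

lemma stopping_epoch1_start:
  assumes a: "0 < a" "1 / (10 * a) < T"
  shows "stopping ty T q0 (epoch1_start T a q0)" "p \<in> start_paths T q0 \<Longrightarrow> tau0 a q0 p \<le> epoch1_start T a q0 p"
proof -
  have st: "stopping ty T q0 (tau0 a q0)"
    unfolding tau0_def[abs_def] by (rule stopping_band) (use a in auto)
  have pos: "0 < p (tau0 a q0 p)" if "p \<in> start_paths T q0" for p
  proof -
    interpret continuous_path T q0 p by (rule start_paths_continuous_path[OF T q0 that])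
    note B = band_exit_facts[of "1 / (10 * a)", folded tau0_def]
    have "q0 / 2 \<le> p (tau0 a q0 p)" using B(3)[of "tau0 a q0 p"] B(1) a by simp
    then show ?thesis using q0 by linarith
  qed
  have "stopping ty T q0 (\<lambda>p. first_time (tau0 a q0 p) T (\<lambda>t. 0 \<le> \<bar>p t\<bar> - 2 * p (tau0 a q0 p)))"
    by (rule stopping_first_time[OF T st known_const, where F = "\<lambda>x y. \<bar>y\<bar> - 2 * x"])
       (use T stopping_range[OF T st] pos in \<open>auto simp: case_prod_unfold intro!: continuous_intros\<close>)
  then have ft: "stopping ty T q0 (\<lambda>p. first_time (tau0 a q0 p) T (\<lambda>t. \<bar>p t\<bar> \<ge> 2 * p (tau0 a q0 p)))" by simp
  have le: "tau0 a q0 p \<le> first_time (tau0 a q0 p) T (\<lambda>t. \<bar>p t\<bar> \<ge> 2 * p (tau0 a q0 p))" if "p \<in> start_paths T q0" for p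
    by (rule first_time_bounds) (use stopping_range[OF T st that] in simp)
  show "stopping ty T q0 (epoch1_start T a q0)"
    unfolding epoch1_start_def[abs_def]
    by (rule stopping_cond[OF T stopping_known[OF T st] known_const[OF T] ft le st order_refl])
  show "tau0 a q0 p \<le> epoch1_start T a q0 p" if "p \<in> start_paths T q0"
    using le[OF that] by (simp add: epoch1_start_def)
qed

lemma epoch_start_Suc:
  "epoch_start T a \<tau> q0 p (Suc 0) = epoch1_start T a q0 p"
  "epoch_start T a \<tau> q0 p (Suc (Suc j)) = next_epoch T a \<tau> p (epoch_start T a \<tau> q0 p (Suc j))"
  by (simp_all add: epoch_start_def)

lemma stopping_epoch_start:
  assumes a: "0 < a" "1 / (10 * a) < T" and \<tau>: "0 < \<tau>"
  shows "stopping ty T q0 (\<lambda>p. epoch_start T a \<tau> q0 p (Suc j))"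
proof (induction j)
  case 0
  then show ?case using stopping_epoch1_start(1)[OF a] by (simp add: epoch_start_Suc)
next
  case (Suc j)
  then show ?case using stopping_next_epoch[OF _ \<tau> a(1)] by (simp add: epoch_start_Suc)
qed

lemma bounded_switching:
  "\<exists>N Sw gn hh. switching ty T q0 N Sw gn hh \<and> (\<forall>p\<in>start_paths T q0. BR_bounded T q0 p (switching.U T N Sw gn hh p))"
proof -
  define t1 where "t1 p = first_time 0 T (\<lambda>t. \<bar>p t\<bar> = 2 * q0)" for p :: "real \<Rightarrow> real"
  define t2 where "t2 p = first_time (t1 p) T (\<lambda>t. \<bar>p t\<bar> = 4 * q0)" for p :: "real \<Rightarrow> real"
  define Sw where "Sw k p = (if k = 0 then 0 else if k = Suc 0 then t1 p else t2 p)" for k :: nat and p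
  define gn where "gn k = (\<lambda>p :: real \<Rightarrow> real. if k = 0 then - 1 else if k = Suc 0 then 1 else 0 :: real)" for k :: nat
  have s1: "stopping ty T q0 t1"
    unfolding t1_def[abs_def] by (rule stopping_level[OF stopping_const[OF T]]) (use T q0 in \<open>auto simp: start_paths_def\<close>)
  have l1: "\<bar>p (t1 p)\<bar> = 2 * q0" if "t1 p < T" "p \<in> start_paths T q0" for p
  proof -
    interpret continuous_path T q0 p by (rule start_paths_continuous_path[OF T q0 that(2)])
    show ?thesis using level_exit_facts(4)[of 0 "2 * q0"] that T q0 p0 unfolding t1_def by simp
  qed
  have s2: "stopping ty T q0 t2"
    unfolding t2_def[abs_def] by (rule stopping_level[OF s1]) (use l1 q0 in force)
  have m2: "t1 p \<le> t2 p" if "p \<in> start_paths T q0" for p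
    unfolding t2_def by (rule first_time_bounds) (use stopping_range[OF T s1 that] in simp)
  interpret switching ty T q0 2 Sw gn "\<lambda>_ _. 0"
  proof
    show "stopping ty T q0 (Sw k)" for k
      unfolding Sw_def[abs_def] using s1 s2 stopping_const[OF T, of 0] T by (cases "k = 0"; cases "k = Suc 0") simp_all
    show "Sw k p \<le> Sw (Suc k) p" if "k < 2" "p \<in> start_paths T q0" for k p
      using that m2 stopping_range[OF T s1 that(2)] by (auto simp: Sw_def less_2_cases_iff)
    show "known ty T q0 (Sw k) (gn k)" for k unfolding gn_def by (rule known_const[OF T])
  qed (use T known_const[OF T] in \<open>auto simp: Sw_def\<close>)
  have "BR_bounded T q0 p (U p)" if p: "p \<in> start_paths T q0" for p
    unfolding BR_bounded_def Let_def t1_def[symmetric] t2_def[symmetric]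
    using U_stage[OF p, of 0] U_stage[OF p, of 1] U_stage[OF p, of 2] by (auto simp: Sw_def nxt_def gn_def)
  then show ?thesis using switching_axioms by blast
qed

lemma negative_switching:
  assumes a: "a < 0" "1 / (10 * \<bar>a\<bar>) < T"
  shows "\<exists>N Sw gn hh. switching ty T q0 N Sw gn hh \<and> (\<forall>p\<in>start_paths T q0. BR_negative T a q0 p (switching.U T N Sw gn hh p))"
proof -
  define s where "s = 1 / (10 * \<bar>a\<bar>)"
  have s: "0 < s" "s < T" using a by (auto simp: s_def)
  define t1 where "t1 p = first_time 0 s (\<lambda>t. p t = 2 * q0 \<or> p t = q0 / 2)" for p :: "real \<Rightarrow> real"
  define t2 where "t2 p = first_time (t1 p) T (\<lambda>t. \<bar>p t\<bar> = 4 * q0)" for p :: "real \<Rightarrow> real"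
  \<comment> \<open>Without an exit from the test the stage with control 0 starts at
    \<open>t1\<close>, so the next switching time is put at T.\<close>
  define Sw where "Sw k p = (if k = 0 then 0 else if k = Suc 0 then t1 p else if t1 p < s then t2 p else T)" for k :: nat and p
  \<comment> \<open>At an exit the path is at q0 / 2 or 2 q0; comparing it with q0 separates the two
    by the strict inequality that \<open>known_cond\<close> handles.\<close>
  define gn where "gn k p = (if k = 0 then - 1 else if k = Suc 0 then if t1 p < s then if p (t1 p) < q0 then - 1000 else 1000 else 0 else 0 :: real)"
    for k :: nat and p
  have s1: "stopping ty T q0 t1" unfolding t1_def[abs_def] by (rule stopping_band[OF s])
  have band: "q0 / 2 \<le> p (t1 p) \<and> p (t1 p) \<le> 2 * q0" "t1 p < s \<Longrightarrow> p (t1 p) = 2 * q0 \<or> p (t1 p) = q0 / 2"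
    "0 < t1 p" "t1 p \<le> s" if "p \<in> start_paths T q0" for p
  proof -
    interpret continuous_path T q0 p by (rule start_paths_continuous_path[OF T q0 that])
    note B = band_exit_facts[OF s, folded t1_def]
    show "q0 / 2 \<le> p (t1 p) \<and> p (t1 p) \<le> 2 * q0" using B(3)[of "t1 p"] B(1) by simp
    show "t1 p < s \<Longrightarrow> p (t1 p) = 2 * q0 \<or> p (t1 p) = q0 / 2" "0 < t1 p" "t1 p \<le> s" using B by auto
  qed
  have s2: "stopping ty T q0 t2"
    unfolding t2_def[abs_def]
  proof (rule stopping_level[OF s1])
    fix p assume "p \<in> start_paths T q0"
    then show "\<bar>p (t1 p)\<bar> \<noteq> 4 * q0" using band(1)[of p] q0 by linarith
  qed
  have m2: "t1 p \<le> t2 p" if "p \<in> start_paths T q0" for p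
    unfolding t2_def by (rule first_time_bounds) (use stopping_range[OF T s1 that] in simp)
  have s3: "stopping ty T q0 (\<lambda>p. if t1 p < s then t2 p else T)"
    by (rule stopping_cond[OF T stopping_known[OF T s1] known_const[OF T] s2 m2 stopping_const[OF T]])
       (use T stopping_range[OF T s1] in auto)
  have g1: "known ty T q0 t1 (gn (Suc 0))"
    unfolding gn_def by simp
      (intro known_cond[OF T, where S = t1] stopping_known[OF T s1] known_at[OF T s1] known_const[OF T] order_refl)
  interpret switching ty T q0 2 Sw gn "\<lambda>_ _. 0"
  proof
    show "stopping ty T q0 (Sw k)" for k
      unfolding Sw_def[abs_def] using s1 s3 stopping_const[OF T, of 0] T by (cases "k = 0"; cases "k = Suc 0") simp_all
    show "Sw k p \<le> Sw (Suc k) p" if "k < 2" "p \<in> start_paths T q0" for k p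
      using that m2 stopping_range[OF T s1 that(2)] by (auto simp: Sw_def less_2_cases_iff)
    show "known ty T q0 (Sw k) (gn k)" for k
    proof (cases "k = Suc 0")
      case True
      then show ?thesis using g1 by (simp add: Sw_def[abs_def])
    next
      case False
      then have "gn k = (\<lambda>_. if k = 0 then - 1 else 0)" by (simp add: gn_def fun_eq_iff)
      then show ?thesis by (simp only: known_const[OF T])
    qed
  qed (use T known_const[OF T] in \<open>auto simp: Sw_def\<close>)
  have "BR_negative T a q0 p (U p)" if p: "p \<in> start_paths T q0" for p
    unfolding BR_negative_def Let_def s_def[symmetric] t1_def[symmetric] t2_def[symmetric]
    using U_stage[OF p, of 0] U_stage[OF p, of 1] U_stage[OF p, of 2] q0 by (auto simp: Sw_def nxt_def gn_def)
  then show ?thesis using switching_axioms by blast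
qed

text \<open>The numbering of the stages for large a: 0 and 1 are the subepochs of Epoch 0, and Epoch
  j + 1 occupies the stages 3 j + 2, 3 j + 3 and 3 j + 4.\<close>

definition pick :: "nat \<Rightarrow> 'a \<Rightarrow> 'a \<Rightarrow> (nat \<Rightarrow> 'a) \<Rightarrow> (nat \<Rightarrow> 'a) \<Rightarrow> (nat \<Rightarrow> 'a) \<Rightarrow> 'a" where
  "pick k x y f g h = (if k = 0 then x else if k = 1 then y else
     if (k - 2) mod 3 = 0 then f ((k - 2) div 3) else if (k - 2) mod 3 = 1 then g ((k - 2) div 3) else h ((k - 2) div 3))"

lemma pick_simps:
  "pick 0 x y f g h = x" "pick 1 x y f g h = y" "pick (3 * j + 2) x y f g h = f j"
  "pick (3 * j + 3) x y f g h = g j" "pick (3 * j + 4) x y f g h = h j"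
proof -
  have "3 * j + 3 - 2 = 3 * j + 1" "3 * j + 4 - 2 = 3 * j + 2" by simp_all
  moreover have "(3 * j + 1) div 3 = j" "(3 * j + 1) mod 3 = 1" "(3 * j + 2) div 3 = j" "(3 * j + 2) mod 3 = 2" by presburger+
  ultimately show "pick (3 * j + 3) x y f g h = g j" "pick (3 * j + 4) x y f g h = h j"
    unfolding pick_def by simp_all
qed (simp_all add: pick_def)

lemma stage_index_cases:
  obtains "k = 0" | "k = 1" | j where "k = 3 * j + 2" | j where "k = 3 * j + 3" | j where "k = 3 * j + (4 :: nat)"
proof -
  have "k = 0 \<or> k = 1 \<or> (\<exists>j. k = 3 * j + 2) \<or> (\<exists>j. k = 3 * j + 3) \<or> (\<exists>j. k = 3 * j + 4)" by presburger
  then show thesis using that by blast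
qed

lemma large_switching:
  assumes a: "0 < a" "1 / (10 * a) < T" and \<tau>: "0 < \<tau>"
  shows "\<exists>N Sw gn hh. switching ty T q0 N Sw gn hh \<and> (\<forall>p\<in>start_paths T q0. BR_large K \<tau> T a q0 p (switching.U T N Sw gn hh p))"
proof -
  define es where "es j p = epoch_start T a \<tau> q0 p (Suc j)" for j p
  define sub where "sub j p = sub_i_end T a \<tau> p (es j p)" for j p
  \<comment> \<open>Without a detection both feedback stages of the epoch become empty:
    \<open>th j\<close> and the start of the next epoch equal \<open>sub j\<close>.\<close>
  define th where "th j p = (if sub j p < min T (es j p + \<tau>) then doubling_time T p (sub j p) else sub j p)" for j p
  define n where "n = nat \<lfloor>a * T\<rfloor>"
  define Sw where "Sw k = pick k (\<lambda>_. 0) (tau0 a q0) es sub th" for k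
  define gn where "gn k = pick k (\<lambda>_. - 1) (\<lambda>p. if p (tau0 a q0 p) < q0 then - K else K) (\<lambda>_ _. 0)
      (\<lambda>j _. K * exp (real (Suc j))) (\<lambda>j _. - K * exp (real (Suc j)))" for k
  \<comment> \<open>Stage 3 n + 2 would be the test of epoch n + 1, which is the final one; there
    the control is 0 and the stage lasts until T.\<close>
  define hh where "hh k = pick k (\<lambda>_. 0) (\<lambda>_. 0)
      (\<lambda>j p. if j < n then exp (real (Suc j)) * p (es j p) / sqrt (a * \<tau>) else 0) (\<lambda>_ _. 0) (\<lambda>_ _. 0)" for k
  note Sweq = pick_simps[where x = "\<lambda>_. 0" and y = "tau0 a q0" and f = es and g = sub and h = th, folded Sw_def]
  note gneq = pick_simps[where x = "\<lambda>_. - 1" and y = "\<lambda>p. if p (tau0 a q0 p) < q0 then - K else K" and f = "\<lambda>_ _. 0"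
      and g = "\<lambda>j _. K * exp (real (Suc j))" and h = "\<lambda>j _. - K * exp (real (Suc j))", folded gn_def]
  note hheq = pick_simps[where x = "\<lambda>_. 0" and y = "\<lambda>_. 0" and f = "\<lambda>j p. if j < n then exp (real (Suc j)) * p (es j p) / sqrt (a * \<tau>) else 0"
      and g = "\<lambda>_ _. 0" and h = "\<lambda>_ _. 0", folded hh_def]
  have st0: "stopping ty T q0 (tau0 a q0)"
    unfolding tau0_def[abs_def] by (rule stopping_band) (use a in auto)
  have ste: "stopping ty T q0 (es j)" for j
    unfolding es_def[abs_def] by (rule stopping_epoch_start[OF a \<tau>])
  have sts: "stopping ty T q0 (sub j)" for j
    unfolding sub_def[abs_def] by (rule stopping_sub_i_end[OF ste \<tau> a(1)])
  have std: "stopping ty T q0 (\<lambda>p. doubling_time T p (sub j p))" for j by (rule stopping_doubling[OF sts])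
  have stt: "stopping ty T q0 (th j)" for j
    unfolding th_def[abs_def] sub_def
    by (rule stopping_after_test[OF ste \<tau> a(1)]) (use std doubling_mono[OF sts] in \<open>auto simp: sub_def\<close>)
  have esS: "es (Suc j) p = (if sub j p < min T (es j p + \<tau>) then doubling_time T p (th j p) else sub j p)" for j p
    by (simp add: es_def epoch_start_Suc next_epoch_def Let_def th_def sub_def)
  have step: "Suc (3 * j + 2) = 3 * j + 3" "Suc (3 * j + 3) = 3 * j + 4" "Suc (3 * j + 4) = 3 * Suc j + 2" for j :: nat by simp_all
  have step01: "Suc 0 = 1" "Suc 1 = 3 * 0 + 2" by simp_all
  interpret switching ty T q0 "3 * n + 2" Sw gn hh
  proof
    show "stopping ty T q0 (Sw k)" for k
      by (cases k rule: stage_index_cases) (simp_all only: Sweq st0 ste sts stt stopping_const[OF T order_refl less_imp_le[OF T]])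
    show "Sw k p \<le> Sw (Suc k) p" if p: "p \<in> start_paths T q0" for k p
    proof (cases k rule: stage_index_cases)
      case 1
      then show ?thesis unfolding 1 step01(1) Sweq using stopping_range[OF T st0 p] by simp
    next
      case 2
      then show ?thesis unfolding 2 step01(2) Sweq using stopping_epoch1_start(2)[OF a p] by (simp add: es_def epoch_start_Suc)
    next
      case (3 j)
      then show ?thesis unfolding 3 step Sweq using sub_i_end_mono[OF ste p \<tau>] by (simp add: sub_def)
    next
      case (4 j)
      then show ?thesis unfolding 4 step Sweq using doubling_mono[OF sts p] by (simp add: th_def)
    next
      case (5 j)
      then show ?thesis unfolding 5 step Sweq esS using doubling_mono[OF stt p, of j] by (auto simp: th_def)
    qed
    show "known ty T q0 (Sw k) (gn k)" for k
    proof (cases k rule: stage_index_cases)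
      case 2
      show ?thesis unfolding 2 Sweq gneq
        by (intro known_cond[OF T, where S = "tau0 a q0"] known_at[OF T st0] known_const[OF T] order_refl)
    qed (simp_all only: Sweq gneq known_const[OF T])
    show "known ty T q0 (Sw k) (hh k)" for k
    proof (cases k rule: stage_index_cases)
      case (3 j)
      show ?thesis
      proof (cases "j < n")
        case True
        have "known ty T q0 (es j) (\<lambda>p. (\<lambda>x y. exp (real (Suc j)) * x / sqrt (a * \<tau>)) (p (es j p)) (p (es j p)))"
          by (rule known_pair[OF T known_at[OF T ste] known_at[OF T ste]]) measurable
        then show ?thesis unfolding 3 Sweq hheq using True by simp
      next
        case False
        then show ?thesis unfolding 3 Sweq hheq using known_const[OF T] by simp
      qed
    qed (simp_all only: Sweq hheq known_const[OF T])
    show "Sw 0 p = 0" for p by (simp only: Sweq)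
  qed (rule T)
  have "BR_large K \<tau> T a q0 p (U p)" if p: "p \<in> start_paths T q0" for p
  proof -
    interpret cp: continuous_path T q0 p by (rule start_paths_continuous_path[OF T q0 p])
    have nx: "nxt k p = Sw (Suc k) p" if "k < 3 * n + 2" for k using that unfolding nxt_def by simp
    have e1: "epoch1_start T a q0 p = es 0 p" by (simp add: es_def epoch_start_Suc)
    have A: "U p t = - p t" if "t \<in> {0..<tau0 a q0 p}" for t
      using U_stage[OF p, of 0 t] that nx[of 0] unfolding step01(1) Sweq gneq hheq by simp
    have B: "U p t = (if p (tau0 a q0 p) < q0 then - K else K) * p t" if "t \<in> {tau0 a q0 p..<epoch1_start T a q0 p}" for t
      using U_stage[OF p, of 1 t] that nx[of 1] unfolding step01(2) Sweq gneq hheq e1 by simp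
    have C: "U p t = exp (real (Suc j)) * p (es j p) / sqrt (a * \<tau>)" if "j < n" "t \<in> {es j p..<sub j p}" for j t
      using U_stage[OF p, of "3 * j + 2" t] that nx[of "3 * j + 2"] unfolding step Sweq gneq hheq by simp
    have D: "U p t = K * exp (real (Suc j)) * p t" if "j < n" "t \<in> {sub j p..<th j p}" for j t
      using U_stage[OF p, of "3 * j + 3" t] that nx[of "3 * j + 3"] unfolding step Sweq gneq hheq by simp
    have E: "U p t = - K * exp (real (Suc j)) * p t" if "j < n" "t \<in> {th j p..<es (Suc j) p}" for j t
      using U_stage[OF p, of "3 * j + 4" t] that nx[of "3 * j + 4"] unfolding step Sweq gneq hheq by simp
    have F: "U p t = 0" if "t \<in> {es n p..<T}" for t
    proof -
      have "nxt (3 * n + 2) p = T" unfolding nxt_def by simp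
      then show ?thesis using U_stage[OF p, of "3 * n + 2" t] that unfolding Sweq gneq hheq by simp
    qed
    have ep: "epoch_start T a \<tau> q0 p \<nu> = es (\<nu> - 1) p" "epoch_start T a \<tau> q0 p (\<nu> + 1) = es (Suc (\<nu> - 1)) p" "\<nu> - 1 < n"
      "real \<nu> = real (Suc (\<nu> - 1))"
      if "\<nu> \<in> {1..n}" for \<nu>
      using that by (auto simp: es_def)
    show ?thesis
      unfolding BR_large_def Let_def n_def[symmetric]
    proof (intro conjI ballI impI)
      fix \<nu> assume \<nu>: "\<nu> \<in> {1..n}"
      note e = ep[OF \<nu>]
      show "U p t = exp (real \<nu>) * p (epoch_start T a \<tau> q0 p \<nu>) / sqrt (a * \<tau>)"
        if "t \<in> {epoch_start T a \<tau> q0 p \<nu>..<sub_i_end T a \<tau> p (epoch_start T a \<tau> q0 p \<nu>)}" for t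
        unfolding e(4) using C[OF e(3)] that unfolding e(1) sub_def by simp
      assume det: "sub_i_end T a \<tau> p (epoch_start T a \<tau> q0 p \<nu>) < min T (epoch_start T a \<tau> q0 p \<nu> + \<tau>)"
      then have thd: "th (\<nu> - 1) p = doubling_time T p (sub (\<nu> - 1) p)" unfolding e(1) by (simp add: th_def sub_def)
      show "U p t = K * exp (real \<nu>) * p t"
        if "t \<in> {sub_i_end T a \<tau> p (epoch_start T a \<tau> q0 p \<nu>)..<doubling_time T p (sub_i_end T a \<tau> p (epoch_start T a \<tau> q0 p \<nu>))}" for t
        unfolding e(4) using D[OF e(3), of t] that unfolding e(1) thd unfolding sub_def by simp
      show "U p t = - K * exp (real \<nu>) * p t"
        if "t \<in> {doubling_time T p (sub_i_end T a \<tau> p (epoch_start T a \<tau> q0 p \<nu>))..<epoch_start T a \<tau> q0 p (\<nu> + 1)}" for t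
        unfolding e(4) using E[OF e(3), of t] that unfolding e(1,2) thd unfolding sub_def by simp
    qed (use A B F q0 in \<open>auto simp: es_def\<close>)
  qed
  then show ?thesis using switching_axioms by blast
qed

end

lemma BR_exists:
  fixes M :: "'w measure"
  assumes bm: "brownian_motion M W" and T: "0 < T" and q0: "1 \<le> \<bar>q0\<bar>" and A: "0 < A" "1 / (10 * A) < T" and \<tau>: "A \<le> a \<Longrightarrow> 0 < \<tau>"
  shows "\<exists>\<sigma>. (\<forall>b. \<forall>\<omega>\<in>space M. solution_path T a b q0 (\<lambda>t. fst \<sigma> t b \<omega>) (\<lambda>t. snd \<sigma> t b \<omega>) (\<lambda>t. W t \<omega>) \<and>
      BR_rule K A \<tau> T a q0 (\<lambda>t. fst \<sigma> t b \<omega>) (\<lambda>t. snd \<sigma> t b \<omega>)) \<and>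
    ((\<forall>b. ECost M T \<sigma> b < \<infinity>) \<longrightarrow> strategy M W T a q0 \<sigma>)"
proof -
  have inv: "1 / (10 * c) < T" if "A \<le> c" for c
  proof -
    have "1 / (10 * c) \<le> 1 / (10 * A)" using that A by (simp add: frac_le)
    then show ?thesis using A by linarith
  qed
  have "\<exists>N Sw gn hh. switching TYPE('w measure) T \<bar>q0\<bar> N Sw gn hh \<and>
      (\<forall>p\<in>start_paths T \<bar>q0\<bar>. BR_rule_pos K A \<tau> T a \<bar>q0\<bar> p (switching.U T N Sw gn hh p))"
  proof (cases "A \<le> a")
    case True
    then show ?thesis using large_switching[OF T q0 _ inv[OF True] \<tau>[OF True]] A by (simp add: BR_rule_pos_def)
  next
    case False
    show ?thesis
    proof (cases "\<bar>a\<bar> \<le> A")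
      case True
      then show ?thesis using bounded_switching[OF T q0] False by (simp add: BR_rule_pos_def)
    next
      case F: False
      then have "a < 0" "A \<le> \<bar>a\<bar>" using False A by auto
      then show ?thesis using negative_switching[OF T q0 _ inv[of "\<bar>a\<bar>"]] False F by (simp add: BR_rule_pos_def)
    qed
  qed
  then obtain N Sw gn hh where sw: "switching TYPE('w measure) T \<bar>q0\<bar> N Sw gn hh"
    and rule: "\<And>p. p \<in> start_paths T \<bar>q0\<bar> \<Longrightarrow> BR_rule_pos K A \<tau> T a \<bar>q0\<bar> p (switching.U T N Sw gn hh p)"
    by blast
  interpret brownian_motion M W by fact
  interpret switching "TYPE('w measure)" T "\<bar>q0\<bar>" N Sw gn hh by fact
  define c :: real where "c = (if 0 < q0 then 1 else - 1)"
  have c: "c = 1 \<or> c = - 1" "c * \<bar>q0\<bar> = q0" using q0 by (auto simp: c_def)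
  have "BR_rule K A \<tau> T a q0 (\<lambda>t. fst (signed c a W) t b \<omega>) (\<lambda>t. snd (signed c a W) t b \<omega>)" if "\<omega> \<in> space M" for b \<omega>
  proof -
    have "continuous_on {0..T} (\<lambda>r. c * W r \<omega>)" by (intro continuous_intros W_cont that)
    from rule[OF sol_path[OF this, of a b]] show ?thesis
      using q0 by (auto simp: BR_rule_def signed_def c_def)
  qed
  moreover have "solution_path T a b q0 (\<lambda>t. fst (signed c a W) t b \<omega>) (\<lambda>t. snd (signed c a W) t b \<omega>) (\<lambda>t. W t \<omega>)" if "\<omega> \<in> space M" for b \<omega>
    using signed_solution_path[OF bm c(1) that, of a b] c(2) by simp
  moreover have "(\<forall>b. ECost M T (signed c a W) b < \<infinity>) \<longrightarrow> strategy M W T a q0 (signed c a W)"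
    using signed_strategy[OF bm c(1), of a] c(2) by simp
  ultimately show ?thesis by blast
qed

section \<open>Feedback with a deterministic gain\<close>

text \<open>The denominator stays positive because |a| is at most the square root of a^2 +
  \<beta>^2, which is positive, and |tanh| < 1.\<close>

lemma kappa_continuous: "continuous_on S (\<lambda>t. kappa a (T - t) \<beta>)"
proof (cases "a = 0 \<and> \<beta> = 0")
  case True
  then show ?thesis by (simp add: kappa_def continuous_intros)
next
  case False
  define s where "s = sqrt (a\<^sup>2 + \<beta>\<^sup>2)"
  have s: "0 < s" using False by (simp add: s_def sum_power2_gt_zero_iff)
  have as: "\<bar>a\<bar> \<le> s" unfolding s_def by (rule real_le_rsqrt) simp
  have "s - a * tanh x \<noteq> 0" for x :: real
  proof -
    have "\<bar>tanh x\<bar> < 1" using tanh_real_bounds[of x] by (auto simp: abs_less_iff)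
    then have "\<bar>a * tanh x\<bar> < s"
      using s as unfolding abs_mult by (metis abs_ge_zero less_eq_real_def mult_less_cancel_left_pos mult.right_neutral mult_zero_left order.strict_trans2 order.trans)
    then show ?thesis by auto
  qed
  moreover have "cosh x \<noteq> 0" for x :: real by (metis cosh_real_nonzero)
  ultimately show ?thesis
    unfolding kappa_def s_def[symmetric] using False by (auto intro!: continuous_intros)
qed

lemma lin_bound:
  assumes K: "\<And>r. r \<in> {0..T} \<Longrightarrow> \<bar>\<alpha> r\<bar> \<le> K" "\<And>r. r \<in> {0..T} \<Longrightarrow> \<bar>A r\<bar> \<le> K" "A 0 = 0"
    and \<alpha>: "continuous_on {0..T} \<alpha>" and A: "continuous_on {0..T} A"
    and w: "continuous_on {0..T} w" "\<And>r. r \<in> {0..T} \<Longrightarrow> \<bar>w r - w 0\<bar> \<le> m"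
    and t: "0 \<le> t" "t \<le> T"
  shows "\<bar>lin A \<alpha> 0 w 0 x t\<bar> \<le> (1 + exp K * (\<bar>x\<bar> + T * exp K * K)) * (1 + m)"
proof -
  have T: "0 \<le> T" using t by simp
  have K0: "0 \<le> K" using K(1)[of 0] T by auto
  have m0: "0 \<le> m" using w(2)[of 0] T by simp
  define f where "f r = exp (A 0 - A r) * (\<alpha> r * (w r - w 0) + 0)" for r
  have "continuous_on {0..t} f"
    unfolding f_def by (intro continuous_intros continuous_on_subset[OF \<alpha>] continuous_on_subset[OF A] continuous_on_subset[OF w(1)]) (use t in auto)
  then have f: "set_integrable lborel {0..t} f" by (rule borel_integrable_atLeastAtMost')
  have fb: "\<bar>f r\<bar> \<le> exp K * (K * m)" if "r \<in> {0..t}" for r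
    unfolding f_def abs_mult
  proof (rule mult_mono)
    show "\<bar>exp (A 0 - A r)\<bar> \<le> exp K" using K(2)[of r] K(3) that t by auto
    show "\<bar>\<alpha> r * (w r - w 0) + 0\<bar> \<le> K * m"
      using mult_mono[OF K(1)[of r] w(2)[of r]] that t K0 by (simp add: abs_mult)
  qed auto
  have "\<bar>LBINT r:{0..t}. f r\<bar> \<le> (LBINT r:{0..t}. exp K * (K * m))"
  proof -
    have "\<bar>LBINT r:{0..t}. f r\<bar> \<le> (LBINT r:{0..t}. \<bar>f r\<bar>)"
      using set_integral_norm_bound[OF f] by simp
    also have "\<dots> \<le> (LBINT r:{0..t}. exp K * (K * m))"
      by (rule set_integral_mono[OF set_integrable_abs[OF f]]) (use fb in \<open>auto intro!: borel_integrable_atLeastAtMost'\<close>)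
    finally show ?thesis .
  qed
  also have "(LBINT r:{0..t}. exp K * (K * m)) = exp K * (K * m) * t"
    using t by (simp add: set_lebesgue_integral_def)
  also have "\<dots> \<le> T * exp K * K * m" using t K0 m0 mult_left_mono[of t T "exp K * (K * m)"] by (simp add: ac_simps)
  finally have I: "\<bar>LBINT r:{0..t}. f r\<bar> \<le> T * exp K * K * m" .
  have At: "exp (A t - A 0) \<le> exp K" using K(2)[of t] K(3) t by auto
  have "\<bar>exp (A t - A 0) * (x + (LBINT r:{0..t}. f r))\<bar> \<le> exp K * (\<bar>x\<bar> + T * exp K * K * m)"
    unfolding abs_mult by (rule mult_mono) (use At I in auto)
  then have "\<bar>lin A \<alpha> 0 w 0 x t\<bar> \<le> m + exp K * (\<bar>x\<bar> + T * exp K * K * m)"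
    using w(2)[of t] t unfolding lin_def f_def by auto
  also have "\<dots> \<le> (1 + exp K * (\<bar>x\<bar> + T * exp K * K)) * (1 + m)"
    using m0 K0 T by (simp add: algebra_simps)
  finally show ?thesis .
qed

text \<open>Provides the witness without which the choice in \<open>sigma_opt\<close> would be
  arbitrary and the lower bound could not be applied to it. The coefficients are cut off by
  indicators so as to be Borel functions on the whole line.\<close>

lemma (in brownian_motion) feedback_strategy:
  assumes T: "0 < T" and k: "continuous_on {0..T} k"
  shows "\<exists>\<sigma>. strategy M W T a q0 \<sigma> \<and> (\<forall>b. AE \<omega> in M. \<forall>t\<in>{0..T}. snd \<sigma> t b \<omega> = k t * fst \<sigma> t b \<omega>)"
proof -
  define \<alpha> where "\<alpha> b t = a + b * (indicator {0..T} t * k t)" for b t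
  define A where "A b t = indicator {0..T} t * integral {0..t} (\<alpha> b)" for b t
  have \<alpha>c: "continuous_on {0..T} (\<alpha> b)" for b
  proof -
    have "continuous_on {0..T} (\<lambda>t. a + b * k t)" by (intro continuous_intros k)
    then show ?thesis by (rule continuous_on_eq) (simp add: \<alpha>_def)
  qed
  have Ic: "continuous_on {0..T} (\<lambda>t. integral {0..t} (\<alpha> b))" for b
    by (intro indefinite_integral_continuous_1 integrable_continuous_interval \<alpha>c)
  have km[measurable]: "(\<lambda>t. indicator {0..T} t * k t) \<in> borel_measurable borel"
    using borel_measurable_continuous_on_indicator[of "{0..T}" k] k by simp
  have \<alpha>m[measurable]: "\<alpha> b \<in> borel_measurable borel" for b unfolding \<alpha>_def by measurable
  have Am[measurable]: "A b \<in> borel_measurable borel" for b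
    using borel_measurable_continuous_on_indicator[of "{0..T}" "\<lambda>t. integral {0..t} (\<alpha> b)"] Ic by (simp add: A_def[abs_def])
  have Ac: "continuous_on {0..T} (A b)" for b by (rule continuous_on_eq[OF Ic]) (simp add: A_def)
  have Ad: "(A b has_real_derivative \<alpha> b r) (at r within {0..T})" if "r \<in> {0..T}" for b r
  proof -
    have "((\<lambda>t. integral {0..t} (\<alpha> b)) has_vector_derivative \<alpha> b r) (at r within {0..T})"
      by (rule integral_has_vector_derivative[OF \<alpha>c that])
    then have "(A b has_vector_derivative \<alpha> b r) (at r within {0..T})"
      by (rule has_vector_derivative_transform[OF that, rotated]) (simp add: A_def)
    then show ?thesis by (simp add: has_real_derivative_iff_has_vector_derivative)
  qed
  define q where "q t b \<omega> = lin (A b) (\<alpha> b) 0 (\<lambda>r. W r \<omega>) 0 q0 t" for t b \<omega>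
  define u where "u t b \<omega> = (indicator {0..T} t * k t) * q t b \<omega>" for t b \<omega>
  obtain B where B: "\<And>t. t \<in> {0..T} \<Longrightarrow> \<bar>k t\<bar> \<le> B" using continuous_bounded_Icc[OF k] by blast
  have sol: "solution_path T a b q0 (\<lambda>t. q t b \<omega>) (\<lambda>t. u t b \<omega>) (\<lambda>t. W t \<omega>)" if \<omega>: "\<omega> \<in> space M" for b \<omega>
  proof -
    note L = lin_solution[OF W_cont[OF \<omega>, of T] \<alpha>c[of b] Ad[of _ b], where \<eta> = 0 and x = q0]
    have qc: "continuous_on {0..T} (\<lambda>t. q t b \<omega>)" using L(1) by (simp add: q_def[abs_def])
    have kqc: "continuous_on {0..T} (\<lambda>t. k t * q t b \<omega>)" by (intro continuous_intros k qc)
    have uc: "continuous_on {0..T} (\<lambda>t. u t b \<omega>)" by (rule continuous_on_eq[OF kqc]) (simp add: u_def)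
    have "set_borel_measurable lborel {0..T} (\<lambda>t. u t b \<omega>)"
      using borel_measurable_continuous_on_indicator[of "{0..T}" "\<lambda>t. u t b \<omega>"] uc by (simp add: set_borel_measurable_def)
    moreover have "set_integrable lborel {0..T} (\<lambda>t. (u t b \<omega>)\<^sup>2)"
      by (intro borel_integrable_atLeastAtMost' continuous_intros uc)
    moreover have "q t b \<omega> = q0 + W t \<omega> + (LBINT s:{0..t}. a * q s b \<omega> + b * u s b \<omega>)" if t: "t \<in> {0..T}" for t
    proof -
      have "(LBINT s:{0..t}. a * q s b \<omega> + b * u s b \<omega>) = integral {0..t} (\<lambda>s. a * q s b \<omega> + b * u s b \<omega>)"
        by (rule set_borel_integral_eq_integral(2), rule borel_integrable_atLeastAtMost')
           (intro continuous_intros continuous_on_subset[OF qc] continuous_on_subset[OF uc], use t in auto)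
      also have "\<dots> = integral {0..t} (\<lambda>s. \<alpha> b s * q s b \<omega> + 0)"
        by (rule Henstock_Kurzweil_Integration.integral_cong) (simp add: \<alpha>_def u_def algebra_simps)
      finally show ?thesis using L(2)[OF _ t] by (simp add: q_def start[OF \<omega>])
    qed
    ultimately show ?thesis using qc by (simp add: solution_path_def)
  qed
  have "strategy M W T a q0 (q, u)"
  proof (rule strategyI[OF sol])
    fix b t assume t: "0 \<le> t" "t \<le> T"
    have sp: "space (natural_filtration M W t) = space M" by (rule natural_filtration_sub[OF t(1)])
    have X: "continuous_process T (natural_filtration M W t) (\<lambda>r \<omega>. W (min r t) \<omega>)"
      using stopped_process[OF t(1), of T 1] by simp
    have "continuous_process T (natural_filtration M W t) (\<lambda>s \<omega>. lin (A b) (\<alpha> b) 0 (\<lambda>r. W (min r t) \<omega>) 0 q0 s)"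
      unfolding continuous_process_def
    proof (intro conjI ballI)
      fix s assume s: "s \<in> {0..T}"
      show "(\<lambda>\<omega>. lin (A b) (\<alpha> b) 0 (\<lambda>r. W (min r t) \<omega>) 0 q0 s) \<in> borel_measurable (natural_filtration M W t)"
        by (rule lin_measurable[OF T X, where A = "\<lambda>_. A b" and \<alpha> = "\<lambda>_. \<alpha> b" and \<eta> = "\<lambda>_. 0" and S = "\<lambda>_. 0" and x = "\<lambda>_. q0"])
          (use s T in \<open>auto intro!: measurable_compose[OF measurable_snd] simp: case_prod_unfold\<close>)
    next
      fix \<omega> assume "\<omega> \<in> space (natural_filtration M W t)"
      then have "continuous_on {0..T} (\<lambda>r. W (min r t) \<omega>)" using X by (simp add: continuous_process_def)
      from lin_solution(1)[OF this \<alpha>c Ad]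
      show "continuous_on {0..T} (lin (A b) (\<alpha> b) 0 (\<lambda>r. W (min r t) \<omega>) 0 q0)" .
    qed
    from process_jointly_measurable[OF T this t]
    show q: "(\<lambda>(s, \<omega>). q s b \<omega>) \<in> borel_measurable (past t)"
      by (rule adapted_cong[OF t(1)]) (auto simp: q_def intro!: lin_cong)
    have "fst \<in> borel_measurable (past t)"
      by (rule measurable_compose[OF measurable_fst]) (rule measurable_restrict_space1, simp)
    from borel_measurable_times[OF measurable_compose[OF this km] q]
    show "(\<lambda>(s, \<omega>). u s b \<omega>) \<in> borel_measurable (past t)"
      by (simp add: u_def case_prod_unfold)
  next
    fix b
    obtain K1 where K1: "\<And>r. r \<in> {0..T} \<Longrightarrow> \<bar>\<alpha> b r\<bar> \<le> K1" using continuous_bounded_Icc[OF \<alpha>c] by blast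
    obtain K2 where K2: "\<And>r. r \<in> {0..T} \<Longrightarrow> \<bar>A b r\<bar> \<le> K2" using continuous_bounded_Icc[OF Ac] by blast
    define K where "K = max K1 K2"
    define D where "D = 1 + exp K * (\<bar>q0\<bar> + T * exp K * K)"
    define m where "m \<omega> = osc (\<lambda>t. W t \<omega>) 0 T" for \<omega>
    have [measurable]: "m \<in> borel_measurable M"
      unfolding m_def by (rule measurable_osc[OF random_variable_W paths]) (use T in auto)
    define E where "E = 2 * (1 + B\<^sup>2) * D\<^sup>2"
    have E0: "0 \<le> E" by (simp add: E_def)
    have pw: "(q t b \<omega>)\<^sup>2 + (u t b \<omega>)\<^sup>2 \<le> E * (1 + (m \<omega>)\<^sup>2)" if \<omega>: "\<omega> \<in> space M" and t: "t \<in> {0..T}" for \<omega> t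
    proof -
      have "\<bar>q t b \<omega>\<bar> \<le> D * (1 + m \<omega>)"
        unfolding q_def D_def
      proof (rule lin_bound[OF _ _ _ \<alpha>c Ac W_cont[OF \<omega>]])
        show "\<And>r. r \<in> {0..T} \<Longrightarrow> \<bar>\<alpha> b r\<bar> \<le> K" "\<And>r. r \<in> {0..T} \<Longrightarrow> \<bar>A b r\<bar> \<le> K"
          unfolding K_def using K1 K2 by (meson max.coboundedI1 max.coboundedI2)+
        show "A b 0 = 0" by (simp add: A_def)
        show "\<bar>W r \<omega> - W 0 \<omega>\<bar> \<le> m \<omega>" if "r \<in> {0..T}" for r
          unfolding m_def using le_osc[OF paths[OF \<omega>], of 0 T r] T that by auto
      qed (use t in auto)
      then have "(q t b \<omega>)\<^sup>2 \<le> (D * (1 + m \<omega>))\<^sup>2" by (rule power2_le_iff_abs_le[THEN iffD2, rotated]) (meson abs_ge_zero order_trans \<open>\<bar>q t b \<omega>\<bar> \<le> D * (1 + m \<omega>)\<close>)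
      also have "\<dots> \<le> 2 * D\<^sup>2 * (1 + (m \<omega>)\<^sup>2)"
      proof -
        have "(1 + m \<omega>)\<^sup>2 \<le> 2 * (1 + (m \<omega>)\<^sup>2)" using sum_squares_bound[of 1 "m \<omega>"] by (simp add: power2_sum)
        then have "D\<^sup>2 * (1 + m \<omega>)\<^sup>2 \<le> D\<^sup>2 * (2 * (1 + (m \<omega>)\<^sup>2))" by (rule mult_left_mono) simp
        then show ?thesis by (simp only: power_mult_distrib mult.assoc mult.left_commute)
      qed
      finally have q2: "(q t b \<omega>)\<^sup>2 \<le> 2 * D\<^sup>2 * (1 + (m \<omega>)\<^sup>2)" .
      have "(k t)\<^sup>2 \<le> B\<^sup>2" using B[OF t] by (metis abs_ge_zero abs_le_square_iff abs_of_nonneg order_trans)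
      then have "(q t b \<omega>)\<^sup>2 + (u t b \<omega>)\<^sup>2 \<le> (1 + B\<^sup>2) * (q t b \<omega>)\<^sup>2"
        using t mult_right_mono[of "(k t)\<^sup>2" "B\<^sup>2" "(q t b \<omega>)\<^sup>2"] by (simp add: u_def power_mult_distrib distrib_right)
      also have "\<dots> \<le> (1 + B\<^sup>2) * (2 * D\<^sup>2 * (1 + (m \<omega>)\<^sup>2))" by (rule mult_left_mono[OF q2]) simp
      finally show ?thesis by (simp only: E_def mult_ac)
    qed
    have "ECost M T (q, u) b \<le> (\<integral>\<^sup>+\<omega>. ennreal (T * E) * (1 + ennreal ((m \<omega>)\<^sup>2)) \<partial>M)"
      unfolding ECost_def prod.case
    proof (rule nn_integral_mono)
      fix \<omega> assume \<omega>: "\<omega> \<in> space M"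
      have "(\<integral>\<^sup>+t\<in>{0..T}. ennreal ((q t b \<omega>)\<^sup>2 + (u t b \<omega>)\<^sup>2) \<partial>lborel) \<le> (\<integral>\<^sup>+t. ennreal (E * (1 + (m \<omega>)\<^sup>2)) * indicator {0..T} t \<partial>lborel)"
        by (rule nn_integral_mono) (use pw[OF \<omega>] in \<open>auto simp: indicator_def simp del: ennreal_plus intro!: ennreal_leI\<close>)
      also have "\<dots> = ennreal (E * (1 + (m \<omega>)\<^sup>2)) * ennreal T" using T by (subst nn_integral_cmult_indicator) auto
      also have "\<dots> = ennreal (T * E) * (1 + ennreal ((m \<omega>)\<^sup>2))"
        using T E0 by (simp add: ennreal_mult' ennreal_plus[symmetric] ennreal_1[symmetric] ac_simps del: ennreal_plus ennreal_1)
      finally show "(\<integral>\<^sup>+t\<in>{0..T}. ennreal ((q t b \<omega>)\<^sup>2 + (u t b \<omega>)\<^sup>2) \<partial>lborel) \<le> ennreal (T * E) * (1 + ennreal ((m \<omega>)\<^sup>2))" .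
    qed
    also have "\<dots> = ennreal (T * E) * (1 + (\<integral>\<^sup>+\<omega>. ennreal ((m \<omega>)\<^sup>2) \<partial>M))"
      by (simp add: nn_integral_cmult nn_integral_add emeasure_space_1)
    also have "\<dots> < \<infinity>"
      using le_less_trans[OF osc_second_moment[of 0 T, folded m_def] ennreal_less_top] T
      by (simp add: ennreal_mult_less_top)
    finally show "ECost M T (q, u) b < \<infinity>" .
  next
    fix \<omega> b b' t s
    assume t: "t \<le> T" and e: "\<forall>s\<in>{0..t}. q s b \<omega> = q s b' \<omega>" and s: "0 \<le> s" "s \<le> t"
    have "q s b \<omega> = q s b' \<omega>" by (rule bspec[OF e]) (use s in simp)
    then show "u s b \<omega> = u s b' \<omega>" by (simp add: u_def)
  qed
  then show ?thesis by (intro exI[of _ "(q, u)"]) (simp add: u_def)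
qed

lemma (in brownian_motion) sigma_opt_strategy:
  assumes T: "0 < T"
  shows "strategy M W T a q0 (sigma_opt M W T a q0 \<beta>)"
proof -
  have "continuous_on {0..T} (\<lambda>t. - \<beta> * kappa a (T - t) \<beta>)" by (intro continuous_intros kappa_continuous)
  from someI_ex[OF feedback_strategy[OF T this]] show ?thesis unfolding sigma_opt_def by blast
qed


section \<open>Expected cost\<close>

text \<open>An l^40 norm over the grid windows: it dominates their maximum, and the expectation of
  its fortieth power is a plain sum of moments from \<open>osc_moment\<close>.\<close>

definition osc_max :: "(real \<Rightarrow> real) \<Rightarrow> real \<Rightarrow> real \<Rightarrow> real" where
  "osc_max w T h = root 40 (\<Sum>j\<le>nat \<lfloor>T / h\<rfloor>. osc w (real j * h) h ^ 40)"

definition osc_energy :: "(real \<Rightarrow> real) \<Rightarrow> real \<Rightarrow> real \<Rightarrow> real" where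
  "osc_energy w T h = (\<Sum>j\<le>nat \<lfloor>T / h\<rfloor>. (osc w (real j * h) h)\<^sup>2)"

lemma osc_max_power: "osc_max w T h ^ 40 = (\<Sum>j\<le>nat \<lfloor>T / h\<rfloor>. osc w (real j * h) h ^ 40)"
  unfolding osc_max_def by (intro real_root_pow_pos2 sum_nonneg) auto

lemma osc_max_nonneg: "0 \<le> osc_max w T h"
  unfolding osc_max_def by (intro real_root_ge_zero sum_nonneg) auto

lemma osc_energy_nonneg: "0 \<le> osc_energy w T h"
  unfolding osc_energy_def by (intro sum_nonneg) auto

lemma osc_le_max:
  assumes "j \<le> nat \<lfloor>T / h\<rfloor>"
  shows "osc w (real j * h) h \<le> osc_max w T h"
proof -
  have "osc w (real j * h) h ^ 40 \<le> osc_max w T h ^ 40"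
    unfolding osc_max_power using assms by (intro member_le_sum) auto
  then show ?thesis using osc_max_nonneg[of w T h] by (rule power_le_imp_le_base[of _ 39, simplified])
qed

text \<open>A window of length h starting anywhere lies in two adjacent grid windows j and j + 1.
  Comparing both its ends with the left end of window j costs at most 2 D_j + D_(j+1), which
  explains the factor 3; and (2 x + y)^2 \<le> 8 x^2 + 2 y^2 explains the factor 10. Only absolute
  increments are compared, so that \<open>w\<close> may be the reflection of
  \<open>w0\<close>.\<close>

lemma noise_osc:
  assumes c: "continuous_on {0..} w0" and eq: "\<And>s t. \<bar>w t - w s\<bar> = \<bar>w0 t - w0 s\<bar>" and h: "0 < h" and T: "0 < T"
  shows "noise w T h (3 * osc_max w0 T h) (10 * osc_energy w0 T h)"
  unfolding noise_def
proof
  fix s assume s: "s \<in> {0..T}"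
  define n where "n = nat \<lfloor>T / h\<rfloor>"
  define D where "D j = (if j \<le> n then osc w0 (real j * h) h else 0)" for j
  define i where "i = nat \<lfloor>s / h\<rfloor>"
  have i: "real i * h \<le> s" "s < real (Suc i) * h"
  proof -
    have r: "real i = of_int \<lfloor>s / h\<rfloor>" using s h by (simp add: i_def)
    have "real i \<le> s / h" "s / h < real i + 1" unfolding r by linarith+
    then show "real i * h \<le> s" "s < real (Suc i) * h" using h by (simp_all add: field_simps)
  qed
  have n: "j \<le> n" if "real j * h \<le> T" for j
  proof -
    have "real j \<le> T / h" using that h by (simp add: field_simps)
    then show ?thesis unfolding n_def by (simp add: le_nat_floor)
  qed
  have D0: "0 \<le> D j" for j unfolding D_def using osc_nonneg[OF c, of "real j * h" h] h by auto
  have Dm: "D j \<le> osc_max w0 T h" for j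
    unfolding D_def using osc_le_max[of j T h w0] osc_max_nonneg[of w0 T h] by (auto simp: n_def)
  have step: "\<bar>w t - w (real j * h)\<bar> \<le> D j" if "real j * h \<le> t" "t \<le> real (Suc j) * h" "t \<le> T" for j t
  proof -
    have "j \<le> n" by (rule n) (use that in linarith)
    moreover have "\<bar>w0 t - w0 (real j * h)\<bar> \<le> osc w0 (real j * h) h"
      by (rule le_osc[OF c]) (use that h in \<open>auto simp: algebra_simps\<close>)
    ultimately show ?thesis by (simp add: D_def eq)
  qed
  define ob where "ob k = 2 * D (i + k) + D (Suc (i + k))" for k
  have "\<bar>w t - w (s + real k * h)\<bar> \<le> ob k" if t: "s + real k * h \<le> t" "t \<le> s + real (Suc k) * h" "t \<le> T" for k t
  proof -
    define j where "j = i + k"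
    have j: "real j * h \<le> s + real k * h" "s + real k * h \<le> real (Suc j) * h" "s + real (Suc k) * h \<le> real (Suc (Suc j)) * h"
      using i by (simp_all add: j_def algebra_simps)
    have 1: "\<bar>w (s + real k * h) - w (real j * h)\<bar> \<le> D j" by (rule step[OF j(1,2)]) (use t in linarith)
    show ?thesis
    proof (cases "t \<le> real (Suc j) * h")
      case True
      have "\<bar>w t - w (real j * h)\<bar> \<le> D j" by (rule step) (use True j t in linarith)+
      then show ?thesis using 1 D0[of "Suc j"] by (simp add: ob_def j_def)
    next
      case False
      have "\<bar>w t - w (real (Suc j) * h)\<bar> \<le> D (Suc j)" by (rule step) (use False j t in linarith)+
      moreover have "\<bar>w (real (Suc j) * h) - w (real j * h)\<bar> \<le> D j"
        by (rule step) (use False t h in \<open>simp_all add: mult_right_mono\<close>)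
      ultimately show ?thesis using 1 unfolding ob_def j_def[symmetric] by linarith
    qed
  qed
  moreover have "ob k \<le> 3 * osc_max w0 T h" for k using Dm[of "i + k"] Dm[of "Suc (i + k)"] by (simp add: ob_def)
  moreover have "(\<Sum>k<N. (ob k)\<^sup>2) \<le> 10 * osc_energy w0 T h" for N
  proof -
    have part: "(\<Sum>k<N. (D (l + k))\<^sup>2) \<le> osc_energy w0 T h" for l
    proof -
      have "(\<Sum>k<N. (D (l + k))\<^sup>2) = (\<Sum>j\<in>(\<lambda>k. l + k) ` {..<N}. (D j)\<^sup>2)" by (subst sum.reindex) auto
      also have "\<dots> \<le> (\<Sum>j\<in>(\<lambda>k. l + k) ` {..<N} \<union> {..n}. (D j)\<^sup>2)" by (rule sum_mono2) auto
      also have "\<dots> = (\<Sum>j\<le>n. (D j)\<^sup>2)" by (rule sum.mono_neutral_right) (auto simp: D_def)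
      also have "\<dots> = osc_energy w0 T h" unfolding osc_energy_def n_def[symmetric] by (rule sum.cong) (auto simp: D_def)
      finally show ?thesis .
    qed
    have "(\<Sum>k<N. (ob k)\<^sup>2) \<le> (\<Sum>k<N. 8 * (D (i + k))\<^sup>2 + 2 * (D (Suc i + k))\<^sup>2)"
    proof (rule sum_mono)
      fix k
      have "2 * (2 * D (i + k)) * D (Suc (i + k)) \<le> (2 * D (i + k))\<^sup>2 + (D (Suc (i + k)))\<^sup>2" by (rule sum_squares_bound)
      then show "(ob k)\<^sup>2 \<le> 8 * (D (i + k))\<^sup>2 + 2 * (D (Suc i + k))\<^sup>2"
        unfolding ob_def power2_sum by (simp add: power_mult_distrib)
    qed
    also have "\<dots> = 8 * (\<Sum>k<N. (D (i + k))\<^sup>2) + 2 * (\<Sum>k<N. (D (Suc i + k))\<^sup>2)"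
      by (simp only: sum.distrib sum_distrib_left)
    also have "\<dots> \<le> 10 * osc_energy w0 T h" using part[of i] part[of "Suc i"] by linarith
    finally show ?thesis .
  qed
  ultimately show "\<exists>ob. (\<forall>k t. s + real k * h \<le> t \<longrightarrow> t \<le> s + real (Suc k) * h \<longrightarrow> t \<le> T \<longrightarrow> \<bar>w t - w (s + real k * h)\<bar> \<le> ob k) \<and>
      (\<forall>k. ob k \<le> 3 * osc_max w0 T h) \<and> (\<forall>N. (\<Sum>k<N. (ob k)\<^sup>2) \<le> 10 * osc_energy w0 T h)"
    by blast
qed

context brownian_motion
begin

lemma osc_measurable: "0 \<le> s \<Longrightarrow> 0 \<le> h \<Longrightarrow> (\<lambda>\<omega>. osc (\<lambda>t. W t \<omega>) s h) \<in> borel_measurable M"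
  by (rule measurable_osc[OF random_variable_W paths]) auto

lemma osc_max_moment:
  assumes h: "0 < h" and T: "0 < T"
  shows "(\<lambda>\<omega>. osc_max (\<lambda>t. W t \<omega>) T h ^ 40) \<in> borel_measurable M"
    and "(\<integral>\<^sup>+\<omega>. ennreal (osc_max (\<lambda>t. W t \<omega>) T h ^ 40) \<partial>M) \<le> ennreal ((T / h + 1) * (moment_const 20 * h ^ 20))"
proof -
  define n where "n = nat \<lfloor>T / h\<rfloor>"
  have n: "real (Suc n) \<le> T / h + 1" using h T by (simp add: n_def)
  have [measurable]: "(\<lambda>\<omega>. osc (\<lambda>t. W t \<omega>) (real j * h) h) \<in> borel_measurable M" for j
    by (rule osc_measurable) (use h in auto)
  show "(\<lambda>\<omega>. osc_max (\<lambda>t. W t \<omega>) T h ^ 40) \<in> borel_measurable M" unfolding osc_max_power by measurable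
  have "(\<integral>\<^sup>+\<omega>. ennreal (osc_max (\<lambda>t. W t \<omega>) T h ^ 40) \<partial>M) = (\<integral>\<^sup>+\<omega>. (\<Sum>j\<le>n. ennreal (osc (\<lambda>t. W t \<omega>) (real j * h) h ^ 40)) \<partial>M)"
    unfolding osc_max_power n_def[symmetric] by (simp add: sum_ennreal)
  also have "\<dots> = (\<Sum>j\<le>n. \<integral>\<^sup>+\<omega>. ennreal (osc (\<lambda>t. W t \<omega>) (real j * h) h ^ 40) \<partial>M)" by (rule nn_integral_sum) measurable
  also have "\<dots> \<le> (\<Sum>j\<le>n. ennreal (moment_const 20 * h ^ 20))"
  proof (rule sum_mono)
    fix j
    show "(\<integral>\<^sup>+\<omega>. ennreal (osc (\<lambda>t. W t \<omega>) (real j * h) h ^ 40) \<partial>M) \<le> ennreal (moment_const 20 * h ^ 20)"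
      using osc_moment[of "real j * h" h 20] h by (simp add: field_simps)
  qed
  also have "\<dots> = ennreal (real (Suc n) * (moment_const 20 * h ^ 20))"
    using h moment_const_pos[of 20] by (simp add: ennreal_mult' ennreal_of_nat_eq_real_of_nat)
  also have "\<dots> \<le> ennreal ((T / h + 1) * (moment_const 20 * h ^ 20))"
    using n h moment_const_pos[of 20] by (intro ennreal_leI mult_right_mono) auto
  finally show "(\<integral>\<^sup>+\<omega>. ennreal (osc_max (\<lambda>t. W t \<omega>) T h ^ 40) \<partial>M) \<le> ennreal ((T / h + 1) * (moment_const 20 * h ^ 20))" .
qed

lemma osc_energy_moment:
  assumes h: "0 < h" and T: "0 < T"
  shows "(\<lambda>\<omega>. osc_energy (\<lambda>t. W t \<omega>) T h) \<in> borel_measurable M"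
    and "(\<integral>\<^sup>+\<omega>. ennreal (osc_energy (\<lambda>t. W t \<omega>) T h) \<partial>M) \<le> ennreal ((T + h) * (1 + moment_const 20))"
proof -
  define n where "n = nat \<lfloor>T / h\<rfloor>"
  have "real (Suc n) \<le> T / h + 1" using h T by (simp add: n_def)
  then have n: "real (Suc n) * h \<le> T + h" using h by (simp add: field_simps)
  have [measurable]: "(\<lambda>\<omega>. osc (\<lambda>t. W t \<omega>) (real j * h) h) \<in> borel_measurable M" for j
    by (rule osc_measurable) (use h in auto)
  show "(\<lambda>\<omega>. osc_energy (\<lambda>t. W t \<omega>) T h) \<in> borel_measurable M" unfolding osc_energy_def by measurable
  have "(\<integral>\<^sup>+\<omega>. ennreal (osc_energy (\<lambda>t. W t \<omega>) T h) \<partial>M) = (\<integral>\<^sup>+\<omega>. (\<Sum>j\<le>n. ennreal ((osc (\<lambda>t. W t \<omega>) (real j * h) h)\<^sup>2)) \<partial>M)"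
    unfolding osc_energy_def n_def[symmetric] by (simp add: sum_ennreal)
  also have "\<dots> = (\<Sum>j\<le>n. \<integral>\<^sup>+\<omega>. ennreal ((osc (\<lambda>t. W t \<omega>) (real j * h) h)\<^sup>2) \<partial>M)" by (rule nn_integral_sum) measurable
  also have "\<dots> \<le> (\<Sum>j\<le>n. ennreal ((1 + moment_const 20) * h))"
    by (intro sum_mono osc_second_moment) (use h in auto)
  also have "\<dots> = ennreal (real (Suc n) * ((1 + moment_const 20) * h))"
    using h moment_const_pos[of 20] by (simp add: ennreal_mult' ennreal_of_nat_eq_real_of_nat)
  also have "\<dots> = ennreal ((real (Suc n) * h) * (1 + moment_const 20))" by (simp only: mult_ac)
  also have "\<dots> \<le> ennreal ((T + h) * (1 + moment_const 20))"
    using n moment_const_pos[of 20] by (intro ennreal_leI mult_right_mono) auto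
  finally show "(\<integral>\<^sup>+\<omega>. ennreal (osc_energy (\<lambda>t. W t \<omega>) T h) \<partial>M) \<le> ennreal ((T + h) * (1 + moment_const 20))" .
qed

lemma expected_bound:
  assumes T: "0 < T" and h: "0 < h" "0 < h'" and c: "0 \<le> \<alpha>" "0 \<le> \<beta>" "0 \<le> \<gamma>"
    and f: "AE \<omega> in M. f \<omega> \<le> ennreal (\<alpha> * (1 + osc_energy (\<lambda>t. W t \<omega>) T h + (osc (\<lambda>t. W t \<omega>) 0 T)\<^sup>2) +
      \<beta> * osc_max (\<lambda>t. W t \<omega>) T h ^ 40 + \<gamma> * osc_max (\<lambda>t. W t \<omega>) T h' ^ 40)"
  shows "(\<integral>\<^sup>+\<omega>. f \<omega> \<partial>M) \<le> ennreal (\<alpha> * (1 + (2 * T + h) * (1 + moment_const 20)) +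
      \<beta> * ((T / h + 1) * (moment_const 20 * h ^ 20)) + \<gamma> * ((T / h' + 1) * (moment_const 20 * h' ^ 20)))"
proof -
  define E where "E \<omega> = osc_energy (\<lambda>t. W t \<omega>) T h" for \<omega>
  define V where "V \<omega> = (osc (\<lambda>t. W t \<omega>) 0 T)\<^sup>2" for \<omega>
  define X where "X \<omega> = osc_max (\<lambda>t. W t \<omega>) T h ^ 40" for \<omega>
  define Y where "Y \<omega> = osc_max (\<lambda>t. W t \<omega>) T h' ^ 40" for \<omega>
  have [measurable]: "E \<in> borel_measurable M" "X \<in> borel_measurable M" "Y \<in> borel_measurable M" "V \<in> borel_measurable M"
    unfolding E_def X_def Y_def V_def
    using osc_energy_moment(1)[OF h(1) T] osc_max_moment(1)[OF h(1) T] osc_max_moment(1)[OF h(2) T] osc_measurable[of 0 T] T by auto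
  have pos: "0 \<le> E \<omega>" "0 \<le> X \<omega>" "0 \<le> Y \<omega>" "0 \<le> V \<omega>" for \<omega>
    by (auto simp: E_def X_def Y_def V_def osc_energy_nonneg)
  have mc: "0 < moment_const 20" by (rule moment_const_pos)
  have e: "ennreal (\<alpha> * (1 + E \<omega> + V \<omega>) + \<beta> * X \<omega> + \<gamma> * Y \<omega>) =
      ennreal \<alpha> * (1 + ennreal (E \<omega>) + ennreal (V \<omega>)) + ennreal \<beta> * ennreal (X \<omega>) + ennreal \<gamma> * ennreal (Y \<omega>)" for \<omega>
    using c pos[of \<omega>] by (simp add: ennreal_mult' ennreal_mult)
  have "(\<integral>\<^sup>+\<omega>. f \<omega> \<partial>M) \<le> (\<integral>\<^sup>+\<omega>. ennreal \<alpha> * (1 + ennreal (E \<omega>) + ennreal (V \<omega>)) + ennreal \<beta> * ennreal (X \<omega>) + ennreal \<gamma> * ennreal (Y \<omega>) \<partial>M)"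
    using f unfolding E_def[symmetric] V_def[symmetric] X_def[symmetric] Y_def[symmetric] e by (rule nn_integral_mono_AE)
  also have "\<dots> = ennreal \<alpha> * (1 + (\<integral>\<^sup>+\<omega>. ennreal (E \<omega>) \<partial>M) + (\<integral>\<^sup>+\<omega>. ennreal (V \<omega>) \<partial>M)) +
      ennreal \<beta> * (\<integral>\<^sup>+\<omega>. ennreal (X \<omega>) \<partial>M) + ennreal \<gamma> * (\<integral>\<^sup>+\<omega>. ennreal (Y \<omega>) \<partial>M)"
    by (simp add: nn_integral_add nn_integral_cmult emeasure_space_1)
  also have "\<dots> \<le> ennreal \<alpha> * (1 + ennreal ((T + h) * (1 + moment_const 20)) + ennreal ((1 + moment_const 20) * T)) +
      ennreal \<beta> * ennreal ((T / h + 1) * (moment_const 20 * h ^ 20)) + ennreal \<gamma> * ennreal ((T / h' + 1) * (moment_const 20 * h' ^ 20))"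
    unfolding E_def V_def X_def Y_def
    by (intro add_mono mult_left_mono order_refl osc_energy_moment(2) osc_second_moment osc_max_moment(2) T h) auto
  also have "\<dots> = ennreal (\<alpha> * (1 + (T + h) * (1 + moment_const 20) + (1 + moment_const 20) * T) +
      \<beta> * ((T / h + 1) * (moment_const 20 * h ^ 20)) + \<gamma> * ((T / h' + 1) * (moment_const 20 * h' ^ 20)))"
    using c T h mc by (simp add: ennreal_mult[symmetric] ennreal_plus[symmetric] ennreal_1[symmetric] del: ennreal_plus ennreal_1)
  also have "\<alpha> * (1 + (T + h) * (1 + moment_const 20) + (1 + moment_const 20) * T) = \<alpha> * (1 + (2 * T + h) * (1 + moment_const 20))"
    by (simp add: algebra_simps)
  finally show ?thesis .
qed

end

section \<open>Cost of a path in terms of its oscillation\<close>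

lemma BR_path:
  assumes sp: "solution_path T a b q0 q u w" and rule: "BR_rule K A \<tau> T a q0 q u" and T: "0 < T" and q0: "1 \<le> \<bar>q0\<bar>" and w: "w 0 = 0"
  obtains p v w' where "controlled_path a b T \<bar>q0\<bar> p v w'" "BR_rule_pos K A \<tau> T a \<bar>q0\<bar> p v" "w' 0 = 0"
    "\<And>s t. \<bar>w' t - w' s\<bar> = \<bar>w t - w s\<bar>" "\<And>t. (p t)\<^sup>2 + (v t)\<^sup>2 = (q t)\<^sup>2 + (u t)\<^sup>2"
proof (cases "0 < q0")
  case True
  show thesis
  proof (rule that)
    show "controlled_path a b T \<bar>q0\<bar> q u w" using solution_path_controlled[OF sp T] True q0 w by simp
    show "BR_rule_pos K A \<tau> T a \<bar>q0\<bar> q u" using rule True by (simp add: BR_rule_def)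
  qed (simp_all add: w)
next
  case False
  show thesis
  proof (rule that)
    show "controlled_path a b T \<bar>q0\<bar> (\<lambda>t. - q t) (\<lambda>t. - u t) (\<lambda>t. - w t)"
      using solution_path_controlled[OF solution_path_uminus[OF sp] T] False q0 w by simp
    show "BR_rule_pos K A \<tau> T a \<bar>q0\<bar> (\<lambda>t. - q t) (\<lambda>t. - u t)" using rule False by (simp add: BR_rule_def)
  qed (simp_all add: w abs_minus_commute)
qed

text \<open>On noisy paths 1000 G \<ge> 1, so every 1 can be replaced by 1000 G and the degree
  raised from 8 to 40. This makes the fortieth moment do the work of a tail estimate.\<close>

lemma large_noise:
  assumes "1/1000 \<le> G" "0 \<le> m" "m \<le> G" "0 \<le> (c :: real)"
  shows "(1 + 192 * G) ^ 6 * (1 + (c + 1) * m)\<^sup>2 \<le> 1192 ^ 6 * 1000 ^ 32 * (1001 + c)\<^sup>2 * G ^ 40"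
proof -
  have G: "0 < G" "1 \<le> 1000 * G" using assms by auto
  have 1: "1 + 192 * G \<le> 1192 * G" using G by simp
  have "(c + 1) * m \<le> (c + 1) * G" using assms by (intro mult_left_mono) auto
  then have 2: "1 + (c + 1) * m \<le> (1001 + c) * G" using G by (simp add: algebra_simps)
  have "(1 + 192 * G) ^ 6 * (1 + (c + 1) * m)\<^sup>2 \<le> (1192 * G) ^ 6 * ((1001 + c) * G)\<^sup>2"
    using G assms by (intro mult_mono power_mono 1 2) (auto intro!: add_nonneg_nonneg mult_nonneg_nonneg)
  also have "\<dots> = (1192 * G) ^ 6 * ((1001 + c) * G)\<^sup>2 * 1" by simp
  also have "\<dots> \<le> (1192 * G) ^ 6 * ((1001 + c) * G)\<^sup>2 * (1000 * G) ^ 32"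
    using G assms by (intro mult_left_mono one_le_power) auto
  also have "\<dots> = 1192 ^ 6 * 1000 ^ 32 * (1001 + c)\<^sup>2 * (G ^ 6 * G ^ 2 * G ^ 32)"
    by (simp only: power_mult_distrib mult_ac)
  also have "G ^ 6 * G ^ 2 * G ^ 32 = G ^ 40" by (simp only: power_add[symmetric]) simp
  finally show ?thesis .
qed

lemma large_noise_simple:
  assumes "1/1000 \<le> m" "0 \<le> (c :: real)"
  shows "(1 + (c + 1) * m)\<^sup>2 \<le> 1192 ^ 6 * 1000 ^ 32 * (1001 + c)\<^sup>2 * m ^ 40"
proof -
  have "1 * (1 + (c + 1) * m)\<^sup>2 \<le> (1 + 192 * m) ^ 6 * (1 + (c + 1) * m)\<^sup>2"
    using assms by (intro mult_right_mono one_le_power) auto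
  also have "\<dots> \<le> 1192 ^ 6 * 1000 ^ 32 * (1001 + c)\<^sup>2 * m ^ 40" by (rule large_noise) (use assms in auto)
  finally show ?thesis by simp
qed

lemma power_add_le:
  assumes "0 \<le> x" "0 \<le> (y :: real)"
  shows "(x + y) ^ k \<le> 2 ^ k * (x ^ k + y ^ k)"
proof -
  have "(x + y) ^ k \<le> (2 * max x y) ^ k" using assms by (intro power_mono) auto
  also have "\<dots> = 2 ^ k * max x y ^ k" by (simp add: power_mult_distrib)
  also have "\<dots> \<le> 2 ^ k * (x ^ k + y ^ k)" using assms by (intro mult_left_mono) (auto simp: max_def)
  finally show ?thesis .
qed

definition noise_const :: real where "noise_const = 1192 ^ 6 * 1000 ^ 32 * 6 ^ 40"

lemma noise_const_pos: "0 < noise_const" by (simp add: noise_const_def)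

lemma sup_bound:
  assumes eq: "\<And>s t. \<bar>w t - w s\<bar> = \<bar>w0 t - w0 s\<bar>" "w 0 = 0" and c: "continuous_on {0..} w0" and T: "0 < T" and t: "0 \<le> t" "t \<le> T"
  shows "\<bar>w t\<bar> \<le> osc w0 0 T"
  using le_osc[OF c, of 0 T t] eq(1)[where s = 0 and t = t] eq(2) T t by simp

text \<open>One bound valid on every path: quiet paths satisfy it by the first term, noisy paths by
  the two moment terms. So the expectation need not be split into events. For quiet paths the
  supremum of the noise is the oscillation over {0..T}; for noisy ones it is bounded through
  \<open>m\<close>, so that all noise is expressed by \<open>G\<close>.\<close>

lemma large_pathwise:
  assumes cp: "controlled_path a b T q0 p v w" and rule: "BR_large 4 (\<delta>\<^sup>2 / a) T a q0 p v"
    and c: "continuous_on {0..} w0" and eq: "\<And>s t. \<bar>w t - w s\<bar> = \<bar>w0 t - w0 s\<bar>" "w 0 = 0"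
    and a: "1 \<le> a" "T \<le> a" "1 \<le> a * T" and \<delta>: "\<delta> = 1 / (100 * a\<^sup>2)" and R: "R = (if \<bar>b\<bar> \<le> 40 * a then a else \<bar>b\<bar>)"
    and n: "1 \<le> n" "n \<le> nat \<lfloor>a * T\<rfloor> + 1" "\<And>\<nu>. 1 \<le> \<nu> \<Longrightarrow> \<nu> < n \<Longrightarrow> \<bar>b\<bar> * exp (real \<nu>) < a / 2"
      "n \<le> nat \<lfloor>a * T\<rfloor> \<Longrightarrow> a / 2 \<le> \<bar>b\<bar> * exp (real n)"
  defines "D \<equiv> T * (27200 * q0\<^sup>2 / \<delta>\<^sup>2 * (exp (real n + 2))\<^sup>2 * noise_const * (1001 + T * R / 2)\<^sup>2)"
  shows "controlled_path.cost p v 0 T \<le> ennreal (10 ^ 7 * exp 6 * q0\<^sup>2 * (exp (real n))\<^sup>2 / R * (1 + osc_energy w0 T (2 / R) + (osc w0 0 T)\<^sup>2) +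
      D * osc_max w0 T (2 / R) ^ 40 + D / \<delta> ^ 40 * osc_max w0 T (\<delta>\<^sup>2 / R) ^ 40)"
proof -
  interpret controlled_path a b T q0 p v w by fact
  have R0: "0 < R" using R a by auto
  have \<delta>0: "0 < \<delta>" using \<delta> a by simp
  define X where "X = osc_max w0 T (2 / R)"
  define Y where "Y = osc_max w0 T (\<delta>\<^sup>2 / R)"
  define E where "E = osc_energy w0 T (2 / R)"
  have X0: "0 \<le> X" and Y0: "0 \<le> Y" and E0: "0 \<le> E" unfolding X_def Y_def E_def by (auto intro: osc_max_nonneg osc_energy_nonneg)
  define m where "m = 3 * X"
  define m' where "m' = 3 * Y"
  define G where "G = m + m' / \<delta>"
  have n1: "noise w T (2 / R) m (10 * E)" unfolding m_def X_def E_def by (rule noise_osc[OF c eq(1)]) (use R0 T in auto)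
  have n2: "noise w T (\<delta>\<^sup>2 / R) m' (10 * osc_energy w0 T (\<delta>\<^sup>2 / R))" unfolding m'_def Y_def by (rule noise_osc[OF c eq(1)]) (use R0 \<delta>0 T in auto)
  have mpos: "0 \<le> m' / \<delta>" "0 \<le> m" using X0 Y0 \<delta>0 by (auto simp: m_def m'_def)
  have lp: "large_path a b T q0 p v w R m (10 * E) \<delta> m' Wst G n" if "\<And>t. 0 \<le> t \<Longrightarrow> t \<le> T \<Longrightarrow> \<bar>w t\<bar> \<le> Wst" for Wst
  proof (unfold_locales)
    show "\<bar>w t - w s\<bar> \<le> m'" if "0 \<le> s" "s \<le> t" "t \<le> s + \<delta>\<^sup>2 / R" "t \<le> T" for s t
      by (rule noiseD[OF n2 that])
  qed (use R0 n1 a \<delta> R rule n that mpos in \<open>auto simp: G_def\<close>)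
  define H where "H = 10 ^ 7 * exp 6 * q0\<^sup>2 * (exp (real n))\<^sup>2 / R * (1 + E + (osc w0 0 T)\<^sup>2)"
  have H0: "0 \<le> H" using R0 E0 by (auto simp: H_def)
  have D0: "0 \<le> D" using T noise_const_pos by (auto simp: D_def)
  have "cost 0 T \<le> ennreal (H + D * X ^ 40 + D / \<delta> ^ 40 * Y ^ 40)"
  proof (cases "G \<le> 1/1000")
    case True
    interpret quiet_large_path a b T q0 p v w R m "10 * E" \<delta> m' "osc w0 0 T" G n
      by (intro quiet_large_path.intro lp sup_bound[OF eq c T] quiet_large_path_axioms.intro True)
    have "S \<le> 10 * (1 + E + (osc w0 0 T)\<^sup>2)" using E0 by (simp add: S_def)
    then have "10 ^ 6 * exp 6 * q0\<^sup>2 * (exp (real n))\<^sup>2 / R * S \<le> 10 ^ 6 * exp 6 * q0\<^sup>2 * (exp (real n))\<^sup>2 / R * (10 * (1 + E + (osc w0 0 T)\<^sup>2))"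
      using R0 by (intro mult_left_mono) auto
    also have "\<dots> = H" by (simp add: H_def)
    also have "H \<le> H + D * X ^ 40 + D / \<delta> ^ 40 * Y ^ 40"
      using D0 X0 Y0 \<delta>0 by (simp add: add.assoc)
    finally show ?thesis using quiet_cost by (auto intro: order_trans ennreal_leI)
  next
    case False
    define Wst where "Wst = (T / (2 / R) + 1) * m"
    interpret large_path a b T q0 p v w R m "10 * E" \<delta> m' Wst G n
      by (rule lp) (use noise_sup[OF n1] R0 T eq(2) in \<open>auto simp: Wst_def\<close>)
    define B where "B = 27200 * q0\<^sup>2 / \<delta>\<^sup>2 * (exp (real n + 2))\<^sup>2"
    have B0: "0 \<le> B" by (simp add: B_def)
    have Wst_eq: "Wst = (T * R / 2 + 1) * m" using R0 by (simp add: Wst_def)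
    have TR: "0 \<le> T * R / 2" using T R0 by simp
    have "(p t)\<^sup>2 + (v t)\<^sup>2 \<le> B * (1192 ^ 6 * 1000 ^ 32 * (1001 + T * R / 2)\<^sup>2 * G ^ 40)" if "0 \<le> t" "t < T" for t
    proof -
      have "(p t)\<^sup>2 + (v t)\<^sup>2 \<le> B * ((1 + 192 * G) ^ 6 * (1 + Wst)\<^sup>2)"
        using crude_bound[OF that] by (simp add: B_def mult.assoc)
      also have "\<dots> \<le> B * (1192 ^ 6 * 1000 ^ 32 * (1001 + T * R / 2)\<^sup>2 * G ^ 40)"
        unfolding Wst_eq by (intro mult_left_mono large_noise B0) (use False TR mpos G in auto)
      finally show ?thesis .
    qed
    moreover have "B * (1192 ^ 6 * 1000 ^ 32 * (1001 + T * R / 2)\<^sup>2 * G ^ 40) \<le> B * noise_const * (1001 + T * R / 2)\<^sup>2 * (X ^ 40 + (Y / \<delta>) ^ 40)"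
    proof -
      have "G = 3 * (X + Y / \<delta>)" by (simp add: G_def m_def m'_def)
      then have "G ^ 40 = 3 ^ 40 * (X + Y / \<delta>) ^ 40" by (simp only: power_mult_distrib)
      also have "\<dots> \<le> 3 ^ 40 * (2 ^ 40 * (X ^ 40 + (Y / \<delta>) ^ 40))"
        using X0 Y0 \<delta>0 by (intro mult_left_mono power_add_le) auto
      also have "\<dots> = 6 ^ 40 * (X ^ 40 + (Y / \<delta>) ^ 40)"
        by (simp only: mult.assoc[symmetric] power_mult_distrib[symmetric]) simp
      finally have "(B * (1192 ^ 6 * 1000 ^ 32 * (1001 + T * R / 2)\<^sup>2)) * G ^ 40 \<le> (B * (1192 ^ 6 * 1000 ^ 32 * (1001 + T * R / 2)\<^sup>2)) * (6 ^ 40 * (X ^ 40 + (Y / \<delta>) ^ 40))"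
        using B0 by (intro mult_left_mono) auto
      then show ?thesis unfolding noise_const_def by (simp only: mult_ac)
    qed
    ultimately have "cost 0 T \<le> ennreal (B * noise_const * (1001 + T * R / 2)\<^sup>2 * (X ^ 40 + (Y / \<delta>) ^ 40) * (T - 0))"
      using T B0 X0 Y0 \<delta>0 noise_const_pos by (intro cost_pointwise) (auto intro: order_trans)
    also have "B * noise_const * (1001 + T * R / 2)\<^sup>2 * (X ^ 40 + (Y / \<delta>) ^ 40) * (T - 0) = D * X ^ 40 + D / \<delta> ^ 40 * Y ^ 40"
    proof -
      have "B * noise_const * (1001 + T * R / 2)\<^sup>2 * (X ^ 40 + (Y / \<delta>) ^ 40) * (T - 0) = D * (X ^ 40 + (Y / \<delta>) ^ 40)"
        unfolding D_def B_def diff_zero by (simp only: mult_ac)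
      then show ?thesis by (simp add: power_divide distrib_left)
    qed
    also have "ennreal \<dots> \<le> ennreal (H + D * X ^ 40 + D / \<delta> ^ 40 * Y ^ 40)" using H0 by (intro ennreal_leI) simp
    finally show ?thesis .
  qed
  then show ?thesis unfolding H_def X_def Y_def E_def .
qed

lemma noisy_pathwise:
  assumes cp: "controlled_path a b T q0 p v w" and c: "continuous_on {0..} w0" and eq: "\<And>s t. \<bar>w t - w s\<bar> = \<bar>w0 t - w0 s\<bar>" "w 0 = 0"
    and h: "0 < h" and HB: "0 \<le> H" "0 \<le> B"
    and quiet: "\<And>m Q. noise w T h m Q \<Longrightarrow> m \<le> 1/1000 \<Longrightarrow> controlled_path.cost p v 0 T \<le> ennreal (H * (1 + Q))"
    and crude: "\<And>Wst t. (\<And>t. 0 \<le> t \<Longrightarrow> t \<le> T \<Longrightarrow> \<bar>w t\<bar> \<le> Wst) \<Longrightarrow> 0 \<le> t \<Longrightarrow> t < T \<Longrightarrow> (p t)\<^sup>2 + (v t)\<^sup>2 \<le> B * (1 + Wst)\<^sup>2"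
  defines "D \<equiv> T * (B * noise_const * (1001 + T / h)\<^sup>2)"
  shows "controlled_path.cost p v 0 T \<le> ennreal (10 * H * (1 + osc_energy w0 T h + (osc w0 0 T)\<^sup>2) + D * osc_max w0 T h ^ 40)"
proof -
  interpret controlled_path a b T q0 p v w by fact
  define X where "X = osc_max w0 T h"
  define E where "E = osc_energy w0 T h"
  have X0: "0 \<le> X" and E0: "0 \<le> E" unfolding X_def E_def by (auto intro: osc_max_nonneg osc_energy_nonneg)
  define m where "m = 3 * X"
  have n: "noise w T h m (10 * E)" unfolding m_def X_def E_def by (rule noise_osc[OF c eq(1) h T])
  define Y where "Y = 10 * H * (1 + E + (osc w0 0 T)\<^sup>2)"
  have Y0: "0 \<le> Y" using HB E0 by (auto simp: Y_def)
  have D0: "0 \<le> D" using T HB noise_const_pos by (auto simp: D_def)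
  have "cost 0 T \<le> ennreal (Y + D * X ^ 40)"
  proof (cases "m \<le> 1/1000")
    case True
    have "H * (1 + 10 * E) \<le> H * (10 * (1 + E + (osc w0 0 T)\<^sup>2))" using E0 HB by (intro mult_left_mono) auto
    also have "\<dots> = Y" by (simp add: Y_def)
    also have "Y \<le> Y + D * X ^ 40" using D0 X0 by simp
    finally show ?thesis using quiet[OF n True] by (auto intro: order_trans ennreal_leI)
  next
    case False
    have Th: "0 \<le> T / h" using T h by simp
    define Z where "Z = B * (1192 ^ 6 * 1000 ^ 32 * (1001 + T / h)\<^sup>2)"
    have Z0: "0 \<le> Z" using HB by (simp add: Z_def)
    have "(p t)\<^sup>2 + (v t)\<^sup>2 \<le> Z * (6 ^ 40 * X ^ 40)" if "0 \<le> t" "t < T" for t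
    proof -
      have "(p t)\<^sup>2 + (v t)\<^sup>2 \<le> B * (1 + (T / h + 1) * m)\<^sup>2"
        by (rule crude) (use noise_sup[OF n h] T eq(2) that in auto)
      also have "\<dots> \<le> B * (1192 ^ 6 * 1000 ^ 32 * (1001 + T / h)\<^sup>2 * m ^ 40)"
        by (intro mult_left_mono large_noise_simple HB) (use False Th in auto)
      also have "\<dots> = Z * (3 ^ 40 * X ^ 40)" by (simp only: Z_def m_def power_mult_distrib mult.assoc)
      also have "\<dots> \<le> Z * (6 ^ 40 * X ^ 40)" using X0 Z0 by (intro mult_left_mono mult_right_mono power_mono) auto
      finally show ?thesis .
    qed
    then have "cost 0 T \<le> ennreal (Z * (6 ^ 40 * X ^ 40) * (T - 0))"
      using T Z0 X0 by (intro cost_pointwise) auto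
    also have "Z * (6 ^ 40 * X ^ 40) * (T - 0) = D * X ^ 40"
      unfolding D_def Z_def noise_const_def diff_zero by (simp only: mult_ac)
    also have "ennreal \<dots> \<le> ennreal (Y + D * X ^ 40)" using Y0 by (intro ennreal_leI) simp
    finally show ?thesis .
  qed
  then show ?thesis unfolding Y_def X_def E_def .
qed

text \<open>The bound has the shape that \<open>ECost_pathwise\<close> expects; the window length 1
  is arbitrary.\<close>

lemma bounded_pathwise_crude:
  assumes cp: "controlled_path a b T q0 p v w" and rule: "BR_bounded T q0 p v"
    and c: "continuous_on {0..} w0" and eq: "\<And>s t. \<bar>w t - w s\<bar> = \<bar>w0 t - w0 s\<bar>" "w 0 = 0"
    and a: "\<bar>a\<bar> \<le> A"
  shows "controlled_path.cost p v 0 T \<le> ennreal (64 * T * (exp (A * T) * q0)\<^sup>2 * (1 + osc_energy w0 T 1 + (osc w0 0 T)\<^sup>2))"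
proof -
  interpret controlled_path a b T q0 p v w by fact
  interpret bounded_path a b T q0 p v w "osc w0 0 T"
    by unfold_locales (use rule sup_bound[OF eq c T] in auto)
  define V where "V = osc w0 0 T"
  have "(1 + V)\<^sup>2 \<le> 2 * (1 + V\<^sup>2)" using sum_squares_bound[of 1 V] by (simp add: power2_sum)
  also have "\<dots> \<le> 2 * (1 + osc_energy w0 T 1 + V\<^sup>2)" using osc_energy_nonneg[of w0 T 1] by simp
  finally have "(1 + V)\<^sup>2 \<le> 2 * (1 + osc_energy w0 T 1 + V\<^sup>2)" .
  then have "32 * (exp (A * T) * q0)\<^sup>2 * (1 + V)\<^sup>2 \<le> 32 * (exp (A * T) * q0)\<^sup>2 * (2 * (1 + osc_energy w0 T 1 + V\<^sup>2))"
    by (intro mult_left_mono) auto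
  then have "(p t)\<^sup>2 + (v t)\<^sup>2 \<le> 32 * (exp (A * T) * q0)\<^sup>2 * (2 * (1 + osc_energy w0 T 1 + V\<^sup>2))" if "0 \<le> t" "t < T" for t
    using bounded_crude[OF that a] unfolding V_def power_mult_distrib mult.assoc by (rule order_trans[rotated])
  then have "cost 0 T \<le> ennreal (32 * (exp (A * T) * q0)\<^sup>2 * (2 * (1 + osc_energy w0 T 1 + V\<^sup>2)) * (T - 0))"
    using T osc_energy_nonneg[of w0 T 1] by (intro cost_pointwise) auto
  moreover have "32 * z * (2 * y) * (T - 0) = 64 * T * z * y" for y z by simp
  ultimately show ?thesis unfolding V_def by (simp only:)
qed

section \<open>Comparison of upper and lower bounds\<close>

text \<open>The better of the two lower bounds, for q0 = 1. It is the yardstick between the cost of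
  BR and the optimal cost.\<close>

definition cost_rate :: "real \<Rightarrow> real \<Rightarrow> real \<Rightarrow> real" where
  "cost_rate T a b = max (1 / (8 * (\<bar>a\<bar> + \<bar>b\<bar> + 1 / T)))
     (if 0 < a \<and> 1 \<le> a * T then 1 / (4 * (2 * a * exp (- (2 * a * T)) + b\<^sup>2 / (2 * a))) else 0)"

lemma cost_rate_pos: "0 < T \<Longrightarrow> 0 < cost_rate T a b"
  unfolding cost_rate_def less_max_iff_disj by (auto intro!: disjI1 divide_pos_pos add_nonneg_pos)

lemma (in brownian_motion) cost_rate_lower:
  assumes T: "0 < T" and st: "strategy M W T a q0 \<sigma>"
  shows "ennreal (q0\<^sup>2 * cost_rate T a b) \<le> ECost M T \<sigma> b"
  using cost_lower_bound[OF T st, of b] cost_lower_bound_unstable[OF T st, of b] by (simp add: cost_rate_def max_def)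

lemma inverse_le_cost_rate:
  fixes a b c :: real
  assumes T: "0 < T" and R: "0 < R" "\<bar>a\<bar> + \<bar>b\<bar> + 1 / T \<le> c * R"
  shows "1 / R \<le> 8 * c * cost_rate T a b"
proof -
  define s where "s = \<bar>a\<bar> + \<bar>b\<bar> + 1 / T"
  have s: "0 < s" "s \<le> c * R" using T R by (auto simp: s_def intro!: add_nonneg_pos)
  then have "1 / R \<le> c / s" using R by (simp add: field_simps)
  also have "\<dots> = 8 * c * (1 / (8 * s))" by simp
  also have "\<dots> \<le> 8 * c * cost_rate T a b"
  proof (rule mult_left_mono)
    show "1 / (8 * s) \<le> cost_rate T a b" by (simp add: cost_rate_def s_def)
    show "0 \<le> 8 * c" using s R by (metis (no_types) less_le_trans less_le mult_nonneg_nonneg zero_less_mult_pos2 zero_le_numeral)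
  qed
  finally show ?thesis .
qed

lemma power_decay:
  assumes "1 \<le> (R :: real)" "k \<le> 19"
  shows "R ^ k / R ^ 20 \<le> 1 / R"
proof -
  have "R ^ Suc k \<le> R ^ 20" using assms by (intro power_increasing) auto
  then show ?thesis using assms by (simp add: field_simps)
qed

lemma noise_terms_le:
  fixes T R c mc :: real
  assumes T: "0 < T" and R: "1 \<le> R" and c: "0 < c" "c \<le> 4" and mc: "0 < mc"
  shows "(1001 + T * R / c)\<^sup>2 * ((T / (c / R) + 1) * (mc * (c / R) ^ 20)) \<le> (1001 + T / c)\<^sup>2 * (T / c + 1) * 4 ^ 20 * mc / R"
proof -
  have 1: "1001 + T * R / c \<le> (1001 + T / c) * R" using R by (simp add: distrib_right)
  have 2: "T / (c / R) + 1 \<le> (T / c + 1) * R" using R by (simp add: distrib_right)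
  have p: "(c / R) ^ 20 = c ^ 20 / R ^ 20" by (rule power_divide)
  have "(1001 + T * R / c)\<^sup>2 * ((T / (c / R) + 1) * (mc * (c / R) ^ 20)) \<le> ((1001 + T / c) * R)\<^sup>2 * (((T / c + 1) * R) * (mc * (4 ^ 20 / R ^ 20)))"
    unfolding p using 1 2 T R c mc
    by (intro mult_mono power_mono divide_right_mono order_refl) (auto intro!: mult_nonneg_nonneg add_nonneg_nonneg)
  also have "\<dots> = (1001 + T / c)\<^sup>2 * (T / c + 1) * 4 ^ 20 * mc * (R ^ 3 / R ^ 20)"
    by (simp add: power_mult_distrib power2_eq_square power3_eq_cube)
  also have "\<dots> \<le> (1001 + T / c)\<^sup>2 * (T / c + 1) * 4 ^ 20 * mc * (1 / R)"
    using T c mc R by (intro mult_left_mono power_decay) auto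
  finally show ?thesis by simp
qed

text \<open>Each summand serves one requirement of the case of large a: 1 \<le> a, T \<le> a and 1
  \<le> a T.\<close>

definition BR_threshold :: "real \<Rightarrow> real" where "BR_threshold T = 1 + T + 1 / T"
definition BR_test :: "real \<Rightarrow> real" where "BR_test a = (1 / (100 * a\<^sup>2))\<^sup>2 / a"

lemma BR_threshold:
  assumes "0 < T"
  shows "1 \<le> BR_threshold T" "1 / (10 * BR_threshold T) < T" "T \<le> BR_threshold T" "1 / T \<le> BR_threshold T"
proof -
  show A: "1 \<le> BR_threshold T" "T \<le> BR_threshold T" "1 / T \<le> BR_threshold T" using assms by (simp_all add: BR_threshold_def)
  have "1 / T < 10 * BR_threshold T" using A by linarith
  then show "1 / (10 * BR_threshold T) < T" using assms A by (simp add: field_simps)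
qed

lemma BR_test:
  assumes "1 \<le> a"
  shows "0 < BR_test a" "BR_test a < 1"
proof -
  have a2: "1 \<le> a\<^sup>2" using assms by simp
  then have "1 / (100 * a\<^sup>2) \<le> 1 / 100" by (simp add: divide_le_eq)
  then have "(1 / (100 * a\<^sup>2))\<^sup>2 \<le> (1 / 100)\<^sup>2" by (intro power_mono) auto
  also have "(1 / 100 :: real)\<^sup>2 < 1" by (simp add: power2_eq_square)
  finally have "(1 / (100 * a\<^sup>2))\<^sup>2 < a" using assms by linarith
  then show "0 < BR_test a" "BR_test a < 1" using assms by (auto simp: BR_test_def divide_less_eq)
qed

lemma critical_epoch:
  fixes a b :: real
  obtains n where "1 \<le> n" "n \<le> N + 1" "\<And>\<nu>. 1 \<le> \<nu> \<Longrightarrow> \<nu> < n \<Longrightarrow> \<bar>b\<bar> * exp (real \<nu>) < a / 2" "n \<le> N \<Longrightarrow> a / 2 \<le> \<bar>b\<bar> * exp (real n)"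
proof -
  define P where "P n \<longleftrightarrow> 1 \<le> n \<and> (n \<le> N \<longrightarrow> a / 2 \<le> \<bar>b\<bar> * exp (real n))" for n
  define n where "n = (LEAST n. P n)"
  have PN: "P (N + 1)" by (simp add: P_def)
  have Pn: "P n" unfolding n_def by (rule LeastI[of P, OF PN])
  have nN: "n \<le> N + 1" unfolding n_def by (rule Least_le[of P, OF PN])
  have "\<bar>b\<bar> * exp (real \<nu>) < a / 2" if "1 \<le> \<nu>" "\<nu> < n" for \<nu>
    using not_less_Least[of \<nu> P] that unfolding n_def[symmetric] by (auto simp: P_def)
  then show thesis using that Pn nN unfolding P_def by blast
qed

text \<open>Here upper and lower bound meet. For n = 1 the general bound suffices, as |a| + |b| +
  1/T \<le> 42 R. For n > 1 epoch n - 1 was weak, so |b| exp n \<le> exp 1 * a / 2, and n \<le> a T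
  + 1; multiplied by exp (2 n), both terms in the denominator of the unstable bound are of order a,
  and R = a.\<close>

lemma epoch_cost_rate:
  assumes a: "1 \<le> a" "1 / T \<le> a" "0 < T" and R: "R = (if \<bar>b\<bar> \<le> 40 * a then a else \<bar>b\<bar>)"
    and n: "1 \<le> n" "n \<le> nat \<lfloor>a * T\<rfloor> + 1" "\<And>\<nu>. 1 \<le> \<nu> \<Longrightarrow> \<nu> < n \<Longrightarrow> \<bar>b\<bar> * exp (real \<nu>) < a / 2"
  shows "(exp (real n))\<^sup>2 / R \<le> 336 * exp 2 * cost_rate T a b"
proof (cases "n = 1")
  case True
  have R0: "0 < R" using R a by auto
  have "1 / R \<le> 8 * 42 * cost_rate T a b"
    by (rule inverse_le_cost_rate[OF a(3) R0]) (use R a in auto)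
  then have "exp 2 * (1 / R) \<le> exp 2 * (8 * 42 * cost_rate T a b)" by (rule mult_left_mono) simp
  moreover have "(exp (1::real))\<^sup>2 = exp 2" using exp_double[of "1::real"] by simp
  ultimately show ?thesis using True by simp
next
  case False
  have aT: "1 \<le> a * T" using a by (simp add: field_simps)
  have n2: "1 \<le> n - 1" "n - 1 < n" using n False by auto
  have w: "\<bar>b\<bar> * exp (real (n - 1)) < a / 2" by (rule n(3)[OF n2])
  have "\<bar>b\<bar> * 1 \<le> \<bar>b\<bar> * exp (real (n - 1))" by (intro mult_left_mono) auto
  then have Ra: "R = a" using w a R by simp
  have en: "exp (real n) = exp 1 * exp (real (n - 1))" using n by (simp add: exp_add[symmetric] of_nat_diff)
  have e2: "(exp (real n))\<^sup>2 = exp 2 * (exp (real (n - 1)))\<^sup>2" unfolding en power_mult_distrib using exp_double[of "1::real"] by simp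
  have s1: "(exp (real n))\<^sup>2 * b\<^sup>2 \<le> exp 2 * (a / 2)\<^sup>2"
  proof -
    have "(\<bar>b\<bar> * exp (real (n - 1)))\<^sup>2 \<le> (a / 2)\<^sup>2" using w by (intro power_mono) auto
    then have "exp 2 * (\<bar>b\<bar> * exp (real (n - 1)))\<^sup>2 \<le> exp 2 * (a / 2)\<^sup>2" by (intro mult_left_mono) auto
    then show ?thesis unfolding e2 power_mult_distrib power2_abs by (simp only: mult_ac)
  qed
  have s2: "(exp (real n))\<^sup>2 * exp (- (2 * a * T)) \<le> exp 2"
  proof -
    have "real n \<le> a * T + 1" using n(2) aT by linarith
    then have "2 * real n + - (2 * a * T) \<le> 2" by linarith
    then have "exp (2 * real n + - (2 * a * T)) \<le> exp 2" by simp
    then show ?thesis unfolding exp_add exp_double .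
  qed
  define N where "N = 2 * a * exp (- (2 * a * T)) + b\<^sup>2 / (2 * a)"
  have N0: "0 < N" using a by (auto simp: N_def intro!: add_pos_nonneg)
  have "(exp (real n))\<^sup>2 * N = 2 * a * ((exp (real n))\<^sup>2 * exp (- (2 * a * T))) + ((exp (real n))\<^sup>2 * b\<^sup>2) / (2 * a)"
    by (simp add: N_def distrib_left)
  also have "\<dots> \<le> 2 * a * exp 2 + (exp 2 * (a / 2)\<^sup>2) / (2 * a)"
    using a by (intro add_mono mult_left_mono divide_right_mono s1 s2) auto
  also have "\<dots> \<le> 84 * exp 2 * a" using a by (simp add: power2_eq_square)
  finally have "(exp (real n))\<^sup>2 / a \<le> 84 * exp 2 / N" using a N0 by (simp add: field_simps)
  also have "\<dots> = 336 * exp 2 * (1 / (4 * N))" by simp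
  also have "\<dots> \<le> 336 * exp 2 * cost_rate T a b"
    using a aT by (intro mult_left_mono) (auto simp: cost_rate_def N_def)
  finally show ?thesis by (simp add: Ra)
qed

text \<open>Powers of R: 4 from 1 / \<delta>^2, 2 from the bound on the supremum of the noise, and 5
  from the number of windows of length \<delta>^2 / R. The factor 1 / \<delta>^40 cancels against
  the moment of the short windows, which leaves R^-20 in both terms.\<close>

lemma large_noise_terms:
  fixes T R a \<delta> mc :: real
  assumes T: "0 < T" and a: "1 \<le> a" "a \<le> R" and \<delta>: "\<delta> = 1 / (100 * a\<^sup>2)" and mc: "0 < mc"
  shows "1 / \<delta>\<^sup>2 * (1001 + T * R / 2)\<^sup>2 * ((T / (2 / R) + 1) * (mc * (2 / R) ^ 20) + 1 / \<delta> ^ 40 * ((T / (\<delta>\<^sup>2 / R) + 1) * (mc * (\<delta>\<^sup>2 / R) ^ 20)))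
    \<le> 10 ^ 4 * (1001 + T)\<^sup>2 * (T + 1) * 2 ^ 21 * mc / R"
proof -
  have R: "1 \<le> R" "0 < R" using a by auto
  have \<delta>0: "0 < \<delta>" using \<delta> a by simp
  have d: "1 / \<delta>\<^sup>2 \<le> 10 ^ 4 * R ^ 4"
  proof -
    have "1 / \<delta>\<^sup>2 = 10 ^ 4 * a ^ 4" unfolding \<delta> using a by (simp add: power_divide power_mult_distrib power_mult[symmetric])
    also have "\<dots> \<le> 10 ^ 4 * R ^ 4" using a by (intro mult_left_mono power_mono) auto
    finally show ?thesis .
  qed
  have "1001 + T * R / 2 \<le> 1001 * R + T * R"
    using T R by (intro add_mono) auto
  then have s: "(1001 + T * R / 2)\<^sup>2 \<le> ((1001 + T) * R)\<^sup>2" using T R by (intro power_mono) (auto simp: distrib_right)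
  have R5: "R \<le> R ^ 5" "1 \<le> R ^ 5" using power_increasing[of 1 5 R] power_increasing[of 0 5 R] R by auto
  have t1: "(T / (2 / R) + 1) * (mc * (2 / R) ^ 20) \<le> (T + 1) * R ^ 5 * (mc * (2 ^ 20 / R ^ 20))"
  proof (rule mult_mono)
    have "0 \<le> T * R" using T R by simp
    then have "T / (2 / R) + 1 \<le> T * R + R" using R by simp
    also have "\<dots> \<le> T * R ^ 5 + R ^ 5" using T R5 by (intro add_mono mult_left_mono) auto
    finally show "T / (2 / R) + 1 \<le> (T + 1) * R ^ 5" by (simp add: distrib_right)
  qed (use T R mc in \<open>auto simp: power_divide\<close>)
  have t2: "1 / \<delta> ^ 40 * ((T / (\<delta>\<^sup>2 / R) + 1) * (mc * (\<delta>\<^sup>2 / R) ^ 20)) \<le> (T + 1) * R ^ 5 * (mc * (10 ^ 4 / R ^ 20))"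
  proof -
    have "T / (\<delta>\<^sup>2 / R) + 1 = T * R * (1 / \<delta>\<^sup>2) + 1" by simp
    also have "\<dots> \<le> T * R * (10 ^ 4 * R ^ 4) + 1" using T R d by (intro add_mono mult_left_mono) auto
    also have "\<dots> = 10 ^ 4 * (T * R ^ 5) + 1" by (simp add: power_Suc[symmetric] mult_ac)
    also have "\<dots> \<le> 10 ^ 4 * (T * R ^ 5) + 10 ^ 4 * R ^ 5" using R5 by simp
    finally have t: "T / (\<delta>\<^sup>2 / R) + 1 \<le> 10 ^ 4 * ((T + 1) * R ^ 5)" by (simp add: distrib_left distrib_right)
    have "1 / \<delta> ^ 40 * ((T / (\<delta>\<^sup>2 / R) + 1) * (mc * (\<delta>\<^sup>2 / R) ^ 20)) = (T / (\<delta>\<^sup>2 / R) + 1) * (mc / R ^ 20)"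
      using \<delta>0 by (simp add: power_divide power_mult[symmetric])
    also have "\<dots> \<le> 10 ^ 4 * ((T + 1) * R ^ 5) * (mc / R ^ 20)" using t mc R by (intro mult_right_mono) auto
    finally show ?thesis by (simp add: mult_ac)
  qed
  define Z where "Z = (T + 1) * R ^ 5 * (mc / R ^ 20)"
  have Z0: "0 \<le> Z" using T R mc by (simp add: Z_def)
  have "(T / (2 / R) + 1) * (mc * (2 / R) ^ 20) + 1 / \<delta> ^ 40 * ((T / (\<delta>\<^sup>2 / R) + 1) * (mc * (\<delta>\<^sup>2 / R) ^ 20)) \<le> 2 ^ 20 * Z + 10 ^ 4 * Z"
  proof -
    have "(T + 1) * R ^ 5 * (mc * (c / R ^ 20)) = c * Z" for c by (simp add: Z_def)
    then show ?thesis using add_mono[OF t1 t2] by (simp only:)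
  qed
  also have "\<dots> \<le> 2 ^ 21 * Z" using Z0 by simp
  finally have "1 / \<delta>\<^sup>2 * (1001 + T * R / 2)\<^sup>2 * ((T / (2 / R) + 1) * (mc * (2 / R) ^ 20) + 1 / \<delta> ^ 40 * ((T / (\<delta>\<^sup>2 / R) + 1) * (mc * (\<delta>\<^sup>2 / R) ^ 20)))
    \<le> (10 ^ 4 * R ^ 4) * ((1001 + T) * R)\<^sup>2 * (2 ^ 21 * Z)"
    using d s T R mc \<delta>0 by (intro mult_mono) (auto intro!: mult_nonneg_nonneg add_nonneg_nonneg)
  also have "\<dots> = 10 ^ 4 * (1001 + T)\<^sup>2 * (T + 1) * 2 ^ 21 * mc * (R ^ 4 * R ^ 2 * R ^ 5 / R ^ 20)"
    unfolding Z_def power_mult_distrib by (simp only: mult_ac times_divide_eq_right times_divide_eq_left)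
  also have "R ^ 4 * R ^ 2 * R ^ 5 = R ^ 11" by (simp only: power_add[symmetric]) simp
  also have "10 ^ 4 * (1001 + T)\<^sup>2 * (T + 1) * 2 ^ 21 * mc * (R ^ 11 / R ^ 20) \<le> 10 ^ 4 * (1001 + T)\<^sup>2 * (T + 1) * 2 ^ 21 * mc * (1 / R)"
    using T mc R by (intro mult_left_mono power_decay) auto
  finally show ?thesis by simp
qed

section \<open>Upper bound for the expected cost\<close>

context brownian_motion
begin

text \<open>Assumes the path equations and the rule instead of \<open>strategy\<close>, since it
  also has to yield the finite cost that \<open>strategy\<close> demands.\<close>

lemma ECost_pathwise:
  assumes T: "0 < T" and q0: "1 \<le> \<bar>q0\<bar>"
    and paths_AE: "AE \<omega> in M. solution_path T a b q0 (\<lambda>t. fst \<sigma> t b \<omega>) (\<lambda>t. snd \<sigma> t b \<omega>) (\<lambda>t. W t \<omega>) \<and>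
      BR_rule K A \<tau> T a q0 (\<lambda>t. fst \<sigma> t b \<omega>) (\<lambda>t. snd \<sigma> t b \<omega>)"
    and bound: "\<And>p v w w0. controlled_path a b T \<bar>q0\<bar> p v w \<Longrightarrow> BR_rule_pos K A \<tau> T a \<bar>q0\<bar> p v \<Longrightarrow> continuous_on {0..} w0 \<Longrightarrow>
      (\<And>s t. \<bar>w t - w s\<bar> = \<bar>w0 t - w0 s\<bar>) \<Longrightarrow> w 0 = 0 \<Longrightarrow>
      controlled_path.cost p v 0 T \<le> ennreal (\<alpha> * (1 + osc_energy w0 T h + (osc w0 0 T)\<^sup>2) + \<beta> * osc_max w0 T h ^ 40 + \<gamma> * osc_max w0 T h' ^ 40)"
    and h: "0 < h" "0 < h'" and c: "0 \<le> \<alpha>" "0 \<le> \<beta>" "0 \<le> \<gamma>"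
  shows "ECost M T \<sigma> b \<le> ennreal (\<alpha> * (1 + (2 * T + h) * (1 + moment_const 20)) +
      \<beta> * ((T / h + 1) * (moment_const 20 * h ^ 20)) + \<gamma> * ((T / h' + 1) * (moment_const 20 * h' ^ 20)))"
proof -
  have "ECost M T \<sigma> b = (\<integral>\<^sup>+\<omega>. (\<integral>\<^sup>+t\<in>{0..T}. ennreal ((fst \<sigma> t b \<omega>)\<^sup>2 + (snd \<sigma> t b \<omega>)\<^sup>2) \<partial>lborel) \<partial>M)"
    by (simp add: ECost_def case_prod_unfold)
  also have "\<dots> \<le> ennreal (\<alpha> * (1 + (2 * T + h) * (1 + moment_const 20)) +
      \<beta> * ((T / h + 1) * (moment_const 20 * h ^ 20)) + \<gamma> * ((T / h' + 1) * (moment_const 20 * h' ^ 20)))"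
  proof (rule expected_bound[OF T h c])
    show "AE \<omega> in M. (\<integral>\<^sup>+t\<in>{0..T}. ennreal ((fst \<sigma> t b \<omega>)\<^sup>2 + (snd \<sigma> t b \<omega>)\<^sup>2) \<partial>lborel) \<le>
      ennreal (\<alpha> * (1 + osc_energy (\<lambda>t. W t \<omega>) T h + (osc (\<lambda>t. W t \<omega>) 0 T)\<^sup>2) +
        \<beta> * osc_max (\<lambda>t. W t \<omega>) T h ^ 40 + \<gamma> * osc_max (\<lambda>t. W t \<omega>) T h' ^ 40)"
      using paths_AE AE_space
    proof eventually_elim
      case (elim \<omega>)
      obtain p v w where pv: "controlled_path a b T \<bar>q0\<bar> p v w" "BR_rule_pos K A \<tau> T a \<bar>q0\<bar> p v" "w 0 = 0"
        "\<And>s t. \<bar>w t - w s\<bar> = \<bar>W t \<omega> - W s \<omega>\<bar>"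
        "\<And>t. (p t)\<^sup>2 + (v t)\<^sup>2 = (fst \<sigma> t b \<omega>)\<^sup>2 + (snd \<sigma> t b \<omega>)\<^sup>2"
        using BR_path[of T a b q0 "\<lambda>t. fst \<sigma> t b \<omega>" "\<lambda>t. snd \<sigma> t b \<omega>" "\<lambda>t. W t \<omega>" K A \<tau>] elim T q0 start[of \<omega>] by blast
      from bound[OF pv(1,2) paths[OF elim(2)] pv(4,3)] show ?case
        unfolding controlled_path.cost_def[OF pv(1)] pv(5) .
    qed
  qed
  finally show ?thesis .
qed

end

definition large_const :: "real \<Rightarrow> real" where
  "large_const T = 10 ^ 7 * exp 6 * (1 + (2 * T + 2) * (1 + moment_const 20)) +
     T * 27200 * exp 4 * noise_const * (10 ^ 4 * (1001 + T)\<^sup>2 * (T + 1) * 2 ^ 21 * moment_const 20)"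

definition noisy_const :: "real \<Rightarrow> real \<Rightarrow> real \<Rightarrow> real \<Rightarrow> real" where
  "noisy_const T c H B = 10 * H * (1 + (2 * T + 4) * (1 + moment_const 20)) +
     T * B * noise_const * ((1001 + T / c)\<^sup>2 * (T / c + 1) * 4 ^ 20 * moment_const 20)"

definition bounded_const :: "real \<Rightarrow> real \<Rightarrow> real" where
  "bounded_const A T = noisy_const T 4 1000 (32 * (exp (A * T))\<^sup>2)"

definition bounded_crude_const :: "real \<Rightarrow> real \<Rightarrow> real" where
  "bounded_crude_const A T = 64 * T * (exp (A * T))\<^sup>2 * (1 + (2 * T + 1) * (1 + moment_const 20))"

definition negative_const :: "real \<Rightarrow> real" where
  "negative_const T = noisy_const T 2 (10 ^ 9) 20000000"

lemma const_pos:
  assumes "0 < T"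
  shows "0 < large_const T" "0 < bounded_const A T" "0 < bounded_crude_const A T" "0 < negative_const T"
  unfolding large_const_def bounded_const_def bounded_crude_const_def negative_const_def noisy_const_def
  using assms moment_const_pos[of 20] noise_const_pos by (auto intro!: add_pos_pos mult_pos_pos)

definition BR_const :: "real \<Rightarrow> real" where
  "BR_const T = 336 * exp 2 * large_const T + 16 * bounded_const (BR_threshold T) T +
     8 * (4 * BR_threshold T + 1) * bounded_crude_const (BR_threshold T) T + 336 * negative_const T"

lemma BR_const_ge:
  assumes "0 < T"
  shows "336 * exp 2 * large_const T \<le> BR_const T" "16 * bounded_const (BR_threshold T) T \<le> BR_const T"
    "8 * (4 * BR_threshold T + 1) * bounded_crude_const (BR_threshold T) T \<le> BR_const T" "336 * negative_const T \<le> BR_const T" "0 < BR_const T"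
proof -
  have "0 < 336 * exp 2 * large_const T" "0 < 16 * bounded_const (BR_threshold T) T"
    "0 < 8 * (4 * BR_threshold T + 1) * bounded_crude_const (BR_threshold T) T" "0 < 336 * negative_const T"
    using const_pos[OF assms] BR_threshold(1)[OF assms] by (auto intro!: mult_pos_pos)
  then show "336 * exp 2 * large_const T \<le> BR_const T" "16 * bounded_const (BR_threshold T) T \<le> BR_const T"
    "8 * (4 * BR_threshold T + 1) * bounded_crude_const (BR_threshold T) T \<le> BR_const T" "336 * negative_const T \<le> BR_const T" "0 < BR_const T"
    unfolding BR_const_def by linarith+
qed

context brownian_motion
begin

context
  fixes T a b q0 :: real and \<sigma> :: "'w strat"
  assumes T: "0 < T" and q0: "1 \<le> \<bar>q0\<bar>"
    and paths_AE: "AE \<omega> in M. solution_path T a b q0 (\<lambda>t. fst \<sigma> t b \<omega>) (\<lambda>t. snd \<sigma> t b \<omega>) (\<lambda>t. W t \<omega>) \<and>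
      BR_rule 4 (BR_threshold T) (BR_test a) T a q0 (\<lambda>t. fst \<sigma> t b \<omega>) (\<lambda>t. snd \<sigma> t b \<omega>)"
begin

lemma large_upper:
  assumes a: "BR_threshold T \<le> a"
  shows "ECost M T \<sigma> b \<le> ennreal (336 * exp 2 * large_const T * (q0\<^sup>2 * cost_rate T a b))"
proof -
  note th = BR_threshold[OF T]
  have a1: "1 \<le> a" "T \<le> a" "1 / T \<le> a" using th a by auto
  then have aT: "1 \<le> a * T" using T by (simp add: field_simps)
  define \<delta> where "\<delta> = 1 / (100 * a\<^sup>2)"
  have \<delta>0: "0 < \<delta>" using a1 by (simp add: \<delta>_def)
  define R where "R = (if \<bar>b\<bar> \<le> 40 * a then a else \<bar>b\<bar>)"
  have R: "1 \<le> R" "a \<le> R" "0 < R" using a1 by (auto simp: R_def)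
  obtain n where n: "1 \<le> n" "n \<le> nat \<lfloor>a * T\<rfloor> + 1" "\<And>\<nu>. 1 \<le> \<nu> \<Longrightarrow> \<nu> < n \<Longrightarrow> \<bar>b\<bar> * exp (real \<nu>) < a / 2"
    "n \<le> nat \<lfloor>a * T\<rfloor> \<Longrightarrow> a / 2 \<le> \<bar>b\<bar> * exp (real n)"
    by (rule critical_epoch[of "nat \<lfloor>a * T\<rfloor>" b a]) blast
  define mc where "mc = moment_const 20"
  have mc: "0 < mc" by (simp add: mc_def moment_const_pos)
  define L where "L = q0\<^sup>2 * (exp (real n))\<^sup>2"
  have L0: "0 \<le> L" by (simp add: L_def)
  define \<alpha> where "\<alpha> = 10 ^ 7 * exp 6 * q0\<^sup>2 * (exp (real n))\<^sup>2 / R"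
  define D where "D = T * (27200 * q0\<^sup>2 / \<delta>\<^sup>2 * (exp (real n + 2))\<^sup>2 * noise_const * (1001 + T * R / 2)\<^sup>2)"
  have nn: "0 \<le> \<alpha>" "0 \<le> D" "0 \<le> D / \<delta> ^ 40" using T R \<delta>0 noise_const_pos by (auto simp: \<alpha>_def D_def)
  have "ECost M T \<sigma> b \<le> ennreal (\<alpha> * (1 + (2 * T + 2 / R) * (1 + mc)) +
      D * ((T / (2 / R) + 1) * (mc * (2 / R) ^ 20)) + D / \<delta> ^ 40 * ((T / (\<delta>\<^sup>2 / R) + 1) * (mc * (\<delta>\<^sup>2 / R) ^ 20)))"
    unfolding mc_def
  proof (rule ECost_pathwise[OF T q0 paths_AE])
    fix p v w w0
    assume H: "controlled_path a b T \<bar>q0\<bar> p v w" "BR_rule_pos 4 (BR_threshold T) (BR_test a) T a \<bar>q0\<bar> p v" "continuous_on {0..} w0"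
      "\<And>s t. \<bar>w t - w s\<bar> = \<bar>w0 t - w0 s\<bar>" "w 0 = 0"
    have "BR_large 4 (\<delta>\<^sup>2 / a) T a \<bar>q0\<bar> p v" using H(2) a by (simp add: BR_rule_pos_def BR_test_def \<delta>_def)
    from large_pathwise[OF H(1) this H(3,4,5) a1(1,2) aT \<delta>_def R_def n]
    show "controlled_path.cost p v 0 T \<le> ennreal (\<alpha> * (1 + osc_energy w0 T (2 / R) + (osc w0 0 T)\<^sup>2) +
        D * osc_max w0 T (2 / R) ^ 40 + D / \<delta> ^ 40 * osc_max w0 T (\<delta>\<^sup>2 / R) ^ 40)"
      by (simp only: \<alpha>_def D_def power2_abs)
  qed (use R \<delta>0 nn in auto)
  also have "\<dots> \<le> ennreal (large_const T * (q0\<^sup>2 * ((exp (real n))\<^sup>2 / R)))"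
  proof (rule ennreal_leI)
    have "2 / R \<le> 2" using R by (simp add: divide_le_eq)
    then have "\<alpha> * (1 + (2 * T + 2 / R) * (1 + mc)) \<le> \<alpha> * (1 + (2 * T + 2) * (1 + mc))"
      using nn mc by (intro mult_left_mono add_left_mono mult_right_mono) auto
    also have "\<dots> = 10 ^ 7 * exp 6 * (1 + (2 * T + 2) * (1 + mc)) * (L / R)" by (simp add: \<alpha>_def L_def)
    finally have 1: "\<alpha> * (1 + (2 * T + 2 / R) * (1 + mc)) \<le> 10 ^ 7 * exp 6 * (1 + (2 * T + 2) * (1 + mc)) * (L / R)" .
    have e: "(exp (real n + 2))\<^sup>2 = exp 4 * (exp (real n))\<^sup>2"
      unfolding exp_add power_mult_distrib using exp_double[of "2::real"] by simp
    define Z where "Z = (T / (2 / R) + 1) * (mc * (2 / R) ^ 20) + 1 / \<delta> ^ 40 * ((T / (\<delta>\<^sup>2 / R) + 1) * (mc * (\<delta>\<^sup>2 / R) ^ 20))"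
    have "D * ((T / (2 / R) + 1) * (mc * (2 / R) ^ 20)) + D / \<delta> ^ 40 * ((T / (\<delta>\<^sup>2 / R) + 1) * (mc * (\<delta>\<^sup>2 / R) ^ 20)) = D * Z"
      unfolding Z_def by (simp add: distrib_left)
    also have "\<dots> = T * 27200 * exp 4 * noise_const * L * (1 / \<delta>\<^sup>2 * (1001 + T * R / 2)\<^sup>2 * Z)"
      unfolding D_def L_def e by simp
    also have "\<dots> \<le> T * 27200 * exp 4 * noise_const * L * (10 ^ 4 * (1001 + T)\<^sup>2 * (T + 1) * 2 ^ 21 * mc / R)"
      unfolding Z_def using T L0 noise_const_pos
      by (intro mult_left_mono large_noise_terms[OF T a1(1) R(2) \<delta>_def mc]) auto
    also have "\<dots> = T * 27200 * exp 4 * noise_const * (10 ^ 4 * (1001 + T)\<^sup>2 * (T + 1) * 2 ^ 21 * mc) * (L / R)"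
      by (simp only: mult_ac times_divide_eq_right times_divide_eq_left)
    finally have 2: "D * ((T / (2 / R) + 1) * (mc * (2 / R) ^ 20)) + D / \<delta> ^ 40 * ((T / (\<delta>\<^sup>2 / R) + 1) * (mc * (\<delta>\<^sup>2 / R) ^ 20)) \<le>
        T * 27200 * exp 4 * noise_const * (10 ^ 4 * (1001 + T)\<^sup>2 * (T + 1) * 2 ^ 21 * mc) * (L / R)" .
    have "large_const T * (L / R) = 10 ^ 7 * exp 6 * (1 + (2 * T + 2) * (1 + mc)) * (L / R) +
        T * 27200 * exp 4 * noise_const * (10 ^ 4 * (1001 + T)\<^sup>2 * (T + 1) * 2 ^ 21 * mc) * (L / R)"
      unfolding large_const_def mc_def by (rule distrib_right)
    moreover have "q0\<^sup>2 * ((exp (real n))\<^sup>2 / R) = L / R" by (simp add: L_def)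
    ultimately show "\<alpha> * (1 + (2 * T + 2 / R) * (1 + mc)) + D * ((T / (2 / R) + 1) * (mc * (2 / R) ^ 20)) +
        D / \<delta> ^ 40 * ((T / (\<delta>\<^sup>2 / R) + 1) * (mc * (\<delta>\<^sup>2 / R) ^ 20)) \<le> large_const T * (q0\<^sup>2 * ((exp (real n))\<^sup>2 / R))"
      using add_mono[OF 1 2] by (simp only: add.assoc)
  qed
  also have "\<dots> \<le> ennreal (large_const T * (q0\<^sup>2 * (336 * exp 2 * cost_rate T a b)))"
    using const_pos(1)[OF T]
    by (intro ennreal_leI mult_left_mono epoch_cost_rate[OF a1(1,3) T R_def n(1,2,3)]) auto
  finally show ?thesis by (simp only: mult_ac)
qed

text \<open>Shared by negative a and by bounded a with large b: what is special to them enters as a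
  bound for quiet paths and a crude bound for all paths.\<close>

lemma noisy_upper:
  assumes R: "1 \<le> R" and c: "0 < c" "c \<le> 4" and HB: "0 \<le> H" "0 \<le> B"
    and quiet: "\<And>p v w m Q Wst. controlled_path a b T \<bar>q0\<bar> p v w \<Longrightarrow> BR_rule_pos 4 (BR_threshold T) (BR_test a) T a \<bar>q0\<bar> p v \<Longrightarrow>
      (\<And>t. 0 \<le> t \<Longrightarrow> t \<le> T \<Longrightarrow> \<bar>w t\<bar> \<le> Wst) \<Longrightarrow> noise w T (c / R) m Q \<Longrightarrow> m \<le> 1/1000 \<Longrightarrow>
      controlled_path.cost p v 0 T \<le> ennreal (H * q0\<^sup>2 / R * (1 + Q))"
    and crude: "\<And>p v w Wst t. controlled_path a b T \<bar>q0\<bar> p v w \<Longrightarrow> BR_rule_pos 4 (BR_threshold T) (BR_test a) T a \<bar>q0\<bar> p v \<Longrightarrow>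
      (\<And>t. 0 \<le> t \<Longrightarrow> t \<le> T \<Longrightarrow> \<bar>w t\<bar> \<le> Wst) \<Longrightarrow> 0 \<le> t \<Longrightarrow> t < T \<Longrightarrow> (p t)\<^sup>2 + (v t)\<^sup>2 \<le> B * q0\<^sup>2 * (1 + Wst)\<^sup>2"
  shows "ECost M T \<sigma> b \<le> ennreal (noisy_const T c H B * (q0\<^sup>2 / R))"
proof -
  define mc where "mc = moment_const 20"
  have mc: "0 < mc" by (simp add: mc_def moment_const_pos)
  define h where "h = c / R"
  have h: "0 < h" "h \<le> 4" "T / h = T * R / c" using R c by (auto simp: h_def divide_le_eq)
  define L where "L = q0\<^sup>2 / R"
  have L0: "0 \<le> L" using R by (simp add: L_def)
  define D where "D = T * (B * q0\<^sup>2 * noise_const * (1001 + T / h)\<^sup>2)"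
  have nn: "0 \<le> H * q0\<^sup>2 / R" "0 \<le> 10 * (H * q0\<^sup>2 / R)" "0 \<le> B * q0\<^sup>2" "0 \<le> D"
    using T R HB noise_const_pos by (auto simp: D_def)
  have "ECost M T \<sigma> b \<le> ennreal (10 * (H * q0\<^sup>2 / R) * (1 + (2 * T + h) * (1 + mc)) +
      D * ((T / h + 1) * (mc * h ^ 20)) + 0 * ((T / 1 + 1) * (mc * 1 ^ 20)))"
    unfolding mc_def
  proof (rule ECost_pathwise[OF T q0 paths_AE])
    fix p v w w0
    assume H: "controlled_path a b T \<bar>q0\<bar> p v w" "BR_rule_pos 4 (BR_threshold T) (BR_test a) T a \<bar>q0\<bar> p v" "continuous_on {0..} w0"
      "\<And>s t. \<bar>w t - w s\<bar> = \<bar>w0 t - w0 s\<bar>" "w 0 = 0"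
    show "controlled_path.cost p v 0 T \<le> ennreal (10 * (H * q0\<^sup>2 / R) * (1 + osc_energy w0 T h + (osc w0 0 T)\<^sup>2) +
        D * osc_max w0 T h ^ 40 + 0 * osc_max w0 T 1 ^ 40)"
      unfolding D_def mult_zero_left add_0_right
      by (rule noisy_pathwise[OF H(1,3,4,5) h(1) nn(1,3) quiet[OF H(1,2) sup_bound[OF H(4,5,3) T], folded h_def] crude[OF H(1,2)]])
  qed (use h nn in auto)
  also have "\<dots> \<le> ennreal (noisy_const T c H B * L)"
  proof (rule ennreal_leI)
    have "10 * (H * q0\<^sup>2 / R) * (1 + (2 * T + h) * (1 + mc)) \<le> 10 * (H * q0\<^sup>2 / R) * (1 + (2 * T + 4) * (1 + mc))"
      using nn mc h by (intro mult_left_mono add_left_mono mult_right_mono) auto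
    also have "\<dots> = 10 * H * (1 + (2 * T + 4) * (1 + mc)) * L" by (simp add: L_def)
    finally have 1: "10 * (H * q0\<^sup>2 / R) * (1 + (2 * T + h) * (1 + mc)) \<le> 10 * H * (1 + (2 * T + 4) * (1 + mc)) * L" .
    have "D * ((T / h + 1) * (mc * h ^ 20)) = T * B * noise_const * q0\<^sup>2 * ((1001 + T * R / c)\<^sup>2 * ((T / (c / R) + 1) * (mc * (c / R) ^ 20)))"
      unfolding D_def h(3) unfolding h_def by simp
    also have "\<dots> \<le> T * B * noise_const * q0\<^sup>2 * ((1001 + T / c)\<^sup>2 * (T / c + 1) * 4 ^ 20 * mc / R)"
      using T HB noise_const_pos by (intro mult_left_mono noise_terms_le R c mc) auto
    also have "\<dots> = T * B * noise_const * ((1001 + T / c)\<^sup>2 * (T / c + 1) * 4 ^ 20 * mc) * L"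
      unfolding L_def by (simp only: mult_ac times_divide_eq_right times_divide_eq_left)
    finally have 2: "D * ((T / h + 1) * (mc * h ^ 20)) \<le> T * B * noise_const * ((1001 + T / c)\<^sup>2 * (T / c + 1) * 4 ^ 20 * mc) * L" .
    show "10 * (H * q0\<^sup>2 / R) * (1 + (2 * T + h) * (1 + mc)) + D * ((T / h + 1) * (mc * h ^ 20)) + 0 * ((T / 1 + 1) * (mc * 1 ^ 20)) \<le> noisy_const T c H B * L"
      using add_mono[OF 1 2] unfolding noisy_const_def mc_def by (simp only: distrib_right mult_zero_left add_0_right)
  qed
  finally show ?thesis by (simp add: L_def)
qed

lemma bounded_upper:
  assumes a: "a < BR_threshold T" "\<bar>a\<bar> \<le> BR_threshold T"
  shows "ECost M T \<sigma> b \<le> ennreal (BR_const T * (q0\<^sup>2 * cost_rate T a b))"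
proof -
  define A where "A = BR_threshold T"
  note th = BR_threshold[OF T, folded A_def]
  have cr: "0 \<le> cost_rate T a b" using cost_rate_pos[OF T, of a b] by simp
  have rule: "BR_bounded T \<bar>q0\<bar> p v" if "BR_rule_pos 4 (BR_threshold T) (BR_test a) T a \<bar>q0\<bar> p v" for p v
    using that a by (simp add: BR_rule_pos_def)
  have a': "\<bar>a\<bar> \<le> A" using a by (simp add: A_def)
  show ?thesis
  proof (cases "\<bar>b\<bar> \<le> 2 * A")
    \<comment> \<open>With a and b both bounded, \<open>cost_rate\<close> is bounded below by a
      constant, so the crude bound is good enough. In the other case |b| \<ge> 2 |a|, as the quiet
      estimate requires.\<close>
    case True
    define D where "D = 64 * T * (exp (A * T) * \<bar>q0\<bar>)\<^sup>2"
    have D0: "0 \<le> D" using T by (simp add: D_def)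
    have "ECost M T \<sigma> b \<le> ennreal (D * (1 + (2 * T + 1) * (1 + moment_const 20)) +
        0 * ((T / 1 + 1) * (moment_const 20 * 1 ^ 20)) + 0 * ((T / 1 + 1) * (moment_const 20 * 1 ^ 20)))"
    proof (rule ECost_pathwise[OF T q0 paths_AE])
      fix p v w w0
      assume H: "controlled_path a b T \<bar>q0\<bar> p v w" "BR_rule_pos 4 (BR_threshold T) (BR_test a) T a \<bar>q0\<bar> p v" "continuous_on {0..} w0"
        "\<And>s t. \<bar>w t - w s\<bar> = \<bar>w0 t - w0 s\<bar>" "w 0 = 0"
      from bounded_pathwise_crude[OF H(1) rule[OF H(2)] H(3,4,5) a']
      show "controlled_path.cost p v 0 T \<le> ennreal (D * (1 + osc_energy w0 T 1 + (osc w0 0 T)\<^sup>2) + 0 * osc_max w0 T 1 ^ 40 + 0 * osc_max w0 T 1 ^ 40)"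
        by (simp only: D_def mult_zero_left add_0_right)
    qed (use D0 in auto)
    also have "D * (1 + (2 * T + 1) * (1 + moment_const 20)) + 0 * ((T / 1 + 1) * (moment_const 20 * 1 ^ 20)) + 0 * ((T / 1 + 1) * (moment_const 20 * 1 ^ 20))
        = bounded_crude_const A T * q0\<^sup>2"
      by (simp add: D_def bounded_crude_const_def power_mult_distrib)
    also have "\<dots> \<le> BR_const T * (q0\<^sup>2 * cost_rate T a b)"
    proof -
      have "\<bar>a\<bar> + \<bar>b\<bar> + 1 / T \<le> (4 * A + 1) * 1" using True a' th(4) by simp
      from inverse_le_cost_rate[OF T _ this] have "1 \<le> 8 * (4 * A + 1) * cost_rate T a b" by simp
      then have "bounded_crude_const A T * q0\<^sup>2 * 1 \<le> bounded_crude_const A T * q0\<^sup>2 * (8 * (4 * A + 1) * cost_rate T a b)"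
        using const_pos(3)[OF T, of A] by (intro mult_left_mono) auto
      also have "\<dots> = 8 * (4 * A + 1) * bounded_crude_const A T * (q0\<^sup>2 * cost_rate T a b)" by (simp only: mult_ac)
      also have "\<dots> \<le> BR_const T * (q0\<^sup>2 * cost_rate T a b)"
        unfolding A_def using cr by (intro mult_right_mono BR_const_ge[OF T]) auto
      finally show ?thesis by simp
    qed
    finally show ?thesis by (simp add: ennreal_leI)
  next
    case False
    define R where "R = \<bar>b\<bar>"
    have R: "1 \<le> R" "0 < R" "2 * \<bar>a\<bar> \<le> R" using False th a' by (auto simp: R_def)
    have "ECost M T \<sigma> b \<le> ennreal (bounded_const A T * (q0\<^sup>2 / R))"
      unfolding bounded_const_def
    proof (rule noisy_upper[OF R(1)])
      fix p v w m Q Wst t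
      assume cp: "controlled_path a b T \<bar>q0\<bar> p v w" and ru: "BR_rule_pos 4 (BR_threshold T) (BR_test a) T a \<bar>q0\<bar> p v"
        and Wst: "\<And>t. 0 \<le> t \<Longrightarrow> t \<le> T \<Longrightarrow> \<bar>w t\<bar> \<le> Wst"
      have bp: "bounded_path a b T \<bar>q0\<bar> p v w Wst"
        by (intro bounded_path.intro cp bounded_path_axioms.intro rule[OF ru] Wst)
      show "(p t)\<^sup>2 + (v t)\<^sup>2 \<le> 32 * (exp (A * T))\<^sup>2 * q0\<^sup>2 * (1 + Wst)\<^sup>2" if "0 \<le> t" "t < T"
        using bounded_path.bounded_crude[OF bp that a'] by (simp only: power_mult_distrib power2_abs mult.assoc)
      assume n: "noise w T (4 / R) m Q" and m: "m \<le> 1/1000"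
      have "noisy_path a b T \<bar>q0\<bar> p v w (4 / \<bar>b\<bar>) m Q"
        by (intro noisy_path.intro cp noisy_path_axioms.intro) (use n R in \<open>auto simp: R_def\<close>)
      then have "quiet_bounded_path a b T \<bar>q0\<bar> p v w Wst m Q"
        by (intro quiet_bounded_path.intro bp quiet_bounded_path_axioms.intro m) (use R in \<open>auto simp: R_def\<close>)
      from quiet_bounded_path.quiet_bounded_cost[OF this]
      show "controlled_path.cost p v 0 T \<le> ennreal (1000 * q0\<^sup>2 / R * (1 + Q))" by (simp add: R_def)
    qed auto
    also have "\<dots> \<le> ennreal (BR_const T * (q0\<^sup>2 * cost_rate T a b))"
    proof (rule ennreal_leI)
      have "\<bar>a\<bar> + \<bar>b\<bar> + 1 / T \<le> 2 * R" using False a' th unfolding R_def by linarith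
      from inverse_le_cost_rate[OF T R(2) this] have "1 / R \<le> 16 * cost_rate T a b" by simp
      then have "bounded_const A T * q0\<^sup>2 * (1 / R) \<le> bounded_const A T * q0\<^sup>2 * (16 * cost_rate T a b)"
        using const_pos(2)[OF T, of A] by (intro mult_left_mono) auto
      also have "\<dots> = 16 * bounded_const A T * (q0\<^sup>2 * cost_rate T a b)" by (simp only: mult_ac)
      also have "\<dots> \<le> BR_const T * (q0\<^sup>2 * cost_rate T a b)"
        unfolding A_def using cr by (intro mult_right_mono BR_const_ge[OF T]) auto
      finally show "bounded_const A T * (q0\<^sup>2 / R) \<le> BR_const T * (q0\<^sup>2 * cost_rate T a b)" by simp
    qed
    finally show ?thesis .
  qed
qed

lemma negative_upper:
  assumes a: "a < - BR_threshold T"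
  shows "ECost M T \<sigma> b \<le> ennreal (336 * negative_const T * (q0\<^sup>2 * cost_rate T a b))"
proof -
  note th = BR_threshold[OF T]
  have a1: "a < 0" "1 \<le> \<bar>a\<bar>" "1 / T \<le> \<bar>a\<bar>" using th a by auto
  have aT: "1 / (10 * \<bar>a\<bar>) < T"
  proof -
    have "1 / (10 * \<bar>a\<bar>) \<le> 1 / (10 * BR_threshold T)" using a th by (intro frac_le) auto
    then show ?thesis using th(2) by linarith
  qed
  define R where "R = (if \<bar>b\<bar> \<le> 40 * \<bar>a\<bar> then \<bar>a\<bar> else \<bar>b\<bar>)"
  have R: "1 \<le> R" "0 < R" using a1 by (auto simp: R_def)
  have "ECost M T \<sigma> b \<le> ennreal (negative_const T * (q0\<^sup>2 / R))"
    unfolding negative_const_def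
  proof (rule noisy_upper[OF R(1)])
    fix p v w m Q Wst t
    assume cp: "controlled_path a b T \<bar>q0\<bar> p v w" and ru: "BR_rule_pos 4 (BR_threshold T) (BR_test a) T a \<bar>q0\<bar> p v"
      and Wst: "\<And>t. 0 \<le> t \<Longrightarrow> t \<le> T \<Longrightarrow> \<bar>w t\<bar> \<le> Wst"
    have "BR_negative T a \<bar>q0\<bar> p v" using ru a th by (simp add: BR_rule_pos_def)
    then have np: "negative_path a b T \<bar>q0\<bar> p v w Wst"
      by (intro negative_path.intro cp negative_path_axioms.intro a1(1) aT Wst)
    show "(p t)\<^sup>2 + (v t)\<^sup>2 \<le> 20000000 * q0\<^sup>2 * (1 + Wst)\<^sup>2" if "0 \<le> t" "t < T"
      using negative_path.negative_crude[OF np that] by (simp only: power_mult_distrib power2_abs mult.assoc)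
    assume n: "noise w T (2 / R) m Q" and m: "m \<le> 1/1000"
    have "noisy_path a b T \<bar>q0\<bar> p v w (2 / R) m Q"
      by (intro noisy_path.intro cp noisy_path_axioms.intro n) (use R in auto)
    then have "quiet_negative_path a b T \<bar>q0\<bar> p v w Wst R m Q"
      by (intro quiet_negative_path.intro np quiet_negative_path_axioms.intro m R_def)
    from quiet_negative_path.quiet_negative_cost[OF this]
    show "controlled_path.cost p v 0 T \<le> ennreal (10 ^ 9 * q0\<^sup>2 / R * (1 + Q))" by simp
  qed auto
  also have "\<dots> \<le> ennreal (336 * negative_const T * (q0\<^sup>2 * cost_rate T a b))"
  proof (rule ennreal_leI)
    have "1 / R \<le> 8 * 42 * cost_rate T a b"
      by (rule inverse_le_cost_rate[OF T R(2)]) (use a1 in \<open>auto simp: R_def\<close>)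
    then have "negative_const T * q0\<^sup>2 * (1 / R) \<le> negative_const T * q0\<^sup>2 * (8 * 42 * cost_rate T a b)"
      using const_pos(4)[OF T] by (intro mult_left_mono) auto
    then show "negative_const T * (q0\<^sup>2 / R) \<le> 336 * negative_const T * (q0\<^sup>2 * cost_rate T a b)" by (simp add: mult_ac)
  qed
  finally show ?thesis .
qed

lemma BR_upper: "ECost M T \<sigma> b \<le> ennreal (BR_const T * (q0\<^sup>2 * cost_rate T a b))"
proof -
  have cr: "0 \<le> q0\<^sup>2 * cost_rate T a b" using cost_rate_pos[OF T, of a b] by simp
  consider "BR_threshold T \<le> a" | "a < BR_threshold T" "\<bar>a\<bar> \<le> BR_threshold T" | "a < - BR_threshold T" by linarith
  then show ?thesis
  proof cases
    case 1
    have "336 * exp 2 * large_const T * (q0\<^sup>2 * cost_rate T a b) \<le> BR_const T * (q0\<^sup>2 * cost_rate T a b)"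
      by (rule mult_right_mono[OF BR_const_ge(1)[OF T] cr])
    then show ?thesis using large_upper[OF 1] by (meson ennreal_leI order_trans)
  next
    case 2
    then show ?thesis by (rule bounded_upper)
  next
    case 3
    have "336 * negative_const T * (q0\<^sup>2 * cost_rate T a b) \<le> BR_const T * (q0\<^sup>2 * cost_rate T a b)"
      by (rule mult_right_mono[OF BR_const_ge(4)[OF T] cr])
    then show ?thesis using negative_upper[OF 3] by (meson ennreal_leI order_trans)
  qed
qed

end

section \<open>Existence of BR and its competitive ratio\<close>

lemma BR_strategy_exists:
  assumes T: "0 < T" and q0: "1 \<le> \<bar>q0\<bar>"
  shows "\<exists>\<sigma>. is_BR 4 (BR_threshold T) (BR_test a) M W T a q0 \<sigma>"
proof -
  have th: "0 < BR_threshold T" "1 / (10 * BR_threshold T) < T" using BR_threshold[OF T] by auto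
  have \<tau>: "0 < BR_test a" if "BR_threshold T \<le> a" by (rule BR_test) (use BR_threshold(1)[OF T] that in linarith)
  obtain \<sigma> where \<sigma>: "\<And>b \<omega>. \<omega> \<in> space M \<Longrightarrow> solution_path T a b q0 (\<lambda>t. fst \<sigma> t b \<omega>) (\<lambda>t. snd \<sigma> t b \<omega>) (\<lambda>t. W t \<omega>) \<and>
      BR_rule 4 (BR_threshold T) (BR_test a) T a q0 (\<lambda>t. fst \<sigma> t b \<omega>) (\<lambda>t. snd \<sigma> t b \<omega>)"
    and st: "(\<forall>b. ECost M T \<sigma> b < \<infinity>) \<longrightarrow> strategy M W T a q0 \<sigma>"
    using BR_exists[OF brownian_motion_axioms T q0 th \<tau>, where K = 4] by blast
  have "ECost M T \<sigma> b < \<infinity>" for b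
    using le_less_trans[OF BR_upper[OF T q0 AE_I2[OF \<sigma>]] ennreal_less_top] by (simp only: infinity_ennreal_def)
  then show ?thesis using st \<sigma> unfolding is_BR_def by blast
qed

lemma BR_competitive:
  assumes T: "0 < T" and q0: "1 \<le> \<bar>q0\<bar>" and \<sigma>: "is_BR 4 (BR_threshold T) (BR_test a) M W T a q0 \<sigma>"
  shows "ECost M T \<sigma> b \<le> ennreal (BR_const T) * ECost_opt M W T a q0 b"
proof -
  have st: "strategy M W T a q0 (fst \<sigma>, snd \<sigma>)" and rule: "AE \<omega> in M. BR_rule 4 (BR_threshold T) (BR_test a) T a q0 (\<lambda>t. fst \<sigma> t b \<omega>) (\<lambda>t. snd \<sigma> t b \<omega>)"
    using \<sigma> by (auto simp: is_BR_def)
  have "ECost M T \<sigma> b \<le> ennreal (BR_const T * (q0\<^sup>2 * cost_rate T a b))"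
    by (rule BR_upper[OF T q0]) (use strategy_solution_path[OF T st, of b] rule in eventually_elim, simp)
  also have "\<dots> = ennreal (BR_const T) * ennreal (q0\<^sup>2 * cost_rate T a b)"
    using BR_const_ge(5)[OF T] by (simp add: ennreal_mult')
  also have "\<dots> \<le> ennreal (BR_const T) * ECost_opt M W T a q0 b"
    unfolding ECost_opt_def by (intro mult_left_mono cost_rate_lower[OF T sigma_opt_strategy[OF T]]) simp
  finally show ?thesis .
qed

end

theorem theorem1:
  shows "\<exists>K\<ge>1. \<exists>(A :: real \<Rightarrow> real) (\<tau> :: real \<Rightarrow> real).
    (\<forall>T>0. A T \<ge> 1 \<and> 1 / (10 * A T) < T \<and> (\<forall>a\<ge>A T. 0 < \<tau> a \<and> \<tau> a < 1)) \<and>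
    (\<forall>q0 T :: real. \<bar>q0\<bar> \<ge> 1 \<longrightarrow> T > 0 \<longrightarrow>
      (\<exists>C>0. \<forall>(M :: 'w measure) W (a :: real). brownian_motion M W \<longrightarrow>
        (\<exists>\<sigma>. is_BR K (A T) (\<tau> a) M W T a q0 \<sigma>) \<and>
        (\<forall>\<sigma>. is_BR K (A T) (\<tau> a) M W T a q0 \<sigma> \<longrightarrow>
          (\<forall>b :: real. ECost M T \<sigma> b \<le> ennreal C * ECost_opt M W T a q0 b))))"
proof (intro exI conjI allI impI)
  \<comment> \<open>This fixes the witness K = 4, the gain for which \<open>stable_rate\<close>
    holds; the other witnesses are fixed by the following goals in the same way.\<close>
  show "(1 :: real) \<le> 4" by simp
  show "1 \<le> BR_threshold T" "1 / (10 * BR_threshold T) < T" if "0 < T" for T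
    by (rule BR_threshold[OF that])+
  show "0 < BR_test a" "BR_test a < 1" if "0 < T" "BR_threshold T \<le> a" for T a
    by (rule BR_test, use BR_threshold(1)[OF that(1)] that in linarith)+
  show "0 < BR_const T" if "0 < T" for T by (rule BR_const_ge[OF that])
  fix q0 T a b :: real and M :: "'w measure" and W
  assume q0: "1 \<le> \<bar>q0\<bar>" and T: "0 < T" and bm: "brownian_motion M W"
  show "is_BR 4 (BR_threshold T) (BR_test a) M W T a q0 (SOME \<sigma>. is_BR 4 (BR_threshold T) (BR_test a) M W T a q0 \<sigma>)"
    by (rule someI_ex[OF brownian_motion.BR_strategy_exists[OF bm T q0]])
  show "ECost M T \<sigma> b \<le> ennreal (BR_const T) * ECost_opt M W T a q0 b"
    if "is_BR 4 (BR_threshold T) (BR_test a) M W T a q0 \<sigma>" for \<sigma>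
    by (rule brownian_motion.BR_competitive[OF bm T q0 that])
qed

end
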